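(* Let $G$ be a pro-finite group and let $\mathcal{C}$ be the category of compactly generated weak Hausdorff spaces with continuous $G$-action and $G$-equivariant maps. In the model structure on pro-$\mathcal{C}$ described in the context, the pro-$G$-space $\{E(G/U)\}$, where $U$ ranges over the finite-index normal subgroups of $G$, is a cofibrant replacement for the constant pro-space $c( * )$ on the one-point $G$-space; that is, $\{E(G/U)\}$ is cofibrant and the map $\{E(G/U)\}\to c( * )$ is a weak equivalence.
   Context: **Pro-categories.** For a category $\mathcal{C}$, pro-$\mathcal{C}$ has as objects all small (non-empty) cofiltering diagrams in $\mathcal{C}$, with $\mathrm{Hom}(X,Y)=\lim_s \mathrm{colim}_t \mathrm{Hom}_{\mathcal{C}}(X_t,Y_s)$. A directed set $I$ is regarded as a cofiltering category with a unique map $t\to s$ when $t\ge s$. A level map is a pro-map given by a natural transformation of diagrams with the same indexing category. For a class $M$ of maps of $\mathcal{C}$, a levelwise $M$-map is a level map $g$ with every $g_s\in M$; an essentially levelwise $M$-map is a pro-map isomorphic, in the category of arrows of pro-$\mathcal{C}$, to a levelwise $M$-map. A directed set is cofinite if every element has only finitely many elements $\le$ it. For a level map $f:X\to Y$ indexed by a cofinite directed set, the relative matching map $M_tf$ is $X_t\to \lim_{s<t}X_s\times_{\lim_{s<t}Y_s}Y_t$. A special $M$-map is a pro-map isomorphic to a cofinite directed level map $f$ with every $M_tf\in M$. $c(X)$ denotes the constant pro-object on $X$. **Equivariant notions.** Finite-index subgroups of $G$ are understood to be open. $E(G/U)$ is the usual (functorial) free contractible $G/U$-CW complex of the finite group $G/U$,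 regarded as a $G$-space via $G\to G/U$. A map of spaces is an $n$-equivalence if (for all basepoints) it induces isomorphisms on homotopy groups/sets in dimensions $<n$ and a surjection on $\pi_n$; it is a co-$n$-equivalence if it induces isomorphisms on homotopy groups in dimensions $>n$ and an injection on $\pi_n$; a co-$n$-fibration is a (Serre) fibration that is a co-$n$-equivalence. Let $U$ be a finite-index subgroup of $G$. A $G$-map $f$ is a $U$-$n$-equivalence (resp. $U$-co-$n$-fibration) if the map $f^V$ on $V$-fixed points is an $n$-equivalence (resp. co-$n$-fibration) for all finite-index subgroups $V$ of $U$. A $U$-cofibration is a retract of a relative cell complex built from cells $G/V\times S^{k}\to G/V\times D^{k+1}$, $k\ge -1$, with $V$ a finite-index subgroup of $U$. Let $A$ be the set of pairs $(U,n)$ with $U$ a finite-index subgroup of $G$ and $n\ge 0$ an integer. Define: $C_{U,n}$ is the class of $U$-cofibrations; $W_{U,n}$ is the class of maps that are $V$-$n$-equivalences for some finite-index subgroup $V$ of $G$; $F_{U,n}$ is the class of $U$-co-$n$-fibrations; $F=\bigcup F_{U,n}$. **Model structure on pro-$\mathcal{C}$.** A map in pro-$\mathcal{C}$ is a cofibration if it is an essentially levelwise $C_{U,n}$-map for every $(U,n)\in A$; a weak equivalence if it is an essentially levelwise $W_{U,n}$-map for every $(U,n)\in A$; a fibration if it is a retract of a special $F$-map. (This is a model structure.) *)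

theory Defs
  imports
    "HOL-Analysis.Analysis"
    "HOL-Algebra.Coset"
    "HOL-Algebra.Left_Coset"
    "HOL-Homology.Simplices"
begin

section \<open>Categories\<close>

text \<open>\<open>Comp C g f\<close> is the composite of \<open>g\<close> after \<open>f\<close>.\<close>

record ('o, 'm) cat =
  Ob :: "'o set"
  Ar :: "'m set"
  Dom :: "'m \<Rightarrow> 'o"
  Cod :: "'m \<Rightarrow> 'o"
  Ident :: "'o \<Rightarrow> 'm"
  Comp :: "'m \<Rightarrow> 'm \<Rightarrow> 'm"

definition homs :: "('o, 'm) cat \<Rightarrow> 'o \<Rightarrow> 'o \<Rightarrow> 'm set" where
  "homs C a b = {f \<in> Ar C. Dom C f = a \<and> Cod C f = b}"

definition category :: "('o, 'm) cat \<Rightarrow> bool" where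
  "category C \<longleftrightarrow>
     (\<forall>f\<in>Ar C. Dom C f \<in> Ob C \<and> Cod C f \<in> Ob C) \<and>
     (\<forall>a\<in>Ob C. Ident C a \<in> homs C a a) \<and>
     (\<forall>f\<in>Ar C. \<forall>g\<in>Ar C. Cod C f = Dom C g \<longrightarrow>
        Comp C g f \<in> homs C (Dom C f) (Cod C g)) \<and>
     (\<forall>f\<in>Ar C. Comp C f (Ident C (Dom C f)) = f \<and> Comp C (Ident C (Cod C f)) f = f) \<and>
     (\<forall>f\<in>Ar C. \<forall>g\<in>Ar C. \<forall>h\<in>Ar C. Cod C f = Dom C g \<and> Cod C g = Dom C h \<longrightarrow>
        Comp C h (Comp C g f) = Comp C (Comp C h g) f)"

definition is_iso :: "('o, 'm) cat \<Rightarrow> 'm \<Rightarrow> bool" where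
  "is_iso C f \<longleftrightarrow> f \<in> Ar C \<and>
     (\<exists>g \<in> homs C (Cod C f) (Dom C f).
        Comp C g f = Ident C (Dom C f) \<and> Comp C f g = Ident C (Cod C f))"

definition arrow_iso :: "('o, 'm) cat \<Rightarrow> 'm \<Rightarrow> 'm \<Rightarrow> bool" where
  "arrow_iso C f g \<longleftrightarrow> f \<in> Ar C \<and> g \<in> Ar C \<and>
     (\<exists>\<alpha> \<in> homs C (Dom C f) (Dom C g). \<exists>\<beta> \<in> homs C (Cod C f) (Cod C g).
        is_iso C \<alpha> \<and> is_iso C \<beta> \<and> Comp C g \<alpha> = Comp C \<beta> f)"

definition arrow_retract :: "('o, 'm) cat \<Rightarrow> 'm \<Rightarrow> 'm \<Rightarrow> bool" where
  "arrow_retract C f g \<longleftrightarrow> f \<in> Ar C \<and> g \<in> Ar C \<and>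
     (\<exists>i \<in> homs C (Dom C f) (Dom C g). \<exists>r \<in> homs C (Dom C g) (Dom C f).
      \<exists>j \<in> homs C (Cod C f) (Cod C g). \<exists>s \<in> homs C (Cod C g) (Cod C f).
        Comp C r i = Ident C (Dom C f) \<and> Comp C s j = Ident C (Cod C f) \<and>
        Comp C g i = Comp C j f \<and> Comp C f r = Comp C s g)"

definition is_initial :: "('o, 'm) cat \<Rightarrow> 'o \<Rightarrow> bool" where
  "is_initial C z \<longleftrightarrow> z \<in> Ob C \<and> (\<forall>a\<in>Ob C. \<exists>!f. f \<in> homs C z a)"

text \<open>The square with legs \<open>f : a \<rightarrow> b\<close>, \<open>g : a \<rightarrow> c\<close> and \<open>h : b \<rightarrow> d\<close>, \<open>k : c \<rightarrow> d\<close> is a pushout;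
  \<open>k\<close> is then the pushout of \<open>f\<close> along \<open>g\<close>.\<close>

definition is_pushout :: "('o, 'm) cat \<Rightarrow> 'm \<Rightarrow> 'm \<Rightarrow> 'm \<Rightarrow> 'm \<Rightarrow> bool" where
  "is_pushout C f g h k \<longleftrightarrow>
     f \<in> Ar C \<and> g \<in> Ar C \<and> h \<in> Ar C \<and> k \<in> Ar C \<and>
     Dom C f = Dom C g \<and> Cod C f = Dom C h \<and> Cod C g = Dom C k \<and> Cod C h = Cod C k \<and>
     Comp C h f = Comp C k g \<and>
     (\<forall>e\<in>Ob C. \<forall>h' \<in> homs C (Cod C f) e. \<forall>k' \<in> homs C (Cod C g) e.
        Comp C h' f = Comp C k' g \<longrightarrow>
        (\<exists>!w. w \<in> homs C (Cod C h) e \<and> Comp C w h = h' \<and> Comp C w k = k'))"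

subsection \<open>Transfinite compositions and relative cell complexes\<close>

text \<open>Ordinals are represented by well-orders \<open>r\<close> (reflexive, as in the library).  A chain along \<open>r\<close>
  consists of objects \<open>Z a\<close> and maps \<open>z a b : Z a \<rightarrow> Z b\<close> for \<open>(a, b) \<in> r\<close>.\<close>

definition is_chain :: "('o, 'm) cat \<Rightarrow> 'w rel \<Rightarrow> ('w \<Rightarrow> 'o) \<Rightarrow> ('w \<Rightarrow> 'w \<Rightarrow> 'm) \<Rightarrow> bool" where
  "is_chain C r Z z \<longleftrightarrow>
     (\<forall>a\<in>Field r. Z a \<in> Ob C \<and> z a a = Ident C (Z a)) \<and>
     (\<forall>a b. (a, b) \<in> r \<longrightarrow> z a b \<in> homs C (Z a) (Z b)) \<and>
     (\<forall>a b c. (a, b) \<in> r \<and> (b, c) \<in> r \<longrightarrow> z a c = Comp C (z b c) (z a b))"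

definition chain_cocone ::
  "('o, 'm) cat \<Rightarrow> 'w rel \<Rightarrow> ('w \<Rightarrow> 'o) \<Rightarrow> ('w \<Rightarrow> 'w \<Rightarrow> 'm) \<Rightarrow> 'w set \<Rightarrow> 'o \<Rightarrow> ('w \<Rightarrow> 'm) \<Rightarrow> bool" where
  "chain_cocone C r Z z S e \<iota> \<longleftrightarrow> e \<in> Ob C \<and> (\<forall>a\<in>S. \<iota> a \<in> homs C (Z a) e) \<and>
     (\<forall>a\<in>S. \<forall>b\<in>S. (a, b) \<in> r \<longrightarrow> Comp C (\<iota> b) (z a b) = \<iota> a)"

definition chain_colimit ::
  "('o, 'm) cat \<Rightarrow> 'w rel \<Rightarrow> ('w \<Rightarrow> 'o) \<Rightarrow> ('w \<Rightarrow> 'w \<Rightarrow> 'm) \<Rightarrow> 'w set \<Rightarrow> 'o \<Rightarrow> ('w \<Rightarrow> 'm) \<Rightarrow> bool" where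
  "chain_colimit C r Z z S d \<iota> \<longleftrightarrow> chain_cocone C r Z z S d \<iota> \<and>
     (\<forall>e \<kappa>. chain_cocone C r Z z S e \<kappa> \<longrightarrow>
        (\<exists>!w. w \<in> homs C d e \<and> (\<forall>a\<in>S. Comp C w (\<iota> a) = \<kappa> a)))"

text \<open>\<open>f : Z 0 \<rightarrow> colim Z\<close> is the composition of the colimit-preserving chain \<open>Z\<close> each of whose
  successor maps is a pushout of a map in \<open>J\<close>.  An element \<open>b\<close> is a successor of \<open>a\<close> iff \<open>a < b\<close> and
  the elements \<open>< b\<close> are exactly the elements \<open>\<le> a\<close>.\<close>

definition cell_composition ::
  "('o, 'm) cat \<Rightarrow> 'm set \<Rightarrow> 'w rel \<Rightarrow> ('w \<Rightarrow> 'o) \<Rightarrow> ('w \<Rightarrow> 'w \<Rightarrow> 'm) \<Rightarrow> 'm \<Rightarrow> bool" where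
  "cell_composition C J r Z z f \<longleftrightarrow>
     Well_order r \<and> Field r \<noteq> {} \<and> is_chain C r Z z \<and>
     (\<forall>a b. a \<in> underS r b \<and> underS r b = under r a \<longrightarrow>
        (\<exists>j\<in>J. \<exists>g h. is_pushout C j g h (z a b))) \<and>
     (\<forall>b\<in>Field r. underS r b \<noteq> {} \<and> (\<nexists>a. a \<in> underS r b \<and> underS r b = under r a) \<longrightarrow>
        chain_colimit C r Z z (underS r b) (Z b) (\<lambda>a. z a b)) \<and>
     (\<exists>d \<iota>. chain_colimit C r Z z (Field r) d \<iota> \<and>
        (\<exists>a\<in>Field r. underS r a = {} \<and> f = \<iota> a))"

section \<open>Pro-categories\<close>

definition eq_closure :: "'a rel \<Rightarrow> 'a rel" where
  "eq_closure r = (r \<union> r\<inverse>)\<^sup>*"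

definition cofiltering :: "('i, 'j) cat \<Rightarrow> bool" where
  "cofiltering I \<longleftrightarrow> Ob I \<noteq> {} \<and>
     (\<forall>s\<in>Ob I. \<forall>t\<in>Ob I. \<exists>u\<in>Ob I. homs I u s \<noteq> {} \<and> homs I u t \<noteq> {}) \<and>
     (\<forall>s\<in>Ob I. \<forall>t\<in>Ob I. \<forall>a\<in>homs I s t. \<forall>b\<in>homs I s t.
        \<exists>u\<in>Ob I. \<exists>c\<in>homs I u s. Comp I a c = Comp I b c)"

record ('i, 'j, 'o, 'm) diagram =
  idx :: "('i, 'j) cat"
  dob :: "'i \<Rightarrow> 'o"
  dar :: "'j \<Rightarrow> 'm"

definition is_pro_object :: "('o, 'm) cat \<Rightarrow> ('i, 'j, 'o, 'm) diagram \<Rightarrow> bool" where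
  "is_pro_object C X \<longleftrightarrow> category (idx X) \<and> cofiltering (idx X) \<and>
     (\<forall>s\<in>Ob (idx X). dob X s \<in> Ob C \<and> dar X (Ident (idx X) s) = Ident C (dob X s)) \<and>
     (\<forall>a\<in>Ar (idx X). dar X a \<in> homs C (dob X (Dom (idx X) a)) (dob X (Cod (idx X) a))) \<and>
     (\<forall>a\<in>Ar (idx X). \<forall>b\<in>Ar (idx X). Cod (idx X) a = Dom (idx X) b \<longrightarrow>
        dar X (Comp (idx X) b a) = Comp C (dar X b) (dar X a))"

text \<open>The set \<open>colim\<^sub>t Hom(X t, y)\<close>: pairs \<open>(t, f)\<close> with \<open>f : X t \<rightarrow> y\<close>, modulo the equivalence
  relation generated by \<open>(t, f) \<sim> (t', f \<circ> X u)\<close> for \<open>u : t' \<rightarrow> t\<close>.\<close>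

definition colim_pts :: "('o, 'm) cat \<Rightarrow> ('i, 'j, 'o, 'm) diagram \<Rightarrow> 'o \<Rightarrow> ('i \<times> 'm) set" where
  "colim_pts C X y = {(t, f). t \<in> Ob (idx X) \<and> f \<in> homs C (dob X t) y}"

definition colim_rel :: "('o, 'm) cat \<Rightarrow> ('i, 'j, 'o, 'm) diagram \<Rightarrow> 'o \<Rightarrow> ('i \<times> 'm) rel" where
  "colim_rel C X y = eq_closure
     {((t, f), (t', f')). (t, f) \<in> colim_pts C X y \<and>
        (\<exists>u \<in> homs (idx X) t' t. f' = Comp C f (dar X u))}"

definition colim_hom :: "('o, 'm) cat \<Rightarrow> ('i, 'j, 'o, 'm) diagram \<Rightarrow> 'o \<Rightarrow> ('i \<times> 'm) set set" where
  "colim_hom C X y = colim_pts C X y // colim_rel C X y"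

text \<open>Postcomposition with \<open>h\<close> as a map from \<open>colim\<^sub>t Hom(X t, Dom h)\<close> to \<open>colim\<^sub>t Hom(X t, Cod h)\<close>.\<close>

definition colim_push ::
  "('o, 'm) cat \<Rightarrow> ('i, 'j, 'o, 'm) diagram \<Rightarrow> 'm \<Rightarrow> ('i \<times> 'm) set \<Rightarrow> ('i \<times> 'm) set" where
  "colim_push C X h c = colim_rel C X (Cod C h) `` ((\<lambda>(t, f). (t, Comp C h f)) ` c)"

text \<open>A pro-map is an element of \<open>lim\<^sub>s colim\<^sub>t Hom(X t, Y s)\<close>, i.e. a compatible family of classes.
  The components at non-indices are \<open>{}\<close>, so that equal families are equal as functions.\<close>

record ('i, 'j, 'o, 'm) pro_arrow =
  pdom :: "('i, 'j, 'o, 'm) diagram"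
  pcod :: "('i, 'j, 'o, 'm) diagram"
  pcomp :: "'i \<Rightarrow> ('i \<times> 'm) set"

definition is_pro_map :: "('o, 'm) cat \<Rightarrow> ('i, 'j, 'o, 'm) pro_arrow \<Rightarrow> bool" where
  "is_pro_map C p \<longleftrightarrow> is_pro_object C (pdom p) \<and> is_pro_object C (pcod p) \<and>
     (\<forall>s\<in>Ob (idx (pcod p)). pcomp p s \<in> colim_hom C (pdom p) (dob (pcod p) s)) \<and>
     (\<forall>s. s \<notin> Ob (idx (pcod p)) \<longrightarrow> pcomp p s = {}) \<and>
     (\<forall>a\<in>Ar (idx (pcod p)).
        colim_push C (pdom p) (dar (pcod p) a) (pcomp p (Dom (idx (pcod p)) a))
          = pcomp p (Cod (idx (pcod p)) a))"

text \<open>The pro-map represented by a natural transformation between diagrams with the same index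
  category.\<close>

definition level_arrow ::
  "('o, 'm) cat \<Rightarrow> ('i, 'j, 'o, 'm) diagram \<Rightarrow> ('i, 'j, 'o, 'm) diagram \<Rightarrow> ('i \<Rightarrow> 'm) \<Rightarrow>
     ('i, 'j, 'o, 'm) pro_arrow" where
  "level_arrow C X Y \<theta> = \<lparr>pdom = X, pcod = Y,
     pcomp = (\<lambda>s. if s \<in> Ob (idx Y) then colim_rel C X (dob Y s) `` {(s, \<theta> s)} else {})\<rparr>"

definition is_nat_trans ::
  "('o, 'm) cat \<Rightarrow> ('i, 'j, 'o, 'm) diagram \<Rightarrow> ('i, 'j, 'o, 'm) diagram \<Rightarrow> ('i \<Rightarrow> 'm) \<Rightarrow> bool" where
  "is_nat_trans C X Y \<theta> \<longleftrightarrow> is_pro_object C X \<and> is_pro_object C Y \<and> idx X = idx Y \<and>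
     (\<forall>s\<in>Ob (idx X). \<theta> s \<in> homs C (dob X s) (dob Y s)) \<and>
     (\<forall>a\<in>Ar (idx X).
        Comp C (dar Y a) (\<theta> (Dom (idx X) a)) = Comp C (\<theta> (Cod (idx X) a)) (dar X a))"

text \<open>In the composite of \<open>p : X \<rightarrow> Y\<close> and \<open>q : Y \<rightarrow> Z\<close>, the component at \<open>s\<close> is represented by
  \<open>(t, g \<circ> f)\<close>, where \<open>(r, g)\<close> represents \<open>q\<close> at \<open>s\<close> and \<open>(t, f)\<close> represents \<open>p\<close> at \<open>r\<close>.  The class
  does not depend on \<open>(r, g)\<close>, so the union below is a union of equal sets.\<close>

definition pro_cat ::
  "('o, 'm) cat \<Rightarrow> (('i, 'j, 'o, 'm) diagram, ('i, 'j, 'o, 'm) pro_arrow) cat" where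
  "pro_cat C = \<lparr>
     Ob = {X. is_pro_object C X},
     Ar = {p. is_pro_map C p},
     Dom = pdom,
     Cod = pcod,
     Ident = (\<lambda>X. level_arrow C X X (\<lambda>s. Ident C (dob X s))),
     Comp = (\<lambda>q p. \<lparr>pdom = pdom p, pcod = pcod q,
        pcomp = (\<lambda>s. \<Union>(r, g)\<in>pcomp q s. colim_push C (pdom p) g (pcomp p r))\<rparr>)\<rparr>"

definition one_cat :: "('i, 'j) cat" where
  "one_cat = \<lparr>Ob = {undefined}, Ar = {undefined}, Dom = (\<lambda>_. undefined), Cod = (\<lambda>_. undefined),
     Ident = (\<lambda>_. undefined), Comp = (\<lambda>_ _. undefined)\<rparr>"

definition const_pro :: "('o, 'm) cat \<Rightarrow> 'o \<Rightarrow> ('i, 'j, 'o, 'm) diagram" where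
  "const_pro C x = \<lparr>idx = one_cat, dob = (\<lambda>_. x), dar = (\<lambda>_. Ident C x)\<rparr>"

definition essentially_levelwise ::
  "('o, 'm) cat \<Rightarrow> 'm set \<Rightarrow> ('i, 'j, 'o, 'm) pro_arrow \<Rightarrow> bool" where
  "essentially_levelwise C M p \<longleftrightarrow>
     (\<exists>(X :: ('i, 'j, 'o, 'm) diagram) Y \<theta>. is_nat_trans C X Y \<theta> \<and>
        (\<forall>s\<in>Ob (idx X). \<theta> s \<in> M) \<and> arrow_iso (pro_cat C) p (level_arrow C X Y \<theta>))"

text \<open>Cofibrations and weak equivalences of pro-objects for classes of maps \<open>M a\<close> indexed by \<open>a \<in> A\<close>.\<close>

definition ess_levelwise_all ::
  "('o, 'm) cat \<Rightarrow> 'a set \<Rightarrow> ('a \<Rightarrow> 'm set) \<Rightarrow> ('i, 'j, 'o, 'm) pro_arrow set" where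
  "ess_levelwise_all C A M = {p \<in> Ar (pro_cat C). \<forall>a\<in>A. essentially_levelwise C (M a) p}"

text \<open>The category of a preordered set \<open>S\<close>, with a unique map \<open>t \<rightarrow> s\<close> when \<open>below s t\<close>.  Objects and
  arrows are named through injections \<open>oc\<close> and \<open>ac\<close>.\<close>

definition directed_cat ::
  "('a \<Rightarrow> 'i) \<Rightarrow> ('a \<times> 'a \<Rightarrow> 'j) \<Rightarrow> 'a set \<Rightarrow> ('a \<Rightarrow> 'a \<Rightarrow> bool) \<Rightarrow> ('i, 'j) cat" where
  "directed_cat oc ac S below = \<lparr>
     Ob = oc ` S,
     Ar = ac ` {(t, s). t \<in> S \<and> s \<in> S \<and> below s t},
     Dom = (\<lambda>a. oc (fst (the_inv ac a))),
     Cod = (\<lambda>a. oc (snd (the_inv ac a))),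
     Ident = (\<lambda>i. ac (the_inv oc i, the_inv oc i)),
     Comp = (\<lambda>b a. ac (fst (the_inv ac a), snd (the_inv ac b)))\<rparr>"

section \<open>Homotopy groups and \<open>n\<close>-equivalences\<close>

definition disc :: "nat \<Rightarrow> (nat \<Rightarrow> real) topology" where
  "disc m = subtopology (Euclidean_space m) {x. (\<Sum>i<m. (x i)\<^sup>2) \<le> 1}"

text \<open>The boundary sphere \<open>S\<^bsup>m-1\<^esup>\<close> of the \<open>m\<close>-disc, which is empty for \<open>m = 0\<close>.\<close>

definition disc_boundary :: "nat \<Rightarrow> (nat \<Rightarrow> real) topology" where
  "disc_boundary m = subtopology (Euclidean_space m) {x. (\<Sum>i<m. (x i)\<^sup>2) = 1}"

text \<open>For \<open>n \<ge> 1\<close>, the set \<open>\<pi>\<^sub>n(X, x)\<close> consists of the maps of pairs from the disc and its boundary to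
  \<open>(X, x)\<close>, up to homotopy of such maps.  An induced map is a homomorphism, so it is an
  isomorphism iff it is bijective; no group structure has to be recorded.\<close>

definition spheroids :: "nat \<Rightarrow> 'a topology \<Rightarrow> 'a \<Rightarrow> ((nat \<Rightarrow> real) \<Rightarrow> 'a) set" where
  "spheroids n X x = {\<alpha>. continuous_map (disc n) X \<alpha> \<and> (\<forall>y\<in>topspace (disc_boundary n). \<alpha> y = x)}"

definition spheroid_rel :: "nat \<Rightarrow> 'a topology \<Rightarrow> 'a \<Rightarrow> ((nat \<Rightarrow> real) \<Rightarrow> 'a) rel" where
  "spheroid_rel n X x = {(\<alpha>, \<beta>).
     homotopic_with (\<lambda>h. \<forall>y\<in>topspace (disc_boundary n). h y = x) (disc n) X \<alpha> \<beta>}"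

definition htpy_group :: "nat \<Rightarrow> 'a topology \<Rightarrow> 'a \<Rightarrow> ((nat \<Rightarrow> real) \<Rightarrow> 'a) set set" where
  "htpy_group n X x = spheroids n X x // spheroid_rel n X x"

definition htpy_map ::
  "nat \<Rightarrow> 'b topology \<Rightarrow> ('a \<Rightarrow> 'b) \<Rightarrow> 'a \<Rightarrow> ((nat \<Rightarrow> real) \<Rightarrow> 'a) set \<Rightarrow> ((nat \<Rightarrow> real) \<Rightarrow> 'b) set" where
  "htpy_map n Y f x c = spheroid_rel n Y (f x) `` ((\<lambda>\<alpha>. f \<circ> \<alpha>) ` c)"

definition pi0_map :: "'b topology \<Rightarrow> ('a \<Rightarrow> 'b) \<Rightarrow> 'a set \<Rightarrow> 'b set" where
  "pi0_map Y f c = (\<Union>x\<in>c. path_component_of_set Y (f x))"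

text \<open>\<open>\<pi>\<^sub>0\<close> needs no base point; treating it separately makes the condition in dimension \<open>0\<close>
  meaningful for empty \<open>X\<close> as well.\<close>

definition n_equivalence :: "nat \<Rightarrow> 'a topology \<Rightarrow> 'b topology \<Rightarrow> ('a \<Rightarrow> 'b) \<Rightarrow> bool" where
  "n_equivalence n X Y f \<longleftrightarrow> continuous_map X Y f \<and>
     (if n = 0 then pi0_map Y f ` path_components_of X = path_components_of Y
      else bij_betw (pi0_map Y f) (path_components_of X) (path_components_of Y)) \<and>
     (\<forall>x\<in>topspace X.
        (\<forall>k. 1 \<le> k \<and> k < n \<longrightarrow>
           bij_betw (htpy_map k Y f x) (htpy_group k X x) (htpy_group k Y (f x))) \<and>
        (1 \<le> n \<longrightarrow> htpy_map n Y f x ` htpy_group n X x = htpy_group n Y (f x)))"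

section \<open>Profinite groups and \<open>G\<close>-spaces\<close>

locale profinite_group = group G for G (structure) +
  fixes T :: "'a topology"
  assumes topspace_eq: "topspace T = carrier G"
    and continuous_mult: "continuous_map (prod_topology T T) T (\<lambda>(x, y). x \<otimes> y)"
    and continuous_inv: "continuous_map T T (\<lambda>x. inv x)"
    and compact: "compact_space T"
    and hausdorff: "Hausdorff_space T"
    and totally_disconnected: "connectedin T S \<Longrightarrow> x \<in> S \<Longrightarrow> y \<in> S \<Longrightarrow> x = y"

definition fi_subgroup :: "('g, 'b) monoid_scheme \<Rightarrow> 'g topology \<Rightarrow> 'g set \<Rightarrow> bool" where
  "fi_subgroup G T U \<longleftrightarrow> subgroup U G \<and> openin T U \<and> finite (rcosets\<^bsub>G\<^esub> U)"

text \<open>It suffices to test with compact Hausdorff spaces \<open>K\<close> carried by a set of elements of type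
  \<open>'a set set\<close>.  If \<open>f(K)\<close> is not closed, replace \<open>K\<close> by the closure of a subset \<open>S\<close> with one point
  over each point of \<open>f(K)\<close>, which has the same image.  If \<open>X\<close> is weak Hausdorff and \<open>f\<^sup>-\<^sup>1(A)\<close> is not
  closed, replace \<open>K\<close> by the closure of a subset \<open>S\<close> of \<open>f\<^sup>-\<^sup>1(A)\<close> with one point over each point of
  \<open>A \<inter> f(K)\<close>; its image is closed, hence contains the image of the closure of \<open>f\<^sup>-\<^sup>1(A)\<close>, so
  \<open>f\<^sup>-\<^sup>1(A)\<close> is still not closed in it.  A Hausdorff space with a dense subset of size \<open>\<kappa>\<close> has at
  most \<open>2\<^bsup>2\<^bsup>\<kappa>\<^esup>\<^esup>\<close> points.\<close>

definition weak_hausdorff :: "'a topology \<Rightarrow> bool" where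
  "weak_hausdorff X \<longleftrightarrow>
     (\<forall>(K :: 'a set set topology) f. compact_space K \<and> Hausdorff_space K \<and> continuous_map K X f \<longrightarrow>
        closedin X (f ` topspace K))"

definition compactly_generated :: "'a topology \<Rightarrow> bool" where
  "compactly_generated X \<longleftrightarrow>
     (\<forall>A. A \<subseteq> topspace X \<and>
        (\<forall>(K :: 'a set set topology) f. compact_space K \<and> Hausdorff_space K \<and> continuous_map K X f \<longrightarrow>
           closedin K {x \<in> topspace K. f x \<in> A}) \<longrightarrow>
        closedin X A)"

record ('g, 'p) gspace =
  gtop :: "'p topology"
  gact :: "'g \<Rightarrow> 'p \<Rightarrow> 'p"

text \<open>The product \<open>G \<times> X\<close> in compactly generated spaces is the ordinary product topology, because
  \<open>G\<close> is compact Hausdorff.\<close>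

definition is_gspace :: "('g, 'b) monoid_scheme \<Rightarrow> 'g topology \<Rightarrow> ('g, 'p) gspace \<Rightarrow> bool" where
  "is_gspace G T X \<longleftrightarrow>
     compactly_generated (gtop X) \<and> weak_hausdorff (gtop X) \<and>
     continuous_map (prod_topology T (gtop X)) (gtop X) (\<lambda>(g, x). gact X g x) \<and>
     (\<forall>x\<in>topspace (gtop X). gact X \<one>\<^bsub>G\<^esub> x = x \<and>
        (\<forall>g\<in>carrier G. \<forall>h\<in>carrier G. gact X (g \<otimes>\<^bsub>G\<^esub> h) x = gact X g (gact X h x)))"

definition equivariant ::
  "('g, 'b) monoid_scheme \<Rightarrow> ('g, 'p) gspace \<Rightarrow> ('g, 'q) gspace \<Rightarrow> ('p \<Rightarrow> 'q) \<Rightarrow> bool" where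
  "equivariant G X Y f \<longleftrightarrow>
     (\<forall>g\<in>carrier G. \<forall>x\<in>topspace (gtop X). f (gact X g x) = gact Y g (f x))"

record ('g, 'p) gmap =
  gdom :: "('g, 'p) gspace"
  gcod :: "('g, 'p) gspace"
  gfun :: "'p \<Rightarrow> 'p"

text \<open>The category of \<open>G\<close>-spaces with points in \<open>'u\<close>; the type \<open>'u\<close> plays the role of the universe
  of small sets.\<close>

definition gspace_cat ::
  "('g, 'b) monoid_scheme \<Rightarrow> 'g topology \<Rightarrow> (('g, 'u) gspace, ('g, 'u) gmap) cat" where
  "gspace_cat G T = \<lparr>
     Ob = {X. is_gspace G T X},
     Ar = {f. is_gspace G T (gdom f) \<and> is_gspace G T (gcod f) \<and>
            continuous_map (gtop (gdom f)) (gtop (gcod f)) (gfun f) \<and>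
            equivariant G (gdom f) (gcod f) (gfun f) \<and>
            gfun f \<in> extensional (topspace (gtop (gdom f)))},
     Dom = gdom,
     Cod = gcod,
     Ident = (\<lambda>X. \<lparr>gdom = X, gcod = X, gfun = restrict id (topspace (gtop X))\<rparr>),
     Comp = (\<lambda>g f. \<lparr>gdom = gdom f, gcod = gcod g,
        gfun = restrict (gfun g \<circ> gfun f) (topspace (gtop (gdom f)))\<rparr>)\<rparr>"

definition point_gspace :: "'p \<Rightarrow> ('g, 'p) gspace" where
  "point_gspace p = \<lparr>gtop = discrete_topology {p}, gact = (\<lambda>_ x. x)\<rparr>"

definition fixed_points :: "'g set \<Rightarrow> ('g, 'p) gspace \<Rightarrow> 'p topology" where
  "fixed_points V X = subtopology (gtop X) {x. \<forall>g\<in>V. gact X g x = x}"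

text \<open>Since \<open>U\<close> has finite index in \<open>G\<close>, the finite-index subgroups of \<open>U\<close> are the finite-index
  subgroups of \<open>G\<close> contained in \<open>U\<close>.\<close>

definition U_n_equivalence ::
  "('g, 'b) monoid_scheme \<Rightarrow> 'g topology \<Rightarrow> 'g set \<Rightarrow> nat \<Rightarrow> ('g, 'u) gmap \<Rightarrow> bool" where
  "U_n_equivalence G T U n f \<longleftrightarrow> f \<in> Ar (gspace_cat G T) \<and>
     (\<forall>V. fi_subgroup G T V \<and> V \<subseteq> U \<longrightarrow>
        n_equivalence n (fixed_points V (gdom f)) (fixed_points V (gcod f)) (gfun f))"

subsection \<open>Cells and cofibrations\<close>

text \<open>The finite set \<open>G/V\<close> of left cosets is discrete because \<open>V\<close> is open.\<close>

definition orbit_times ::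
  "('g, 'b) monoid_scheme \<Rightarrow> 'g set \<Rightarrow> 'q topology \<Rightarrow> ('g, 'g set \<times> 'q) gspace" where
  "orbit_times G V Q = \<lparr>gtop = prod_topology (discrete_topology (lcosets\<^bsub>G\<^esub> V)) Q,
     gact = (\<lambda>g (c, y). (g <#\<^bsub>G\<^esub> c, y))\<rparr>"

definition g_homeo ::
  "('g, 'b) monoid_scheme \<Rightarrow> ('g, 'p) gspace \<Rightarrow> ('g, 'q) gspace \<Rightarrow> ('p \<Rightarrow> 'q) \<Rightarrow> bool" where
  "g_homeo G X Y f \<longleftrightarrow> homeomorphic_map (gtop X) (gtop Y) f \<and> equivariant G X Y f"

text \<open>Maps of \<open>G\<close>-spaces with points in \<open>'u\<close> that are isomorphic to an inclusion
  \<open>G/V \<times> S\<^bsup>m-1\<^esup> \<rightarrow> G/V \<times> D\<^bsup>m\<^esup>\<close> with \<open>m \<ge> 0\<close> and \<open>V\<close> a finite-index subgroup of \<open>U\<close>.\<close>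

definition U_cells ::
  "('g, 'b) monoid_scheme \<Rightarrow> 'g topology \<Rightarrow> 'g set \<Rightarrow> ('g, 'u) gmap set" where
  "U_cells G T U = {j \<in> Ar (gspace_cat G T).
     \<exists>V m \<phi> \<psi>. fi_subgroup G T V \<and> V \<subseteq> U \<and>
       g_homeo G (orbit_times G V (disc_boundary m)) (gdom j) \<phi> \<and>
       g_homeo G (orbit_times G V (disc m)) (gcod j) \<psi> \<and>
       (\<forall>x\<in>topspace (gtop (orbit_times G V (disc_boundary m))). gfun j (\<phi> x) = \<psi> x)}"

text \<open>Every cell attachment adds points, so a relative cell complex between spaces with points in
  \<open>'u\<close> has at most \<open>|'u|\<close> stages.  It is therefore enough to index stages by well-orders on
  subsets of \<open>'u\<close> (for infinite \<open>'u\<close>).\<close>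

definition U_relative_cell_complex ::
  "('g, 'b) monoid_scheme \<Rightarrow> 'g topology \<Rightarrow> 'g set \<Rightarrow> ('g, 'u) gmap \<Rightarrow> bool" where
  "U_relative_cell_complex G T U f \<longleftrightarrow>
     (\<exists>(r :: 'u rel) Z z. cell_composition (gspace_cat G T) (U_cells G T U) r Z z f)"

definition U_cofibration ::
  "('g, 'b) monoid_scheme \<Rightarrow> 'g topology \<Rightarrow> 'g set \<Rightarrow> ('g, 'u) gmap \<Rightarrow> bool" where
  "U_cofibration G T U f \<longleftrightarrow>
     (\<exists>g. U_relative_cell_complex G T U g \<and> arrow_retract (gspace_cat G T) f g)"

subsection \<open>The model structure on pro-\<open>G\<close>-spaces\<close>

definition indices :: "('g, 'b) monoid_scheme \<Rightarrow> 'g topology \<Rightarrow> ('g set \<times> nat) set" where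
  "indices G T = {(U, n). fi_subgroup G T U}"

definition C_class ::
  "('g, 'b) monoid_scheme \<Rightarrow> 'g topology \<Rightarrow> 'g set \<times> nat \<Rightarrow> ('g, 'u) gmap set" where
  "C_class G T = (\<lambda>(U, n). {f. U_cofibration G T U f})"

definition W_class ::
  "('g, 'b) monoid_scheme \<Rightarrow> 'g topology \<Rightarrow> 'g set \<times> nat \<Rightarrow> ('g, 'u) gmap set" where
  "W_class G T = (\<lambda>(U, n). {f. \<exists>V. fi_subgroup G T V \<and> U_n_equivalence G T V n f})"

text \<open>Small diagrams are indexed by categories whose objects and arrows are elements of the universe
  \<open>'u\<close>.\<close>

type_synonym ('g, 'u) pro_gspace = "('u, 'u, ('g, 'u) gspace, ('g, 'u) gmap) diagram"
type_synonym ('g, 'u) pro_gmap = "('u, 'u, ('g, 'u) gspace, ('g, 'u) gmap) pro_arrow"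

definition pro_gspace_cat ::
  "('g, 'b) monoid_scheme \<Rightarrow> 'g topology \<Rightarrow> (('g, 'u) pro_gspace, ('g, 'u) pro_gmap) cat" where
  "pro_gspace_cat G T = pro_cat (gspace_cat G T)"

definition pro_cofibrations ::
  "('g, 'b) monoid_scheme \<Rightarrow> 'g topology \<Rightarrow> ('g, 'u) pro_gmap set" where
  "pro_cofibrations G T = ess_levelwise_all (gspace_cat G T) (indices G T) (C_class G T)"

definition pro_weak_equivalences ::
  "('g, 'b) monoid_scheme \<Rightarrow> 'g topology \<Rightarrow> ('g, 'u) pro_gmap set" where
  "pro_weak_equivalences G T = ess_levelwise_all (gspace_cat G T) (indices G T) (W_class G T)"

definition cofibrant ::
  "('g, 'b) monoid_scheme \<Rightarrow> 'g topology \<Rightarrow> ('g, 'u) pro_gspace \<Rightarrow> bool" where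
  "cofibrant G T X \<longleftrightarrow>
     (\<exists>z i. is_initial (pro_gspace_cat G T) z \<and> i \<in> homs (pro_gspace_cat G T) z X \<and>
        i \<in> pro_cofibrations G T)"

section \<open>The spaces \<open>E(G/U)\<close>\<close>

text \<open>For a finite set \<open>S\<close>, we form the geometric realization of the simplicial set with \<open>n\<close>-simplices
  \<open>S\<^bsup>n+1\<^esup>\<close>, whose faces omit and whose degeneracies repeat entries.  For a group \<open>S\<close> this is the
  simplicial bar construction of \<open>ES\<close>, on which \<open>S\<close> acts by left translation.

  A nonempty list of pairs represents a simplex \<open>(s\<^sub>0, \<dots>, s\<^sub>n)\<close> together with a point of the standard
  simplex given by its barycentric coordinates.\<close>

definition bar_pts :: "'s set \<Rightarrow> ('s \<times> real) list set" where
  "bar_pts S = {ps. fst ` set ps \<subseteq> S \<and> (\<forall>t \<in> snd ` set ps. 0 \<le> t) \<and> sum_list (map snd ps) = 1}"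

inductive bar_step :: "('s \<times> real) list \<Rightarrow> ('s \<times> real) list \<Rightarrow> bool" where
  face: "bar_step (ps @ (s, 0) # qs) (ps @ qs)"
| degeneracy: "bar_step (ps @ (s, t) # (s, t') # qs) (ps @ (s, t + t') # qs)"

definition bar_rel :: "'s set \<Rightarrow> ('s \<times> real) list rel" where
  "bar_rel S = eq_closure {(ps, qs). ps \<in> bar_pts S \<and> qs \<in> bar_pts S \<and> bar_step ps qs}"

definition bar_chart :: "'s set \<Rightarrow> 's list \<Rightarrow> (nat \<Rightarrow> real) \<Rightarrow> ('s \<times> real) list set" where
  "bar_chart S xs t = bar_rel S `` {zip xs (map t [0..<length xs])}"

definition bar_open :: "'s set \<Rightarrow> ('s \<times> real) list set set \<Rightarrow> bool" where
  "bar_open S W \<longleftrightarrow> W \<subseteq> bar_pts S // bar_rel S \<and>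
     (\<forall>xs. xs \<noteq> [] \<and> set xs \<subseteq> S \<longrightarrow>
        openin (subtopology (powertop_real UNIV) (standard_simplex (length xs - 1)))
          {t \<in> standard_simplex (length xs - 1). bar_chart S xs t \<in> W})"

text \<open>The quotient topology: the final topology for the characteristic maps of all simplices.\<close>

definition bar_top :: "'s set \<Rightarrow> ('s \<times> real) list set topology" where
  "bar_top S = topology (bar_open S)"

lemma bar_openI:
  assumes "W \<subseteq> bar_pts S // bar_rel S"
    and "\<And>xs. xs \<noteq> [] \<Longrightarrow> set xs \<subseteq> S \<Longrightarrow>
      openin (subtopology (powertop_real UNIV) (standard_simplex (length xs - 1)))
        {t \<in> standard_simplex (length xs - 1). bar_chart S xs t \<in> W}"
  shows "bar_open S W"
  using assms unfolding bar_open_def by simp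

lemma bar_openD:
  assumes "bar_open S W"
  shows "W \<subseteq> bar_pts S // bar_rel S"
    and "xs \<noteq> [] \<Longrightarrow> set xs \<subseteq> S \<Longrightarrow>
      openin (subtopology (powertop_real UNIV) (standard_simplex (length xs - 1)))
        {t \<in> standard_simplex (length xs - 1). bar_chart S xs t \<in> W}"
  using assms unfolding bar_open_def by simp_all

lemma openin_bar_top: "openin (bar_top S) = bar_open S"
proof -
  have int: "bar_open S (V \<inter> W)" if V: "bar_open S V" and W: "bar_open S W" for V W
  proof (rule bar_openI)
    show "V \<inter> W \<subseteq> bar_pts S // bar_rel S"
      using bar_openD(1)[OF V] by (rule subset_trans[OF Int_lower1])
    fix xs :: "'a list" assume xs: "xs \<noteq> []" "set xs \<subseteq> S"
    have eq: "{t \<in> standard_simplex (length xs - 1). bar_chart S xs t \<in> V \<inter> W} =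
        {t \<in> standard_simplex (length xs - 1). bar_chart S xs t \<in> V} \<inter>
        {t \<in> standard_simplex (length xs - 1). bar_chart S xs t \<in> W}"
      by (simp add: set_eq_iff conj_ac)
    show "openin (subtopology (powertop_real UNIV) (standard_simplex (length xs - 1)))
        {t \<in> standard_simplex (length xs - 1). bar_chart S xs t \<in> V \<inter> W}"
      unfolding eq by (rule openin_Int[OF bar_openD(2)[OF V xs] bar_openD(2)[OF W xs]])
  qed
  have un: "bar_open S (\<Union>\<W>)" if \<W>: "\<And>W. W \<in> \<W> \<Longrightarrow> bar_open S W" for \<W>
  proof (rule bar_openI)
    show "\<Union>\<W> \<subseteq> bar_pts S // bar_rel S"
      using bar_openD(1)[OF \<W>] by (rule Union_least)
    fix xs :: "'a list" assume xs: "xs \<noteq> []" "set xs \<subseteq> S"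
    have eq: "{t \<in> standard_simplex (length xs - 1). bar_chart S xs t \<in> \<Union>\<W>} =
        \<Union>((\<lambda>W. {t \<in> standard_simplex (length xs - 1). bar_chart S xs t \<in> W}) ` \<W>)"
      by auto
    show "openin (subtopology (powertop_real UNIV) (standard_simplex (length xs - 1)))
        {t \<in> standard_simplex (length xs - 1). bar_chart S xs t \<in> \<Union>\<W>}"
      unfolding eq
    proof (rule openin_Union)
      fix Y assume "Y \<in> (\<lambda>W. {t \<in> standard_simplex (length xs - 1). bar_chart S xs t \<in> W}) ` \<W>"
      then obtain W where W: "W \<in> \<W>"
        and Y: "Y = {t \<in> standard_simplex (length xs - 1). bar_chart S xs t \<in> W}"
        by (rule imageE)
      show "openin (subtopology (powertop_real UNIV) (standard_simplex (length xs - 1))) Y"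
        unfolding Y by (rule bar_openD(2)[OF \<W>[OF W] xs])
    qed
  qed
  have "istopology (bar_open S)"
    unfolding istopology_def using int un by simp
  then show ?thesis
    unfolding bar_top_def by (rule topology_inverse')
qed

text \<open>The map of realizations induced by a function \<open>f : S \<rightarrow> S'\<close>.\<close>

definition bar_map ::
  "'r set \<Rightarrow> ('s \<Rightarrow> 'r) \<Rightarrow> ('s \<times> real) list set \<Rightarrow> ('r \<times> real) list set" where
  "bar_map S' f c = bar_rel S' `` (map (map_prod f id) ` c)"

definition E_gspace ::
  "('g, 'b) monoid_scheme \<Rightarrow> 'g set \<Rightarrow> ('g, ('g set \<times> real) list set) gspace" where
  "E_gspace G U = \<lparr>gtop = bar_top (carrier (G Mod U)),
     gact = (\<lambda>g. bar_map (carrier (G Mod U)) (\<lambda>c. (U #>\<^bsub>G\<^esub> g) \<otimes>\<^bsub>G Mod U\<^esub> c))\<rparr>"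

text \<open>For \<open>V \<subseteq> U\<close>, the map \<open>E(G/V) \<rightarrow> E(G/U)\<close> induced by the projection \<open>G/V \<rightarrow> G/U\<close>, which sends a
  coset \<open>c\<close> of \<open>V\<close> to the coset \<open>U c\<close> of \<open>U\<close>.\<close>

definition E_proj ::
  "('g, 'b) monoid_scheme \<Rightarrow> 'g set \<Rightarrow> ('g set \<times> real) list set \<Rightarrow> ('g set \<times> real) list set" where
  "E_proj G U = bar_map (carrier (G Mod U)) (\<lambda>c. U <#>\<^bsub>G\<^esub> c)"

text \<open>The isomorphic copy of a \<open>G\<close>-space along an injection \<open>e\<close> of its points into the universe.\<close>

definition gspace_copy :: "('p \<Rightarrow> 'u) \<Rightarrow> ('g, 'p) gspace \<Rightarrow> ('g, 'u) gspace" where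
  "gspace_copy e X = \<lparr>gtop = pullback_topology (e ` topspace (gtop X)) (the_inv e) (gtop X),
     gact = (\<lambda>g x. e (gact X g (the_inv e x)))\<rparr>"

definition fi_normal_subgroups ::
  "('g, 'b) monoid_scheme \<Rightarrow> 'g topology \<Rightarrow> 'g set set" where
  "fi_normal_subgroups G T = {U. fi_subgroup G T U \<and> U \<lhd> G}"

text \<open>The pro-\<open>G\<close>-space \<open>{E(G/U)}\<close>.  Its index set is directed by reverse inclusion.  The injections
  \<open>pc\<close>, \<open>oc\<close> and \<open>ac\<close> realize points, indices and index arrows inside the universe \<open>'u\<close>.\<close>

definition E_pro ::
  "('g, 'b) monoid_scheme \<Rightarrow> 'g topology \<Rightarrow> (('g set \<times> real) list set \<Rightarrow> 'u) \<Rightarrow>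
     ('g set \<Rightarrow> 'u) \<Rightarrow> ('g set \<times> 'g set \<Rightarrow> 'u) \<Rightarrow> ('g, 'u) pro_gspace" where
  "E_pro G T pc oc ac = \<lparr>
     idx = directed_cat oc ac (fi_normal_subgroups G T) (\<lambda>U V. V \<subseteq> U),
     dob = (\<lambda>i. gspace_copy pc (E_gspace G (the_inv oc i))),
     dar = (\<lambda>a. case the_inv ac a of (V, U) \<Rightarrow>
        \<lparr>gdom = gspace_copy pc (E_gspace G V), gcod = gspace_copy pc (E_gspace G U),
         gfun = restrict (\<lambda>x. pc (E_proj G U (the_inv pc x)))
                  (topspace (gtop (gspace_copy pc (E_gspace G V))))\<rparr>)\<rparr>"

end

theory Submission
  imports Defs "HOL-Library.Sublist"
begin

text \<open>A point of \<open>E(G/U)\<close> is a step function \<open>[0, 1) \<rightarrow> G/U\<close>.  The time spent at a coset before a given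
  time is a continuous function, and these functions separate points, so \<open>E(G/U)\<close> is a Hausdorff
  space.  Replacing a step function on \<open>[0, \<tau>)\<close> by a fixed one contracts \<open>E(G/U)\<close> to an arbitrary
  point relative to that point.  Every subgroup of \<open>U\<close> acts trivially on \<open>E(G/U)\<close>, so that
  \<open>E(G/U) \<rightarrow> *\<close> is a \<open>U\<close>-\<open>n\<close>-equivalence for all \<open>n\<close>, and \<open>{E(G/U)} \<rightarrow> c(*)\<close> is a levelwise weak
  equivalence onto a constant diagram.  On the other hand, \<open>G/U\<close> permutes the nondegenerate simplices
  of \<open>E(G/U)\<close> freely, so \<open>\<emptyset> \<rightarrow> E(G/U)\<close> is a relative cell complex with cells of type \<open>G/U\<close>.  For a given
  \<open>V\<close> these are \<open>V\<close>-cells as soon as \<open>U \<subseteq> V\<close>, and the normal subgroups \<open>U \<subseteq> V\<close> are cofinal.\<close>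

section \<open>Compactly generated and weak Hausdorff spaces\<close>

text \<open>The two halves of the theorem treat an index (U, n) differently. A weak equivalence may
  use at the level V the subgroup V itself, since \<open>W_class\<close> asks for some subgroup
  only. A cofibration must be built from cells of type G/V with V inside the prescribed U, and the
  cell structure of a level with V not contained in U is not of this kind. So each U gets its own
  levelwise representative, which \<open>essentially_levelwise\<close> permits. The only pro-map
  that has to be computed is the resulting isomorphism with a cofinal subdiagram; every other square
  starts at an initial or ends at a terminal object and commutes by uniqueness. The Hausdorff
  property serves the gluing: images of compact cells are closed, so pushouts and colimits can be
  recognised inside one fixed space from a filtration by closed invariant subspaces. A further
  constraint is that all cells and stages must live in the universe \<open>'u\<close>, for which
  only injections of points, indices and index arrows are given; they are therefore encoded as
  points through \<open>pc\<close>.\<close>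

definition copy_top :: "('p \<Rightarrow> 'u) \<Rightarrow> 'p topology \<Rightarrow> 'u topology" where
  "copy_top e X = pullback_topology (e ` topspace X) (the_inv e) X"

lemma topspace_copy_top:
  assumes "inj e"
  shows "topspace (copy_top e X) = e ` topspace X"
  using the_inv_f_f[OF assms] by (auto simp: copy_top_def topspace_pullback_topology)

lemma homeomorphic_maps_copy_top:
  assumes "inj e"
  shows "homeomorphic_maps X (copy_top e X) e (the_inv e)"
  unfolding homeomorphic_maps_def
proof (intro conjI ballI)
  have *: "the_inv e \<circ> e = id"
    using the_inv_f_f[OF assms] by auto
  show "continuous_map X (copy_top e X) e"
    unfolding copy_top_def by (rule continuous_map_pullback') (auto simp: *)
  show "continuous_map (copy_top e X) X (the_inv e)"
    unfolding copy_top_def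
    by (rule continuous_map_pullback[where g = "\<lambda>x. x", unfolded o_def, simplified]) simp
qed (use the_inv_f_f[OF assms] in \<open>auto simp: topspace_copy_top[OF assms]\<close>)

lemma continuous_map_into_copy:
  "inj e \<Longrightarrow> continuous_map X (copy_top e X) e"
  using homeomorphic_maps_copy_top homeomorphic_maps_def by blast

lemma continuous_map_from_copy:
  "inj e \<Longrightarrow> continuous_map (copy_top e X) X (the_inv e)"
  using homeomorphic_maps_copy_top homeomorphic_maps_def by blast

lemma homeomorphic_space_copy_top:
  "inj e \<Longrightarrow> X homeomorphic_space copy_top e X"
  using homeomorphic_maps_copy_top homeomorphic_space_def by blast

text \<open>Replaces the test by all compact Hausdorff spaces with a test by any family for which
  \<open>X\<close> carries the final topology. The family may have points of another type, as long
  as that type injects into the type of points of \<open>X\<close>.\<close>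

lemma compactly_generatedI:
  fixes X :: "'a topology" and f :: "'i \<Rightarrow> 'd \<Rightarrow> 'a" and e :: "'d \<Rightarrow> 'a"
  assumes e: "inj e"
    and D: "\<And>i. i \<in> I \<Longrightarrow> compact_space (D i) \<and> Hausdorff_space (D i) \<and> continuous_map (D i) X (f i)"
    and final: "\<And>A. A \<subseteq> topspace X \<Longrightarrow>
      (\<And>i. i \<in> I \<Longrightarrow> closedin (D i) {x \<in> topspace (D i). f i x \<in> A}) \<Longrightarrow> closedin X A"
  shows "compactly_generated X"
  unfolding compactly_generated_def
proof (intro allI impI, elim conjE, rule final)
  \<comment> \<open>The definition admits only test spaces with points of type
    \<open>'a set set\<close>, so each \<open>D i\<close> is replaced by its copy under iterated
    singletons.\<close>
  define k where "k = (\<lambda>x. {{e x}})"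
  have k: "inj k"
    using e unfolding k_def inj_on_def by auto
  fix A :: "'a set" and i
  assume A: "\<forall>(K :: 'a set set topology) f. compact_space K \<and> Hausdorff_space K \<and> continuous_map K X f \<longrightarrow>
           closedin K {x \<in> topspace K. f x \<in> A}" and i: "i \<in> I"
  have "compact_space (copy_top k (D i))" "Hausdorff_space (copy_top k (D i))"
    using D[OF i] homeomorphic_space_copy_top[OF k, of "D i"] homeomorphic_compact_space
      homeomorphic_Hausdorff_space by metis+
  moreover have "continuous_map (copy_top k (D i)) X (f i \<circ> the_inv k)"
    using continuous_map_compose continuous_map_from_copy[OF k] D[OF i] by blast
  ultimately have "closedin (copy_top k (D i))
      {x \<in> topspace (copy_top k (D i)). (f i \<circ> the_inv k) x \<in> A}"
    using A by blast
  from closedin_continuous_map_preimage[OF continuous_map_into_copy[OF k] this]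
  show "closedin (D i) {x \<in> topspace (D i). f i x \<in> A}"
    by (rule back_subst[of "closedin (D i)"]) (auto simp: topspace_copy_top[OF k] the_inv_f_f[OF k])
qed

lemma compactly_generated_compact_Hausdorff:
  assumes "compact_space X" "Hausdorff_space X"
  shows "compactly_generated X"
proof (rule compactly_generatedI[where I = "{()}" and D = "\<lambda>_. X" and f = "\<lambda>_ x. x" and e = "\<lambda>x. x"])
  fix A assume "A \<subseteq> topspace X"
    and *: "\<And>i. i \<in> {()} \<Longrightarrow> closedin X {x \<in> topspace X. x \<in> A}"
  then have "{x \<in> topspace X. x \<in> A} = A" by auto
  then show "closedin X A" using *[of "()"] by simp
qed (use assms in auto)

lemma weak_hausdorff_Hausdorff:
  "Hausdorff_space X \<Longrightarrow> weak_hausdorff X"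
  unfolding weak_hausdorff_def
  by (metis compactin_imp_closedin compact_space_def image_compactin)

text \<open>A test map into \<open>X\<close> pulls the closed set \<open>C\<close> back to a closed,
  hence compact, part of the test space, and restricts there to a test map into the
  subspace.\<close>

lemma compactly_generated_closed_subtopology:
  assumes X: "compactly_generated X" and C: "closedin X C"
  shows "compactly_generated (subtopology X C)"
  unfolding compactly_generated_def
proof (intro allI impI, elim conjE)
  fix A :: "'a set"
  assume AC: "A \<subseteq> topspace (subtopology X C)"
    and A: "\<forall>(K :: 'a set set topology) f.
      compact_space K \<and> Hausdorff_space K \<and> continuous_map K (subtopology X C) f \<longrightarrow>
      closedin K {x \<in> topspace K. f x \<in> A}"
  have "closedin X A"
  proof (rule X[unfolded compactly_generated_def, rule_format], intro conjI allI impI; (elim conjE)?)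
    show "A \<subseteq> topspace X" using AC by auto
    fix K :: "'a set set topology" and f
    assume K: "compact_space K" "Hausdorff_space K" and f: "continuous_map K X f"
    define B where "B = {x \<in> topspace K. f x \<in> C}"
    have B: "closedin K B"
      unfolding B_def by (rule closedin_continuous_map_preimage[OF f C])
    have top: "topspace (subtopology K B) = B"
      by (auto simp: B_def)
    have "compact_space (subtopology K B)" "Hausdorff_space (subtopology K B)"
      using K B closedin_compact_space compact_space_subtopology Hausdorff_space_subtopology by blast+
    moreover have "continuous_map (subtopology K B) (subtopology X C) f"
      using f by (auto simp: continuous_map_in_subtopology continuous_map_from_subtopology B_def)
    ultimately have "closedin (subtopology K B) {x \<in> topspace (subtopology K B). f x \<in> A}"
      using A by blast
    then have "closedin K {x \<in> B. f x \<in> A}"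
      unfolding top using B closedin_closed_subtopology by blast
    moreover have "{x \<in> B. f x \<in> A} = {x \<in> topspace K. f x \<in> A}"
      using AC by (auto simp: B_def)
    ultimately show "closedin K {x \<in> topspace K. f x \<in> A}" by simp
  qed
  then show "closedin (subtopology X C) A"
    using AC closedin_subset_topspace by auto
qed

section \<open>The bar construction\<close>

subsection \<open>Points\<close>

lemma bar_rel_refl [simp, intro]: "(ps, ps) \<in> bar_rel S"
  by (simp add: bar_rel_def eq_closure_def)

lemma bar_rel_sym: "(ps, qs) \<in> bar_rel S \<Longrightarrow> (qs, ps) \<in> bar_rel S"
  unfolding bar_rel_def eq_closure_def
  by (rule symD[OF sym_rtrancl]) (auto simp: sym_def)

lemma bar_rel_trans: "(ps, qs) \<in> bar_rel S \<Longrightarrow> (qs, rs) \<in> bar_rel S \<Longrightarrow> (ps, rs) \<in> bar_rel S"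
  unfolding bar_rel_def eq_closure_def by (rule rtrancl_trans)

text \<open>\<open>bar_rel\<close> is the equivalence relation generated by single steps, so
  invariance only has to be tested on these. All functions on the bar construction are shown to be
  well defined in this way.\<close>

lemma bar_rel_invariant:
  assumes "(ps, qs) \<in> bar_rel S"
    and step: "\<And>ps qs. ps \<in> bar_pts S \<Longrightarrow> qs \<in> bar_pts S \<Longrightarrow> bar_step ps qs \<Longrightarrow> f ps = f qs"
  shows "f ps = f qs"
  using assms(1) unfolding bar_rel_def eq_closure_def
  by (induction rule: rtrancl_induct) (auto dest: step)

definition bar_class :: "'s set \<Rightarrow> ('s \<times> real) list \<Rightarrow> ('s \<times> real) list set" where
  "bar_class S ps = bar_rel S `` {ps}"

lemma bar_class_eq_iff: "bar_class S ps = bar_class S qs \<longleftrightarrow> (ps, qs) \<in> bar_rel S"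
  unfolding bar_class_def using bar_rel_sym bar_rel_trans by (blast dest: eqset_imp_iff)

lemma bar_class_eqI: "(ps, qs) \<in> bar_rel S \<Longrightarrow> bar_class S ps = bar_class S qs"
  by (simp add: bar_class_eq_iff)

lemma bar_points_eq: "bar_pts S // bar_rel S = bar_class S ` bar_pts S"
  by (auto simp: quotient_def bar_class_def)

lemma mem_bar_class: "qs \<in> bar_class S ps \<longleftrightarrow> (ps, qs) \<in> bar_rel S"
  by (simp add: bar_class_def)

lemma bar_pts_iff:
  "ps \<in> bar_pts S \<longleftrightarrow> (\<forall>(s, t)\<in>set ps. s \<in> S \<and> 0 \<le> t) \<and> sum_list (map snd ps) = 1"
  by (auto simp: bar_pts_def)

lemma bar_step_pts: "bar_step ps qs \<Longrightarrow> ps \<in> bar_pts S \<Longrightarrow> qs \<in> bar_pts S"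
  by (induction rule: bar_step.induct) (auto simp: bar_pts_iff)

lemma bar_step_append: "bar_step ps qs \<Longrightarrow> bar_step (as @ ps @ bs) (as @ qs @ bs)"
proof (induction rule: bar_step.induct)
  case (face ps s qs)
  then show ?case using bar_step.face[of "as @ ps" s "qs @ bs"] by simp
next
  case (degeneracy ps s t t' qs)
  then show ?case using bar_step.degeneracy[of "as @ ps" s t t' "qs @ bs"] by simp
qed

lemma bar_steps_append:
  "bar_step\<^sup>*\<^sup>* ps qs \<Longrightarrow> bar_step\<^sup>*\<^sup>* (as @ ps @ bs) (as @ qs @ bs)"
  by (induction rule: rtranclp_induct) (auto intro: rtranclp.rtrancl_into_rtrancl bar_step_append)

lemma bar_steps_pts: "bar_step\<^sup>*\<^sup>* ps qs \<Longrightarrow> ps \<in> bar_pts S \<Longrightarrow> qs \<in> bar_pts S"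
  by (induction rule: rtranclp_induct) (auto intro: bar_step_pts)

lemma bar_steps_rel:
  assumes "bar_step\<^sup>*\<^sup>* ps qs" "ps \<in> bar_pts S"
  shows "(ps, qs) \<in> bar_rel S"
  using assms
proof (induction rule: rtranclp_induct)
  case (step qs rs)
  then have "(qs, rs) \<in> bar_rel S"
    unfolding bar_rel_def eq_closure_def
    by (intro r_into_rtrancl) (use bar_steps_pts bar_step_pts in blast)
  then show ?case using step bar_rel_trans by blast
qed simp

lemma bar_rel_pts: "(ps, qs) \<in> bar_rel S \<Longrightarrow> ps \<in> bar_pts S \<Longrightarrow> qs \<in> bar_pts S"
  using bar_rel_invariant[where f = "\<lambda>ps. ps \<in> bar_pts S"] by blast

lemma bar_class_in_iff: "bar_class S ps \<in> bar_pts S // bar_rel S \<longleftrightarrow> ps \<in> bar_pts S"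
  unfolding bar_points_eq using bar_class_eq_iff bar_rel_pts bar_rel_sym by blast

subsection \<open>Occupation times and normal forms\<close>

text \<open>A list of pairs encodes a step function \<open>[0, 1) \<rightarrow> S\<close>, with pieces of value \<open>s\<close> and length \<open>t\<close>.
  Faces and degeneracies do not change it, so that the time spent at \<open>s\<close> before \<open>x\<close> is
  well-defined on the bar construction.\<close>

fun occ :: "'s \<Rightarrow> real \<Rightarrow> ('s \<times> real) list \<Rightarrow> real" where
  "occ s x [] = 0"
| "occ s x ((s', t) # ps) = (if s' = s then max 0 (min t x) else 0) + occ s (x - t) ps"

lemma occ_append: "occ s x (ps @ qs) = occ s x ps + occ s (x - sum_list (map snd ps)) qs"
  by (induction ps arbitrary: x) (auto simp: algebra_simps)

lemma occ_step:
  assumes "bar_step ps qs" "\<forall>t\<in>snd ` set ps. 0 \<le> t"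
  shows "occ s x ps = occ s x qs"
  using assms by (induction rule: bar_step.induct) (auto simp: occ_append max_def min_def algebra_simps)

lemma occ_rel: "(ps, qs) \<in> bar_rel S \<Longrightarrow> occ s x ps = occ s x qs"
  by (erule bar_rel_invariant) (rule occ_step, auto simp: bar_pts_iff)

text \<open>For points of the bar construction, these are the nondegenerate simplices with an
  interior point. As step functions, the pieces are the maximal intervals of constancy.\<close>

definition bar_normal :: "('s \<times> real) list \<Rightarrow> bool" where
  "bar_normal ps \<longleftrightarrow> (\<forall>t\<in>snd ` set ps. 0 < t) \<and> distinct_adj (map fst ps)"

lemma bar_normal_Cons:
  "bar_normal ((s, t) # ps) \<longleftrightarrow> 0 < t \<and> bar_normal ps \<and> (ps = [] \<or> s \<noteq> fst (hd ps))"
  by (cases ps) (auto simp: bar_normal_def)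

lemma occ_nonpos: "bar_normal ps \<Longrightarrow> x \<le> 0 \<Longrightarrow> occ s x ps = 0"
  by (induction ps arbitrary: x) (auto simp: bar_normal_Cons)

lemma sum_list_bar_normal: "bar_normal ps \<Longrightarrow> 0 \<le> sum_list (map snd ps)"
  by (force simp: bar_normal_def intro!: sum_list_nonneg)

text \<open>If the first piece of one list were shorter, that list would leave \<open>s\<close>
  while the other still stays there, and the occupation times of \<open>s\<close> would part. Used
  in both directions.\<close>

lemma occ_head_length:
  assumes n: "bar_normal ((s, t) # ps)" "bar_normal ((s, t') # qs)"
    and sum: "sum_list (map snd ((s, t) # ps)) = sum_list (map snd ((s, t') # qs))"
    and occ: "\<And>x. occ s x ((s, t) # ps) = occ s x ((s, t') # qs)"
  shows "\<not> t < t'"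
proof
  assume t: "t < t'"
  then have "ps \<noteq> []"
    using sum sum_list_bar_normal[of qs] n by (auto simp: bar_normal_Cons)
  then obtain s2 t2 ps' where ps: "ps = (s2, t2) # ps'"
    by (metis list.exhaust surj_pair)
  \<comment> \<open>Up to this time the first list has left \<open>s\<close> and is still in its
    second piece, whose label differs from \<open>s\<close>, while the second list is still in its
    first piece: the times spent at \<open>s\<close> are \<open>t\<close> and
    \<open>x\<close>.\<close>
  define x where "x = min (t + t2) t'"
  have pos: "0 < t" "0 < t2" "s2 \<noteq> s" "bar_normal ps'" "bar_normal qs"
    using n by (auto simp: ps bar_normal_Cons)
  have "occ s (x - t - t2) ps' = 0" "occ s (x - t') qs = 0"
    using pos by (auto simp: x_def intro!: occ_nonpos)
  then have "occ s x ((s, t) # ps) = t" "occ s x ((s, t') # qs) = x" "t < x"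
    using pos t by (auto simp: ps x_def)
  then show False using occ[of x] by simp
qed

text \<open>Immediately after time 0 only the label of the first piece gains time, so the first
  labels agree; \<open>occ_head_length\<close> gives equal first lengths, and the tails inherit the
  hypotheses with time shifted by that length. Equal total lengths prevent one list from ending
  first.\<close>

lemma bar_normal_unique:
  assumes "bar_normal ps" "bar_normal qs"
    and "sum_list (map snd ps) = sum_list (map snd qs)"
    and "\<And>s x. occ s x ps = occ s x qs"
  shows "ps = qs"
  using assms
proof (induction ps arbitrary: qs)
  case Nil
  have "qs = []"
  proof (cases qs)
    case (Cons q qs')
    then show ?thesis
      using Nil sum_list_bar_normal[of qs'] by (cases q) (auto simp: bar_normal_Cons)
  qed
  then show ?case by simp
next
  case (Cons p ps)
  obtain s t where p: "p = (s, t)" by force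
  have n: "0 < t" "bar_normal ps"
    using Cons.prems(1) by (auto simp: p bar_normal_Cons)
  have "qs \<noteq> []"
    using Cons.prems(3) n sum_list_bar_normal[of ps] by (auto simp: p)
  then obtain s' t' qs' where qs: "qs = (s', t') # qs'"
    by (metis list.exhaust surj_pair)
  have n': "0 < t'" "bar_normal qs'"
    using Cons.prems(2) by (auto simp: qs bar_normal_Cons)
  have s: "s = s'"
  proof (rule ccontr)
    assume ne: "s \<noteq> s'"
    define x where "x = min t t'"
    have "occ s (x - t) ps = 0" "occ s (x - t') qs' = 0"
      using n n' by (auto simp: x_def intro!: occ_nonpos)
    then have "occ s x (p # ps) = x" "occ s x qs = 0" "0 < x"
      using ne n n' by (auto simp: p qs x_def)
    then show False using Cons.prems(4)[of s x] by simp
  qed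
  note prems = Cons.prems[unfolded p qs s]
  have t: "t = t'"
    using occ_head_length[OF prems(1,2,3) prems(4)]
      occ_head_length[OF prems(2,1) prems(3)[symmetric] prems(4)[symmetric]] by simp
  have "ps = qs'"
  proof (rule Cons.IH[OF n(2) n'(2)])
    show "sum_list (map snd ps) = sum_list (map snd qs')"
      using prems(3) t by simp
    fix r x
    show "occ r x ps = occ r x qs'"
      using prems(4)[of r "x + t"] t by simp
  qed
  then show ?case by (simp add: p qs s t)
qed

text \<open>A violation of normality is a zero coordinate, removed by a face, or two equal
  neighbours, fused by a degeneracy. Both shorten the list, so the reduction to a normal form
  terminates.\<close>

lemma bar_not_normal_step:
  assumes "ps \<in> bar_pts S" "\<not> bar_normal ps"
  obtains qs where "bar_step ps qs" "length qs < length ps"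
proof (cases "\<forall>t\<in>snd ` set ps. 0 < t")
  case False
  then obtain s t where "(s, t) \<in> set ps" "\<not> 0 < t"
    by auto
  moreover from this have "t = 0"
    using assms(1) by (force simp: bar_pts_iff)
  ultimately have "(s, 0) \<in> set ps"
    by simp
  then obtain as bs where ps: "ps = as @ (s, 0) # bs"
    by (meson split_list)
  show thesis by (rule that[of "as @ bs"]) (auto simp: ps intro: bar_step.face)
next
  case True
  then have "\<not> distinct_adj (map fst ps)"
    using assms(2) by (simp add: bar_normal_def)
  then obtain i where i: "Suc i < length ps" "fst (ps ! i) = fst (ps ! Suc i)"
    by (auto simp: distinct_adj_conv_nth)
  obtain s t where p: "ps ! i = (s, t)" by force
  obtain t' where p': "ps ! Suc i = (s, t')" using i p by (metis fst_conv prod.collapse)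
  have ps: "ps = take i ps @ (s, t) # (s, t') # drop (Suc (Suc i)) ps"
    using i p p' by (metis Cons_nth_drop_Suc Suc_lessD append_take_drop_id)
  show thesis
  proof (rule that)
    show "bar_step ps (take i ps @ (s, t + t') # drop (Suc (Suc i)) ps)"
      using bar_step.degeneracy[of "take i ps" s t t' "drop (Suc (Suc i)) ps"] ps by simp
    show "length (take i ps @ (s, t + t') # drop (Suc (Suc i)) ps) < length ps"
      using i by simp
  qed
qed

lemma bar_normal_form:
  assumes "ps \<in> bar_pts S"
  obtains qs where "bar_normal qs" "bar_step\<^sup>*\<^sup>* ps qs"
  using assms
proof (induction "length ps" arbitrary: ps thesis rule: less_induct)
  case less
  show ?case
  proof (cases "bar_normal ps")
    case True
    then show ?thesis using less.prems by blast
  next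
    case False
    then obtain qs where qs: "bar_step ps qs" "length qs < length ps"
      using bar_not_normal_step less.prems(2) by blast
    then show ?thesis
      using less.hyps[OF qs(2) _ bar_step_pts[OF qs(1) less.prems(2)]] less.prems(1)
      by (metis converse_rtranclp_into_rtranclp)
  qed
qed

text \<open>For the converse, both lists reduce to normal forms with the same occupation times,
  which coincide by uniqueness. This is the separation of points that makes the bar construction
  Hausdorff.\<close>

lemma bar_rel_iff_occ:
  assumes "ps \<in> bar_pts S" "qs \<in> bar_pts S"
  shows "(ps, qs) \<in> bar_rel S \<longleftrightarrow> (\<forall>s x. occ s x ps = occ s x qs)"
proof
  assume eq: "\<forall>s x. occ s x ps = occ s x qs"
  obtain ps' where ps': "bar_normal ps'" "bar_step\<^sup>*\<^sup>* ps ps'"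
    using bar_normal_form[OF assms(1)] by blast
  obtain qs' where qs': "bar_normal qs'" "bar_step\<^sup>*\<^sup>* qs qs'"
    using bar_normal_form[OF assms(2)] by blast
  have rel: "(ps, ps') \<in> bar_rel S" "(qs, qs') \<in> bar_rel S"
    using ps' qs' assms bar_steps_rel by blast+
  have "ps' = qs'"
  proof (rule bar_normal_unique[OF ps'(1) qs'(1)])
    show "sum_list (map snd ps') = sum_list (map snd qs')"
      using bar_steps_pts[OF ps'(2) assms(1)] bar_steps_pts[OF qs'(2) assms(2)]
      by (simp add: bar_pts_iff)
    show "occ s x ps' = occ s x qs'" for s x
      using occ_rel[OF rel(1), of s x] occ_rel[OF rel(2), of s x] eq by simp
  qed
  then show "(ps, qs) \<in> bar_rel S"
    using rel bar_rel_sym bar_rel_trans by metis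
qed (auto simp: occ_rel)

lemma bar_normal_rel_eq:
  assumes "ps \<in> bar_pts S" "(ps, qs) \<in> bar_rel S" "bar_normal ps" "bar_normal qs"
  shows "ps = qs"
  using assms occ_rel[OF assms(2)] bar_rel_pts[OF assms(2,1)]
  by (intro bar_normal_unique) (auto simp: bar_pts_iff)

subsection \<open>The topology\<close>

abbreviation simplex_top :: "nat \<Rightarrow> (nat \<Rightarrow> real) topology" where
  "simplex_top n \<equiv> subtopology (powertop_real UNIV) (standard_simplex n)"

definition bar_zip :: "'s list \<Rightarrow> (nat \<Rightarrow> real) \<Rightarrow> ('s \<times> real) list" where
  "bar_zip xs t = zip xs (map t [0..<length xs])"

lemma bar_chart_eq: "bar_chart S xs t = bar_class S (bar_zip xs t)"
  by (simp add: bar_chart_def bar_class_def bar_zip_def)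

lemma map_fst_bar_zip [simp]: "map fst (bar_zip xs t) = xs"
  and map_snd_bar_zip [simp]: "map snd (bar_zip xs t) = map t [0..<length xs]"
  and length_bar_zip [simp]: "length (bar_zip xs t) = length xs"
  by (simp_all add: bar_zip_def)

lemma map_bar_zip: "map (map_prod f id) (bar_zip xs t) = bar_zip (map f xs) t"
  by (simp add: bar_zip_def zip_map1 map_prod_def case_prod_unfold)

lemma set_bar_zip: "set (bar_zip xs t) = {(xs ! i, t i) | i. i < length xs}"
  by (auto simp: bar_zip_def set_zip)

lemma bar_zip_pts:
  assumes "xs \<noteq> []" "set xs \<subseteq> S" "t \<in> standard_simplex (length xs - 1)"
  shows "bar_zip xs t \<in> bar_pts S"
proof -
  have "{..length xs - 1} = {0..<length xs}"
    using assms(1) by (cases xs) auto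
  then have "sum t {0..<length xs} = 1" "\<forall>i. 0 \<le> t i"
    using assms(3) by (auto simp: standard_simplex_def)
  then show ?thesis
    using assms(2) by (auto simp: bar_pts_iff set_bar_zip sum_list_distinct_conv_sum_set)
qed

lemma bar_pts_zip:
  assumes "ps \<in> bar_pts S"
  obtains xs t where "xs \<noteq> []" "set xs \<subseteq> S" "t \<in> standard_simplex (length xs - 1)"
    "ps = bar_zip xs t"
proof
  define t where "t = (\<lambda>i. if i < length ps then snd (ps ! i) else 0)"
  have ne: "ps \<noteq> []" using assms by (auto simp: bar_pts_iff)
  then show "map fst ps \<noteq> []" by simp
  show "set (map fst ps) \<subseteq> S" using assms by (auto simp: bar_pts_iff)
  have m: "map t [0..<length ps] = map snd ps"
    by (rule nth_equalityI) (auto simp: t_def)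
  then show "ps = bar_zip (map fst ps) t"
    by (simp add: bar_zip_def zip_map_fst_snd)
  have "sum t {0..<length ps} = 1"
    using assms m by (metis bar_pts_iff sum_list_distinct_conv_sum_set distinct_upt set_upt)
  moreover have "{..length ps - 1} = {0..<length ps}"
    using ne by (cases ps) auto
  ultimately have sum: "sum t {..length ps - 1} = 1" by simp
  have nn: "0 \<le> t i" for i
    using assms by (auto simp: t_def bar_pts_iff) (metis nth_mem prod.collapse case_prodD)
  have "t i \<le> 1" for i
  proof (cases "i < length ps")
    case True
    then have "t i \<le> sum t {..length ps - 1}"
      by (intro member_le_sum) (auto simp: nn)
    then show ?thesis using sum by simp
  qed (auto simp: t_def)
  then show "t \<in> standard_simplex (length (map fst ps) - 1)"
    using sum nn by (auto simp: standard_simplex_def t_def)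
qed

lemma topspace_bar_top: "topspace (bar_top S) = bar_class S ` bar_pts S"
proof (rule antisym)
  show "topspace (bar_top S) \<subseteq> bar_class S ` bar_pts S"
    using openin_topspace[of "bar_top S"] unfolding openin_bar_top bar_open_def bar_points_eq by blast
  have "bar_open S (bar_class S ` bar_pts S)"
  proof (rule bar_openI)
    fix xs :: "'a list" assume xs: "xs \<noteq> []" "set xs \<subseteq> S"
    have "{t \<in> standard_simplex (length xs - 1). bar_chart S xs t \<in> bar_class S ` bar_pts S}
        = topspace (simplex_top (length xs - 1))"
      using xs by (auto simp: bar_chart_eq bar_zip_pts)
    then show "openin (simplex_top (length xs - 1))
      {t \<in> standard_simplex (length xs - 1). bar_chart S xs t \<in> bar_class S ` bar_pts S}"
      by (metis openin_topspace)
  qed (simp add: bar_points_eq)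
  then show "bar_class S ` bar_pts S \<subseteq> topspace (bar_top S)"
    by (simp add: openin_bar_top openin_subset)
qed

lemma bar_class_topspace: "bar_class S ps \<in> topspace (bar_top S) \<longleftrightarrow> ps \<in> bar_pts S"
  using bar_class_in_iff by (simp add: topspace_bar_top bar_points_eq)

lemma bar_chart_topspace:
  assumes "xs \<noteq> []" "set xs \<subseteq> S" "t \<in> standard_simplex (length xs - 1)"
  shows "bar_chart S xs t \<in> topspace (bar_top S)"
  using assms by (simp add: bar_chart_eq bar_class_topspace bar_zip_pts)

lemma bar_top_cases:
  assumes "c \<in> topspace (bar_top S)"
  obtains xs t where "xs \<noteq> []" "set xs \<subseteq> S" "t \<in> standard_simplex (length xs - 1)"
    "c = bar_chart S xs t"
  using assms unfolding topspace_bar_top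
  by (metis imageE bar_pts_zip bar_chart_eq)

lemma continuous_map_bar_chart:
  assumes "xs \<noteq> []" "set xs \<subseteq> S"
  shows "continuous_map (simplex_top (length xs - 1)) (bar_top S) (bar_chart S xs)"
  unfolding continuous_map_def
  using assms bar_openD(2)[of S _ xs] by (auto simp: openin_bar_top bar_chart_topspace)

lemma openin_bar_topI:
  assumes "W \<subseteq> topspace (bar_top S)"
    and "\<And>xs. xs \<noteq> [] \<Longrightarrow> set xs \<subseteq> S \<Longrightarrow> openin (simplex_top (length xs - 1))
      {t \<in> standard_simplex (length xs - 1). bar_chart S xs t \<in> W}"
  shows "openin (bar_top S) W"
  using assms by (auto simp: openin_bar_top topspace_bar_top bar_points_eq intro!: bar_openI)

lemma closedin_bar_topI:
  assumes W: "W \<subseteq> topspace (bar_top S)"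
    and cl: "\<And>xs. xs \<noteq> [] \<Longrightarrow> set xs \<subseteq> S \<Longrightarrow> closedin (simplex_top (length xs - 1))
      {t \<in> standard_simplex (length xs - 1). bar_chart S xs t \<in> W}"
  shows "closedin (bar_top S) W"
  unfolding closedin_def
proof (intro conjI W openin_bar_topI)
  fix xs :: "'a list" assume xs: "xs \<noteq> []" "set xs \<subseteq> S"
  have eq: "{t \<in> standard_simplex (length xs - 1). bar_chart S xs t \<in> topspace (bar_top S) - W}
     = topspace (simplex_top (length xs - 1)) -
       {t \<in> standard_simplex (length xs - 1). bar_chart S xs t \<in> W}"
    using bar_chart_topspace xs by auto
  show "openin (simplex_top (length xs - 1))
      {t \<in> standard_simplex (length xs - 1). bar_chart S xs t \<in> topspace (bar_top S) - W}"
    unfolding eq by (rule openin_diff[OF openin_topspace cl[OF xs]])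
qed auto

lemma continuous_map_from_bar_top:
  assumes "\<And>xs. xs \<noteq> [] \<Longrightarrow> set xs \<subseteq> S \<Longrightarrow>
    continuous_map (simplex_top (length xs - 1)) Y (\<lambda>t. f (bar_chart S xs t))"
  shows "continuous_map (bar_top S) Y f"
  unfolding continuous_map_def
proof (intro conjI allI impI)
  show "f \<in> topspace (bar_top S) \<rightarrow> topspace Y"
  proof
    fix c assume "c \<in> topspace (bar_top S)"
    then obtain xs t where "xs \<noteq> []" "set xs \<subseteq> S" "t \<in> standard_simplex (length xs - 1)"
      "c = bar_chart S xs t"
      by (rule bar_top_cases)
    then show "f c \<in> topspace Y"
      using continuous_map_funspace[OF assms, of xs] by auto
  qed
  fix U assume U: "openin Y U"
  show "openin (bar_top S) {x \<in> topspace (bar_top S). f x \<in> U}"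
  proof (rule openin_bar_topI)
    fix xs :: "'a list" assume xs: "xs \<noteq> []" "set xs \<subseteq> S"
    show "openin (simplex_top (length xs - 1)) {t \<in> standard_simplex (length xs - 1).
        bar_chart S xs t \<in> {x \<in> topspace (bar_top S). f x \<in> U}}"
      using openin_continuous_map_preimage[OF assms[OF xs] U] bar_chart_topspace[OF xs]
      by (auto cong: conj_cong)
  qed auto
qed

text \<open>The list consists of constant labels and of coordinate functions on \<open>Z\<close>.
  Its shape is then fixed, and the recursion of \<open>occ\<close> can be followed with a cutoff
  that varies continuously.\<close>

lemma continuous_map_occ:
  assumes "continuous_map Z euclideanreal x"
    and "\<And>s f. (s, f) \<in> set l \<Longrightarrow> continuous_map Z euclideanreal f"
  shows "continuous_map Z euclideanreal (\<lambda>z. occ s (x z) (map (\<lambda>(s, f). (s, f z)) l))"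
  using assms
proof (induction l arbitrary: x)
  case (Cons p l)
  obtain r f where p: "p = (r, f)" by force
  have "continuous_map Z euclideanreal (\<lambda>z. occ s (x z - f z) (map (\<lambda>(s, f). (s, f z)) l))"
    using Cons.prems p by (intro Cons.IH continuous_map_diff) auto
  moreover have "continuous_map Z euclideanreal (\<lambda>z. max 0 (min (f z) (x z)))"
    using Cons.prems p by (intro continuous_map_real_max continuous_map_real_min) auto
  ultimately show ?case
    by (auto simp: p intro!: continuous_map_add)
qed simp

lemma continuous_map_simplex_coord:
  "continuous_map (simplex_top n) euclideanreal (\<lambda>t. t i)"
  by (intro continuous_map_from_subtopology continuous_map_product_projection) simp

text \<open>The choice of a representative is harmless by \<open>occ_rel\<close>; on each simplex it
  can be traded for the barycentric coordinates.\<close>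

lemma continuous_map_occ_bar:
  "continuous_map (bar_top S) euclideanreal (\<lambda>c. occ s x (SOME ps. ps \<in> c))"
proof (rule continuous_map_from_bar_top)
  fix xs :: "'a list"
  have "occ s x (SOME ps. ps \<in> bar_chart S xs t) = occ s x (bar_zip xs t)" for t
  proof (rule someI2[where a = "bar_zip xs t"])
    fix ps assume "ps \<in> bar_chart S xs t"
    then show "occ s x ps = occ s x (bar_zip xs t)"
      unfolding bar_chart_eq mem_bar_class by (rule occ_rel[symmetric])
  qed (simp add: bar_chart_eq mem_bar_class)
  moreover have "continuous_map (simplex_top (length xs - 1)) euclideanreal
     (\<lambda>t. occ s x (map (\<lambda>(s, f). (s, f t)) (zip xs (map (\<lambda>i t. t i) [0..<length xs]))))"
    by (rule continuous_map_occ) (auto dest!: set_zip_rightD intro: continuous_map_simplex_coord)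
  moreover have "map (\<lambda>(s, f). (s, f t)) (zip xs (map (\<lambda>i t. t i) [0..<length xs])) = bar_zip xs t" for t
    by (rule nth_equalityI) (auto simp: bar_zip_def)
  ultimately show "continuous_map (simplex_top (length xs - 1)) euclideanreal
     (\<lambda>t. occ s x (SOME ps. ps \<in> bar_chart S xs t))"
    by simp
qed

lemma Hausdorff_bar_top: "Hausdorff_space (bar_top S)"
  unfolding Hausdorff_space_def
proof (intro allI impI, elim conjE)
  fix c d assume c: "c \<in> topspace (bar_top S)" and d: "d \<in> topspace (bar_top S)" and "c \<noteq> d"
  define F where "F = (\<lambda>s x c. occ s x (SOME ps. ps \<in> (c :: ('a \<times> real) list set)))"
  obtain ps qs where ps: "ps \<in> bar_pts S" "c = bar_class S ps" and qs: "qs \<in> bar_pts S" "d = bar_class S qs"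
    using c d by (auto simp: topspace_bar_top)
  have F: "F s x (bar_class S ps) = occ s x ps" for s x ps
    unfolding F_def
    by (rule someI2[where a = ps]) (auto simp: mem_bar_class dest: occ_rel[symmetric])
  have "(ps, qs) \<notin> bar_rel S"
    using \<open>c \<noteq> d\<close> ps qs by (auto simp: bar_class_eq_iff)
  then obtain s x where ne: "F s x c \<noteq> F s x d"
    using bar_rel_iff_occ[OF ps(1) qs(1)] ps(2) qs(2) F by auto
  then obtain U V where UV: "open U" "open V" "F s x c \<in> U" "F s x d \<in> V" "U \<inter> V = {}"
    by (meson hausdorff)
  have cont: "continuous_map (bar_top S) euclideanreal (F s x)"
    unfolding F_def by (rule continuous_map_occ_bar)
  show "\<exists>U V. openin (bar_top S) U \<and> openin (bar_top S) V \<and> c \<in> U \<and> d \<in> V \<and> disjnt U V"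
  proof (intro exI conjI)
    show "openin (bar_top S) {z \<in> topspace (bar_top S). F s x z \<in> U}"
      "openin (bar_top S) {z \<in> topspace (bar_top S). F s x z \<in> V}"
      using UV by (auto intro!: openin_continuous_map_preimage[OF cont])
  qed (use UV c d in \<open>auto simp: disjnt_def\<close>)
qed

subsection \<open>Induced maps\<close>

lemma bar_step_map: "bar_step ps qs \<Longrightarrow> bar_step (map (map_prod f id) ps) (map (map_prod f id) qs)"
  by (induction rule: bar_step.induct) (auto intro: bar_step.intros)

lemma bar_pts_map: "f ` S \<subseteq> S' \<Longrightarrow> ps \<in> bar_pts S \<Longrightarrow> map (map_prod f id) ps \<in> bar_pts S'"
  by (force simp: bar_pts_iff o_def)

lemma bar_rel_map:
  assumes "(ps, qs) \<in> bar_rel S" "f ` S \<subseteq> S'"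
  shows "(map (map_prod f id) ps, map (map_prod f id) qs) \<in> bar_rel S'"
proof -
  have "bar_class S' (map (map_prod f id) ps) = bar_class S' (map (map_prod f id) qs)"
    using assms(1)
  proof (rule bar_rel_invariant)
    fix ps qs assume "ps \<in> bar_pts S" "bar_step ps qs"
    then show "bar_class S' (map (map_prod f id) ps) = bar_class S' (map (map_prod f id) qs)"
      using bar_steps_rel[of "map (map_prod f id) ps" "map (map_prod f id) qs" S'] assms(2)
      by (simp add: bar_class_eq_iff r_into_rtranclp[of bar_step, OF bar_step_map] bar_pts_map)
  qed
  then show ?thesis by (simp add: bar_class_eq_iff)
qed

lemma bar_map_class:
  assumes "f ` S \<subseteq> S'"
  shows "bar_map S' f (bar_class S ps) = bar_class S' (map (map_prod f id) ps)"
proof -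
  have "(map (map_prod f id) ps, qs) \<in> bar_rel S'"
    if "(ps, rs) \<in> bar_rel S" "(map (map_prod f id) rs, qs) \<in> bar_rel S'" for qs rs
    using bar_rel_trans[OF bar_rel_map[OF that(1) assms] that(2)] .
  then show ?thesis
    unfolding bar_map_def bar_class_def by auto
qed

lemma bar_map_chart:
  assumes "f ` S \<subseteq> S'"
  shows "bar_map S' f (bar_chart S xs t) = bar_chart S' (map f xs) t"
  by (simp add: bar_chart_eq bar_map_class[OF assms] map_bar_zip)

lemma bar_map_topspace:
  assumes "f ` S \<subseteq> S'" "c \<in> topspace (bar_top S)"
  shows "bar_map S' f c \<in> topspace (bar_top S')"
  using assms bar_pts_map[OF assms(1)] by (auto simp: topspace_bar_top bar_map_class[OF assms(1)])

lemma continuous_map_bar_map: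
  assumes "f ` S \<subseteq> S'"
  shows "continuous_map (bar_top S) (bar_top S') (bar_map S' f)"
proof (rule continuous_map_from_bar_top)
  fix xs assume xs: "xs \<noteq> []" "set xs \<subseteq> S"
  have "continuous_map (simplex_top (length (map f xs) - 1)) (bar_top S') (bar_chart S' (map f xs))"
    using xs assms by (intro continuous_map_bar_chart) auto
  then show "continuous_map (simplex_top (length xs - 1)) (bar_top S') (\<lambda>t. bar_map S' f (bar_chart S xs t))"
    by (simp add: bar_map_chart[OF assms])
qed

lemma bar_map_comp:
  assumes "f ` S \<subseteq> S'" "g ` S' \<subseteq> S''" "c \<in> topspace (bar_top S)"
    and "\<And>s. s \<in> S \<Longrightarrow> h s = g (f s)"
  shows "bar_map S'' g (bar_map S' f c) = bar_map S'' h c"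
proof -
  have h: "h ` S \<subseteq> S''" using assms by auto
  obtain ps where ps: "ps \<in> bar_pts S" "c = bar_class S ps"
    using assms(3) by (auto simp: topspace_bar_top)
  have "map (map_prod g id) (map (map_prod f id) ps) = map (map_prod h id) ps"
    using ps(1) assms(4) by (auto simp: bar_pts_iff)
  then show ?thesis
    by (simp del: map_map add: ps(2) bar_map_class[OF assms(1)] bar_map_class[OF assms(2)] bar_map_class[OF h])
qed

lemma bar_map_id:
  assumes "c \<in> topspace (bar_top S)" "\<And>s. s \<in> S \<Longrightarrow> h s = s"
  shows "bar_map S h c = c"
proof -
  have h: "h ` S \<subseteq> S" using assms by auto
  obtain ps where ps: "ps \<in> bar_pts S" "c = bar_class S ps"
    using assms(1) by (auto simp: topspace_bar_top)
  have "map (map_prod h id) ps = ps"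
    using ps(1) assms(2) by (auto simp: bar_pts_iff intro!: map_idI)
  then show ?thesis by (simp add: ps(2) bar_map_class[OF h])
qed

subsection \<open>Contractibility\<close>

text \<open>The homotopy replaces a step function by \<open>x\<close> on \<open>[0, \<tau>)\<close> at time \<open>\<tau>\<close>.  Since it fixes \<open>x\<close>, no
  change of base point is needed to see that all homotopy groups at \<open>x\<close> vanish.\<close>

fun bar_take :: "real \<Rightarrow> ('s \<times> real) list \<Rightarrow> ('s \<times> real) list" where
  "bar_take \<tau> [] = []"
| "bar_take \<tau> ((s, t) # ps) = (s, max 0 (min t \<tau>)) # bar_take (\<tau> - t) ps"

text \<open>Like \<open>bar_take\<close>, this keeps every label and lets a piece shrink to length 0
  instead of deleting it. The list of labels is thus independent of \<tau>, which turns continuity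
  of the contraction into continuity of coordinates.\<close>

fun bar_drop :: "real \<Rightarrow> ('s \<times> real) list \<Rightarrow> ('s \<times> real) list" where
  "bar_drop \<tau> [] = []"
| "bar_drop \<tau> ((s, t) # ps) = (s, t - max 0 (min t \<tau>)) # bar_drop (\<tau> - t) ps"

lemma bar_drop_append: "bar_drop \<tau> (ps @ qs) = bar_drop \<tau> ps @ bar_drop (\<tau> - sum_list (map snd ps)) qs"
  by (induction ps arbitrary: \<tau>) (auto simp: algebra_simps)

lemma map_fst_bar_take [simp]: "map fst (bar_take \<tau> ps) = map fst ps"
  by (induction ps arbitrary: \<tau>) auto

lemma map_fst_bar_drop [simp]: "map fst (bar_drop \<tau> ps) = map fst ps"
  by (induction ps arbitrary: \<tau>) auto

lemma length_bar_take [simp]: "length (bar_take \<tau> ps) = length ps"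
  by (metis length_map map_fst_bar_take)

lemma length_bar_drop [simp]: "length (bar_drop \<tau> ps) = length ps"
  by (metis length_map map_fst_bar_drop)

lemma sum_list_bar_take:
  "\<forall>t\<in>snd ` set ps. 0 \<le> t \<Longrightarrow> sum_list (map snd (bar_take \<tau> ps)) = max 0 (min (sum_list (map snd ps)) \<tau>)"
proof (induction ps arbitrary: \<tau>)
  case (Cons p ps)
  moreover have "0 \<le> sum_list (map snd ps)"
    using Cons.prems by (auto intro!: sum_list_nonneg)
  ultimately show ?case by (cases p) (auto simp: max_def min_def)
qed auto

lemma sum_list_bar_drop:
  "\<forall>t\<in>snd ` set ps. 0 \<le> t \<Longrightarrow>
    sum_list (map snd (bar_drop \<tau> ps)) = sum_list (map snd ps) - max 0 (min (sum_list (map snd ps)) \<tau>)"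
proof (induction ps arbitrary: \<tau>)
  case (Cons p ps)
  moreover have "0 \<le> sum_list (map snd ps)"
    using Cons.prems by (auto intro!: sum_list_nonneg)
  ultimately show ?case by (cases p) (auto simp: max_def min_def)
qed auto

lemma set_bar_take:
  assumes "\<forall>(s, t)\<in>set ps. s \<in> S \<and> 0 \<le> t" "(s, t) \<in> set (bar_take \<tau> ps)"
  shows "s \<in> S \<and> 0 \<le> t"
  using assms by (induction ps arbitrary: \<tau>) auto

lemma set_bar_drop:
  assumes "\<forall>(s, t)\<in>set ps. s \<in> S \<and> 0 \<le> t" "(s, t) \<in> set (bar_drop \<tau> ps)"
  shows "s \<in> S \<and> 0 \<le> t"
  using assms by (induction ps arbitrary: \<tau>) auto

lemma bar_pts_nonneg: "ps \<in> bar_pts S \<Longrightarrow> \<forall>t\<in>snd ` set ps. 0 \<le> t"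
  by (auto simp: bar_pts_iff)

lemma bar_take_drop_pts:
  assumes "ps \<in> bar_pts S" "qs \<in> bar_pts S" "0 \<le> \<tau>" "\<tau> \<le> 1"
  shows "bar_take \<tau> ps @ bar_drop \<tau> qs \<in> bar_pts S"
proof -
  have "sum_list (map snd (bar_take \<tau> ps @ bar_drop \<tau> qs)) = 1"
    using assms sum_list_bar_take[of ps \<tau>] sum_list_bar_drop[of qs \<tau>]
    by (simp add: bar_pts_nonneg) (simp add: bar_pts_iff)
  moreover have "s \<in> S \<and> 0 \<le> t" if "(s, t) \<in> set (bar_take \<tau> ps @ bar_drop \<tau> qs)" for s t
    using that set_bar_take[of ps S s t \<tau>] set_bar_drop[of qs S s t \<tau>] assms
    by (auto simp: bar_pts_iff)
  ultimately show ?thesis by (auto simp: bar_pts_iff)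
qed

text \<open>This makes cutting off an initial interval well defined on classes: a piece of length 0
  stays one, and two neighbours with the same label keep their common label.\<close>

lemma bar_step_drop:
  assumes "bar_step ps qs" "\<forall>t\<in>snd ` set ps. 0 \<le> t"
  shows "bar_step (bar_drop \<tau> ps) (bar_drop \<tau> qs)"
  using assms
proof (induction rule: bar_step.induct)
  case (face ps s qs)
  then show ?case
    using bar_step.face[of "bar_drop \<tau> ps" s] by (simp add: bar_drop_append)
next
  case (degeneracy ps s t t' qs)
  define \<sigma> where "\<sigma> = \<tau> - sum_list (map snd ps)"
  \<comment> \<open>Cutting two successive pieces of nonnegative length leaves the same total as
    cutting the fused piece; \<sigma> is the part of \<tau> that remains after
    \<open>ps\<close>.\<close>
  have "t - max 0 (min t \<sigma>) + (t' - max 0 (min t' (\<sigma> - t))) = t + t' - max 0 (min (t + t') \<sigma>)"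
    using degeneracy by (auto simp: max_def min_def)
  note step = bar_step.degeneracy[of "bar_drop \<tau> ps" s "t - max 0 (min t \<sigma>)"
      "t' - max 0 (min t' (\<sigma> - t))" "bar_drop (\<sigma> - t - t') qs", unfolded this]
  then show ?case
    by (simp add: bar_drop_append \<sigma>_def[symmetric] diff_diff_eq)
qed

lemma bar_steps_ConsI: "bar_step\<^sup>*\<^sup>* ps qs \<Longrightarrow> bar_step\<^sup>*\<^sup>* (p # ps) (p # qs)"
  using bar_steps_append[of ps qs "[p]" "[]"] by simp

lemma bar_steps_zero: "bar_step\<^sup>*\<^sup>* ps qs \<Longrightarrow> bar_step\<^sup>*\<^sup>* ((s, 0) # ps) qs"
  using bar_step.face[of "[]" s ps] by (simp add: converse_rtranclp_into_rtranclp)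

lemma bar_take_start:
  "\<forall>t\<in>snd ` set ps. 0 \<le> t \<Longrightarrow> \<tau> \<le> 0 \<Longrightarrow> bar_step\<^sup>*\<^sup>* (bar_take \<tau> ps) []"
  by (induction ps arbitrary: \<tau>) (auto intro!: bar_steps_zero)

lemma bar_drop_start: "\<forall>t\<in>snd ` set ps. 0 \<le> t \<Longrightarrow> \<tau> \<le> 0 \<Longrightarrow> bar_drop \<tau> ps = ps"
  by (induction ps arbitrary: \<tau>) auto

lemma bar_take_end:
  "\<forall>t\<in>snd ` set ps. 0 \<le> t \<Longrightarrow> sum_list (map snd ps) \<le> \<tau> \<Longrightarrow> bar_take \<tau> ps = ps"
proof (induction ps arbitrary: \<tau>)
  case (Cons p ps)
  moreover have "0 \<le> sum_list (map snd ps)"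
    using Cons.prems by (auto intro!: sum_list_nonneg)
  ultimately show ?case by (cases p) auto
qed auto

lemma bar_drop_end:
  "\<forall>t\<in>snd ` set ps. 0 \<le> t \<Longrightarrow> sum_list (map snd ps) \<le> \<tau> \<Longrightarrow> bar_step\<^sup>*\<^sup>* (bar_drop \<tau> ps) []"
proof (induction ps arbitrary: \<tau>)
  case (Cons p ps)
  moreover have "0 \<le> sum_list (map snd ps)"
    using Cons.prems by (auto intro!: sum_list_nonneg)
  ultimately show ?case by (cases p) (auto intro!: bar_steps_zero)
qed auto

text \<open>The cut splits at most one piece, into two with the same label that a degeneracy fuses
  again; all other pieces occur once in full and once with length 0, which a face removes. Hence the
  contraction towards a point fixes that point at all times.\<close>

lemma bar_take_drop_self:
  "\<forall>t\<in>snd ` set ps. 0 \<le> t \<Longrightarrow> bar_step\<^sup>*\<^sup>* (bar_take \<tau> ps @ bar_drop \<tau> ps) ps"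
proof (induction ps arbitrary: \<tau>)
  case (Cons p ps)
  obtain s t where p: "p = (s, t)" by force
  have nn: "0 \<le> t" "\<forall>t\<in>snd ` set ps. 0 \<le> t"
    using Cons.prems p by auto
  show ?case
  proof (cases "t \<le> \<tau>")
    case True
    have "bar_step\<^sup>*\<^sup>* (bar_take (\<tau> - t) ps @ (s, 0) # bar_drop (\<tau> - t) ps) (bar_take (\<tau> - t) ps @ bar_drop (\<tau> - t) ps)"
      by (rule r_into_rtranclp[of bar_step, OF bar_step.face])
    then have "bar_step\<^sup>*\<^sup>* (bar_take (\<tau> - t) ps @ (s, 0) # bar_drop (\<tau> - t) ps) ps"
      using Cons.IH[OF nn(2), of "\<tau> - t"] by (rule rtranclp_trans)
    then show ?thesis
      using True nn by (auto simp: p intro: bar_steps_ConsI)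
  next
    case False
    define a where "a = max 0 (min t \<tau>)"
    have "bar_step\<^sup>*\<^sup>* (bar_take (\<tau> - t) ps) []"
      using False nn by (intro bar_take_start) auto
    from bar_steps_append[OF this, of "[(s, a)]" "(s, t - a) # ps"]
    have "bar_step\<^sup>*\<^sup>* ((s, a) # bar_take (\<tau> - t) ps @ (s, t - a) # ps) ([] @ (s, a) # (s, t - a) # ps)"
      by simp
    also have "bar_step\<^sup>*\<^sup>* ([] @ (s, a) # (s, t - a) # ps) ([] @ (s, a + (t - a)) # ps)"
      by (rule r_into_rtranclp[of bar_step, OF bar_step.degeneracy])
    finally show ?thesis
      using False bar_drop_start[OF nn(2), of "\<tau> - t"] by (simp add: p a_def)
  qed
qed simp

definition bar_contract :: "'s set \<Rightarrow> ('s \<times> real) list \<Rightarrow> real \<Rightarrow> ('s \<times> real) list set \<Rightarrow> ('s \<times> real) list set" where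
  "bar_contract S ps \<tau> c = bar_class S (bar_take \<tau> ps @ bar_drop \<tau> (SOME qs. qs \<in> c))"

lemma bar_contract_class:
  assumes "ps \<in> bar_pts S" "qs \<in> bar_pts S" "0 \<le> \<tau>" "\<tau> \<le> 1"
  shows "bar_contract S ps \<tau> (bar_class S qs) = bar_class S (bar_take \<tau> ps @ bar_drop \<tau> qs)"
  unfolding bar_contract_def
proof (rule someI2[where a = qs])
  fix rs assume "rs \<in> bar_class S qs"
  then have "(qs, rs) \<in> bar_rel S"
    by (simp add: mem_bar_class)
  then show "bar_class S (bar_take \<tau> ps @ bar_drop \<tau> rs) = bar_class S (bar_take \<tau> ps @ bar_drop \<tau> qs)"
  proof (rule bar_rel_invariant[symmetric])
    fix qs rs assume *: "qs \<in> bar_pts S" "bar_step qs rs"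
    have "bar_step (bar_take \<tau> ps @ bar_drop \<tau> qs) (bar_take \<tau> ps @ bar_drop \<tau> rs)"
      using bar_step_append[OF bar_step_drop[OF *(2) bar_pts_nonneg[OF *(1)]], of _ _ "[]"] by simp
    then show "bar_class S (bar_take \<tau> ps @ bar_drop \<tau> qs) = bar_class S (bar_take \<tau> ps @ bar_drop \<tau> rs)"
      by (intro bar_class_eqI bar_steps_rel[OF r_into_rtranclp[of bar_step]] bar_take_drop_pts assms *)
  qed
qed (simp add: mem_bar_class)

section \<open>Continuity of the contraction\<close>

lemma continuous_map_bar_take:
  assumes "continuous_map Z euclideanreal x"
    and "\<And>s f. (s, f) \<in> set l \<Longrightarrow> continuous_map Z euclideanreal f" "i < length l"
  shows "continuous_map Z euclideanreal (\<lambda>z. snd (bar_take (x z) (map (\<lambda>(s, f). (s, f z)) l) ! i))"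
  using assms
proof (induction l arbitrary: x i)
  case (Cons p l)
  obtain r f where p: "p = (r, f)" by force
  have "continuous_map Z euclideanreal (\<lambda>z. snd (bar_take (x z - f z) (map (\<lambda>(s, f). (s, f z)) l) ! (i - 1)))"
    if "i \<noteq> 0"
    using Cons.prems p that by (intro Cons.IH continuous_map_diff) auto
  moreover have "continuous_map Z euclideanreal (\<lambda>z. max 0 (min (f z) (x z)))"
    using Cons.prems p by (intro continuous_map_real_max continuous_map_real_min) auto
  ultimately show ?case
    by (cases i) (auto simp: p)
qed simp

lemma continuous_map_bar_drop:
  assumes "continuous_map Z euclideanreal x"
    and "\<And>s f. (s, f) \<in> set l \<Longrightarrow> continuous_map Z euclideanreal f" "i < length l"
  shows "continuous_map Z euclideanreal (\<lambda>z. snd (bar_drop (x z) (map (\<lambda>(s, f). (s, f z)) l) ! i))"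
  using assms
proof (induction l arbitrary: x i)
  case (Cons p l)
  obtain r f where p: "p = (r, f)" by force
  have "continuous_map Z euclideanreal (\<lambda>z. snd (bar_drop (x z - f z) (map (\<lambda>(s, f). (s, f z)) l) ! (i - 1)))"
    if "i \<noteq> 0"
    using Cons.prems p that by (intro Cons.IH continuous_map_diff) auto
  moreover have "continuous_map Z euclideanreal (\<lambda>z. f z - max 0 (min (f z) (x z)))"
    using Cons.prems p by (intro continuous_map_real_max continuous_map_real_min continuous_map_diff) auto
  ultimately show ?case
    by (cases i) (auto simp: p)
qed simp

text \<open>If the labels of the representing lists do not vary, the map factors through the
  characteristic map of a single simplex, and only its coordinates have to be continuous.\<close>

lemma continuous_map_bar_class:
  assumes l: "\<And>z. z \<in> topspace Z \<Longrightarrow> l z \<in> bar_pts S \<and> map fst (l z) = xs"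
    and c: "\<And>i. i < length xs \<Longrightarrow> continuous_map Z euclideanreal (\<lambda>z. snd (l z ! i))"
  shows "continuous_map Z (bar_top S) (\<lambda>z. bar_class S (l z))"
proof (cases "topspace Z = {}")
  case False
  then obtain z0 where "z0 \<in> topspace Z" by blast
  then have xs: "xs \<noteq> []" "set xs \<subseteq> S"
    using l[of z0] by (auto simp: bar_pts_def)
  define u where "u = (\<lambda>z i. if i < length xs then snd (l z ! i) else 0)"
  have zip: "l z = bar_zip xs (u z)" if "z \<in> topspace Z" for z
  proof -
    have "length (l z) = length xs" using l[OF that] by auto
    then have "map snd (l z) = map (u z) [0..<length xs]"
      by (intro nth_equalityI) (auto simp: u_def)
    then show ?thesis
      unfolding bar_zip_def using l[OF that] by (metis zip_map_fst_snd)
  qed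
  have u: "u z \<in> standard_simplex (length xs - 1)" if z: "z \<in> topspace Z" for z
  proof -
    obtain ys t where t: "ys \<noteq> []" "t \<in> standard_simplex (length ys - 1)" "l z = bar_zip ys t"
      using bar_pts_zip l[OF z] by metis
    have ys: "ys = xs" using t(3) l[OF z] by simp
    have "u z i = t i" for i
    proof (cases "i < length xs")
      case True
      then show ?thesis
        using t(3) ys by (simp add: u_def bar_zip_def)
    next
      case False
      then show ?thesis
        using t(1,2) ys by (cases xs) (auto simp: u_def standard_simplex_def)
    qed
    then have "u z = t" by auto
    then show ?thesis using t ys by simp
  qed
  have "continuous_map Z (powertop_real UNIV) u"
    unfolding continuous_map_componentwise_UNIV using c by (auto simp: u_def)
  then have "continuous_map Z (simplex_top (length xs - 1)) u"
    using u by (auto simp: continuous_map_in_subtopology)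
  then have "continuous_map Z (bar_top S) (bar_chart S xs \<circ> u)"
    using continuous_map_bar_chart[OF xs] continuous_map_compose by blast
  then show ?thesis
    by (rule continuous_map_eq) (simp add: bar_chart_eq zip)
qed simp

text \<open>Products with a compact space preserve the final topology, by the tube lemma.\<close>

lemma continuous_map_prod_bar_top:
  assumes Z: "compact_space Z" "Hausdorff_space Z"
    and h: "\<And>xs. xs \<noteq> [] \<Longrightarrow> set xs \<subseteq> S \<Longrightarrow>
      continuous_map (prod_topology Z (simplex_top (length xs - 1))) Y (\<lambda>(z, t). h (z, bar_chart S xs t))"
  shows "continuous_map (prod_topology Z (bar_top S)) Y h"
  unfolding continuous_map_def
proof (intro conjI allI impI)
  show "h \<in> topspace (prod_topology Z (bar_top S)) \<rightarrow> topspace Y"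
  proof
    fix p assume "p \<in> topspace (prod_topology Z (bar_top S))"
    then obtain z c where p: "p = (z, c)" "z \<in> topspace Z" "c \<in> topspace (bar_top S)"
      by auto
    then obtain xs t where "xs \<noteq> []" "set xs \<subseteq> S" "t \<in> standard_simplex (length xs - 1)"
      "c = bar_chart S xs t"
      by (meson bar_top_cases)
    then have "(\<lambda>(z, t). h (z, bar_chart S xs t)) (z, t) \<in> topspace Y"
      using p(2) by (intro funcset_mem[OF continuous_map_funspace[OF h]]) auto
    then show "h p \<in> topspace Y"
      using p(1) \<open>c = bar_chart S xs t\<close> by simp
  qed
  fix U assume U: "openin Y U"
  define W where "W = {p \<in> topspace (prod_topology Z (bar_top S)). h p \<in> U}"
  have "\<exists>T. openin (prod_topology Z (bar_top S)) T \<and> p \<in> T \<and> T \<subseteq> W" if "p \<in> W" for p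
  proof -
    obtain z0 c0 where z0: "p = (z0, c0)" by force
    then have p: "p = (z0, c0)" "z0 \<in> topspace Z" "c0 \<in> topspace (bar_top S)" "h (z0, c0) \<in> U"
      using that by (auto simp: W_def)
    obtain xs t0 where t0: "xs \<noteq> []" "set xs \<subseteq> S" "t0 \<in> standard_simplex (length xs - 1)"
      "c0 = bar_chart S xs t0"
      using p(3) by (meson bar_top_cases)
    have "continuous_map Z (prod_topology Z (simplex_top (length xs - 1))) (\<lambda>z. (z, t0))"
      using t0 by (simp add: continuous_map_pairedI)
    from continuous_map_compose[OF this h[OF t0(1,2)]]
    have "continuous_map Z Y (\<lambda>z. h (z, c0))"
      by (simp add: o_def t0(4))
    then have "openin Z {z \<in> topspace Z. h (z, c0) \<in> U}"
      using U by (rule openin_continuous_map_preimage)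
    moreover have "neighbourhood_base_of (closedin Z) Z"
      using Z compact_Hausdorff_imp_regular_space neighbourhood_base_of_closedin by blast
    ultimately obtain N K where N: "openin Z N" "closedin Z K" "z0 \<in> N" "N \<subseteq> K"
      "K \<subseteq> {z \<in> topspace Z. h (z, c0) \<in> U}"
      using p by (smt (verit) neighbourhood_base_of mem_Collect_eq)
    \<comment> \<open>The tube around the compact neighbourhood \<open>K\<close> of
      \<open>z0\<close>. In each chart its complement is the projection along \<open>K\<close> of a
      closed set, hence closed.\<close>
    define V where "V = {c \<in> topspace (bar_top S). \<forall>z\<in>K. h (z, c) \<in> U}"
    have "openin (bar_top S) V"
    proof (rule openin_bar_topI)
      fix ys  assume ys: "ys \<noteq> []" "set ys \<subseteq> S"
      let ?D = "simplex_top (length ys - 1)"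
      let ?O = "{q \<in> topspace (prod_topology Z ?D). (case q of (z, t) \<Rightarrow> h (z, bar_chart S ys t)) \<in> U}"
      have O: "openin (prod_topology Z ?D) ?O"
        by (rule openin_continuous_map_preimage[OF h[OF ys] U])
      have K: "compact_space (subtopology Z K)"
        using Z N closedin_compact_space compact_space_subtopology by blast
      have "closedin (prod_topology Z ?D) (K \<times> topspace ?D - ?O)"
        using N O by (intro closedin_diff) (auto simp: closedin_prod_Times_iff)
      then have "closedin (prod_topology (subtopology Z K) ?D) (K \<times> topspace ?D - ?O)"
        using N closedin_subset[OF N(2)]
        by (auto simp: prod_topology_subtopology(1) closedin_closed_subtopology closedin_prod_Times_iff)
      then have "closedin ?D (snd ` (K \<times> topspace ?D - ?O))"
        using closed_map_snd[OF K] unfolding closed_map_def by blast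
      then have "openin ?D (topspace ?D - snd ` (K \<times> topspace ?D - ?O))"
        by blast
      moreover have "topspace ?D - snd ` (K \<times> topspace ?D - ?O) =
          {t \<in> standard_simplex (length ys - 1). bar_chart S ys t \<in> V}"
        using closedin_subset[OF N(2)] bar_chart_topspace[OF ys] by (force simp: V_def)
      ultimately show "openin ?D {t \<in> standard_simplex (length ys - 1). bar_chart S ys t \<in> V}"
        by simp
    qed (auto simp: V_def)
    then have "openin (prod_topology Z (bar_top S)) (N \<times> V)"
      using N by (simp add: openin_prod_Times_iff)
    moreover have "p \<in> N \<times> V" "N \<times> V \<subseteq> W"
      using N p by (auto simp: V_def W_def subset_iff)
    ultimately show ?thesis by blast
  qed
  then show "openin (prod_topology Z (bar_top S)) {p \<in> topspace (prod_topology Z (bar_top S)). h p \<in> U}"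
    unfolding W_def[symmetric] by (subst openin_subopen) blast
qed

definition pointed_contractible :: "'a topology \<Rightarrow> 'a \<Rightarrow> bool" where
  "pointed_contractible X x \<longleftrightarrow> (\<exists>h. continuous_map (prod_topology (top_of_set {0..1::real}) X) X h \<and>
     (\<forall>c\<in>topspace X. h (0, c) = c \<and> h (1, c) = x) \<and> (\<forall>\<tau>\<in>{0..1}. h (\<tau>, x) = x))"

lemma pointed_contractible_bar_top:
  assumes "c \<in> topspace (bar_top S)"
  shows "pointed_contractible (bar_top S) c"
proof -
  obtain ps where ps: "ps \<in> bar_pts S" "c = bar_class S ps"
    using assms by (auto simp: topspace_bar_top)
  have nn: "\<forall>t\<in>snd ` set ps. 0 \<le> t" and sum: "sum_list (map snd ps) = 1"
    using ps by (auto simp: bar_pts_iff)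
  show ?thesis
    unfolding pointed_contractible_def
  proof (intro exI conjI ballI)
    show "continuous_map (prod_topology (top_of_set {0..1}) (bar_top S)) (bar_top S)
        (\<lambda>(\<tau>, d). bar_contract S ps \<tau> d)"
    proof (rule continuous_map_prod_bar_top)
      show "compact_space (top_of_set {0..1::real})"
        by (simp add: compact_space_subtopology)
      show "Hausdorff_space (top_of_set {0..1::real})"
        by (simp add: Hausdorff_space_subtopology)
      fix xs :: "'a list" assume xs: "xs \<noteq> []" "set xs \<subseteq> S"
      let ?Z = "prod_topology (top_of_set {0..1::real}) (simplex_top (length xs - 1))"
      let ?l = "\<lambda>(\<tau>, t). bar_take \<tau> ps @ bar_drop \<tau> (bar_zip xs t)"
      have proj: "continuous_map ?Z euclideanreal fst"
        using continuous_map_fst continuous_map_into_fulltopology by blast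
      have coord: "continuous_map ?Z euclideanreal (\<lambda>z. snd z i)" for i
        using continuous_map_compose[OF continuous_map_snd continuous_map_simplex_coord]
        by (simp add: o_def)
      have "continuous_map ?Z (bar_top S) (\<lambda>z. bar_class S (?l z))"
      \<comment> \<open>For all \<tau> and \<open>t\<close> the spliced list has the labels of
        \<open>ps\<close> followed by \<open>xs\<close>, so the homotopy on this chart lands in one
        simplex.\<close>
      proof (rule continuous_map_bar_class[where xs = "map fst ps @ xs"])
        fix z assume "z \<in> topspace ?Z"
        then show "?l z \<in> bar_pts S \<and> map fst (?l z) = map fst ps @ xs"
          using xs ps by (auto intro!: bar_take_drop_pts bar_zip_pts)
      next
        fix i assume i: "i < length (map fst ps @ xs)"
        show "continuous_map ?Z euclideanreal (\<lambda>z. snd (?l z ! i))"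
        proof (cases "i < length ps")
          case True
          have "continuous_map ?Z euclideanreal
            (\<lambda>z. snd (bar_take (fst z) (map (\<lambda>(s, f). (s, f z)) (map (\<lambda>(s, t). (s, \<lambda>z. t)) ps)) ! i))"
            using True by (intro continuous_map_bar_take proj) auto
          moreover have "map (\<lambda>(s, f). (s, f z)) (map (\<lambda>(s, t). (s, \<lambda>z. t)) ps) = ps" for z :: "real \<times> (nat \<Rightarrow> real)"
            by (simp add: o_def case_prod_unfold)
          ultimately show ?thesis
            using True by (simp add: nth_append case_prod_unfold)
        next
          case False
          define l :: "('a \<times> (real \<times> (nat \<Rightarrow> real) \<Rightarrow> real)) list"
            where "l = zip xs (map (\<lambda>i z. snd z i) [0..<length xs])"
          have "continuous_map ?Z euclideanreal
            (\<lambda>z. snd (bar_drop (fst z) (map (\<lambda>(s, f). (s, f z)) l) ! (i - length ps)))"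
            using False i
            by (intro continuous_map_bar_drop proj) (auto simp: l_def simp del: One_nat_def dest!: set_zip_rightD intro: coord)
          moreover have "map (\<lambda>(s, f). (s, f z)) l = bar_zip xs (snd z)" for z
            unfolding l_def by (rule nth_equalityI) (auto simp: bar_zip_def)
          ultimately show ?thesis
            using False by (simp add: nth_append case_prod_unfold)
        qed
      qed
      then show "continuous_map ?Z (bar_top S)
          (\<lambda>(\<tau>, t). case (\<tau>, bar_chart S xs t) of (\<tau>, d) \<Rightarrow> bar_contract S ps \<tau> d)"
        by (rule continuous_map_eq)
           (use xs ps in \<open>auto simp: bar_chart_eq bar_contract_class bar_zip_pts\<close>)
    qed
  next
    fix d assume "d \<in> topspace (bar_top S)"
    then obtain qs where qs: "qs \<in> bar_pts S" "d = bar_class S qs"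
      by (auto simp: topspace_bar_top)
    have nn': "\<forall>t\<in>snd ` set qs. 0 \<le> t" and sum': "sum_list (map snd qs) = 1"
      using qs by (auto simp: bar_pts_iff)
    have "bar_step\<^sup>*\<^sup>* (bar_take 0 ps @ bar_drop 0 qs) qs"
      using bar_steps_append[OF bar_take_start[OF nn, of 0], of "[]" qs] bar_drop_start[OF nn', of 0] by simp
    then have "(bar_take 0 ps @ bar_drop 0 qs, qs) \<in> bar_rel S"
      using ps qs by (intro bar_steps_rel bar_take_drop_pts) auto
    then show "(case (0, d) of (\<tau>, d) \<Rightarrow> bar_contract S ps \<tau> d) = d"
      using ps qs by (simp add: bar_contract_class bar_class_eqI)
    have "bar_step\<^sup>*\<^sup>* (bar_take 1 ps @ bar_drop 1 qs) ps"
      using bar_steps_append[OF bar_drop_end[OF nn', of 1], of ps "[]"] bar_take_end[OF nn, of 1] sum sum' by simp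
    then have "(bar_take 1 ps @ bar_drop 1 qs, ps) \<in> bar_rel S"
      using ps qs by (intro bar_steps_rel bar_take_drop_pts) auto
    then show "(case (1, d) of (\<tau>, d) \<Rightarrow> bar_contract S ps \<tau> d) = c"
      using ps qs by (simp add: bar_contract_class bar_class_eqI)
  next
    fix \<tau> :: real assume \<tau>: "\<tau> \<in> {0..1}"
    have "(bar_take \<tau> ps @ bar_drop \<tau> ps, ps) \<in> bar_rel S"
      using ps \<tau> by (intro bar_steps_rel bar_take_drop_self nn bar_take_drop_pts) auto
    then show "(case (\<tau>, c) of (\<tau>, d) \<Rightarrow> bar_contract S ps \<tau> d) = c"
      using ps \<tau> by (simp add: bar_contract_class bar_class_eqI)
  qed
qed

subsection \<open>Cells\<close>

text \<open>Names the open cell that contains a point: the labels of its normal form, read off from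
  any representative.\<close>

definition bar_word :: "('s \<times> real) list \<Rightarrow> 's list" where
  "bar_word ps = remdups_adj (map fst (filter (\<lambda>p. snd p \<noteq> 0) ps))"

lemma bar_word_step:
  assumes "bar_step ps qs" "\<forall>t\<in>snd ` set ps. 0 \<le> t"
  shows "bar_word ps = bar_word qs"
  using assms
proof (induction rule: bar_step.induct)
  case (degeneracy ps s t t' qs)
  have "remdups_adj (as @ s # s # bs) = remdups_adj (as @ s # bs)" for as bs
    using remdups_adj_append[of as s "s # bs"] remdups_adj_append[of as s bs] by simp
  moreover have "t + t' = 0 \<longleftrightarrow> t = 0 \<and> t' = 0"
    using degeneracy by auto
  ultimately show ?case
    by (auto simp: bar_word_def)
qed (simp add: bar_word_def)

lemma bar_word_rel: "(ps, qs) \<in> bar_rel S \<Longrightarrow> bar_word ps = bar_word qs"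
  by (erule bar_rel_invariant) (rule bar_word_step, auto simp: bar_pts_iff)

lemma bar_word_normal: "bar_normal ps \<Longrightarrow> bar_word ps = map fst ps"
proof -
  assume n: "bar_normal ps"
  then have "filter (\<lambda>p. snd p \<noteq> 0) ps = ps"
    by (intro filter_True) (auto simp: bar_normal_def)
  then show ?thesis
    using n by (simp add: bar_word_def bar_normal_def distinct_adj_altdef)
qed

definition bar_words :: "'s set \<Rightarrow> 's list set" where
  "bar_words S = {w. w \<noteq> [] \<and> set w \<subseteq> S \<and> distinct_adj w}"

lemma bar_word_in: "ps \<in> bar_pts S \<Longrightarrow> bar_word ps \<in> bar_words S"
proof -
  assume ps: "ps \<in> bar_pts S"
  have "filter (\<lambda>p. snd p \<noteq> 0) ps \<noteq> []"
  proof
    assume "filter (\<lambda>p. snd p \<noteq> 0) ps = []"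
    then have "map snd ps = map (\<lambda>_. 0) ps"
      by (auto simp: filter_empty_conv)
    then have "sum_list (map snd ps) = 0"
      by (metis sum_list_0)
    then show False using ps by (simp add: bar_pts_iff)
  qed
  then show ?thesis
    using ps by (auto simp: bar_word_def bar_words_def bar_pts_iff)
qed

definition open_simplex :: "nat \<Rightarrow> (nat \<Rightarrow> real) set" where
  "open_simplex n = {t \<in> standard_simplex n. \<forall>i\<le>n. 0 < t i}"

lemma bar_zip_normal:
  assumes "w \<in> bar_words S" "t \<in> open_simplex (length w - 1)"
  shows "bar_normal (bar_zip w t)"
  using assms by (cases w) (auto simp: bar_normal_def bar_words_def open_simplex_def set_bar_zip)

lemma bar_word_chart_interior:
  assumes "w \<in> bar_words S" "t \<in> open_simplex (length w - 1)"
  shows "bar_word (bar_zip w t) = w"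
  using bar_word_normal[OF bar_zip_normal[OF assms]] by simp

text \<open>A boundary point has a vanishing coordinate, whose label is filtered out; removing
  repetitions can only shorten the word further. So the boundary of a cell lies in cells of smaller
  dimension.\<close>

lemma bar_word_chart_boundary:
  assumes "w \<noteq> []" "t \<in> standard_simplex (length w - 1)" "t \<notin> open_simplex (length w - 1)"
  shows "length (bar_word (bar_zip w t)) < length w"
proof -
  obtain i where i: "i \<le> length w - 1" "t i \<le> 0"
    using assms by (auto simp: open_simplex_def not_less)
  then have "t i = 0" "i < length w"
    using assms by (cases w; auto simp: standard_simplex_def order_antisym)+
  then have "(w ! i, 0) \<in> set (bar_zip w t)"
    by (auto simp: set_bar_zip)
  then have "length (filter (\<lambda>p. snd p \<noteq> 0) (bar_zip w t)) < length (bar_zip w t)"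
    by (intro length_filter_less) auto
  then show ?thesis
    using remdups_adj_length[of "map fst (filter (\<lambda>p. snd p \<noteq> 0) (bar_zip w t))"]
    by (simp add: bar_word_def)
qed

lemma bar_top_interior_cases:
  assumes "ps \<in> bar_pts S"
  obtains t where "t \<in> open_simplex (length (bar_word ps) - 1)" "bar_class S ps = bar_chart S (bar_word ps) t"
proof -
  obtain qs where qs: "bar_normal qs" "bar_step\<^sup>*\<^sup>* ps qs"
    using bar_normal_form[OF assms] by blast
  have rel: "(ps, qs) \<in> bar_rel S" and "qs \<in> bar_pts S"
    using bar_steps_rel[OF qs(2) assms] bar_steps_pts[OF qs(2) assms] by auto
  then obtain xs t where t: "xs \<noteq> []" "t \<in> standard_simplex (length xs - 1)" "qs = bar_zip xs t"
    by (metis bar_pts_zip)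
  have w: "bar_word ps = xs"
    using bar_word_rel[OF rel] bar_word_normal[OF qs(1)] t(3) by simp
  have "t \<in> open_simplex (length xs - 1)"
    using t qs(1) by (cases xs) (auto simp: open_simplex_def bar_normal_def set_bar_zip less_Suc_eq_le)
  then show thesis
    using that[of t] bar_class_eqI[OF rel] t w by (simp add: bar_chart_eq)
qed

text \<open>Interior points of nondegenerate simplices are represented by normal lists, and these
  are unique. Hence the open cells are disjoint and embedded injectively.\<close>

lemma bar_chart_interior_inj:
  assumes w: "w \<in> bar_words S" "t \<in> open_simplex (length w - 1)"
    and w': "w' \<in> bar_words S" "t' \<in> open_simplex (length w' - 1)"
    and eq: "bar_chart S w t = bar_chart S w' t'"
  shows "w = w' \<and> t = t'"
proof -
  have rel: "(bar_zip w t, bar_zip w' t') \<in> bar_rel S"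
    using eq by (simp add: bar_chart_eq bar_class_eq_iff)
  have "bar_zip w t \<in> bar_pts S"
    using w by (intro bar_zip_pts) (auto simp: bar_words_def open_simplex_def)
  from bar_normal_rel_eq[OF this rel bar_zip_normal[OF w] bar_zip_normal[OF w']]
  have z: "bar_zip w t = bar_zip w' t'" .
  then have ww: "w = w'" by (metis map_fst_bar_zip)
  have "t i = t' i" for i
  proof (cases "i < length w")
    case True
    then show ?thesis using z ww by (auto simp: bar_zip_def dest!: arg_cong[where f = "\<lambda>l. snd (l ! i)"])
  next
    case False
    then show ?thesis
      using w w' ww by (cases w) (auto simp: open_simplex_def standard_simplex_def bar_words_def)
  qed
  then show ?thesis using ww by auto
qed

text \<open>A union of open cells; it becomes a closed subspace if \<open>D\<close> is
  \<open>word_closed\<close>.\<close>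

definition bar_sub :: "'s set \<Rightarrow> 's list set \<Rightarrow> ('s \<times> real) list set set" where
  "bar_sub S D = {bar_class S ps | ps. ps \<in> bar_pts S \<and> bar_word ps \<in> D}"

lemma bar_class_in_sub: "bar_class S ps \<in> bar_sub S D \<longleftrightarrow> ps \<in> bar_pts S \<and> bar_word ps \<in> D"
proof
  assume "bar_class S ps \<in> bar_sub S D"
  then obtain qs where "qs \<in> bar_pts S" "bar_word qs \<in> D" "(ps, qs) \<in> bar_rel S"
    by (auto simp: bar_sub_def bar_class_eq_iff)
  then show "ps \<in> bar_pts S \<and> bar_word ps \<in> D"
    using bar_rel_pts[OF bar_rel_sym] bar_word_rel by metis
qed (auto simp: bar_sub_def)

lemma bar_sub_topspace: "bar_sub S D \<subseteq> topspace (bar_top S)"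
  by (auto simp: bar_sub_def topspace_bar_top)

lemma bar_word_zip: "bar_word (bar_zip xs t) = remdups_adj (nths xs {i. t i \<noteq> 0})"
  unfolding bar_word_def bar_zip_def nths_def zip_map2 filter_map
  by (simp add: o_def case_prod_unfold)

lemma subseq_nths_mono: "I \<subseteq> J \<Longrightarrow> subseq (nths xs I) (nths xs J)"
proof (induction xs arbitrary: I J)
  case (Cons x xs)
  then have "subseq (nths xs {j. Suc j \<in> I}) (nths xs {j. Suc j \<in> J})"
    by (intro Cons.IH) auto
  then show ?case using Cons.prems by (auto simp: nths_Cons)
qed simp

text \<open>Of two equal neighbours in \<open>xs\<close> an embedding of \<open>ys\<close> needs
  only one, because \<open>ys\<close> itself has no equal neighbours.\<close>

lemma subseq_remdups_adj: "subseq ys xs \<Longrightarrow> distinct_adj ys \<Longrightarrow> subseq ys (remdups_adj xs)"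
proof (induction xs arbitrary: ys rule: remdups_adj.induct)
  case (3 x y xs)
  show ?case
  proof (cases "x = y")
    case True
    have "subseq ys (x # xs)"
    proof (cases ys)
      case (Cons z zs)
      show ?thesis
      proof (cases "z = x")
        case z: True
        have "subseq zs (x # xs)" using 3(3) Cons True z by simp
        then have "subseq zs xs"
          using 3(4) Cons z by (cases zs) auto
        then show ?thesis using Cons z by simp
      next
        case z: False
        then show ?thesis using 3(3) Cons True by auto
      qed
    qed simp
    then show ?thesis using 3(1)[OF True] 3(4) True by simp
  next
    case False
    show ?thesis
    proof (cases ys)
      case (Cons z zs)
      show ?thesis
      proof (cases "z = x")
        case True
        then have "subseq zs (y # xs)" using 3(3) Cons by simp
        then have "subseq zs (remdups_adj (y # xs))"
          using 3(2)[OF False, of zs] distinct_adj_ConsD[of z zs] 3(4) Cons by simp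
        then show ?thesis using True False Cons by simp
      next
        case z: False
        then have "subseq ys (y # xs)" using 3(3) Cons by simp
        then have "subseq ys (remdups_adj (y # xs))"
          using 3(2)[OF False, of ys] 3(4) by simp
        then show ?thesis using False by auto
      qed
    qed simp
  qed
qed auto

lemma remdups_adj_subseq: "subseq (remdups_adj xs) xs"
  by (induction xs rule: remdups_adj.induct) auto

text \<open>Asks for all shorter words and not only for faces, which fits the attachment of cells in
  order of length and spares a description of the faces of a word.\<close>

definition word_closed :: "'s set \<Rightarrow> 's list set \<Rightarrow> bool" where
  "word_closed S D \<longleftrightarrow> (\<forall>w\<in>D. \<forall>w'\<in>bar_words S. length w' < length w \<longrightarrow> w' \<in> D)"

text \<open>In the simplex with vertices \<open>xs\<close> the preimage is the union of the finitely
  many closed faces whose own word is in \<open>D\<close>. A point of such a face has a word that is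
  a subsequence of the word of the face, so it is equal to it or shorter and lies in
  \<open>D\<close> as well.\<close>

lemma closedin_bar_sub:
  assumes D: "word_closed S D"
  shows "closedin (bar_top S) (bar_sub S D)"
proof (rule closedin_bar_topI[OF bar_sub_topspace])
  fix xs :: "'a list" assume xs: "xs \<noteq> []" "set xs \<subseteq> S"
  define n where "n = length xs - 1"
  \<comment> \<open>A face is given by the set \<open>I\<close> of positions whose coordinates may
    be nonzero; its word is the word of its interior points.\<close>
  define \<I> where "\<I> = {I. I \<subseteq> {..<length xs} \<and> remdups_adj (nths xs I) \<in> D}"
  have nths: "nths xs I = nths xs (I \<inter> {..<length xs})" for I
    unfolding nths_def by (rule arg_cong[where f = "map fst"], rule filter_cong) (auto dest: set_zip_rightD)
  \<comment> \<open>The face \<open>I\<close> is cut out by the equations \<open>t i = 0\<close>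
    outside \<open>I\<close>. Inserting the index 0 keeps the intersection nonempty for every
    \<open>I\<close>; for 0 in \<open>I\<close> the condition there is vacuous.\<close>
  have eq: "{t \<in> standard_simplex n. bar_chart S xs t \<in> bar_sub S D} =
     (\<Union>I\<in>\<I>. \<Inter>i\<in>insert 0 (- I). {t \<in> topspace (simplex_top n). t i \<in> (if i \<in> I then UNIV else {0})})"
  proof (intro Set.set_eqI iffI)
    fix t assume t: "t \<in> {t \<in> standard_simplex n. bar_chart S xs t \<in> bar_sub S D}"
    then have "remdups_adj (nths xs {i. t i \<noteq> 0}) \<in> D"
      by (simp add: bar_chart_eq bar_class_in_sub bar_word_zip)
    then have "{i. t i \<noteq> 0} \<inter> {..<length xs} \<in> \<I>"
      using nths[of "{i. t i \<noteq> 0}"] by (simp add: \<I>_def)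
    moreover have "t i = 0" if "\<not> i < length xs" for i
      using t that xs by (cases xs) (auto simp: standard_simplex_def n_def)
    ultimately show "t \<in> (\<Union>I\<in>\<I>. \<Inter>i\<in>insert 0 (- I). {t \<in> topspace (simplex_top n). t i \<in> (if i \<in> I then UNIV else {0})})"
      using t by (intro UN_I[of "{i. t i \<noteq> 0} \<inter> {..<length xs}"]) auto
  next
    fix t assume "t \<in> (\<Union>I\<in>\<I>. \<Inter>i\<in>insert 0 (- I). {t \<in> topspace (simplex_top n). t i \<in> (if i \<in> I then UNIV else {0})})"
    then obtain I where I: "I \<in> \<I>" "t \<in> standard_simplex n" "\<forall>i. i \<notin> I \<longrightarrow> t i = 0"
      by (force split: if_splits)
    have pts: "bar_zip xs t \<in> bar_pts S"
      using I xs by (auto simp: n_def intro: bar_zip_pts)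
    define u v where "u = bar_word (bar_zip xs t)" and "v = remdups_adj (nths xs I)"
    have "subseq (nths xs {i. t i \<noteq> 0}) (nths xs I)"
      using I by (intro subseq_nths_mono) auto
    then have "subseq u (nths xs I)"
      unfolding u_def bar_word_zip using subseq_order.order_trans remdups_adj_subseq by blast
    then have sub: "subseq u v"
      unfolding v_def by (intro subseq_remdups_adj) (auto simp: u_def bar_word_def)
    have "v \<in> D" using I by (simp add: \<I>_def v_def)
    have "u \<in> D"
    proof (cases "length u < length v")
      case True
      then show ?thesis
        using D \<open>v \<in> D\<close> bar_word_in[OF pts] by (auto simp: word_closed_def u_def)
    next
      case False
      then have "u = v"
        using sub by (metis list_emb_length linorder_neqE_nat not_less subseq_same_length)
      then show ?thesis using \<open>v \<in> D\<close> by simp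
    qed
    then show "t \<in> {t \<in> standard_simplex n. bar_chart S xs t \<in> bar_sub S D}"
      using I pts by (simp add: bar_chart_eq bar_class_in_sub u_def)
  qed
  have "finite \<I>"
    by (rule finite_subset[of _ "Pow {..<length xs}"]) (auto simp: \<I>_def)
  moreover have "closedin (simplex_top n) (\<Inter>i\<in>insert 0 (- I).
      {t \<in> topspace (simplex_top n). t i \<in> (if i \<in> I then UNIV else {0})})" for I
  proof (rule closedin_INT)
    fix i
    show "closedin (simplex_top n) {t \<in> topspace (simplex_top n). t i \<in> (if i \<in> I then UNIV else {0})}"
      by (rule closedin_continuous_map_preimage[OF continuous_map_simplex_coord]) simp
  qed simp
  ultimately have "closedin (simplex_top n) (\<Union>I\<in>\<I>. \<Inter>i\<in>insert 0 (- I).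
      {t \<in> topspace (simplex_top n). t i \<in> (if i \<in> I then UNIV else {0})})"
    by (intro closedin_Union finite_imageI) (auto simp del: INT_insert topspace_subtopology)
  then show "closedin (simplex_top (length xs - 1))
      {t \<in> standard_simplex (length xs - 1). bar_chart S xs t \<in> bar_sub S D}"
    using eq by (simp add: n_def)
qed

text \<open>A closed simplex meets only finitely many open cells, since the words of its points come
  from subsequences of \<open>xs\<close>. This is what makes limit stages colimits.\<close>

lemma finite_bar_chart_words: "finite {bar_word (bar_zip xs t) | t. t \<in> T}"
proof (rule finite_subset)
  show "{bar_word (bar_zip xs t) | t. t \<in> T} \<subseteq> remdups_adj ` {ys. subseq ys xs}"
  proof (clarsimp simp: bar_word_zip)
    fix t :: "nat \<Rightarrow> real"
    have "subseq (nths xs {i. t i \<noteq> 0}) xs"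
      using subseq_nths_mono[of "{i. t i \<noteq> 0}" UNIV xs] by (simp add: nths_all)
    then show "remdups_adj (nths xs {i. t i \<noteq> 0}) \<in> remdups_adj ` {ys. subseq ys xs}"
      by blast
  qed
  show "finite (remdups_adj ` {ys. subseq ys xs})"
    using List.finite_set[of "subseqs xs"] by (simp add: set_subseqs_eq)
qed

subsection \<open>A map from the disc onto the simplex\<close>

text \<open>The disc is mapped radially: with \<open>simplex_dir m x\<close> the vector of \<open>\<real>\<^sup>m\<^sup>+\<^sup>1\<close> with coordinate sum \<open>0\<close> and
  first coordinates \<open>x\<close>, and \<open>simplex_gauge m\<close> the gauge of the simplex with respect to its
  barycentre, the sphere of radius \<open>r\<close> goes to the boundary of the simplex scaled by \<open>r\<close> about the
  barycentre.  At \<open>x = 0\<close> the formula relies on \<open>0 / 0 = 0\<close>.\<close>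

definition simplex_dir :: "nat \<Rightarrow> (nat \<Rightarrow> real) \<Rightarrow> nat \<Rightarrow> real" where
  "simplex_dir m x i = (if i < m then x i else if i = m then - sum x {..<m} else 0)"

text \<open>The factor comes from the barycentre, whose coordinates are all 1/(m + 1): the
  barycentre plus a vector v has nonnegative coordinates iff m + 1 times the largest -v_i is at most
  1.\<close>

definition simplex_gauge :: "nat \<Rightarrow> (nat \<Rightarrow> real) \<Rightarrow> real" where
  "simplex_gauge m x = real (Suc m) * Max ((\<lambda>i. - simplex_dir m x i) ` {..m})"

definition disc_norm :: "nat \<Rightarrow> (nat \<Rightarrow> real) \<Rightarrow> real" where
  "disc_norm m x = sqrt (\<Sum>i<m. (x i)\<^sup>2)"

definition disc_to_simplex :: "nat \<Rightarrow> (nat \<Rightarrow> real) \<Rightarrow> nat \<Rightarrow> real" where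
  "disc_to_simplex m x i = (if i \<le> m then 1 / real (Suc m) else 0) +
     simplex_dir m x i * disc_norm m x / simplex_gauge m x"

lemma topspace_disc: "topspace (disc m) = {x. (\<forall>i\<ge>m. x i = 0) \<and> disc_norm m x \<le> 1}"
  by (auto simp: disc_def topspace_Euclidean_space disc_norm_def)

lemma topspace_disc_boundary: "topspace (disc_boundary m) = {x. (\<forall>i\<ge>m. x i = 0) \<and> disc_norm m x = 1}"
  by (auto simp: disc_boundary_def topspace_Euclidean_space disc_norm_def)

lemma topspace_disc_boundary_subset: "topspace (disc_boundary m) \<subseteq> topspace (disc m)"
  by (auto simp: topspace_disc topspace_disc_boundary)

lemma sum_simplex_dir: "sum (simplex_dir m x) {..m} = 0"
proof -
  have "sum (simplex_dir m x) {..m} = sum (simplex_dir m x) {..<m} + simplex_dir m x m"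
    by (simp add: lessThan_Suc_atMost[symmetric])
  also have "sum (simplex_dir m x) {..<m} = sum x {..<m}"
    by (rule sum.cong) (auto simp: simplex_dir_def)
  finally show ?thesis by (simp add: simplex_dir_def)
qed

lemma simplex_dir_gauge: "i \<le> m \<Longrightarrow> - simplex_dir m x i * real (Suc m) \<le> simplex_gauge m x"
  unfolding simplex_gauge_def mult.commute[of _ "real (Suc m)"]
  by (intro mult_left_mono Max_ge) auto

lemma simplex_gauge_attained: "\<exists>i\<le>m. - simplex_dir m x i * real (Suc m) = simplex_gauge m x"
proof -
  have "Max ((\<lambda>i. - simplex_dir m x i) ` {..m}) \<in> (\<lambda>i. - simplex_dir m x i) ` {..m}"
    by (rule Max_in) auto
  then obtain i where i: "Max ((\<lambda>i. - simplex_dir m x i) ` {..m}) = - simplex_dir m x i" "i \<in> {..m}"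
    by (rule imageE)
  show ?thesis
    unfolding simplex_gauge_def i(1) using i(2) mult.commute by blast
qed

lemma simplex_gauge_nonneg: "0 \<le> simplex_gauge m x"
proof (rule ccontr)
  assume "\<not> 0 \<le> simplex_gauge m x"
  then have "0 < simplex_dir m x i" if "i \<le> m" for i
    using simplex_dir_gauge[OF that, of x] by (smt (verit) mult_nonneg_nonneg of_nat_0_le_iff)
  then have "0 < sum (simplex_dir m x) {..m}"
    by (intro sum_pos) auto
  then show False by (simp add: sum_simplex_dir)
qed

lemma disc_norm_eq_0: "disc_norm m x = 0 \<longleftrightarrow> (\<forall>i<m. x i = 0)"
  by (auto simp: disc_norm_def sum_nonneg_eq_0_iff)

lemma disc_norm_nonneg: "0 \<le> disc_norm m x"
  by (simp add: disc_norm_def sum_nonneg)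

lemma simplex_gauge_eq_0: "simplex_gauge m x = 0 \<longleftrightarrow> disc_norm m x = 0"
proof
  assume "simplex_gauge m x = 0"
  then have "0 \<le> simplex_dir m x i" if "i \<le> m" for i
    using simplex_dir_gauge[OF that, of x] by (simp add: mult_le_0_iff zero_le_mult_iff)
  then have *: "\<forall>i\<in>{..m}. simplex_dir m x i = 0"
    using sum_nonneg_eq_0_iff[of "{..m}" "simplex_dir m x"] sum_simplex_dir[of m x] by auto
  have "x i = 0" if "i < m" for i
    using bspec[OF *, of i] that by (simp add: simplex_dir_def)
  then show "disc_norm m x = 0"
    by (simp add: disc_norm_eq_0)
next
  assume "disc_norm m x = 0"
  then have "simplex_dir m x i = 0" for i
    by (auto simp: disc_norm_eq_0 simplex_dir_def)
  then show "simplex_gauge m x = 0"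
    using simplex_gauge_attained[of m x] by auto
qed

text \<open>The definition of the gauge bounds the coordinates from below; since they add up to 0,
  each one is minus the sum of the others, which bounds it from above. Gives continuity at the
  centre of the disc.\<close>

lemma simplex_dir_le_gauge: "\<bar>simplex_dir m x i\<bar> \<le> simplex_gauge m x"
proof (cases "i \<le> m")
  case True
  have lower: "- simplex_dir m x j \<le> simplex_gauge m x / real (Suc m)" if "j \<le> m" for j
    using simplex_dir_gauge[OF that, of x] by (simp add: field_simps)
  have "simplex_dir m x i = (\<Sum>j\<in>{..m} - {i}. - simplex_dir m x j)"
    using sum_simplex_dir[of m x] True by (simp add: sum_negf sum_diff1)
  also have "\<dots> \<le> (\<Sum>j\<in>{..m} - {i}. simplex_gauge m x / real (Suc m))"
    using lower by (intro sum_mono) auto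
  also have "\<dots> = real m * (simplex_gauge m x / real (Suc m))"
    using True by simp
  also have "\<dots> \<le> real (Suc m) * (simplex_gauge m x / real (Suc m))"
    using simplex_gauge_nonneg[of m x] by (intro mult_right_mono) auto
  finally have "simplex_dir m x i \<le> simplex_gauge m x"
    by simp
  moreover have "- simplex_dir m x i \<le> simplex_gauge m x"
  proof -
    have "simplex_gauge m x / real (Suc m) \<le> simplex_gauge m x / 1"
      using simplex_gauge_nonneg[of m x] by (intro divide_left_mono) auto
    then show ?thesis using lower[OF True] by simp
  qed
  ultimately show ?thesis by simp
qed (simp add: simplex_dir_def simplex_gauge_nonneg)

text \<open>Together: the least coordinate of the image is (1 - r)/(m + 1), where r is the norm of
  \<open>x\<close>. It decides whether the image lies in the simplex or in its interior, and it
  recovers r.\<close>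

lemma disc_to_simplex_min:
  shows "i \<le> m \<Longrightarrow> (1 - disc_norm m x) / real (Suc m) \<le> disc_to_simplex m x i"
    and "\<exists>i\<le>m. disc_to_simplex m x i = (1 - disc_norm m x) / real (Suc m)"
proof -
  have eq: "simplex_dir m x i * disc_norm m x / simplex_gauge m x
      = - disc_norm m x / real (Suc m) * (- simplex_dir m x i * real (Suc m) / simplex_gauge m x)" for i
    by simp
  show "(1 - disc_norm m x) / real (Suc m) \<le> disc_to_simplex m x i" if "i \<le> m"
  proof -
    have "- simplex_dir m x i * real (Suc m) / simplex_gauge m x \<le> 1"
      using simplex_dir_gauge[OF that, of x] simplex_gauge_nonneg[of m x]
      by (cases "simplex_gauge m x = 0") (simp_all only: divide_le_eq_1 div_by_0, simp_all)
    then have "disc_norm m x / real (Suc m) * (- simplex_dir m x i * real (Suc m) / simplex_gauge m x)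
        \<le> disc_norm m x / real (Suc m) * 1"
      by (intro mult_left_mono) (auto simp: disc_norm_nonneg)
    then show ?thesis
      using that unfolding disc_to_simplex_def eq by (simp add: diff_divide_distrib)
  qed
  obtain i where i: "i \<le> m" "- simplex_dir m x i * real (Suc m) = simplex_gauge m x"
    using simplex_gauge_attained by blast
  have "disc_to_simplex m x i = (1 - disc_norm m x) / real (Suc m)"
  proof (cases "disc_norm m x = 0")
    case False
    then have "- simplex_dir m x i * real (Suc m) / simplex_gauge m x = 1"
      using i(2) simplex_gauge_eq_0[of m x] by simp
    then show ?thesis
      unfolding disc_to_simplex_def eq using i(1) by (simp add: diff_divide_distrib)
  qed (use i in \<open>simp add: disc_to_simplex_def\<close>)
  then show "\<exists>i\<le>m. disc_to_simplex m x i = (1 - disc_norm m x) / real (Suc m)"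
    using i by blast
qed

lemma sum_disc_to_simplex: "sum (disc_to_simplex m x) {..m} = 1"
proof -
  have "sum (disc_to_simplex m x) {..m} =
      (\<Sum>i\<le>m. 1 / real (Suc m)) + (\<Sum>i\<le>m. simplex_dir m x i * (disc_norm m x / simplex_gauge m x))"
    unfolding sum.distrib[symmetric] by (rule sum.cong) (auto simp: disc_to_simplex_def)
  also have "(\<Sum>i\<le>m. simplex_dir m x i * (disc_norm m x / simplex_gauge m x)) = 0"
    unfolding sum_distrib_right[symmetric] sum_simplex_dir by simp
  finally show ?thesis by simp
qed

lemma disc_to_simplex_in:
  assumes "disc_norm m x \<le> 1"
  shows "disc_to_simplex m x \<in> standard_simplex m"
proof -
  have nn: "0 \<le> disc_to_simplex m x i" for i
  proof (cases "i \<le> m")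
    case True
    then show ?thesis
      using disc_to_simplex_min(1)[OF True, of x] assms by (smt (verit) divide_nonneg_nonneg of_nat_0_le_iff)
  qed (simp add: disc_to_simplex_def simplex_dir_def)
  have "disc_to_simplex m x i \<le> 1" for i
  proof (cases "i \<le> m")
    case True
    then have "disc_to_simplex m x i \<le> sum (disc_to_simplex m x) {..m}"
      by (intro member_le_sum) (auto simp: nn)
    then show ?thesis by (simp add: sum_disc_to_simplex)
  qed (simp add: disc_to_simplex_def simplex_dir_def)
  then show ?thesis
    using nn by (auto simp: standard_simplex_def sum_disc_to_simplex) (simp add: disc_to_simplex_def simplex_dir_def)
qed

lemma disc_to_simplex_open_iff:
  assumes "disc_norm m x \<le> 1"
  shows "disc_to_simplex m x \<in> open_simplex m \<longleftrightarrow> disc_norm m x < 1"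
proof
  assume "disc_to_simplex m x \<in> open_simplex m"
  moreover obtain i where "i \<le> m" "disc_to_simplex m x i = (1 - disc_norm m x) / real (Suc m)"
    using disc_to_simplex_min(2) by blast
  ultimately have "0 < (1 - disc_norm m x) / real (Suc m)"
    by (auto simp: open_simplex_def)
  then show "disc_norm m x < 1"
    by (simp add: zero_less_divide_iff)
next
  assume "disc_norm m x < 1"
  then have "0 < (1 - disc_norm m x) / real (Suc m)"
    by simp
  then show "disc_to_simplex m x \<in> open_simplex m"
    using disc_to_simplex_in[OF assms] disc_to_simplex_min(1)[of _ m x]
    by (auto simp: open_simplex_def intro: less_le_trans)
qed

lemma disc_norm_eqI:
  assumes eq: "disc_to_simplex m x = disc_to_simplex m y"
  shows "disc_norm m x = disc_norm m y"
proof -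
  have "disc_norm m a \<le> disc_norm m b" if ab: "disc_to_simplex m a = disc_to_simplex m b" for a b
  proof -
    obtain i where "i \<le> m" "disc_to_simplex m a i = (1 - disc_norm m a) / real (Suc m)"
      using disc_to_simplex_min(2) by blast
    then have "(1 - disc_norm m b) / real (Suc m) \<le> (1 - disc_norm m a) / real (Suc m)"
      using disc_to_simplex_min(1)[of i m b] ab by simp
    then have "1 - disc_norm m b \<le> 1 - disc_norm m a"
      by (simp add: divide_le_cancel del: of_nat_Suc)
    then show ?thesis by simp
  qed
  then show ?thesis using eq by (metis order_antisym)
qed

lemma simplex_dir_scale: "simplex_dir m (\<lambda>j. a * x j) i = a * simplex_dir m x i"
  by (simp add: simplex_dir_def sum_distrib_left)

lemma disc_norm_scale: "0 \<le> a \<Longrightarrow> disc_norm m (\<lambda>j. a * x j) = a * disc_norm m x"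
  by (simp add: disc_norm_def power_mult_distrib sum_distrib_left[symmetric] real_sqrt_mult)

lemma simplex_gauge_scale:
  assumes "0 \<le> a"
  shows "simplex_gauge m (\<lambda>j. a * x j) = a * simplex_gauge m x"
proof (rule antisym)
  obtain i where "i \<le> m" "- simplex_dir m (\<lambda>j. a * x j) i * real (Suc m) = simplex_gauge m (\<lambda>j. a * x j)"
    using simplex_gauge_attained by blast
  then show "simplex_gauge m (\<lambda>j. a * x j) \<le> a * simplex_gauge m x"
    using mult_left_mono[OF simplex_dir_gauge[of i m x] assms] by (simp add: simplex_dir_scale algebra_simps)
  obtain i where "i \<le> m" "- simplex_dir m x i * real (Suc m) = simplex_gauge m x"
    using simplex_gauge_attained by blast
  then have "i \<le> m" "a * simplex_gauge m x = - simplex_dir m (\<lambda>j. a * x j) i * real (Suc m)"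
    unfolding simplex_dir_scale by (metis, metis mult.assoc mult_minus_right)
  then show "a * simplex_gauge m x \<le> simplex_gauge m (\<lambda>j. a * x j)"
    using simplex_dir_gauge[of i m "\<lambda>j. a * x j"] by simp
qed

text \<open>The image determines the radius, and away from the centre it determines the ray.\<close>

lemma disc_to_simplex_inj:
  assumes x: "\<forall>i\<ge>m. x i = 0" and y: "\<forall>i\<ge>m. y i = 0"
    and eq: "disc_to_simplex m x = disc_to_simplex m y"
  shows "x = y"
proof -
  have r: "disc_norm m x = disc_norm m y"
    by (rule disc_norm_eqI[OF eq])
  have "x i = y i" if i: "i < m" for i
  proof (cases "disc_norm m x = 0")
    case True
    then show ?thesis using r i disc_norm_eq_0 by metis
  next
    case False
    have pos: "0 < simplex_gauge m x" "0 < simplex_gauge m y" "0 < disc_norm m x"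
      using False r simplex_gauge_eq_0[of m] simplex_gauge_nonneg[of m] disc_norm_nonneg[of m x]
      by (metis order_le_less)+
    \<comment> \<open>Equal images with equal radii make \<open>x / simplex_gauge m x\<close> and
      \<open>y / simplex_gauge m y\<close> agree, so \<open>x\<close> is \<open>a\<close> times
      \<open>y\<close>; equal norms then force \<open>a = 1\<close>.\<close>
    define a where "a = simplex_gauge m x / simplex_gauge m y"
    have a: "x j = a * y j" if "j < m" for j
    proof -
      have "disc_to_simplex m x j = disc_to_simplex m y j"
        by (simp add: eq)
      then have "x j * disc_norm m y / simplex_gauge m x = y j * disc_norm m y / simplex_gauge m y"
        using that r by (simp add: disc_to_simplex_def simplex_dir_def)
      then have "x j / simplex_gauge m x = y j / simplex_gauge m y"
        using pos r by (simp add: divide_simps)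
      then show ?thesis using pos by (simp add: a_def field_simps)
    qed
    have "disc_norm m x = disc_norm m (\<lambda>j. a * y j)"
      unfolding disc_norm_def by (rule arg_cong[where f = sqrt], rule sum.cong) (auto simp: a)
    also have "\<dots> = a * disc_norm m x"
      using pos r by (subst disc_norm_scale) (auto simp: a_def)
    finally have "a = 1" using pos by simp
    then show ?thesis using a[OF i] by simp
  qed
  then show ?thesis using x y by (metis ext not_le)
qed

lemma disc_to_simplex_surj:
  assumes "t \<in> standard_simplex m"
  obtains x where "x \<in> topspace (disc m)" "disc_to_simplex m x = t"
proof -
  \<comment> \<open>The displacement of \<open>t\<close> from the barycentre; its last coordinate is
    recovered by \<open>simplex_dir\<close> from the vanishing sum.\<close>
  define y where "y = (\<lambda>i. if i < m then t i - 1 / real (Suc m) else 0)"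
  have sum: "sum t {..<m} = 1 - t m"
    using assms by (auto simp: standard_simplex_def lessThan_Suc_atMost[symmetric])
  have "sum y {..<m} = sum t {..<m} - real m / real (Suc m)"
    by (simp add: y_def sum_subtractf)
  also have "\<dots> = 1 / real (Suc m) - t m"
    unfolding sum by (simp add: field_simps)
  finally have dir: "simplex_dir m y i = (if i \<le> m then t i - 1 / real (Suc m) else 0)" for i
    by (auto simp: simplex_dir_def) (simp_all add: y_def)
  have t: "t i = 0" if "m < i" for i
    using assms that by (auto simp: standard_simplex_def)
  have nn: "0 \<le> t i" for i
    using assms by (auto simp: standard_simplex_def)
  \<comment> \<open>Inverts the radial scaling: the multiple of \<open>y\<close> by \<open>a\<close>
    has norm \<open>simplex_gauge m y\<close>, which is at most 1 because \<open>t\<close> has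
    nonnegative coordinates. The barycentre, where both norms vanish, is treated separately.\<close>
  define a where "a = simplex_gauge m y / disc_norm m y"
  have a: "0 \<le> a"
    using simplex_gauge_nonneg disc_norm_nonneg by (simp add: a_def)
  define x where "x = (\<lambda>i. a * y i)"
  obtain i where i: "i \<le> m" "- simplex_dir m y i * real (Suc m) = simplex_gauge m y"
    using simplex_gauge_attained by blast
  have "simplex_gauge m y \<le> 1"
  proof -
    have "simplex_gauge m y = 1 - t i * real (Suc m)"
      using i by (simp add: dir left_diff_distrib del: of_nat_Suc)
    then show ?thesis using nn[of i] by (simp del: of_nat_Suc)
  qed
  show thesis
  proof (cases "disc_norm m y = 0")
    case True
    then have "y i = 0" for i
      by (cases "i < m") (auto simp: disc_norm_eq_0, simp add: y_def)
    then have "simplex_dir m y i = 0" for i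
      by (simp add: simplex_dir_def)
    then have "disc_to_simplex m y i = t i" for i
      using dir[of i] t[of i] by (auto simp: disc_to_simplex_def split: if_splits)
    moreover have "y \<in> topspace (disc m)"
      using True by (simp add: topspace_disc y_def)
    ultimately show thesis using that[of y] by blast
  next
    case False
    then have pos: "0 < simplex_gauge m y" "0 < disc_norm m y"
      using simplex_gauge_eq_0[of m y] simplex_gauge_nonneg[of m y] disc_norm_nonneg[of m y] by linarith+
    then have "0 < a" by (simp add: a_def)
    have r: "disc_norm m x = simplex_gauge m y"
      using pos unfolding x_def disc_norm_scale[OF a] by (simp add: a_def)
    have "disc_to_simplex m x i = t i" for i
    proof -
      have "simplex_dir m x i * disc_norm m x / simplex_gauge m x = simplex_dir m y i"
        using pos \<open>0 < a\<close> unfolding r unfolding x_def simplex_gauge_scale[OF a] simplex_dir_scale by simp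
      then show ?thesis
        using dir[of i] t[of i] by (simp add: disc_to_simplex_def)
    qed
    moreover have "x \<in> topspace (disc m)"
      using \<open>simplex_gauge m y \<le> 1\<close> by (simp add: topspace_disc r) (simp add: x_def y_def)
    ultimately show thesis using that[of x] by blast
  qed
qed

section \<open>Continuity of the radial map\<close>

lemma isCont_coord: "isCont (\<lambda>x :: nat \<Rightarrow> real. x i) x"
  by (rule continuous_on_interior[OF continuous_on_product_coordinates]) simp

lemma isCont_simplex_dir: "isCont (\<lambda>x. simplex_dir m x i) x"
proof -
  consider "i < m" | "i = m" | "m < i" by linarith
  then show ?thesis
  proof cases
    case 2
    have "isCont (\<lambda>x :: nat \<Rightarrow> real. - sum x {..<m}) x"
      by (intro continuous_intros isCont_coord)
    then show ?thesis using 2 by (simp add: simplex_dir_def[abs_def])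
  qed (simp_all add: simplex_dir_def[abs_def] isCont_coord)
qed

lemma isCont_simplex_gauge: "isCont (simplex_gauge m) x"
proof -
  have "isCont (\<lambda>x. Max ((\<lambda>i. - simplex_dir m x i) ` {..n})) x" for n
  proof (induction n)
    case 0
    then show ?case by (simp add: isCont_simplex_dir continuous_minus)
  next
    case (Suc n)
    have "Max ((\<lambda>i. - simplex_dir m x i) ` {..Suc n})
       = max (- simplex_dir m x (Suc n)) (Max ((\<lambda>i. - simplex_dir m x i) ` {..n}))" for x
      by (simp add: atMost_Suc)
    then show ?case
      using Suc by (simp add: isCont_simplex_dir continuous_minus continuous_max)
  qed
  then show ?thesis
    unfolding simplex_gauge_def[abs_def] by (intro continuous_intros)
qed

lemma isCont_disc_norm: "isCont (disc_norm m) x"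
  unfolding disc_norm_def[abs_def] by (intro continuous_intros isCont_coord)

lemma isCont_disc_to_simplex: "isCont (\<lambda>x. disc_to_simplex m x i) x"
proof -
  have "isCont (\<lambda>x. simplex_dir m x i * disc_norm m x / simplex_gauge m x) x"
  proof (cases "disc_norm m x = 0")
    case False
    then have "simplex_gauge m x \<noteq> 0" by (simp add: simplex_gauge_eq_0)
    then show ?thesis
      by (intro continuous_intros isCont_simplex_dir isCont_disc_norm isCont_simplex_gauge)
  next
    case True
    \<comment> \<open>At the centre the quotient rule does not apply. The term has value 0 there by
      the convention for division by 0, and this bound squeezes it to 0 nearby.\<close>
    have le: "\<bar>simplex_dir m y i * disc_norm m y / simplex_gauge m y\<bar> \<le> disc_norm m y" for y
    proof (cases "simplex_gauge m y = 0")
      case False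
      then have "\<bar>simplex_dir m y i\<bar> / simplex_gauge m y \<le> 1"
        using simplex_dir_le_gauge[of m y i] simplex_gauge_nonneg[of m y] by (simp add: divide_le_eq_1)
      then have "\<bar>simplex_dir m y i\<bar> / simplex_gauge m y * disc_norm m y \<le> 1 * disc_norm m y"
        by (intro mult_right_mono) (auto simp: disc_norm_nonneg)
      then show ?thesis
        using simplex_gauge_nonneg[of m y] disc_norm_nonneg[of m y] by (simp add: abs_mult)
    qed (simp add: disc_norm_nonneg)
    have "(disc_norm m \<longlongrightarrow> 0) (at x)"
      using isCont_disc_norm[of x m] True by (simp add: isCont_def)
    then have "((\<lambda>y. simplex_dir m y i * disc_norm m y / simplex_gauge m y) \<longlongrightarrow> 0) (at x)"
      by (rule Lim_null_comparison[rotated]) (use le in auto)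
    then show ?thesis using True by (simp add: isCont_def)
  qed
  then show ?thesis
    unfolding disc_to_simplex_def by (intro continuous_add continuous_const)
qed

lemma continuous_map_disc_to_simplex:
  "continuous_map (disc m) (simplex_top m) (disc_to_simplex m)"
proof -
  have "continuous_on UNIV (disc_to_simplex m)"
    by (intro continuous_on_coordinatewise_then_product)
       (simp add: continuous_on_eq_continuous_at isCont_disc_to_simplex)
  then have "continuous_map (powertop_real UNIV) (powertop_real UNIV) (disc_to_simplex m)"
    by (simp add: euclidean_product_topology)
  then have "continuous_map (disc m) (powertop_real UNIV) (disc_to_simplex m)"
    unfolding disc_def Euclidean_space_def by (intro continuous_map_from_subtopology)
  moreover have "disc_to_simplex m ` topspace (disc m) \<subseteq> standard_simplex m"
    by (auto simp: topspace_disc disc_to_simplex_in)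
  ultimately show ?thesis
    by (auto simp: continuous_map_in_subtopology)
qed

section \<open>Compactness and separation of discs and spheres\<close>

lemma Hausdorff_disc: "Hausdorff_space (disc m)"
  unfolding disc_def Euclidean_space_def
  by (intro Hausdorff_space_subtopology) (simp add: Hausdorff_space_product_topology)

lemma disc_norm_coord_le:
  assumes "i < m"
  shows "\<bar>x i\<bar> \<le> disc_norm m x"
proof -
  have "(x i)\<^sup>2 \<le> (\<Sum>i<m. (x i)\<^sup>2)"
    using assms by (intro member_le_sum) auto
  then show ?thesis
    unfolding disc_norm_def using real_le_rsqrt by (simp add: real_le_rsqrt)
qed

lemma closedin_disc_norm:
  assumes "closed C"
  shows "closedin (powertop_real UNIV) {x. (\<forall>i\<ge>m. x i = 0) \<and> disc_norm m x \<in> C}"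
proof -
  have coord: "closed {x :: nat \<Rightarrow> real. x i = 0}" for i
    using continuous_on_product_coordinates[of i]
    by (intro closed_Collect_eq) (auto intro: continuous_intros)
  have "closed (disc_norm m -` C)"
    using assms isCont_disc_norm by (intro continuous_closed_vimage) auto
  then have "closed ((\<Inter>i\<in>{m..}. {x :: nat \<Rightarrow> real. x i = 0}) \<inter> disc_norm m -` C)"
    using coord by (intro closed_Int closed_INT) auto
  moreover have "(\<Inter>i\<in>{m..}. {x :: nat \<Rightarrow> real. x i = 0}) \<inter> disc_norm m -` C
      = {x. (\<forall>i\<ge>m. x i = 0) \<and> disc_norm m x \<in> C}"
    by auto
  ultimately show ?thesis
    by (simp add: euclidean_product_topology)
qed

lemma disc_eq_subtopology:
  "disc m = subtopology (powertop_real UNIV) {x. (\<forall>i\<ge>m. x i = 0) \<and> disc_norm m x \<in> {..1}}"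
  "disc_boundary m = subtopology (powertop_real UNIV) {x. (\<forall>i\<ge>m. x i = 0) \<and> disc_norm m x \<in> {1}}"
  unfolding disc_def disc_boundary_def Euclidean_space_def subtopology_subtopology
  by (auto simp: disc_norm_def intro!: arg_cong2[where f = subtopology])

lemma compact_disc: "compact_space (disc m)"
proof -
  have "compactin (powertop_real UNIV) {x. (\<forall>i\<ge>m. x i = 0) \<and> disc_norm m x \<in> {..1}}"
  proof (rule closed_compactin)
    show "compactin (powertop_real UNIV) (PiE UNIV (\<lambda>_. {-1..1::real}))"
      by (simp add: compactin_PiE)
    show "{x. (\<forall>i\<ge>m. x i = 0) \<and> disc_norm m x \<in> {..1}} \<subseteq> UNIV \<rightarrow>\<^sub>E {-1..1}"
    proof (intro subsetI PiE_I)
      fix x :: "nat \<Rightarrow> real" and i assume "x \<in> {x. (\<forall>i\<ge>m. x i = 0) \<and> disc_norm m x \<in> {..1}}"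
      then have "\<bar>x i\<bar> \<le> 1"
        using disc_norm_coord_le[of i m x] by (cases "i < m") auto
      then show "x i \<in> {-1..1}" by auto
    qed simp
  qed (rule closedin_disc_norm, simp)
  then show ?thesis
    unfolding disc_eq_subtopology by (rule compact_space_subtopology)
qed

lemma disc_boundary_eq: "disc_boundary m = subtopology (disc m) (topspace (disc_boundary m))"
  unfolding topspace_disc_boundary unfolding disc_eq_subtopology subtopology_subtopology
  by (rule arg_cong2[where f = subtopology]) auto

lemma compact_disc_boundary: "compact_space (disc_boundary m)"
proof -
  have "closedin (disc m) (topspace (disc_boundary m))"
    unfolding topspace_disc_boundary disc_eq_subtopology closedin_subtopology
    by (rule exI[of _ "{x. (\<forall>i\<ge>m. x i = 0) \<and> disc_norm m x \<in> {1}}"])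
       (use closedin_disc_norm[of "{1}" m] in auto)
  then show ?thesis
    using compact_disc closedin_compact_space compact_space_subtopology disc_boundary_eq by metis
qed

lemma Hausdorff_disc_boundary: "Hausdorff_space (disc_boundary m)"
  using Hausdorff_disc disc_boundary_eq Hausdorff_space_subtopology by metis

section \<open>Homotopy groups of contractible spaces\<close>

lemma pointed_contractible_homeomorphic:
  assumes X: "pointed_contractible X x" and h: "homeomorphic_maps X Y f g" and x: "x \<in> topspace X"
  shows "pointed_contractible Y (f x)"
proof -
  obtain k where k: "continuous_map (prod_topology (top_of_set {0..1::real}) X) X k"
    "\<forall>c\<in>topspace X. k (0, c) = c \<and> k (1, c) = x" "\<forall>\<tau>\<in>{0..1}. k (\<tau>, x) = x"
    using X unfolding pointed_contractible_def by blast
  have f: "continuous_map X Y f" and g: "continuous_map Y X g"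
    and gf: "\<And>x. x \<in> topspace X \<Longrightarrow> g (f x) = x" and fg: "\<And>y. y \<in> topspace Y \<Longrightarrow> f (g y) = y"
    using h by (auto simp: homeomorphic_maps_def)
  have "continuous_map (prod_topology (top_of_set {0..1::real}) Y)
      (prod_topology (top_of_set {0..1::real}) X) (\<lambda>(\<tau>, y). (\<tau>, g y))"
    using continuous_map_prod_top[of "top_of_set {0..1::real}" Y "top_of_set {0..1::real}" X "\<lambda>x. x" g] g by simp
  then have "continuous_map (prod_topology (top_of_set {0..1::real}) Y) Y (f \<circ> k \<circ> (\<lambda>(\<tau>, y). (\<tau>, g y)))"
    by (rule continuous_map_compose[OF _ continuous_map_compose[OF k(1) f]])
  moreover have "g y \<in> topspace X" if "y \<in> topspace Y" for y
    using continuous_map_funspace[OF g] that by auto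
  ultimately show ?thesis
    unfolding pointed_contractible_def
    by (intro exI[of _ "f \<circ> k \<circ> (\<lambda>(\<tau>, y). (\<tau>, g y))"]) (use k gf[OF x] fg in auto)
qed

text \<open>Composing a spheroid with the contraction deforms it to the constant map. The boundary
  sits at \<open>x\<close>, which the contraction fixes, so this is a homotopy of maps of
  pairs.\<close>

lemma spheroid_rel_trivial:
  assumes X: "pointed_contractible X x" and \<alpha>: "\<alpha> \<in> spheroids n X x" and \<beta>: "\<beta> \<in> spheroids n X x"
  shows "(\<alpha>, \<beta>) \<in> spheroid_rel n X x"
proof -
  obtain k where k: "continuous_map (prod_topology (top_of_set {0..1::real}) X) X k"
    "\<forall>c\<in>topspace X. k (0, c) = c \<and> k (1, c) = x" "\<forall>\<tau>\<in>{0..1}. k (\<tau>, x) = x"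
    using X unfolding pointed_contractible_def by blast
  let ?P = "\<lambda>h. \<forall>y\<in>topspace (disc_boundary n). h y = x"
  have hom: "homotopic_with ?P (disc n) X \<gamma> (\<lambda>_. x)" if \<gamma>: "\<gamma> \<in> spheroids n X x" for \<gamma>
  proof (subst homotopic_with)
    show "?P h \<longleftrightarrow> ?P k" if "\<And>x. x \<in> topspace (disc n) \<Longrightarrow> h x = k x" for h k
      using that topspace_disc_boundary_subset by (metis subsetD)
    have c: "continuous_map (disc n) X \<gamma>" and b: "?P \<gamma>"
      using \<gamma> by (auto simp: spheroids_def)
    have "continuous_map (prod_topology (top_of_set {0..1::real}) (disc n))
      (prod_topology (top_of_set {0..1::real}) X) (\<lambda>(\<tau>, y). (\<tau>, \<gamma> y))"
      using continuous_map_prod_top[of "top_of_set {0..1::real}" "disc n" "top_of_set {0..1::real}" X "\<lambda>x. x" \<gamma>] c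
      by simp
    then have H: "continuous_map (prod_topology (top_of_set {0..1::real}) (disc n)) X (k \<circ> (\<lambda>(\<tau>, y). (\<tau>, \<gamma> y)))"
      by (rule continuous_map_compose[OF _ k(1)])
    have \<gamma>X: "\<gamma> y \<in> topspace X" if "y \<in> topspace (disc n)" for y
      using continuous_map_funspace[OF c] that by auto
    show "\<exists>h. continuous_map (prod_topology (top_of_set {0..1::real}) (disc n)) X h \<and>
        (\<forall>y\<in>topspace (disc n). h (0, y) = \<gamma> y) \<and> (\<forall>y\<in>topspace (disc n). h (1, y) = x) \<and>
        (\<forall>t\<in>{0..1}. ?P (\<lambda>y. h (t, y)))"
      by (rule exI, rule conjI, rule H) (use k b \<gamma>X in auto)
  qed
  show ?thesis
    using homotopic_with_trans[OF hom[OF \<alpha>] homotopic_with_symD[OF hom[OF \<beta>]]]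
    by (simp add: spheroid_rel_def)
qed

lemma spheroid_rel_spheroids:
  assumes "(\<alpha>, \<beta>) \<in> spheroid_rel n X x"
  shows "\<beta> \<in> spheroids n X x"
proof -
  have h: "homotopic_with (\<lambda>h. \<forall>y\<in>topspace (disc_boundary n). h y = x) (disc n) X \<alpha> \<beta>"
    using assms by (simp add: spheroid_rel_def)
  show ?thesis
    using homotopic_with_imp_continuous_maps[OF h] homotopic_with_imp_property[OF h]
    by (simp add: spheroids_def)
qed

lemma spheroid_class_trivial:
  assumes "pointed_contractible X x" "A \<subseteq> spheroids n X x" "A \<noteq> {}"
  shows "spheroid_rel n X x `` A = spheroids n X x"
proof (intro antisym subsetI)
  fix \<beta> assume "\<beta> \<in> spheroid_rel n X x `` A"
  then obtain \<alpha> where "(\<alpha>, \<beta>) \<in> spheroid_rel n X x" by (elim ImageE)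
  then show "\<beta> \<in> spheroids n X x" by (rule spheroid_rel_spheroids)
next
  fix \<beta> assume \<beta>: "\<beta> \<in> spheroids n X x"
  obtain \<alpha> where \<alpha>: "\<alpha> \<in> A" using assms(3) by auto
  then have "(\<alpha>, \<beta>) \<in> spheroid_rel n X x"
    using assms(2) \<beta> by (intro spheroid_rel_trivial[OF assms(1)]) auto
  then show "\<beta> \<in> spheroid_rel n X x `` A" using \<alpha> by (rule ImageI)
qed

lemma htpy_group_trivial:
  assumes "pointed_contractible X x" "x \<in> topspace X"
  shows "htpy_group n X x = {spheroids n X x}"
proof -
  have "(\<lambda>_. x) \<in> spheroids n X x"
    using assms(2) by (simp add: spheroids_def)
  moreover have "spheroid_rel n X x `` {\<alpha>} = spheroids n X x" if "\<alpha> \<in> spheroids n X x" for \<alpha>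
    using spheroid_class_trivial[OF assms(1), of "{\<alpha>}"] that by simp
  ultimately show ?thesis
    by (auto simp: htpy_group_def quotient_def)
qed

lemma path_connected_contractible:
  assumes "pointed_contractible X x" "x \<in> topspace X"
  shows "path_connected_space X"
proof -
  obtain k where k: "continuous_map (prod_topology (top_of_set {0..1::real}) X) X k"
    "\<forall>c\<in>topspace X. k (0, c) = c \<and> k (1, c) = x"
    using assms(1) unfolding pointed_contractible_def by blast
  have "path_component_of X y x" if "y \<in> topspace X" for y
    unfolding path_component_of_def pathin_def
  proof (intro exI conjI)
    have "continuous_map (top_of_set {0..1::real}) (prod_topology (top_of_set {0..1::real}) X) (\<lambda>\<tau>. (\<tau>, y))"
      using that by (simp add: continuous_map_pairedI)
    from continuous_map_compose[OF this k(1)]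
    show "continuous_map (top_of_set {0..1}) X (\<lambda>\<tau>. k (\<tau>, y))" by (simp add: o_def)
  qed (use k that in auto)
  then show ?thesis
    unfolding path_connected_space_iff_path_component
    by (meson path_component_of_sym path_component_of_trans)
qed

text \<open>All sets of path components and all homotopy groups are singletons, so every map between
  them is bijective; \<open>X\<close> must have a point for this to hold of its components.\<close>

lemma n_equivalence_contractible:
  assumes X: "\<And>x. x \<in> topspace X \<Longrightarrow> pointed_contractible X x" "topspace X \<noteq> {}"
    and Y: "\<And>y. y \<in> topspace Y \<Longrightarrow> pointed_contractible Y y"
    and f: "continuous_map X Y f"
  shows "n_equivalence n X Y f"
proof -
  obtain x where x: "x \<in> topspace X" using X by blast
  have fY: "f x \<in> topspace Y" if "x \<in> topspace X" for x
    using continuous_map_funspace[OF f] that by auto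
  have pX: "path_components_of X = {topspace X}"
    using path_connected_contractible[OF X(1)[OF x] x] X(2)
    by (simp add: path_components_of_eq_singleton)
  have pcY: "path_connected_space Y"
    by (rule path_connected_contractible[OF Y[OF fY[OF x]] fY[OF x]])
  then have pY: "path_components_of Y = {topspace Y}"
    using fY[OF x] by (auto simp: path_components_of_eq_singleton)
  have "path_component_of_set Y (f x) = topspace Y" if "x \<in> topspace X" for x
    using pcY fY[OF that] by (simp add: path_connected_space_path_component_set)
  then have "pi0_map Y f (topspace X) = topspace Y"
    using X(2) by (auto simp: pi0_map_def)
  then have "bij_betw (pi0_map Y f) (path_components_of X) (path_components_of Y)"
    "pi0_map Y f ` path_components_of X = path_components_of Y"
    by (auto simp: pX pY bij_betw_def)
  moreover have "bij_betw (htpy_map k Y f x) (htpy_group k X x) (htpy_group k Y (f x))"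
    "htpy_map k Y f x ` htpy_group k X x = htpy_group k Y (f x)" if x: "x \<in> topspace X" for k x
  proof -
    have "(\<lambda>_. x) \<in> spheroids k X x"
      using x by (simp add: spheroids_def)
    moreover have "(\<lambda>\<alpha>. f \<circ> \<alpha>) ` spheroids k X x \<subseteq> spheroids k Y (f x)"
      using continuous_map_compose[OF _ f] by (auto simp: spheroids_def)
    ultimately have "htpy_map k Y f x (spheroids k X x) = spheroids k Y (f x)"
      unfolding htpy_map_def by (intro spheroid_class_trivial Y fY x) auto
    then show "bij_betw (htpy_map k Y f x) (htpy_group k X x) (htpy_group k Y (f x))"
      "htpy_map k Y f x ` htpy_group k X x = htpy_group k Y (f x)"
      by (auto simp: htpy_group_trivial X Y fY x bij_betw_def)
  qed
  ultimately show ?thesis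
    using f by (simp add: n_equivalence_def)
qed

section \<open>Gluing\<close>

text \<open>As \<open>P\<close> is compact and \<open>X\<close> Hausdorff, the images of closed
  subsets of \<open>P\<close> are closed. The preimage of a closed set under \<open>w\<close> is
  therefore a union of two closed sets, one in \<open>A\<close> and one image from
  \<open>P\<close>.\<close>

lemma continuous_map_attach:
  assumes X: "Hausdorff_space X" and A: "closedin X A" and P: "compact_space P"
    and h: "continuous_map P X h" and B: "B = A \<union> h ` topspace P"
    and w: "continuous_map (subtopology X A) E w" "continuous_map P E (w \<circ> h)"
  shows "continuous_map (subtopology X B) E w"
proof -
  have sub: "A \<subseteq> topspace X" "h ` topspace P \<subseteq> topspace X"
    using A closedin_subset continuous_map_image_subset_topspace[OF h] by auto
  then have top: "topspace (subtopology X B) = B"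
    by (auto simp: B)
  show ?thesis
    unfolding continuous_map_closedin top
  proof (intro conjI allI impI funcsetI)
    show "w x \<in> topspace E" if "x \<in> B" for x
      using that B sub continuous_map_funspace[OF w(1)] continuous_map_funspace[OF w(2)] by auto
  next
    fix C assume C: "closedin E C"
    have "closedin X {x \<in> A. w x \<in> C}"
      using closedin_continuous_map_preimage[OF w(1) C] closedin_closed_subtopology[OF A] sub
      by (simp add: Int_absorb1)
    moreover have "closedin P {p \<in> topspace P. w (h p) \<in> C}"
      using closedin_continuous_map_preimage[OF w(2) C] by simp
    then have "compactin P {p \<in> topspace P. w (h p) \<in> C}"
      using P closedin_compact_space by blast
    then have "closedin X (h ` {p \<in> topspace P. w (h p) \<in> C})"
      using image_compactin[OF _ h] compactin_imp_closedin[OF X] by blast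
    ultimately have "closedin X ({x \<in> A. w x \<in> C} \<union> h ` {p \<in> topspace P. w (h p) \<in> C})"
      by (rule closedin_Un)
    moreover have "{x \<in> B. w x \<in> C} = {x \<in> A. w x \<in> C} \<union> h ` {p \<in> topspace P. w (h p) \<in> C}"
      by (auto simp: B)
    ultimately show "closedin (subtopology X B) {x \<in> B. w x \<in> C}"
      by (metis (no_types, lifting) closedin_subset_topspace mem_Collect_eq subsetI)
  qed
qed

section \<open>Spaces with an action of a profinite group\<close>

definition mk_gmap :: "('g, 'p) gspace \<Rightarrow> ('g, 'p) gspace \<Rightarrow> ('p \<Rightarrow> 'p) \<Rightarrow> ('g, 'p) gmap" where
  "mk_gmap X Y f = \<lparr>gdom = X, gcod = Y, gfun = restrict f (topspace (gtop X))\<rparr>"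

lemma mk_gmap_simps [simp]:
  "gdom (mk_gmap X Y f) = X" "gcod (mk_gmap X Y f) = Y"
  "x \<in> topspace (gtop X) \<Longrightarrow> gfun (mk_gmap X Y f) x = f x"
  by (simp_all add: mk_gmap_def)

lemma gspace_cat_simps [simp]:
  "X \<in> Ob (gspace_cat G T) \<longleftrightarrow> is_gspace G T X"
  "Dom (gspace_cat G T) = gdom" "Cod (gspace_cat G T) = gcod"
  "Ident (gspace_cat G T) X = mk_gmap X X (\<lambda>x. x)"
  "Comp (gspace_cat G T) g f = mk_gmap (gdom f) (gcod g) (\<lambda>x. gfun g (gfun f x))"
  by (simp_all add: gspace_cat_def mk_gmap_def o_def id_def)

lemma in_homs_gspace_iff:
  "f \<in> homs (gspace_cat G T) X Y \<longleftrightarrow> gdom f = X \<and> gcod f = Y \<and> is_gspace G T X \<and> is_gspace G T Y \<and>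
     continuous_map (gtop X) (gtop Y) (gfun f) \<and> equivariant G X Y (gfun f) \<and>
     gfun f \<in> extensional (topspace (gtop X))"
  by (auto simp: homs_def gspace_cat_def)

lemma in_Ar_gspace_iff: "f \<in> Ar (gspace_cat G T) \<longleftrightarrow> f \<in> homs (gspace_cat G T) (gdom f) (gcod f)"
  by (auto simp: homs_def)

lemma homs_gspace_topspace:
  "f \<in> homs (gspace_cat G T) X Y \<Longrightarrow> x \<in> topspace (gtop X) \<Longrightarrow> gfun f x \<in> topspace (gtop Y)"
  by (auto simp: in_homs_gspace_iff dest!: continuous_map_funspace)

lemma homs_gspace_eqI:
  assumes "f \<in> homs (gspace_cat G T) X Y" "g \<in> homs (gspace_cat G T) X Y"
    and "\<And>x. x \<in> topspace (gtop X) \<Longrightarrow> gfun f x = gfun g x"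
  shows "f = g"
proof -
  have "gfun f = gfun g"
    using assms extensionalityI[of "gfun f" "topspace (gtop X)" "gfun g"] by (auto simp: in_homs_gspace_iff)
  then show ?thesis
    using assms by (auto simp: in_homs_gspace_iff)
qed

text \<open>Reduces joint continuity to continuity in one variable. It applies to actions that
  factor through the discrete quotient G/U, and to maps out of a discrete orbit times a
  disc.\<close>

lemma continuous_map_locally_constant_left:
  assumes const: "\<And>g. g \<in> topspace T \<Longrightarrow> \<exists>N. openin T N \<and> g \<in> N \<and>
      (\<forall>h\<in>N. \<forall>x\<in>topspace X. f h x = f g x)"
    and cont: "\<And>g. g \<in> topspace T \<Longrightarrow> continuous_map X Y (f g)"
  shows "continuous_map (prod_topology T X) Y (\<lambda>(g, x). f g x)"
  unfolding continuous_map_def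
proof (intro conjI allI impI)
  show "(\<lambda>(g, x). f g x) \<in> topspace (prod_topology T X) \<rightarrow> topspace Y"
    using continuous_map_funspace[OF cont] by auto
  fix U assume U: "openin Y U"
  show "openin (prod_topology T X) {p \<in> topspace (prod_topology T X). (\<lambda>(g, x). f g x) p \<in> U}"
  proof (subst openin_subopen, intro ballI)
    fix p assume p: "p \<in> {p \<in> topspace (prod_topology T X). (\<lambda>(g, x). f g x) p \<in> U}"
    obtain g x where gx: "p = (g, x)" by force
    have g: "g \<in> topspace T" and x: "x \<in> topspace X" "f g x \<in> U"
      using p by (auto simp: gx)
    obtain N where N: "openin T N" "g \<in> N" "\<forall>h\<in>N. \<forall>x\<in>topspace X. f h x = f g x"
      using const[OF g] by blast
    have "openin (prod_topology T X) (N \<times> {x \<in> topspace X. f g x \<in> U})"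
      using N(1) openin_continuous_map_preimage[OF cont[OF g] U] by (simp add: openin_prod_Times_iff)
    moreover have "p \<in> N \<times> {x \<in> topspace X. f g x \<in> U}"
      using N(2) x gx by simp
    moreover have "N \<times> {x \<in> topspace X. f g x \<in> U}
        \<subseteq> {p \<in> topspace (prod_topology T X). (\<lambda>(g, x). f g x) p \<in> U}"
      using N(3) openin_subset[OF N(1)] by auto
    ultimately show "\<exists>S. openin (prod_topology T X) S \<and> p \<in> S \<and>
        S \<subseteq> {p \<in> topspace (prod_topology T X). (\<lambda>(g, x). f g x) p \<in> U}"
      by blast
  qed
qed

context profinite_group
begin

abbreviation GC :: "(('a, 'u) gspace, ('a, 'u) gmap) cat" where
  "GC \<equiv> gspace_cat G T"

lemma gact_topspace:
  assumes "is_gspace G T X" "g \<in> carrier G" "x \<in> topspace (gtop X)"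
  shows "gact X g x \<in> topspace (gtop X)"
proof -
  have "(\<lambda>(g, x). gact X g x) \<in> topspace (prod_topology T (gtop X)) \<rightarrow> topspace (gtop X)"
    using assms(1) by (intro continuous_map_funspace) (simp add: is_gspace_def)
  from funcset_mem[OF this, of "(g, x)"] show ?thesis
    using assms(2,3) topspace_eq by simp
qed

lemma mk_gmap_homs:
  assumes X: "is_gspace G T X" "is_gspace G T Y" and c: "continuous_map (gtop X) (gtop Y) f"
    and e: "equivariant G X Y f"
  shows "mk_gmap X Y f \<in> homs GC X Y"
proof -
  have "continuous_map (gtop X) (gtop Y) (restrict f (topspace (gtop X)))"
    using c by (rule continuous_map_eq) auto
  moreover have "equivariant G X Y (restrict f (topspace (gtop X)))"
    using e gact_topspace[OF X(1)] by (simp add: equivariant_def)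
  ultimately show ?thesis
    using X by (simp add: in_homs_gspace_iff mk_gmap_def)
qed

lemma ident_homs: "is_gspace G T X \<Longrightarrow> mk_gmap X X (\<lambda>x. x) \<in> homs GC X X"
  by (rule mk_gmap_homs) (auto simp: equivariant_def)

lemma comp_homs:
  assumes f: "f \<in> homs GC X Y" and g: "g \<in> homs GC Y Z"
  shows "mk_gmap X Z (\<lambda>x. gfun g (gfun f x)) \<in> homs GC X Z"
proof (rule mk_gmap_homs)
  show "continuous_map (gtop X) (gtop Z) (\<lambda>x. gfun g (gfun f x))"
    using f g continuous_map_compose[of "gtop X" "gtop Y" "gfun f" "gtop Z" "gfun g"]
    by (simp add: in_homs_gspace_iff o_def)
  show "equivariant G X Z (\<lambda>x. gfun g (gfun f x))"
    using f g homs_gspace_topspace[OF f] by (simp add: in_homs_gspace_iff equivariant_def)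
qed (use f g in \<open>auto simp: in_homs_gspace_iff\<close>)

lemma category_gspace_cat: "category GC"
  unfolding category_def gspace_cat_simps
proof (intro conjI ballI impI; (elim conjE)?)
  fix X :: "('a, 'u) gspace" assume "X \<in> Ob GC"
  then show "mk_gmap X X (\<lambda>x. x) \<in> homs GC X X"
    using ident_homs by simp
next
  fix f g :: "('a, 'u) gmap"
  assume f: "f \<in> Ar GC" and g: "g \<in> Ar GC" and fg: "gcod f = gdom g"
  show "mk_gmap (gdom f) (gcod g) (\<lambda>x. gfun g (gfun f x)) \<in> homs GC (gdom f) (gcod g)"
    using f g fg by (intro comp_homs) (auto simp: in_Ar_gspace_iff)
  fix h :: "('a, 'u) gmap"
  assume h: "h \<in> Ar GC" and gh: "gcod g = gdom h"
  have "f \<in> homs GC (gdom f) (gdom g)"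
    using f fg by (simp add: in_Ar_gspace_iff)
  then show "mk_gmap (gdom (mk_gmap (gdom f) (gcod g) (\<lambda>x. gfun g (gfun f x)))) (gcod h)
       (\<lambda>x. gfun h (gfun (mk_gmap (gdom f) (gcod g) (\<lambda>x. gfun g (gfun f x))) x)) =
      mk_gmap (gdom f) (gcod (mk_gmap (gdom g) (gcod h) (\<lambda>x. gfun h (gfun g x))))
       (\<lambda>x. gfun (mk_gmap (gdom g) (gcod h) (\<lambda>x. gfun h (gfun g x))) (gfun f x))"
    by (auto simp: mk_gmap_def homs_gspace_topspace intro!: restrict_ext)
next
  fix f :: "('a, 'u) gmap" assume "f \<in> Ar GC"
  then have f: "f \<in> homs GC (gdom f) (gcod f)"
    by (simp add: in_Ar_gspace_iff)
  then show "is_gspace G T (gdom f)" "is_gspace G T (gcod f)"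
    by (simp_all add: in_homs_gspace_iff)
  show "mk_gmap (gdom (mk_gmap (gdom f) (gdom f) (\<lambda>x. x))) (gcod f)
      (\<lambda>x. gfun f (gfun (mk_gmap (gdom f) (gdom f) (\<lambda>x. x)) x)) = f"
    using comp_homs[OF ident_homs f] f
    by (intro homs_gspace_eqI[of _ G T "gdom f" "gcod f"]) (auto simp: in_homs_gspace_iff)
  show "mk_gmap (gdom f) (gcod (mk_gmap (gcod f) (gcod f) (\<lambda>x. x)))
      (\<lambda>x. gfun (mk_gmap (gcod f) (gcod f) (\<lambda>x. x)) (gfun f x)) = f"
    using comp_homs[OF f ident_homs] f homs_gspace_topspace[OF f]
    by (intro homs_gspace_eqI[of _ G T "gdom f" "gcod f"]) (auto simp: in_homs_gspace_iff)
qed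

subsection \<open>Open subgroups\<close>

lemma rcosets_self: "subgroup U G \<Longrightarrow> U \<in> rcosets U"
  by (rule subgroup.subgroup_in_rcosets[OF _ is_group])

lemma r_coset_eq_preimage:
  assumes "U \<subseteq> carrier G" "g \<in> carrier G"
  shows "U #> g = {x \<in> carrier G. x \<otimes> inv g \<in> U}"
proof -
  have "x \<in> U #> g" if "x \<in> carrier G" "x \<otimes> inv g \<in> U" for x
    unfolding r_coset_def using that assms(2) by (intro UN_I[of "x \<otimes> inv g"]) (auto simp: m_assoc)
  moreover have "x \<in> carrier G \<and> x \<otimes> inv g \<in> U" if "x \<in> U #> g" for x
    using that assms unfolding r_coset_def by (auto simp: m_assoc subset_iff)
  ultimately show ?thesis by blast
qed

lemma continuous_map_right_translation: "g \<in> carrier G \<Longrightarrow> continuous_map T T (\<lambda>x. x \<otimes> g)"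
  using continuous_map_compose[OF _ continuous_mult, of T "\<lambda>x. (x, g)"]
  by (simp add: o_def continuous_map_pairedI topspace_eq)

lemma continuous_map_left_translation: "g \<in> carrier G \<Longrightarrow> continuous_map T T (\<lambda>x. g \<otimes> x)"
  using continuous_map_compose[OF _ continuous_mult, of T "\<lambda>x. (g, x)"]
  by (simp add: o_def continuous_map_pairedI topspace_eq)

lemma openin_r_coset:
  assumes "subgroup U G" "openin T U" "g \<in> carrier G"
  shows "openin T (U #> g)"
  unfolding r_coset_eq_preimage[OF subgroup.subset[OF assms(1)] assms(3)]
  using openin_continuous_map_preimage[OF continuous_map_right_translation assms(2), of "inv g"] assms(3)
  by (simp add: topspace_eq)

text \<open>The cosets form a cover of a compact group by disjoint nonempty open sets, so a finite
  subcover already contains all of them. Finite index thus follows from openness.\<close>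

lemma finite_rcosets_open:
  assumes U: "subgroup U G" "openin T U"
  shows "finite (rcosets U)"
proof -
  have "\<Union>(rcosets U) = carrier G"
    using U(1) by (rule rcosets_part_G)
  moreover have "openin T c" if "c \<in> rcosets U" for c
    using that openin_r_coset[OF U] by (auto simp: RCOSETS_def)
  ultimately obtain \<F> where \<F>: "finite \<F>" "\<F> \<subseteq> rcosets U" "carrier G \<subseteq> \<Union>\<F>"
    using compact unfolding compact_space_alt topspace_eq by (metis subset_refl)
  have "c \<in> \<F>" if c: "c \<in> rcosets U" for c
  proof -
    obtain x where "x \<in> carrier G" "x \<in> c"
      using c rcos_self[OF _ U(1)] by (auto simp: RCOSETS_def)
    then obtain d where "d \<in> \<F>" "x \<in> d" using \<F>(3) by blast
    then have "c = d"
      using \<F>(2) c \<open>x \<in> c\<close> rcos_disjoint[OF U(1)] unfolding pairwise_def disjnt_def by blast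
    then show ?thesis using \<open>d \<in> \<F>\<close> by simp
  qed
  then have "rcosets U \<subseteq> \<F>" by (rule subsetI)
  then show ?thesis using \<F>(1) by (rule finite_subset)
qed

lemma fi_subgroup_iff: "fi_subgroup G T U \<longleftrightarrow> subgroup U G \<and> openin T U"
  using finite_rcosets_open by (auto simp: fi_subgroup_def)

lemma fi_normal_iff: "U \<in> fi_normal_subgroups G T \<longleftrightarrow> U \<lhd> G \<and> openin T U"
  by (auto simp: fi_normal_subgroups_def fi_subgroup_iff normal_imp_subgroup)

lemma fi_normal_carrier: "carrier G \<in> fi_normal_subgroups G T"
proof -
  have "carrier G \<lhd> G"
    by (intro normal_invI subgroup_self) auto
  then show ?thesis
    using openin_topspace[of T] by (simp add: fi_normal_iff topspace_eq)
qed

lemma fi_normal_Int: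
  assumes "U \<in> fi_normal_subgroups G T" "V \<in> fi_normal_subgroups G T"
  shows "U \<inter> V \<in> fi_normal_subgroups G T"
proof -
  have "subgroup (U \<inter> V) G"
    using assms by (intro subgroups_Inter_pair) (auto simp: fi_normal_iff normal_imp_subgroup)
  then have "U \<inter> V \<lhd> G"
    using assms by (intro normal_invI) (auto simp: fi_normal_iff dest: normal.inv_op_closed2)
  then show ?thesis using assms by (auto simp: fi_normal_iff)
qed

text \<open>The cofinality of the normal subgroups: inside an open subgroup lies its normal
  core.\<close>

lemma ex_fi_normal_subset:
  assumes "fi_subgroup G T U"
  obtains V where "V \<in> fi_normal_subgroups G T" "V \<subseteq> U"
proof
  have U: "subgroup U G" "openin T U" "finite (rcosets U)"
    using assms by (auto simp: fi_subgroup_def)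
  have Usub: "U \<subseteq> carrier G" using U(1) subgroup.subset by blast
  have csub: "c \<subseteq> carrier G" if "c \<in> rcosets U" for c
    using that r_coset_subset_G[OF Usub] by (auto simp: RCOSETS_def)
  have cmult: "c #> x \<in> rcosets U" if "c \<in> rcosets U" "x \<in> carrier G" for c x
    using that coset_mult_assoc[OF Usub] by (auto simp: RCOSETS_def)
  \<comment> \<open>The kernel of the right translation action on the finite set of right cosets. It
    lies in \<open>U\<close> because it fixes the coset \<open>U\<close>.\<close>
  define K where "K = {x \<in> carrier G. \<forall>c\<in>rcosets U. c #> x = c}"
  have Kc: "x \<in> carrier G" if "x \<in> K" for x
    using that by (simp add: K_def)
  have Kinv: "inv x \<in> K" if x: "x \<in> K" for x
  proof -
    have "c #> inv x = c" if c: "c \<in> rcosets U" for c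
    proof -
      have "c #> inv x = (c #> x) #> inv x"
        using x c by (simp add: K_def)
      also have "\<dots> = c #> (x \<otimes> inv x)"
        using Kc[OF x] csub[OF c] by (intro coset_mult_assoc) auto
      also have "\<dots> = c"
        using Kc[OF x] csub[OF c] by simp
      finally show ?thesis .
    qed
    then show ?thesis using x by (simp add: K_def)
  qed
  have sub: "subgroup K G"
  proof
    show "x \<otimes> y \<in> K" if "x \<in> K" "y \<in> K" for x y
      using that by (simp add: K_def coset_mult_assoc[symmetric] csub)
    show "\<one> \<in> K" by (simp add: K_def csub)
  qed (use Kc Kinv in auto)
  have "K \<lhd> G"
  proof (rule normal_invI[OF sub])
    fix g x assume g: "g \<in> carrier G" and x: "x \<in> K"
    have "c #> (g \<otimes> x \<otimes> inv g) = c" if c: "c \<in> rcosets U" for c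
    proof -
      have "c #> (g \<otimes> x \<otimes> inv g) = ((c #> g) #> x) #> inv g"
        using g Kc[OF x] csub[OF c] by (simp add: coset_mult_assoc m_assoc r_coset_subset_G)
      also have "\<dots> = (c #> g) #> inv g"
        using x cmult[OF c g] by (simp add: K_def)
      also have "\<dots> = c"
        using g csub[OF c] by (simp add: coset_mult_assoc)
      finally show ?thesis .
    qed
    then show "g \<otimes> x \<otimes> inv g \<in> K"
      using g Kc[OF x] by (simp add: K_def)
  qed
  moreover have "openin T K"
  proof -
    have "openin T {x \<in> carrier G. c #> x = c}" if c: "c \<in> rcosets U" for c
    proof -
      obtain g where g: "g \<in> carrier G" "c = U #> g"
        using c by (auto simp: RCOSETS_def)
      \<comment> \<open>Exhibits the stabiliser of a coset as the preimage of an open coset under a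
        left translation; \<open>K\<close> is a finite intersection of such stabilisers.\<close>
      have "c #> x = c \<longleftrightarrow> g \<otimes> x \<in> c" if x: "x \<in> carrier G" for x
      proof -
        have "c #> x = U #> (g \<otimes> x)"
          using g x Usub by (simp add: coset_mult_assoc)
        moreover have "U #> (g \<otimes> x) = U #> g \<longleftrightarrow> g \<otimes> x \<in> U #> g"
          using g x U(1) rcos_self[of "g \<otimes> x" U] repr_independence[of "g \<otimes> x" U g] by auto
        ultimately show ?thesis using g by simp
      qed
      then have "{x \<in> carrier G. c #> x = c} = {x \<in> topspace T. g \<otimes> x \<in> c}"
        by (auto simp: topspace_eq)
      then show ?thesis
        using openin_continuous_map_preimage[OF continuous_map_left_translation[OF g(1)]
            openin_r_coset[OF U(1,2) g(1)]] g(2) by simp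
    qed
    then have "openin T (\<Inter>c\<in>rcosets U. {x \<in> carrier G. c #> x = c})"
      using U(3) rcosets_self[OF U(1)] by (intro openin_INT2) auto
    moreover have "(\<Inter>c\<in>rcosets U. {x \<in> carrier G. c #> x = c}) = K"
      using rcosets_self[OF U(1)] by (auto simp: K_def)
    ultimately show ?thesis by simp
  qed
  ultimately show "K \<in> fi_normal_subgroups G T"
    by (simp add: fi_normal_iff)
  have "U \<in> rcosets U"
    by (rule rcosets_self[OF U(1)])
  then show "K \<subseteq> U"
    using coset_join1[OF _ _ U(1)] by (auto simp: K_def)
qed

subsection \<open>Copies of spaces with an action\<close>

text \<open>Compact generation is asked of the copy and not of \<open>X\<close>, because the test
  spaces in its definition depend on the type of points, which the copy changes.\<close>

lemma is_gspace_copy: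
  assumes e: "inj e" and cg: "compactly_generated (copy_top e (gtop X))" and H: "Hausdorff_space (gtop X)"
    and c: "continuous_map (prod_topology T (gtop X)) (gtop X) (\<lambda>(g, x). gact X g x)"
    and act: "\<And>x. x \<in> topspace (gtop X) \<Longrightarrow> gact X \<one> x = x"
      "\<And>x g h. x \<in> topspace (gtop X) \<Longrightarrow> g \<in> carrier G \<Longrightarrow> h \<in> carrier G \<Longrightarrow>
        gact X (g \<otimes> h) x = gact X g (gact X h x)"
  shows "is_gspace G T (gspace_copy e X)"
proof -
  let ?Y = "copy_top e (gtop X)"
  have g: "gtop (gspace_copy e X) = ?Y" "gact (gspace_copy e X) = (\<lambda>g x. e (gact X g (the_inv e x)))"
    by (simp_all add: gspace_copy_def copy_top_def)
  have "Hausdorff_space ?Y"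
    using H homeomorphic_space_copy_top[OF e] homeomorphic_Hausdorff_space by blast
  then have "weak_hausdorff ?Y" by (rule weak_hausdorff_Hausdorff)
  moreover have "continuous_map (prod_topology T ?Y) ?Y (\<lambda>(g, x). e (gact X g (the_inv e x)))"
  proof -
    have "continuous_map (prod_topology T ?Y) (prod_topology T (gtop X)) (\<lambda>(g, x). (g, the_inv e x))"
      using continuous_map_prod_top[of T ?Y T "gtop X" "\<lambda>x. x" "the_inv e"] continuous_map_from_copy[OF e]
      by simp
    from continuous_map_compose[OF continuous_map_compose[OF this c] continuous_map_into_copy[OF e]]
    show ?thesis by (simp add: o_def case_prod_unfold)
  qed
  ultimately show ?thesis
    using cg act unfolding is_gspace_def g
    by (auto simp: topspace_copy_top[OF e] the_inv_f_f[OF e])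
qed

lemma gspace_copy_simps:
  "gtop (gspace_copy e X) = copy_top e (gtop X)"
  "inj e \<Longrightarrow> gact (gspace_copy e X) g (e x) = e (gact X g x)"
  by (simp_all add: gspace_copy_def copy_top_def the_inv_f_f)

lemma copy_in_homs:
  assumes e: "inj e" and X: "is_gspace G T (gspace_copy e X)" "is_gspace G T (gspace_copy e Y)"
    and f: "continuous_map (gtop X) (gtop Y) f" "equivariant G X Y f"
  shows "mk_gmap (gspace_copy e X) (gspace_copy e Y) (\<lambda>x. e (f (the_inv e x))) \<in> homs GC (gspace_copy e X) (gspace_copy e Y)"
proof (rule mk_gmap_homs[OF X])
  show "continuous_map (gtop (gspace_copy e X)) (gtop (gspace_copy e Y)) (\<lambda>x. e (f (the_inv e x)))"
    using continuous_map_compose[OF continuous_map_compose[OF continuous_map_from_copy[OF e] f(1)]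
        continuous_map_into_copy[OF e]] by (simp add: o_def gspace_copy_simps)
  show "equivariant G (gspace_copy e X) (gspace_copy e Y) (\<lambda>x. e (f (the_inv e x)))"
    using f(2) by (auto simp: equivariant_def gspace_copy_simps topspace_copy_top[OF e] e the_inv_f_f[OF e])
qed

subsection \<open>The spaces \<open>E(G/U)\<close>\<close>

lemma carrier_Mod: "carrier (G Mod U) = rcosets U"
  by (simp add: FactGroup_def)

lemma mult_Mod: "a \<otimes>\<^bsub>G Mod U\<^esub> b = a <#> b"
  by (simp add: FactGroup_def)

lemma E_act_coset:
  assumes U: "U \<lhd> G" and g: "g \<in> carrier G" "a \<in> carrier G"
  shows "(U #> g) \<otimes>\<^bsub>G Mod U\<^esub> (U #> a) = U #> (g \<otimes> a)"
  using normal.rcos_sum[OF U g] by (simp add: mult_Mod)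

lemma E_act_closed:
  assumes U: "U \<lhd> G" and g: "g \<in> carrier G"
  shows "(\<lambda>c. (U #> g) \<otimes>\<^bsub>G Mod U\<^esub> c) ` (rcosets U) \<subseteq> rcosets U"
  using E_act_coset[OF U g] g by (auto simp: RCOSETS_def)

lemma E_gspace_simps:
  "gtop (E_gspace G U) = bar_top (rcosets U)"
  "gact (E_gspace G U) g = bar_map (rcosets U) (\<lambda>c. (U #> g) \<otimes>\<^bsub>G Mod U\<^esub> c)"
  by (simp_all add: E_gspace_def carrier_Mod)

text \<open>Cells have points that are pairs of a coset and a real sequence, and these must be
  injected into \<open>'u\<close> with the help of \<open>pc\<close>. Such a pair is encoded by the
  graph of the sequence: a set of two-element lists in which the coset serves as label and the first
  real number is the argument.\<close>

lemma inj_points: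
  assumes "inj (pc :: ('s \<times> real) list set \<Rightarrow> 'u)"
  shows "inj (\<lambda>(c :: 's, \<phi> :: nat \<Rightarrow> real). pc (range (\<lambda>n. [(c, real n), (c, \<phi> n)])))"
proof (rule injI, clarify)
  fix c d :: 's and \<phi> \<psi> :: "nat \<Rightarrow> real"
  assume "pc (range (\<lambda>n. [(c, real n), (c, \<phi> n)])) = pc (range (\<lambda>n. [(d, real n), (d, \<psi> n)]))"
  then have eq: "range (\<lambda>n. [(c, real n), (c, \<phi> n)]) = range (\<lambda>n. [(d, real n), (d, \<psi> n)])"
    by (rule injD[OF assms])
  have "c = d \<and> \<phi> n = \<psi> n" for n
  proof -
    have "[(c, real n), (c, \<phi> n)] \<in> range (\<lambda>n. [(d, real n), (d, \<psi> n)])"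
      unfolding eq[symmetric] by (rule rangeI)
    then show ?thesis by auto
  qed
  then show "c = d \<and> \<phi> = \<psi>" by auto
qed

lemma compactly_generated_bar_copy:
  fixes pc :: "('s \<times> real) list set \<Rightarrow> 'u"
  assumes pc: "inj pc"
  shows "compactly_generated (copy_top pc (bar_top S))"
proof (rule compactly_generatedI[where I = "{xs. xs \<noteq> [] \<and> set xs \<subseteq> S}"
      and D = "\<lambda>xs. simplex_top (length xs - 1)" and f = "\<lambda>xs t. pc (bar_chart S xs t)"
      \<comment> \<open>Points of a simplex are real sequences without a label, so the encoding of
        labelled sequences is used with an arbitrary fixed label.\<close>
      and e = "\<lambda>\<phi>. (\<lambda>(c :: 's, \<phi> :: nat \<Rightarrow> real). pc (range (\<lambda>n. [(c, real n), (c, \<phi> n)]))) (undefined, \<phi>)"])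
  show "inj (\<lambda>\<phi>. (\<lambda>(c :: 's, \<phi> :: nat \<Rightarrow> real). pc (range (\<lambda>n. [(c, real n), (c, \<phi> n)]))) (undefined, \<phi>))"
    using injD[OF inj_points[OF pc]] by (intro injI) blast
  fix xs assume "xs \<in> {xs. xs \<noteq> [] \<and> set xs \<subseteq> S}"
  then have xs: "xs \<noteq> []" "set xs \<subseteq> S" by auto
  have "compact_space (simplex_top (length xs - 1))"
    by (intro compact_space_subtopology compactin_standard_simplex)
  moreover have "Hausdorff_space (simplex_top (length xs - 1))"
    by (intro Hausdorff_space_subtopology) (simp add: Hausdorff_space_product_topology)
  moreover have "continuous_map (simplex_top (length xs - 1)) (copy_top pc (bar_top S)) (\<lambda>t. pc (bar_chart S xs t))"
    using continuous_map_compose[OF continuous_map_bar_chart[OF xs] continuous_map_into_copy[OF pc]]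
    by (simp add: o_def)
  ultimately show "compact_space (simplex_top (length xs - 1)) \<and> Hausdorff_space (simplex_top (length xs - 1)) \<and>
      continuous_map (simplex_top (length xs - 1)) (copy_top pc (bar_top S)) (\<lambda>t. pc (bar_chart S xs t))"
    by blast
next
  fix A assume A: "A \<subseteq> topspace (copy_top pc (bar_top S))"
    and cl: "\<And>xs. xs \<in> {xs. xs \<noteq> [] \<and> set xs \<subseteq> S} \<Longrightarrow>
      closedin (simplex_top (length xs - 1)) {t \<in> topspace (simplex_top (length xs - 1)). pc (bar_chart S xs t) \<in> A}"
  have "closedin (bar_top S) {c \<in> topspace (bar_top S). pc c \<in> A}"
  proof (rule closedin_bar_topI)
    fix xs assume xs: "xs \<noteq> []" "set xs \<subseteq> S"
    show "closedin (simplex_top (length xs - 1))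
        {t \<in> standard_simplex (length xs - 1). bar_chart S xs t \<in> {c \<in> topspace (bar_top S). pc c \<in> A}}"
      using cl[of xs] xs bar_chart_topspace[OF xs] by (simp cong: conj_cong)
  qed auto
  from closedin_continuous_map_preimage[OF continuous_map_from_copy[OF pc] this]
  have "closedin (copy_top pc (bar_top S)) {x \<in> topspace (copy_top pc (bar_top S)).
      the_inv pc x \<in> {c \<in> topspace (bar_top S). pc c \<in> A}}" .
  moreover have "{x \<in> topspace (copy_top pc (bar_top S)). the_inv pc x \<in> {c \<in> topspace (bar_top S). pc c \<in> A}} = A"
    using A by (auto simp: topspace_copy_top[OF pc] the_inv_f_f[OF pc])
  ultimately show "closedin (copy_top pc (bar_top S)) A" by simp
qed

lemma is_gspace_E:
  assumes pc: "inj pc" and U: "U \<in> fi_normal_subgroups G T"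
  shows "is_gspace G T (gspace_copy pc (E_gspace G U))"
proof (rule is_gspace_copy[OF pc]; (unfold E_gspace_simps)?)
  have n: "U \<lhd> G" and o: "openin T U" using U by (auto simp: fi_normal_iff)
  note sub = normal_imp_subgroup[OF n]
  show "compactly_generated (copy_top pc (bar_top (rcosets U)))"
    by (rule compactly_generated_bar_copy[OF pc])
  show "Hausdorff_space (bar_top (rcosets U))"
    by (rule Hausdorff_bar_top)
  show "continuous_map (prod_topology T (bar_top (rcosets U))) (bar_top (rcosets U))
      (\<lambda>(g, x). bar_map (rcosets U) (\<lambda>c. (U #> g) \<otimes>\<^bsub>G Mod U\<^esub> c) x)"
  proof (rule continuous_map_locally_constant_left)
    fix g assume "g \<in> topspace T"
    then have g: "g \<in> carrier G" by (simp add: topspace_eq)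
    \<comment> \<open>The action of a group element depends only on its coset, and this coset is an
      open neighbourhood on which the action is constant.\<close>
    have eq: "U #> h = U #> g" if "h \<in> U #> g" for h
      using repr_independence[OF that g sub] by (rule sym)
    show "\<exists>N. openin T N \<and> g \<in> N \<and> (\<forall>h\<in>N. \<forall>x\<in>topspace (bar_top (rcosets U)).
        bar_map (rcosets U) (\<lambda>c. (U #> h) \<otimes>\<^bsub>G Mod U\<^esub> c) x = bar_map (rcosets U) (\<lambda>c. (U #> g) \<otimes>\<^bsub>G Mod U\<^esub> c) x)"
    proof (intro exI conjI ballI)
      fix h x assume "h \<in> U #> g"
      show "bar_map (rcosets U) (\<lambda>c. (U #> h) \<otimes>\<^bsub>G Mod U\<^esub> c) x = bar_map (rcosets U) (\<lambda>c. (U #> g) \<otimes>\<^bsub>G Mod U\<^esub> c) x"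
        unfolding eq[OF \<open>h \<in> U #> g\<close>] by (rule refl)
    qed (rule openin_r_coset[OF sub o g], rule rcos_self[OF g sub])
    show "continuous_map (bar_top (rcosets U)) (bar_top (rcosets U)) (bar_map (rcosets U) (\<lambda>c. (U #> g) \<otimes>\<^bsub>G Mod U\<^esub> c))"
      by (rule continuous_map_bar_map[OF E_act_closed[OF n g]])
  qed
  fix x assume x: "x \<in> topspace (bar_top (rcosets U))"
  show "bar_map (rcosets U) (\<lambda>c. (U #> \<one>) \<otimes>\<^bsub>G Mod U\<^esub> c) x = x"
    using x by (rule bar_map_id) (use E_act_coset[OF n one_closed] in \<open>auto simp: RCOSETS_def\<close>)
  fix g h assume gh: "g \<in> carrier G" "h \<in> carrier G"
  show "bar_map (rcosets U) (\<lambda>c. (U #> (g \<otimes> h)) \<otimes>\<^bsub>G Mod U\<^esub> c) x =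
      bar_map (rcosets U) (\<lambda>c. (U #> g) \<otimes>\<^bsub>G Mod U\<^esub> c) (bar_map (rcosets U) (\<lambda>c. (U #> h) \<otimes>\<^bsub>G Mod U\<^esub> c) x)"
    by (rule bar_map_comp[symmetric, OF E_act_closed[OF n gh(2)] E_act_closed[OF n gh(1)] x])
       (use gh E_act_coset[OF n] in \<open>auto simp: RCOSETS_def m_assoc\<close>)
qed

lemma E_proj_coset:
  assumes U: "subgroup U G" and V: "subgroup V G" "V \<subseteq> U" and a: "a \<in> carrier G"
  shows "U <#> (V #> a) = U #> a"
proof -
  have "U <#> V = U"
  proof
    show "U <#> V \<subseteq> U"
      using U V(2) by (auto simp: set_mult_def dest: subgroup.m_closed)
    show "U \<subseteq> U <#> V"
      using subgroup.one_closed[OF V(1)] subgroup.subset[OF U] by (force simp: set_mult_def)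
  qed
  then show ?thesis
    using setmult_rcos_assoc[OF subgroup.subset[OF U] subgroup.subset[OF V(1)] a] by simp
qed

lemma E_proj_closed:
  assumes "U \<lhd> G" "V \<lhd> G" "V \<subseteq> U"
  shows "(\<lambda>c. U <#> c) ` (rcosets V) \<subseteq> rcosets U"
  using E_proj_coset[OF normal_imp_subgroup[OF assms(1)] normal_imp_subgroup[OF assms(2)] assms(3)]
  by (auto simp: RCOSETS_def)

lemma equivariant_E_proj:
  assumes "U \<lhd> G" "V \<lhd> G" "V \<subseteq> U"
  shows "equivariant G (E_gspace G V) (E_gspace G U) (E_proj G U)"
  unfolding equivariant_def E_gspace_simps E_proj_def carrier_Mod
proof (intro ballI)
  fix g x assume g: "g \<in> carrier G" and x: "x \<in> topspace (bar_top (rcosets V))"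
  note sub = normal_imp_subgroup[OF assms(1)] normal_imp_subgroup[OF assms(2)]
  define h where "h = (\<lambda>c. U <#> ((V #> g) \<otimes>\<^bsub>G Mod V\<^esub> c))"
  have "h c = (U #> g) \<otimes>\<^bsub>G Mod U\<^esub> (U <#> c)" if "c \<in> rcosets V" for c
    using that g sub E_act_coset[OF assms(1) g] E_act_coset[OF assms(2) g] E_proj_coset[OF sub assms(3)]
    by (auto simp: RCOSETS_def h_def)
  then have "bar_map (rcosets U) (\<lambda>c. (U #> g) \<otimes>\<^bsub>G Mod U\<^esub> c) (bar_map (rcosets U) (\<lambda>c. U <#> c) x)
      = bar_map (rcosets U) h x"
    by (rule bar_map_comp[OF E_proj_closed[OF assms] E_act_closed[OF assms(1) g] x])
  moreover have "bar_map (rcosets U) (\<lambda>c. U <#> c) (bar_map (rcosets V) (\<lambda>c. (V #> g) \<otimes>\<^bsub>G Mod V\<^esub> c) x)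
      = bar_map (rcosets U) h x"
    by (rule bar_map_comp[OF E_act_closed[OF assms(2) g] E_proj_closed[OF assms] x]) (simp add: h_def)
  ultimately show "bar_map (rcosets U) (\<lambda>c. U <#> c) (bar_map (rcosets V) (\<lambda>c. (V #> g) \<otimes>\<^bsub>G Mod V\<^esub> c) x) =
      bar_map (rcosets U) (\<lambda>c. (U #> g) \<otimes>\<^bsub>G Mod U\<^esub> c) (bar_map (rcosets U) (\<lambda>c. U <#> c) x)"
    by simp
qed

definition E_copy :: "(('a set \<times> real) list set \<Rightarrow> 'u) \<Rightarrow> 'a set \<Rightarrow> ('a, 'u) gspace" where
  "E_copy pc U = gspace_copy pc (E_gspace G U)"

definition E_map :: "(('a set \<times> real) list set \<Rightarrow> 'u) \<Rightarrow> 'a set \<Rightarrow> 'a set \<Rightarrow> ('a, 'u) gmap" where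
  "E_map pc V U = mk_gmap (E_copy pc V) (E_copy pc U) (\<lambda>x. pc (E_proj G U (the_inv pc x)))"

lemma topspace_E_copy: "inj pc \<Longrightarrow> topspace (gtop (E_copy pc U)) = pc ` topspace (bar_top (rcosets U))"
  by (simp add: E_copy_def gspace_copy_simps E_gspace_simps topspace_copy_top)

lemma E_map_homs:
  assumes pc: "inj pc" and UV: "U \<in> fi_normal_subgroups G T" "V \<in> fi_normal_subgroups G T" "V \<subseteq> U"
  shows "E_map pc V U \<in> homs GC (E_copy pc V) (E_copy pc U)"
proof -
  have n: "U \<lhd> G" "V \<lhd> G" using UV by (auto simp: fi_normal_iff)
  have "continuous_map (gtop (E_gspace G V)) (gtop (E_gspace G U)) (E_proj G U)"
    unfolding E_gspace_simps E_proj_def carrier_Mod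
    by (rule continuous_map_bar_map[OF E_proj_closed[OF n UV(3)]])
  from copy_in_homs[OF pc is_gspace_E[OF pc UV(2)] is_gspace_E[OF pc UV(1)] this equivariant_E_proj[OF n UV(3)]]
  show ?thesis by (simp add: E_map_def E_copy_def)
qed

lemma E_map_id:
  assumes pc: "inj pc" and U: "U \<in> fi_normal_subgroups G T"
  shows "E_map pc U U = mk_gmap (E_copy pc U) (E_copy pc U) (\<lambda>x. x)"
proof -
  have s: "subgroup U G" using U by (auto simp: fi_normal_iff normal_imp_subgroup)
  have "E_proj G U c = c" if "c \<in> topspace (bar_top (rcosets U))" for c
    unfolding E_proj_def carrier_Mod
    using that by (rule bar_map_id) (use E_proj_coset[OF s s] in \<open>auto simp: RCOSETS_def\<close>)
  then show ?thesis
    unfolding E_map_def mk_gmap_def by (auto simp: topspace_E_copy[OF pc] the_inv_f_f[OF pc] intro!: restrict_ext)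
qed

lemma E_map_comp:
  assumes pc: "inj pc" and U: "U \<in> fi_normal_subgroups G T" and V: "V \<in> fi_normal_subgroups G T"
    and W: "W \<in> fi_normal_subgroups G T" and sub: "W \<subseteq> V" "V \<subseteq> U"
  shows "Comp GC (E_map pc V U) (E_map pc W V) = E_map pc W U"
proof (rule homs_gspace_eqI)
  have n: "U \<lhd> G" "V \<lhd> G" "W \<lhd> G" using U V W by (auto simp: fi_normal_iff)
  note s = n[THEN normal_imp_subgroup]
  show "Comp GC (E_map pc V U) (E_map pc W V) \<in> homs GC (E_copy pc W) (E_copy pc U)"
    using comp_homs[OF E_map_homs[OF pc V W sub(1)] E_map_homs[OF pc U V sub(2)]]
    by (simp add: E_map_def)
  show "E_map pc W U \<in> homs GC (E_copy pc W) (E_copy pc U)"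
    using sub by (intro E_map_homs pc U W) auto
  fix x assume x: "x \<in> topspace (gtop (E_copy pc W))"
  then obtain c where c: "c \<in> topspace (bar_top (rcosets W))" "x = pc c"
    by (auto simp: topspace_E_copy[OF pc])
  have "E_proj G V c \<in> topspace (bar_top (rcosets V))"
    unfolding E_proj_def carrier_Mod by (rule bar_map_topspace[OF E_proj_closed[OF n(2,3) sub(1)] c(1)])
  moreover have "E_proj G U (E_proj G V c) = E_proj G U c"
    unfolding E_proj_def carrier_Mod
    by (rule bar_map_comp[OF E_proj_closed[OF n(2,3) sub(1)] E_proj_closed[OF n(1,2) sub(2)] c(1)])
       (use s sub E_proj_coset[of V W] E_proj_coset[of U V] E_proj_coset[of U W] in \<open>auto simp: RCOSETS_def\<close>)
  ultimately show "gfun (Comp GC (E_map pc V U) (E_map pc W V)) x = gfun (E_map pc W U) x"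
    using x c by (simp add: E_map_def mk_gmap_def topspace_E_copy[OF pc] the_inv_f_f[OF pc])
qed

subsection \<open>The empty space and the point\<close>

definition empty_gspace :: "('a, 'p) gspace" where
  "empty_gspace = \<lparr>gtop = discrete_topology {}, gact = (\<lambda>_ x. x)\<rparr>"

lemma is_gspace_empty: "is_gspace G T empty_gspace"
  unfolding is_gspace_def empty_gspace_def
  by (auto intro!: compactly_generated_compact_Hausdorff weak_hausdorff_Hausdorff
      simp: compact_space_discrete_topology continuous_map_def)

lemma is_gspace_point: "is_gspace G T (point_gspace p)"
proof -
  have "continuous_map (prod_topology T (discrete_topology {p})) (discrete_topology {p}) (\<lambda>(g, x). x)"
    using continuous_map_snd[of T "discrete_topology {p}"] by (simp add: case_prod_unfold)
  then show ?thesis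
    unfolding is_gspace_def point_gspace_def
    by (auto intro!: compactly_generated_compact_Hausdorff weak_hausdorff_Hausdorff
        simp: compact_space_discrete_topology)
qed

text \<open>Stated for every space without points, because such spaces need not be equal:
  \<open>sub_gspace X {}\<close> keeps the action function of \<open>X\<close>, while
  \<open>empty_gspace\<close> has its own.\<close>

lemma homs_from_empty:
  assumes X: "is_gspace G T X" "topspace (gtop X) = {}" and Y: "is_gspace G T Y"
  shows "\<exists>!f. f \<in> homs GC X Y"
proof (rule ex1I)
  show "mk_gmap X Y (\<lambda>x. x) \<in> homs GC X Y"
    using X(2) by (intro mk_gmap_homs X Y) (auto simp: equivariant_def continuous_map_def)
  then show "f = mk_gmap X Y (\<lambda>x. x)" if "f \<in> homs GC X Y" for f
    using that X(2) by (intro homs_gspace_eqI[of f G T X Y]) auto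
qed

lemma point_map_homs:
  assumes "is_gspace G T X"
  shows "mk_gmap X (point_gspace p) (\<lambda>_. p) \<in> homs GC X (point_gspace p)"
  by (intro mk_gmap_homs is_gspace_point assms) (auto simp: equivariant_def point_gspace_def)

lemma homs_to_point:
  assumes X: "is_gspace G T X"
  shows "\<exists>!f. f \<in> homs GC X (point_gspace p)"
proof (rule ex1I)
  show "mk_gmap X (point_gspace p) (\<lambda>_. p) \<in> homs GC X (point_gspace p)"
    by (rule point_map_homs[OF X])
  fix f assume f: "f \<in> homs GC X (point_gspace p)"
  show "f = mk_gmap X (point_gspace p) (\<lambda>_. p)"
    using f point_map_homs[OF X]
    by (rule homs_gspace_eqI) (use homs_gspace_topspace[OF f] in \<open>auto simp: point_gspace_def\<close>)
qed

lemma pointed_contractible_point: "pointed_contractible (discrete_topology {p}) p"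
  unfolding pointed_contractible_def by (rule exI[of _ "\<lambda>_. p"]) auto

lemma fixed_points_trivial:
  assumes "\<And>g x. g \<in> V \<Longrightarrow> x \<in> topspace (gtop X) \<Longrightarrow> gact X g x = x"
  shows "fixed_points V X = gtop X"
  unfolding fixed_points_def using assms by (intro subtopology_superset) auto

lemma U_n_equivalence_E_point:
  assumes pc: "inj pc" and U: "U \<in> fi_normal_subgroups G T"
    and f: "f \<in> homs GC (E_copy pc U) (point_gspace p)"
  shows "U_n_equivalence G T U n f"
  unfolding U_n_equivalence_def
proof (intro conjI allI impI)
  show "f \<in> Ar GC" using f by (simp add: homs_def)
  fix V assume V: "fi_subgroup G T V \<and> V \<subseteq> U"
  have n: "U \<lhd> G" using U by (simp add: fi_normal_iff)
  note s = normal_imp_subgroup[OF n]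
  have g: "gdom f = E_copy pc U" "gcod f = point_gspace p"
    using f by (auto simp: homs_def)
  have "fixed_points V (E_copy pc U) = gtop (E_copy pc U)"
  proof (rule fixed_points_trivial)
    fix g x assume g: "g \<in> V" and "x \<in> topspace (gtop (E_copy pc U))"
    then obtain c where c: "c \<in> topspace (bar_top (rcosets U))" "x = pc c"
      by (auto simp: topspace_E_copy[OF pc])
    have gU: "g \<in> U" "g \<in> carrier G" using g V subgroup.subset[OF s] by auto
    then have "U #> g = U #> \<one>"
      using coset_join2[OF _ s] subgroup.subset[OF s] by simp
    then have "bar_map (rcosets U) (\<lambda>c. (U #> g) \<otimes>\<^bsub>G Mod U\<^esub> c) c = c"
      by (intro bar_map_id[OF c(1)]) (use E_act_coset[OF n one_closed] in \<open>auto simp: RCOSETS_def\<close>)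
    then show "gact (E_copy pc U) g x = x"
      using c by (simp add: E_copy_def gspace_copy_simps pc E_gspace_simps)
  qed
  moreover have "fixed_points V (gcod f) = gtop (gcod f)"
    by (rule fixed_points_trivial) (simp add: g point_gspace_def)
  moreover have "n_equivalence n (gtop (E_copy pc U)) (gtop (gcod f)) (gfun f)"
  proof (rule n_equivalence_contractible)
    fix x assume "x \<in> topspace (gtop (E_copy pc U))"
    then obtain c where c: "c \<in> topspace (bar_top (rcosets U))" "x = pc c"
      by (auto simp: topspace_E_copy[OF pc])
    show "pointed_contractible (gtop (E_copy pc U)) x"
      using pointed_contractible_homeomorphic[OF pointed_contractible_bar_top[OF c(1)] homeomorphic_maps_copy_top[OF pc] c(1)]
      by (simp add: c(2) E_copy_def gspace_copy_simps E_gspace_simps)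
  next
    obtain c where "c \<in> rcosets U" using rcosets_self[OF s] by blast
    then have "[(c, 1)] \<in> bar_pts (rcosets U)" by (simp add: bar_pts_iff)
    then show "topspace (gtop (E_copy pc U)) \<noteq> {}"
      by (auto simp: topspace_E_copy[OF pc] topspace_bar_top)
  next
    fix y assume "y \<in> topspace (gtop (gcod f))"
    then show "pointed_contractible (gtop (gcod f)) y"
      using pointed_contractible_point by (simp add: g point_gspace_def)
  next
    show "continuous_map (gtop (E_copy pc U)) (gtop (gcod f)) (gfun f)"
      using f by (simp add: in_homs_gspace_iff)
  qed
  ultimately show "n_equivalence n (fixed_points V (gdom f)) (fixed_points V (gcod f)) (gfun f)"
    using g(1) by simp
qed

end

section \<open>Relative cell complexes\<close>

no_notation subset_mset (infix \<open><#\<close> 50)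

subsection \<open>Closed subspaces\<close>

definition sub_gspace :: "('g, 'p) gspace \<Rightarrow> 'p set \<Rightarrow> ('g, 'p) gspace" where
  "sub_gspace X A = \<lparr>gtop = subtopology (gtop X) A, gact = gact X\<rparr>"

lemma sub_gspace_simps [simp]:
  "gtop (sub_gspace X A) = subtopology (gtop X) A" "gact (sub_gspace X A) = gact X"
  by (simp_all add: sub_gspace_def)

lemma sub_gspace_topspace: "sub_gspace X (topspace (gtop X)) = X"
  by (simp add: sub_gspace_def)

definition inclusion :: "('g, 'p) gspace \<Rightarrow> 'p set \<Rightarrow> 'p set \<Rightarrow> ('g, 'p) gmap" where
  "inclusion X A B = mk_gmap (sub_gspace X A) (sub_gspace X B) (\<lambda>x. x)"

context profinite_group
begin

definition closed_sub :: "('a, 'u) gspace \<Rightarrow> 'u set \<Rightarrow> bool" where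
  "closed_sub X A \<longleftrightarrow> closedin (gtop X) A \<and> (\<forall>g\<in>carrier G. \<forall>x\<in>A. gact X g x \<in> A)"

lemma closed_sub_topspace: "closed_sub X A \<Longrightarrow> topspace (subtopology (gtop X) A) = A"
  using closedin_subset[of "gtop X" A] by (auto simp: closed_sub_def)

lemma is_gspace_sub:
  assumes X: "is_gspace G T X" "Hausdorff_space (gtop X)" and A: "closed_sub X A"
  shows "is_gspace G T (sub_gspace X A)"
proof -
  have c: "closedin (gtop X) A" using A by (simp add: closed_sub_def)
  have "continuous_map (prod_topology T (gtop X)) (gtop X) (\<lambda>(g, x). gact X g x)"
    using X(1) by (simp add: is_gspace_def)
  then have "continuous_map (prod_topology T (subtopology (gtop X) A)) (gtop X) (\<lambda>(g, x). gact X g x)"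
    by (simp add: prod_topology_subtopology(2) continuous_map_from_subtopology)
  then have "continuous_map (prod_topology T (subtopology (gtop X) A)) (subtopology (gtop X) A) (\<lambda>(g, x). gact X g x)"
    using A by (auto simp: continuous_map_in_subtopology closed_sub_def topspace_eq)
  moreover have "compactly_generated (subtopology (gtop X) A)"
    using X(1) c by (intro compactly_generated_closed_subtopology) (simp_all add: is_gspace_def)
  moreover have "weak_hausdorff (subtopology (gtop X) A)"
    using X(2) by (intro weak_hausdorff_Hausdorff Hausdorff_space_subtopology)
  ultimately show ?thesis
    using X(1) by (simp add: is_gspace_def)
qed

lemma inclusion_homs:
  assumes X: "is_gspace G T X" "Hausdorff_space (gtop X)" and A: "closed_sub X A" "closed_sub X B" "A \<subseteq> B"
  shows "inclusion X A B \<in> homs GC (sub_gspace X A) (sub_gspace X B)"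
  unfolding inclusion_def
proof (rule mk_gmap_homs)
  show "continuous_map (gtop (sub_gspace X A)) (gtop (sub_gspace X B)) (\<lambda>x. x)"
    using A(3) by (auto simp: continuous_map_in_subtopology continuous_map_from_subtopology)
qed (use X A in \<open>auto simp: is_gspace_sub equivariant_def\<close>)

lemma inclusion_comp:
  assumes f: "f \<in> homs GC (sub_gspace X B) Y" and A: "closed_sub X A" "A \<subseteq> B" and x: "x \<in> A"
  shows "gfun (Comp GC f (inclusion X A B)) x = gfun f x"
  using x closed_sub_topspace[OF A(1)] by (simp add: inclusion_def)

subsection \<open>Attaching an orbit of cells\<close>

lemma lcosets_normal: "U \<lhd> G \<Longrightarrow> lcosets U = rcosets U"
  using normal.coset_eq[of U G] by (auto simp: LCOSETS_def RCOSETS_def)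

text \<open>Cells are built from left cosets with left translation, \<open>E_gspace\<close> from
  right cosets and the product of the quotient group; for normal \<open>U\<close> the two actions
  agree.\<close>

lemma l_coset_r_coset:
  assumes U: "U \<lhd> G" and g: "g \<in> carrier G" and c: "c \<in> rcosets U"
  shows "g <# c = (U #> g) \<otimes>\<^bsub>G Mod U\<^esub> c"
proof -
  obtain a where a: "a \<in> carrier G" "c = U #> a" using c by (auto simp: RCOSETS_def)
  note sub = subgroup.subset[OF normal_imp_subgroup[OF U]]
  have eq: "U #> x = x <# U" if "x \<in> carrier G" for x
    using normal.coset_eq[OF U] that by simp
  have "g <# c = (g \<otimes> a) <# U"
    using a g sub by (simp add: eq lcos_m_assoc)
  also have "\<dots> = U #> (g \<otimes> a)"
    using a g by (simp add: eq)
  finally show ?thesis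
    using E_act_coset[OF U g a(1)] a(2) by simp
qed

lemma is_gspace_orbit_copy:
  fixes e :: "'a set \<times> 'q \<Rightarrow> 'u"
  assumes e: "inj e" and U: "U \<in> fi_normal_subgroups G T" and Q: "compact_space Q" "Hausdorff_space Q"
  shows "is_gspace G T (gspace_copy e (orbit_times G U Q))"
proof (rule is_gspace_copy[OF e])
  have n: "U \<lhd> G" and o: "openin T U" and fin: "finite (lcosets U)"
    using U finite_rcosets_open by (auto simp: fi_normal_iff lcosets_normal normal_imp_subgroup)
  note sub = normal_imp_subgroup[OF n]
  let ?P = "prod_topology (discrete_topology (lcosets U)) Q"
  have P: "compact_space ?P" "Hausdorff_space ?P"
    using Q fin by (auto simp: compact_space_prod_topology compact_space_discrete_topology
        Hausdorff_space_prod_topology)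
  have g: "gtop (orbit_times G U Q) = ?P" "gact (orbit_times G U Q) = (\<lambda>g (c, y). (g <# c, y))"
    by (simp_all add: orbit_times_def)
  have act: "g <# c = (U #> g) \<otimes>\<^bsub>G Mod U\<^esub> c" if "g \<in> carrier G" "c \<in> lcosets U" for g c
    using l_coset_r_coset[OF n that(1)] that(2) by (simp add: lcosets_normal[OF n])
  have lc: "\<exists>a\<in>carrier G. c = U #> a" if "c \<in> lcosets U" for c
    using that by (auto simp: lcosets_normal[OF n] RCOSETS_def)
  have closed: "g <# c \<in> lcosets U" if "g \<in> carrier G" "c \<in> lcosets U" for g c
    using E_act_closed[OF n that(1)] that(2) unfolding act[OF that] lcosets_normal[OF n] by auto
  show "Hausdorff_space (gtop (orbit_times G U Q))"
    using P by (simp add: g)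
  have "?P homeomorphic_space copy_top e ?P"
    by (rule homeomorphic_space_copy_top[OF e])
  then have "compact_space (copy_top e ?P)" "Hausdorff_space (copy_top e ?P)"
    using P homeomorphic_compact_space homeomorphic_Hausdorff_space by auto
  then show "compactly_generated (copy_top e (gtop (orbit_times G U Q)))"
    unfolding g by (rule compactly_generated_compact_Hausdorff)
  show "continuous_map (prod_topology T (gtop (orbit_times G U Q))) (gtop (orbit_times G U Q))
      (\<lambda>(g, x). gact (orbit_times G U Q) g x)"
    unfolding g
  proof (rule continuous_map_locally_constant_left)
    fix g assume "g \<in> topspace T"
    then have gc: "g \<in> carrier G" by (simp add: topspace_eq)
    show "\<exists>N. openin T N \<and> g \<in> N \<and> (\<forall>h\<in>N. \<forall>x\<in>topspace ?P. (\<lambda>(c, y). (h <# c, y)) x = (\<lambda>(c, y). (g <# c, y)) x)"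
    proof (intro exI conjI ballI)
      fix h x assume h: "h \<in> U #> g" and x: "x \<in> topspace ?P"
      have hc: "h \<in> carrier G" using h r_coset_subset_G[OF subgroup.subset[OF sub] gc] by auto
      have eq: "U #> h = U #> g" using repr_independence[OF h gc sub] by (rule sym)
      obtain c y where cy: "x = (c, y)" "c \<in> lcosets U" using x by auto
      show "(\<lambda>(c, y). (h <# c, y)) x = (\<lambda>(c, y). (g <# c, y)) x"
        unfolding cy(1) prod.case act[OF hc cy(2)] act[OF gc cy(2)] eq by (rule refl)
    qed (rule openin_r_coset[OF sub o gc], rule rcos_self[OF gc sub])
    have "continuous_map ?P (discrete_topology (lcosets U)) (\<lambda>p. g <# fst p)"
    proof -
      have "continuous_map (discrete_topology (lcosets U)) (discrete_topology (lcosets U)) (\<lambda>c. g <# c)"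
        using closed[OF gc] by simp
      from continuous_map_compose[OF continuous_map_fst this] show ?thesis by (simp add: o_def)
    qed
    then show "continuous_map ?P ?P (\<lambda>(c, y). (g <# c, y))"
      by (simp add: case_prod_unfold continuous_map_pairedI continuous_map_snd)
  qed
  fix x assume "x \<in> topspace (gtop (orbit_times G U Q))"
  then obtain c y where x: "x = (c, y)" "c \<in> lcosets U" by (auto simp: g)
  obtain a where a: "a \<in> carrier G" "c = U #> a" using lc[OF x(2)] by blast
  show "gact (orbit_times G U Q) \<one> x = x"
    using E_act_coset[OF n one_closed a(1)] act[OF one_closed x(2)] a(1) by (simp add: g x(1)) (simp add: a(2))
  fix k h assume kh: "k \<in> carrier G" "h \<in> carrier G"
  have "(k \<otimes> h) <# c = k <# (h <# c)"
  proof -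
    have ga: "g <# (U #> b) = U #> (g \<otimes> b)" if "g \<in> carrier G" "b \<in> carrier G" for g b
      using l_coset_r_coset[OF n that(1), of "U #> b"] E_act_coset[OF n that] that(2)
      by (auto simp: RCOSETS_def)
    show ?thesis
      unfolding a(2) using a(1) kh by (simp add: ga m_assoc)
  qed
  then show "gact (orbit_times G U Q) (k \<otimes> h) x = gact (orbit_times G U Q) k (gact (orbit_times G U Q) h x)"
    by (simp add: g x(1))
qed

lemma topspace_orbit: "topspace (gtop (orbit_times G U Q)) = (lcosets U) \<times> topspace Q"
  by (simp add: orbit_times_def)

text \<open>\<open>h\<close> need not be an embedding on the boundary; no topological condition on \<open>B\<close> is needed because
  \<open>X\<close> is Hausdorff and the cells are compact.\<close>

definition cell_attachment ::
  "('a, 'u) gspace \<Rightarrow> 'a set \<Rightarrow> 'u set \<Rightarrow> 'u set \<Rightarrow> nat \<Rightarrow> ('a set \<times> (nat \<Rightarrow> real) \<Rightarrow> 'u) \<Rightarrow> bool" where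
  "cell_attachment X U A B m h \<longleftrightarrow>
     continuous_map (gtop (orbit_times G U (disc m))) (gtop X) h \<and>
     equivariant G (orbit_times G U (disc m)) X h \<and>
     B = A \<union> h ` ((lcosets U) \<times> topspace (disc m)) \<and>
     h ` ((lcosets U) \<times> topspace (disc_boundary m)) \<subseteq> A \<and>
     inj_on h ((lcosets U) \<times> (topspace (disc m) - topspace (disc_boundary m))) \<and>
     h ` ((lcosets U) \<times> (topspace (disc m) - topspace (disc_boundary m))) \<inter> A = {}"

text \<open>The map \<open>h\<close> carries the open cells bijectively onto the complement of
  \<open>A\<close> in \<open>B\<close>. A compatible pair of maps on \<open>A\<close> and on the
  closed cells hence defines exactly one function on \<open>B\<close>, and
  \<open>continuous_map_attach\<close> makes it continuous. The injection \<open>e\<close> places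
  the cells inside the universe.\<close>

lemma cell_attachment_pushout:
  fixes X :: "('a, 'u) gspace" and e :: "'a set \<times> (nat \<Rightarrow> real) \<Rightarrow> 'u"
  assumes e: "inj e" and U: "U \<in> fi_normal_subgroups G T" "U \<subseteq> U0"
    and X: "is_gspace G T X" "Hausdorff_space (gtop X)" and A: "closed_sub X A" and B: "closed_sub X B"
    and h: "cell_attachment X U A B m h"
  shows "\<exists>j\<in>U_cells G T U0. \<exists>g h. is_pushout GC j g h (inclusion X A B)"
proof -
  define D where "D = orbit_times G U (disc m)"
  define S where "S = orbit_times G U (disc_boundary m)"
  define P where "P = gspace_copy e D"
  define Q where "Q = gspace_copy e S"
  have tD: "topspace (gtop D) = (lcosets U) \<times> topspace (disc m)"
    and tS: "topspace (gtop S) = (lcosets U) \<times> topspace (disc_boundary m)"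
    by (simp_all add: D_def S_def topspace_orbit)
  have tP: "topspace (gtop P) = e ` topspace (gtop D)" and tQ: "topspace (gtop Q) = e ` topspace (gtop S)"
    by (simp_all add: P_def Q_def gspace_copy_simps topspace_copy_top[OF e])
  have P: "is_gspace G T P" and Q: "is_gspace G T Q"
    unfolding P_def Q_def D_def S_def
    by (rule is_gspace_orbit_copy[OF e U(1)]; rule compact_disc Hausdorff_disc compact_disc_boundary Hausdorff_disc_boundary)+
  have SD: "topspace (gtop S) \<subseteq> topspace (gtop D)"
    using topspace_disc_boundary_subset by (auto simp: tD tS)
  have gS: "gtop S = subtopology (gtop D) (topspace (gtop S))"
  proof -
    have "gtop S = prod_topology (discrete_topology (lcosets U)) (subtopology (disc m) (topspace (disc_boundary m)))"
      by (simp add: S_def orbit_times_def disc_boundary_eq[symmetric])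
    also have "\<dots> = subtopology (gtop D) (topspace (gtop S))"
      unfolding tS by (simp add: prod_topology_subtopology(2) D_def orbit_times_def)
    finally show ?thesis .
  qed
  have actDS: "gact S = gact D" by (simp add: S_def D_def orbit_times_def)
  have e1: "the_inv e (e p) = p" for p by (rule the_inv_f_f[OF e])
  have DS: "topspace (gtop D) - topspace (gtop S) = (lcosets U) \<times> (topspace (disc m) - topspace (disc_boundary m))"
    by (auto simp: tD tS)
  have hc: "continuous_map (gtop D) (gtop X) h" and he: "equivariant G D X h"
    and hB: "B = A \<union> h ` topspace (gtop D)" and hS: "h ` topspace (gtop S) \<subseteq> A"
    and hi: "inj_on h (topspace (gtop D) - topspace (gtop S))"
    and hd: "h ` (topspace (gtop D) - topspace (gtop S)) \<inter> A = {}"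
    using h unfolding cell_attachment_def D_def[symmetric] DS unfolding tD tS by simp_all
  have cP: "gtop P = copy_top e (gtop D)" and cQ: "gtop Q = copy_top e (gtop S)"
    by (simp_all add: P_def Q_def gspace_copy_simps)
  have aP: "gact P g (e p) = e (gact D g p)" and aQ: "gact Q g (e p) = e (gact D g p)" for g p
    by (simp_all add: P_def Q_def gspace_copy_simps[OF] e actDS gspace_copy_simps(2))
  have Dg: "gact D g p \<in> topspace (gtop D)" if "g \<in> carrier G" "p \<in> topspace (gtop D)" for g p
    using gact_topspace[OF P that(1), of "e p"] that(2) by (auto simp: tP aP dest: injD[OF e])
  define j where "j = mk_gmap Q P (\<lambda>x. x)"
  define g' where "g' = mk_gmap Q (sub_gspace X A) (\<lambda>x. h (the_inv e x))"
  define h' where "h' = mk_gmap P (sub_gspace X B) (\<lambda>x. h (the_inv e x))"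
  have j: "j \<in> homs GC Q P"
    unfolding j_def
  proof (rule mk_gmap_homs[OF Q P])
    have "continuous_map (gtop S) (gtop D) (\<lambda>x. x)"
      by (subst gS) (simp add: continuous_map_from_subtopology)
    from continuous_map_compose[OF continuous_map_compose[OF continuous_map_from_copy[OF e] this]
        continuous_map_into_copy[OF e]]
    have "continuous_map (gtop Q) (gtop P) (e \<circ> ((\<lambda>x. x) \<circ> the_inv e))"
      by (simp add: cP cQ)
    then show "continuous_map (gtop Q) (gtop P) (\<lambda>x. x)"
      by (rule continuous_map_eq) (auto simp: tQ e1)
    show "equivariant G Q P (\<lambda>x. x)"
      by (auto simp: equivariant_def tQ aP aQ)
  qed
  have XA: "is_gspace G T (sub_gspace X A)" and XB: "is_gspace G T (sub_gspace X B)"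
    using is_gspace_sub X A B by auto
  have hP: "continuous_map (gtop P) (gtop X) (\<lambda>x. h (the_inv e x))"
    using continuous_map_compose[OF continuous_map_from_copy[OF e] hc] by (simp add: cP o_def)
  have hQ: "continuous_map (gtop Q) (gtop X) (\<lambda>x. h (the_inv e x))"
  proof -
    have "continuous_map (gtop S) (gtop X) h"
      by (subst gS) (rule continuous_map_from_subtopology[OF hc])
    from continuous_map_compose[OF continuous_map_from_copy[OF e] this] show ?thesis
      by (simp add: cQ o_def)
  qed
  have g': "g' \<in> homs GC Q (sub_gspace X A)"
    unfolding g'_def
  proof (rule mk_gmap_homs[OF Q XA])
    show "continuous_map (gtop Q) (gtop (sub_gspace X A)) (\<lambda>x. h (the_inv e x))"
      using hQ hS by (auto simp: continuous_map_in_subtopology tQ e1)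
    show "equivariant G Q (sub_gspace X A) (\<lambda>x. h (the_inv e x))"
      using he SD by (auto simp: equivariant_def tQ e1 aQ)
  qed
  have h': "h' \<in> homs GC P (sub_gspace X B)"
    unfolding h'_def
  proof (rule mk_gmap_homs[OF P XB])
    show "continuous_map (gtop P) (gtop (sub_gspace X B)) (\<lambda>x. h (the_inv e x))"
      using hP hB by (auto simp: continuous_map_in_subtopology tP e1)
    show "equivariant G P (sub_gspace X B) (\<lambda>x. h (the_inv e x))"
      using he by (auto simp: equivariant_def tP e1 aP)
  qed
  have AB: "A \<subseteq> B" using hB by auto
  have i: "inclusion X A B \<in> homs GC (sub_gspace X A) (sub_gspace X B)"
    by (rule inclusion_homs[OF X A B AB])
  note topA = closed_sub_topspace[OF A] and topB = closed_sub_topspace[OF B]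
  have cell: "j \<in> U_cells G T U0"
    unfolding U_cells_def
  proof (intro CollectI conjI exI)
    show "j \<in> Ar GC" using j by (simp add: homs_def)
    show "fi_subgroup G T U" using U by (simp add: fi_normal_subgroups_def)
    show "U \<subseteq> U0" by (rule U(2))
    have hom: "homeomorphic_map Y (copy_top e Y) e" for Y
      using homeomorphic_maps_copy_top[OF e] homeomorphic_maps_map by blast
    show "g_homeo G (orbit_times G U (disc_boundary m)) (gdom j) e"
      unfolding S_def[symmetric] g_homeo_def
      using hom by (auto simp: j_def equivariant_def cQ aQ actDS)
    show "g_homeo G (orbit_times G U (disc m)) (gcod j) e"
      unfolding D_def[symmetric] g_homeo_def
      using hom by (auto simp: j_def equivariant_def cP aP)
    show "\<forall>x\<in>topspace (gtop (orbit_times G U (disc_boundary m))). gfun j (e x) = e x"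
      unfolding S_def[symmetric] by (simp add: j_def tQ)
  qed
  have "is_pushout GC j g' h' (inclusion X A B)"
    unfolding is_pushout_def
  proof (intro conjI ballI impI)
    show "j \<in> Ar GC" "g' \<in> Ar GC" "h' \<in> Ar GC" "inclusion X A B \<in> Ar GC"
      using j g' h' i by (simp_all add: homs_def)
    show "Dom GC j = Dom GC g'" "Cod GC j = Dom GC h'" "Cod GC g' = Dom GC (inclusion X A B)"
      "Cod GC h' = Cod GC (inclusion X A B)"
      by (simp_all add: j_def g'_def h'_def inclusion_def)
    have "h (the_inv e x) \<in> A" "x \<in> topspace (gtop P)" if "x \<in> topspace (gtop Q)" for x
      using that hS SD by (auto simp: tQ tP e1)
    moreover from this(1) have "h (the_inv e x) \<in> topspace (gtop X)" if "x \<in> topspace (gtop Q)" for x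
      using that closedin_subset[of "gtop X" A] A unfolding closed_sub_def by blast
    ultimately show "Comp GC h' j = Comp GC (inclusion X A B) g'"
      by (auto simp: j_def g'_def h'_def inclusion_def mk_gmap_def topA intro!: restrict_ext)
    fix E h'' k''
    assume E: "E \<in> Ob GC" and h'': "h'' \<in> homs GC (Cod GC j) E" and k'': "k'' \<in> homs GC (Cod GC g') E"
      and comm: "Comp GC h'' j = Comp GC k'' g'"
    have E': "is_gspace G T E" using E by simp
    have h2: "h'' \<in> homs GC P E" and k2: "k'' \<in> homs GC (sub_gspace X A) E"
      using h'' k'' by (simp_all add: j_def g'_def)
    \<comment> \<open>The inverse is taken over the open cells only, where \<open>h\<close> is
      injective; on the boundary \<open>h\<close> may identify points, but its values lie in
      \<open>A\<close> and the first branch applies.\<close>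
    define u where "u = (\<lambda>x. if x \<in> A then gfun k'' x else gfun h'' (e (inv_into (topspace (gtop D) - topspace (gtop S)) h x)))"
    have comm': "gfun k'' (h p) = gfun h'' (e p)" if "p \<in> topspace (gtop S)" for p
    proof -
      have x: "e p \<in> topspace (gtop Q)" using that by (simp add: tQ)
      have "gfun (Comp GC h'' j) (e p) = gfun (Comp GC k'' g') (e p)"
        by (simp only: comm)
      then show ?thesis using x by (simp add: j_def g'_def e1)
    qed
    have uh: "u (h p) = gfun h'' (e p)" if p: "p \<in> topspace (gtop D)" for p
    proof (cases "p \<in> topspace (gtop S)")
      case True
      then show ?thesis using hS comm' by (auto simp: u_def)
    next
      case False
      then have "h p \<notin> A" using p hd by blast
      then show ?thesis using False p by (simp add: u_def inv_into_f_f[OF hi])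
    qed
    have uA: "u x = gfun k'' x" if "x \<in> A" for x
      using that by (simp add: u_def)
    have cD: "compact_space (gtop D)"
      using U finite_rcosets_open by (auto simp: D_def orbit_times_def compact_space_prod_topology
          compact_space_discrete_topology compact_disc fi_normal_iff lcosets_normal normal_imp_subgroup)
    have uc: "continuous_map (subtopology (gtop X) B) (gtop E) u"
    proof (rule continuous_map_attach[OF X(2) _ cD hc hB])
      show "closedin (gtop X) A" using A by (simp add: closed_sub_def)
      have "continuous_map (subtopology (gtop X) A) (gtop E) (gfun k'')"
        using k2 by (simp add: in_homs_gspace_iff)
      then show "continuous_map (subtopology (gtop X) A) (gtop E) u"
        by (rule continuous_map_eq) (auto simp: uA)
      have "continuous_map (gtop P) (gtop E) (gfun h'')"
        using h2 by (simp add: in_homs_gspace_iff)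
      then have "continuous_map (gtop D) (gtop E) (gfun h'' \<circ> e)"
        using continuous_map_compose[OF continuous_map_into_copy[OF e]] by (simp add: cP)
      then show "continuous_map (gtop D) (gtop E) (u \<circ> h)"
        by (rule continuous_map_eq) (simp add: uh)
    qed
    have ue: "equivariant G (sub_gspace X B) E u"
      unfolding equivariant_def sub_gspace_simps topB
    proof (intro ballI)
      fix g x assume g: "g \<in> carrier G" and x: "x \<in> B"
      show "u (gact X g x) = gact E g (u x)"
      proof (cases "x \<in> A")
        case True
        then have "gact X g x \<in> A" using A g by (simp add: closed_sub_def)
        then show ?thesis
          using True k2 g topA by (auto simp: uA in_homs_gspace_iff equivariant_def)
      next
        case False
        then obtain p where p: "p \<in> topspace (gtop D)" "x = h p" using x hB by auto
        have "u (gact X g x) = u (h (gact D g p))"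
          using he g p by (simp add: equivariant_def)
        also have "\<dots> = gfun h'' (gact P g (e p))"
          using uh[OF Dg[OF g p(1)]] by (simp add: aP)
        also have "\<dots> = gact E g (gfun h'' (e p))"
          using h2 g p by (simp add: in_homs_gspace_iff equivariant_def tP)
        finally show ?thesis using uh[OF p(1)] p(2) by simp
      qed
    qed
    define w where "w = mk_gmap (sub_gspace X B) E u"
    have w: "w \<in> homs GC (sub_gspace X B) E"
      unfolding w_def by (rule mk_gmap_homs[OF XB E']) (use uc ue in auto)
    have wB: "gfun w x = u x" if "x \<in> B" for x
      using that topB by (simp add: w_def)
    show "\<exists>!w. w \<in> homs GC (Cod GC h') E \<and> Comp GC w h' = h'' \<and> Comp GC w (inclusion X A B) = k''"
    proof (rule ex1I[of _ w], intro conjI)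
      show "w \<in> homs GC (Cod GC h') E" using w by (simp add: h'_def)
      show "Comp GC w h' = h''"
      proof (rule homs_gspace_eqI[OF _ h2])
        show "Comp GC w h' \<in> homs GC P E"
          using comp_homs[OF h' w] by (simp add: h'_def w_def)
        show "gfun (Comp GC w h') x = gfun h'' x" if xP: "x \<in> topspace (gtop P)" for x
        proof -
          obtain p where p: "p \<in> topspace (gtop D)" "x = e p" using xP unfolding tP by (elim imageE)
          then have "h p \<in> B" using hB by blast
          then show ?thesis using xP p uh[OF p(1)] by (simp add: h'_def e1 wB)
        qed
      qed
      show "Comp GC w (inclusion X A B) = k''"
      proof (rule homs_gspace_eqI[OF _ k2])
        show "Comp GC w (inclusion X A B) \<in> homs GC (sub_gspace X A) E"
          using comp_homs[OF i w] by (simp add: inclusion_def w_def)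
        show "gfun (Comp GC w (inclusion X A B)) x = gfun k'' x" if "x \<in> topspace (gtop (sub_gspace X A))" for x
          using that AB unfolding sub_gspace_simps topA
          by (subst inclusion_comp[OF w A AB]) (auto simp: wB uA)
      qed
    next
      fix v assume v: "v \<in> homs GC (Cod GC h') E \<and> Comp GC v h' = h'' \<and> Comp GC v (inclusion X A B) = k''"
      then have v1: "v \<in> homs GC (sub_gspace X B) E" by (simp add: h'_def)
      show "v = w"
      proof (rule homs_gspace_eqI[OF v1 w])
        fix x assume "x \<in> topspace (gtop (sub_gspace X B))"
        then have x: "x \<in> B" by (simp only: sub_gspace_simps topB)
        show "gfun v x = gfun w x"
        proof (cases "x \<in> A")
          case True
          have "gfun v x = gfun (Comp GC v (inclusion X A B)) x"
            by (rule inclusion_comp[OF v1 A AB True, symmetric])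
          also have "\<dots> = gfun k'' x" using v by simp
          finally show ?thesis using True x by (simp add: wB uA)
        next
          case False
          then obtain p where p: "p \<in> topspace (gtop D)" "x = h p" using x hB by auto
          have "gfun (Comp GC v h') (e p) = gfun h'' (e p)" using v by simp
          then have "gfun v x = gfun h'' (e p)"
            using p by (simp add: h'_def tP e1)
          then show ?thesis using x p uh by (simp add: wB)
        qed
      qed
    qed
  qed
  then show ?thesis using cell by blast
qed

subsection \<open>Filtrations by closed subspaces\<close>

text \<open>All stages are closed invariant subspaces of one space and all transition maps are
  inclusions, so the universal properties become statements about single functions on
  \<open>X\<close>. As \<open>r\<close> has a last element, the colimit of the whole chain is simply
  the last stage; only proper limit stages need the weak topology.\<close>

lemma cell_filtration_complex:
  fixes X :: "('a, 'u) gspace" and e :: "'a set \<times> (nat \<Rightarrow> real) \<Rightarrow> 'u" and r :: "'u rel"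
  assumes e: "inj e" and U: "U \<in> fi_normal_subgroups G T" "U \<subseteq> U0"
    and X: "is_gspace G T X" "Hausdorff_space (gtop X)"
    and r: "Well_order r" and last: "l \<in> Field r" "\<And>b. b \<in> Field r \<Longrightarrow> (b, l) \<in> r"
    and A: "\<And>b. b \<in> Field r \<Longrightarrow> closed_sub X (A b)"
    and mono: "\<And>a b. (a, b) \<in> r \<Longrightarrow> A a \<subseteq> A b"
    and start: "\<And>b. b \<in> Field r \<Longrightarrow> underS r b = {} \<Longrightarrow> A b = {}"
    and whole: "A l = topspace (gtop X)"
    and succ: "\<And>a b. a \<in> underS r b \<Longrightarrow> underS r b = under r a \<Longrightarrow>
      \<exists>m h. cell_attachment X U (A a) (A b) m h"
    and limit: "\<And>b. b \<in> Field r \<Longrightarrow> underS r b \<noteq> {} \<Longrightarrow> (\<nexists>a. a \<in> underS r b \<and> underS r b = under r a) \<Longrightarrow>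
      A b = (\<Union>a\<in>underS r b. A a) \<and>
      (\<forall>B \<subseteq> A b. (\<forall>a\<in>underS r b. closedin (gtop X) (B \<inter> A a)) \<longrightarrow> closedin (gtop X) B)"
  shows "U_relative_cell_complex G T U0 (inclusion X {} (topspace (gtop X)))"
proof -
  define Z where "Z = (\<lambda>b. sub_gspace X (A b))"
  define z where "z = (\<lambda>a b. inclusion X (A a) (A b))"
  have fld: "a \<in> Field r" "b \<in> Field r" if "(a, b) \<in> r" for a b
    using that by (auto simp: Field_def)
  have fldS: "a \<in> Field r" "b \<in> Field r" "(a, b) \<in> r" if "a \<in> underS r b" for a b
    using that fld by (auto simp: underS_def)
  have top: "topspace (gtop (Z b)) = A b" if "b \<in> Field r" for b
    using closed_sub_topspace[OF A[OF that]] by (simp add: Z_def)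
  have Z: "is_gspace G T (Z b)" if "b \<in> Field r" for b
    unfolding Z_def by (rule is_gspace_sub[OF X A[OF that]])
  have z: "z a b \<in> homs GC (Z a) (Z b)" if "(a, b) \<in> r" for a b
    unfolding z_def Z_def by (rule inclusion_homs[OF X A[OF fld(1)[OF that]] A[OF fld(2)[OF that]] mono[OF that]])
  have zx: "gfun (Comp GC f (z a b)) x = gfun f x" if "(a, b) \<in> r" "f \<in> homs GC (Z b) E" "x \<in> A a" for a b f E x
    using inclusion_comp[of f X "A b" E "A a" x] A[OF fld(1)[OF that(1)]] mono[OF that(1)] that(2,3)
    by (simp add: z_def Z_def)
  have zid: "z a a = Ident GC (Z a)" for a
    by (simp add: z_def Z_def inclusion_def)
  have lin: "Linear_order r" using r by (simp add: well_order_on_def)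
  have refl: "(a, a) \<in> r" if "a \<in> Field r" for a
    using lin that by (auto simp: order_on_defs refl_on_def)
  have trans: "(a, c) \<in> r" if "(a, b) \<in> r" "(b, c) \<in> r" for a b c
    using lin that by (auto simp: order_on_defs dest: transD)
  have total: "(a, b) \<in> r \<or> (b, a) \<in> r" if "a \<in> Field r" "b \<in> Field r" for a b
    using lin that refl[OF that(1)] unfolding order_on_defs total_on_def by (cases "a = b") auto
  have compose: "Comp GC f (z a b) \<in> homs GC (Z a) E" if "(a, b) \<in> r" "f \<in> homs GC (Z b) E" for a b f E
    using comp_homs[OF z[OF that(1)] that(2)] that z[OF that(1)]
    by (auto simp: in_homs_gspace_iff[of f] in_homs_gspace_iff[of "z a b"])
  have chain: "is_chain GC r Z z"
    unfolding is_chain_def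
  proof (intro conjI ballI allI impI)
    show "Z a \<in> Ob GC" if "a \<in> Field r" for a using Z[OF that] by simp
    fix a b c assume abc: "(a, b) \<in> r \<and> (b, c) \<in> r"
    then have ac: "(a, c) \<in> r" using trans by blast
    show "z a c = Comp GC (z b c) (z a b)"
    proof (rule homs_gspace_eqI[OF z[OF ac]])
      show "Comp GC (z b c) (z a b) \<in> homs GC (Z a) (Z c)"
        using compose[OF _ z] abc by blast
      fix x assume "x \<in> topspace (gtop (Z a))"
      then have x: "x \<in> A a" using top fld(1) ac by simp
      moreover from this have "x \<in> A b" using mono abc by blast
      ultimately show "gfun (z a c) x = gfun (Comp GC (z b c) (z a b)) x"
        using zx[OF conjunct1[OF abc] z[OF conjunct2[OF abc]] x] top[OF fld(1)[OF ac]] top[OF fld(2)[OF conjunct1[OF abc]]]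
        by (simp add: z_def Z_def inclusion_def)
    qed
  qed (rule zid, rule z)
  have cocone_part: "chain_cocone GC r Z z S (Z b) (\<lambda>a. z a b)" if b: "b \<in> Field r" and S: "\<And>a. a \<in> S \<Longrightarrow> (a, b) \<in> r" for S b
    unfolding chain_cocone_def
  proof (intro conjI ballI impI)
    show "Z b \<in> Ob GC" using Z[OF b] by simp
    show "z a b \<in> homs GC (Z a) (Z b)" if "a \<in> S" for a using z[OF S[OF that]] .
    show "Comp GC (z c b) (z a c) = z a b" if "a \<in> S" "c \<in> S" "(a, c) \<in> r" for a c
      using chain S[OF that(2)] that(3) unfolding is_chain_def by metis
  qed
  have limit_colimit: "chain_colimit GC r Z z (underS r b) (Z b) (\<lambda>a. z a b)"
    if b: "b \<in> Field r" "underS r b \<noteq> {}" "\<nexists>a. a \<in> underS r b \<and> underS r b = under r a" for b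
    unfolding chain_colimit_def
  proof (intro conjI allI impI)
    show "chain_cocone GC r Z z (underS r b) (Z b) (\<lambda>a. z a b)"
      by (rule cocone_part[OF b(1) fldS(3)])
    fix E \<kappa> assume co: "chain_cocone GC r Z z (underS r b) E \<kappa>"
    have E: "is_gspace G T E" and \<kappa>: "\<And>a. a \<in> underS r b \<Longrightarrow> \<kappa> a \<in> homs GC (Z a) E"
      and comp: "\<And>a c. a \<in> underS r b \<Longrightarrow> c \<in> underS r b \<Longrightarrow> (a, c) \<in> r \<Longrightarrow> Comp GC (\<kappa> c) (z a c) = \<kappa> a"
      using co by (auto simp: chain_cocone_def)
    have un: "A b = (\<Union>a\<in>underS r b. A a)"
      and weak: "\<And>B. B \<subseteq> A b \<Longrightarrow> (\<And>a. a \<in> underS r b \<Longrightarrow> closedin (gtop X) (B \<inter> A a)) \<Longrightarrow> closedin (gtop X) B"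
      using limit[OF b] by auto
    have agree1: "gfun (\<kappa> a) x = gfun (\<kappa> c) x"
      if "a \<in> underS r b" "c \<in> underS r b" "(a, c) \<in> r" "x \<in> A a" for a c x
      using zx[OF that(3) \<kappa>[OF that(2)] that(4)] comp[OF that(1,2,3)] by simp
    have agree: "gfun (\<kappa> a) x = gfun (\<kappa> c) x"
      if "a \<in> underS r b" "c \<in> underS r b" "x \<in> A a" "x \<in> A c" for a c x
      using total[OF fldS(1)[OF that(1)] fldS(1)[OF that(2)]] agree1[OF that(1,2) _ that(3)] agree1[OF that(2,1) _ that(4)]
      by auto
    \<comment> \<open>Any earlier stage that contains \<open>x\<close> gives the same value, since
      two stages are always comparable and the cocone is compatible.\<close>
    define u where "u = (\<lambda>x. gfun (\<kappa> (SOME a. a \<in> underS r b \<and> x \<in> A a)) x)"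
    have u: "u x = gfun (\<kappa> a) x" if "a \<in> underS r b" "x \<in> A a" for a x
    proof -
      have "(SOME a. a \<in> underS r b \<and> x \<in> A a) \<in> underS r b \<and> x \<in> A (SOME a. a \<in> underS r b \<and> x \<in> A a)"
        by (rule someI[of "\<lambda>a. a \<in> underS r b \<and> x \<in> A a" a]) (use that in auto)
      then show ?thesis unfolding u_def using that by (intro agree) auto
    qed
    define w where "w = mk_gmap (Z b) E u"
    have w: "w \<in> homs GC (Z b) E"
      unfolding w_def
    proof (rule mk_gmap_homs[OF Z[OF b(1)] E])
      show "equivariant G (Z b) E u"
        unfolding equivariant_def top[OF b(1)]
      proof (intro ballI)
        fix g x assume g: "g \<in> carrier G" and "x \<in> A b"
        then obtain a where a: "a \<in> underS r b" "x \<in> A a" using un by auto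
        have "gact X g x \<in> A a" using A[OF fldS(1)[OF a(1)]] g a(2) by (simp add: closed_sub_def)
        then show "u (gact (Z b) g x) = gact E g (u x)"
          using \<kappa>[OF a(1)] g a top[OF fldS(1)[OF a(1)]]
          by (simp add: u[OF a(1)] in_homs_gspace_iff equivariant_def Z_def)
      qed
      show "continuous_map (gtop (Z b)) (gtop E) u"
        unfolding continuous_map_closedin top[OF b(1)]
      proof (intro conjI allI impI funcsetI)
        fix x assume "x \<in> A b"
        then obtain a where a: "a \<in> underS r b" "x \<in> A a" using un by auto
        then show "u x \<in> topspace (gtop E)"
          using homs_gspace_topspace[OF \<kappa>[OF a(1)]] top[OF fldS(1)[OF a(1)]] u by simp
      next
        fix C assume C: "closedin (gtop E) C"
        have "closedin (gtop X) {x \<in> A b. u x \<in> C}"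
        proof (rule weak)
          fix a assume a: "a \<in> underS r b"
          have "continuous_map (gtop (Z a)) (gtop E) (gfun (\<kappa> a))"
            using \<kappa>[OF a] by (simp add: in_homs_gspace_iff)
          from closedin_continuous_map_preimage[OF this C]
          have "closedin (gtop (Z a)) {x \<in> A a. gfun (\<kappa> a) x \<in> C}"
            unfolding top[OF fldS(1)[OF a]] .
          then have "closedin (subtopology (gtop X) (A a)) {x \<in> A a. gfun (\<kappa> a) x \<in> C}"
            by (simp add: Z_def)
          then have "closedin (gtop X) {x \<in> A a. gfun (\<kappa> a) x \<in> C}"
            using A[OF fldS(1)[OF a]] closedin_closed_subtopology unfolding closed_sub_def by blast
          moreover have "{x \<in> A b. u x \<in> C} \<inter> A a = {x \<in> A a. gfun (\<kappa> a) x \<in> C}"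
            using u[OF a] mono[OF fldS(3)[OF a]] by auto
          ultimately show "closedin (gtop X) ({x \<in> A b. u x \<in> C} \<inter> A a)" by simp
        qed auto
        then show "closedin (gtop (Z b)) {x \<in> A b. u x \<in> C}"
          unfolding Z_def sub_gspace_simps by (rule closedin_subset_topspace) auto
      qed
    qed
    show "\<exists>!w. w \<in> homs GC (Z b) E \<and> (\<forall>a\<in>underS r b. Comp GC w (z a b) = \<kappa> a)"
    proof (rule ex1I[of _ w], intro conjI ballI)
      show "w \<in> homs GC (Z b) E" by (rule w)
      fix a assume a: "a \<in> underS r b"
      show "Comp GC w (z a b) = \<kappa> a"
      proof (rule homs_gspace_eqI[OF compose[OF fldS(3)[OF a] w] \<kappa>[OF a]])
        fix x assume "x \<in> topspace (gtop (Z a))"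
        then have x: "x \<in> A a" using top[OF fldS(1)[OF a]] by simp
        have "x \<in> A b" using mono[OF fldS(3)[OF a]] x by blast
        then show "gfun (Comp GC w (z a b)) x = gfun (\<kappa> a) x"
          using zx[OF fldS(3)[OF a] w x] u[OF a x] top[OF b(1)] by (simp add: w_def)
      qed
    next
      fix v assume v: "v \<in> homs GC (Z b) E \<and> (\<forall>a\<in>underS r b. Comp GC v (z a b) = \<kappa> a)"
      show "v = w"
      proof (rule homs_gspace_eqI[OF conjunct1[OF v] w])
        fix x assume "x \<in> topspace (gtop (Z b))"
        then have xb: "x \<in> A b" using top[OF b(1)] by simp
        then obtain a where a: "a \<in> underS r b" "x \<in> A a" using un by auto
        have "gfun v x = gfun (\<kappa> a) x"
          using zx[OF fldS(3)[OF a(1)] conjunct1[OF v] a(2)] v a(1) by simp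
        then show "gfun v x = gfun w x"
          using u[OF a] xb top[OF b(1)] by (simp add: w_def)
      qed
    qed
  qed
  have total_colimit: "chain_colimit GC r Z z (Field r) (Z l) (\<lambda>a. z a l)"
    unfolding chain_colimit_def
  proof (intro conjI allI impI)
    show "chain_cocone GC r Z z (Field r) (Z l) (\<lambda>a. z a l)"
      by (rule cocone_part[OF last])
    fix E \<kappa> assume co: "chain_cocone GC r Z z (Field r) E \<kappa>"
    have \<kappa>: "\<kappa> l \<in> homs GC (Z l) E" and comp: "\<And>a. a \<in> Field r \<Longrightarrow> Comp GC (\<kappa> l) (z a l) = \<kappa> a"
      using co last by (auto simp: chain_cocone_def)
    show "\<exists>!w. w \<in> homs GC (Z l) E \<and> (\<forall>a\<in>Field r. Comp GC w (z a l) = \<kappa> a)"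
    proof (rule ex1I[of _ "\<kappa> l"])
      fix v assume v: "v \<in> homs GC (Z l) E \<and> (\<forall>a\<in>Field r. Comp GC v (z a l) = \<kappa> a)"
      have "Comp GC v (z l l) = v"
        using category_gspace_cat v unfolding category_def zid by (auto simp: homs_def)
      then show "v = \<kappa> l" using v last(1) by metis
    qed (use \<kappa> comp in auto)
  qed
  \<comment> \<open>A least element of the order is needed as the start of the chain; its stage is
    empty by \<open>start\<close>.\<close>
  have "wf (r - Id)" using r by (simp add: well_order_on_def)
  then obtain a where a: "a \<in> Field r" "\<And>y. (y, a) \<in> r - Id \<Longrightarrow> y \<notin> Field r"
    using last(1) by (rule wfE_min) blast
  have aS: "underS r a = {}"
    using a(2) fld(1) by (auto simp: underS_def)
  have f: "inclusion X {} (topspace (gtop X)) = z a l"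
    using start[OF a(1) aS] whole by (simp add: z_def)
  have "cell_composition GC (U_cells G T U0) r Z z (inclusion X {} (topspace (gtop X)))"
    unfolding cell_composition_def
  proof (intro conjI allI impI ballI)
    show "Field r \<noteq> {}" using last(1) by auto
    show "\<exists>j\<in>U_cells G T U0. \<exists>g h. is_pushout GC j g h (z a b)" if "a \<in> underS r b \<and> underS r b = under r a" for a b
    proof -
      note ab = conjunct1[OF that] conjunct2[OF that]
      obtain m h where "cell_attachment X U (A a) (A b) m h"
        using succ[OF ab] by (elim exE)
      from cell_attachment_pushout[OF e U X A[OF fldS(1)[OF ab(1)]] A[OF fldS(2)[OF ab(1)]] this]
      show ?thesis by (simp add: z_def)
    qed
    show "\<exists>d \<iota>. chain_colimit GC r Z z (Field r) d \<iota> \<and>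
        (\<exists>a\<in>Field r. underS r a = {} \<and> inclusion X {} (topspace (gtop X)) = \<iota> a)"
      using total_colimit a(1) aS f by blast
  qed (use r chain limit_colimit in auto)
  then show ?thesis
    unfolding U_relative_cell_complex_def by blast
qed

text \<open>The cell complex starts at \<open>sub_gspace X {}\<close>, which may differ from
  \<open>empty_gspace\<close> in its action function only. The two are isomorphic by unique maps,
  which presents \<open>f\<close> as a retract of the complex.\<close>

lemma U_cofibration_empty:
  fixes X :: "('a, 'u) gspace"
  assumes X: "is_gspace G T X" "Hausdorff_space (gtop X)"
    and c: "U_relative_cell_complex G T U0 (inclusion X {} (topspace (gtop X)))"
    and f: "f \<in> homs GC empty_gspace X"
  shows "U_cofibration G T U0 f"
  unfolding U_cofibration_def
proof (intro exI conjI)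
  let ?Z = "sub_gspace X {}"
  let ?g = "inclusion X {} (topspace (gtop X))"
  have cl: "closed_sub X {}" "closed_sub X (topspace (gtop X))"
    using gact_topspace[OF X(1)] by (auto simp: closed_sub_def)
  have g: "?g \<in> homs GC ?Z X"
    using inclusion_homs[OF X cl] by (simp add: sub_gspace_topspace)
  have Z: "is_gspace G T ?Z" by (rule is_gspace_sub[OF X cl(1)])
  have E: "is_gspace G T empty_gspace" "topspace (gtop empty_gspace) = {}"
    using is_gspace_empty by (auto simp: empty_gspace_def)
  have uniq: "u = v" if "u \<in> homs GC Y W" "v \<in> homs GC Y W" "topspace (gtop Y) = {}" for u v Y and W :: "('a, 'u) gspace"
    using that by (intro homs_gspace_eqI[OF that(1,2)]) auto
  obtain i where i: "i \<in> homs GC empty_gspace ?Z" using homs_from_empty[OF E Z] by blast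
  have tZ: "topspace (gtop ?Z) = {}" by simp
  obtain k where k: "k \<in> homs GC ?Z empty_gspace" using homs_from_empty[OF Z tZ E(1)] by blast
  have comp: "Comp GC b a \<in> homs GC P R" if "a \<in> homs GC P Q" "b \<in> homs GC Q R" for a b and P Q R :: "('a, 'u) gspace"
    using comp_homs[OF that] that by (simp add: in_homs_gspace_iff)
  have dom: "Dom GC f = empty_gspace" "Cod GC f = X" "Dom GC ?g = ?Z" "Cod GC ?g = X"
    using f g by (auto simp: homs_def)
  have id: "Ident GC Y \<in> homs GC Y Y" if "is_gspace G T Y" for Y :: "('a, 'u) gspace"
    using ident_homs[OF that] by simp
  show "U_relative_cell_complex G T U0 ?g" by (rule c)
  show "arrow_retract GC f ?g"
    unfolding arrow_retract_def dom
  proof (intro conjI bexI)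
    show "f \<in> Ar GC" "?g \<in> Ar GC" using f g by (auto simp: homs_def)
    show "Comp GC k i = Ident GC empty_gspace"
      by (rule uniq[OF comp[OF i k] id[OF E(1)] E(2)])
    show "Comp GC (Ident GC X) (Ident GC X) = Ident GC X"
      using homs_gspace_eqI[OF comp[OF id[OF X(1)] id[OF X(1)]] id[OF X(1)]] by simp
    show "Comp GC ?g i = Comp GC (Ident GC X) f"
      by (rule uniq[OF comp[OF i g] comp[OF f id[OF X(1)]] E(2)])
    show "Comp GC f k = Comp GC (Ident GC X) ?g"
      by (rule uniq[OF comp[OF k f] comp[OF g id[OF X(1)]] tZ])
  qed (use i k id[OF X(1)] in auto)
qed

end

section \<open>The cell structure of \<open>E(G/U)\<close>\<close>

subsection \<open>Well-ordering the cells\<close>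

text \<open>Cells are attached one orbit at a time.  The orbits of cells are represented by the words that
  start with the unit, and are ordered first by length, so that the boundary of a cell is
  attached earlier; \<open>None\<close> stands for the final stage.\<close>

definition word_order :: "'s list rel" where
  "word_order = (SOME r. well_order_on UNIV r)"

fun stage_key :: "'s list option \<Rightarrow> nat \<times> nat \<times> 's list" where
  "stage_key None = (1, 0, [])"
| "stage_key (Some w) = (0, length w, w)"

text \<open>Words of equal length are ordered by an arbitrary well-order. The key is injective, so
  that the lexicographic order pulls back to a total one.\<close>

definition stage_less :: "'s list option rel" where
  "stage_less = inv_image (less_than <*lex*> less_than <*lex*> (word_order - Id)) stage_key"

lemma word_order: "well_order_on UNIV word_order"
  unfolding word_order_def by (rule someI_ex) (rule well_order_on)

lemma wf_stage_less: "wf stage_less"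
  using word_order unfolding stage_less_def well_order_on_def
  by (intro wf_inv_image wf_lex_prod wf_less_than) auto

lemma trans_stage_less: "trans stage_less"
proof -
  have "trans (word_order - Id)"
    using word_order unfolding well_order_on_def linear_order_on_def partial_order_on_def preorder_on_def
    by (intro trans_diff_Id) auto
  then show ?thesis
    unfolding stage_less_def by (intro trans_inv_image trans_lex_prod trans_less_than)
qed

lemma stage_less_total:
  assumes "x \<noteq> y"
  shows "(x, y) \<in> stage_less \<or> (y, x) \<in> stage_less"
proof (cases x; cases y)
  fix v w assume xy: "x = Some v" "y = Some w"
  then have "(v, w) \<in> word_order \<or> (w, v) \<in> word_order"
    using word_order assms by (auto simp: well_order_on_def linear_order_on_def total_on_def)
  then show ?thesis
    using xy assms by (auto simp: stage_less_def)
qed (use assms in \<open>auto simp: stage_less_def\<close>)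

lemma stage_less_None: "(Some w, None) \<in> stage_less"
  by (simp add: stage_less_def)

lemma stage_less_None_left: "(None, x) \<notin> stage_less"
  by (cases x) (simp_all add: stage_less_def)

lemma stage_less_length: "length v < length w \<Longrightarrow> (Some v, Some w) \<in> stage_less"
  by (simp add: stage_less_def)

lemma stage_less_irrefl: "(x, x) \<notin> stage_less"
  using wf_stage_less by (rule wf_not_refl)

lemma stage_less_trans: "(x, y) \<in> stage_less \<Longrightarrow> (y, z) \<in> stage_less \<Longrightarrow> (x, z) \<in> stage_less"
  using trans_stage_less by (rule transD)

text \<open>Turns a strict well-founded total order into the reflexive form of the library,
  restricted to the set of stages.\<close>

lemma Well_order_reflexive_closure:
  assumes "wf L" "trans L" and total: "\<And>x y. x \<in> F \<Longrightarrow> y \<in> F \<Longrightarrow> x \<noteq> y \<Longrightarrow> (x, y) \<in> L \<or> (y, x) \<in> L"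
  defines "r \<equiv> {(x, y). x \<in> F \<and> y \<in> F \<and> (x = y \<or> (x, y) \<in> L)}"
  shows "Well_order r" "Field r = F"
    "b \<in> F \<Longrightarrow> underS r b = {a \<in> F. (a, b) \<in> L}"
    "a \<in> F \<Longrightarrow> under r a = {x \<in> F. x = a \<or> (x, a) \<in> L}"
proof -
  show F: "Field r = F" by (auto simp: Field_def r_def)
  have irr: "(x, x) \<notin> L" for x using assms(1) by (rule wf_not_refl)
  have asym: "(x, y) \<in> L \<Longrightarrow> (y, x) \<notin> L" for x y
    using assms(1) by (rule wf_not_sym)
  have "wf (r - Id)"
    by (rule wf_subset[OF assms(1)]) (auto simp: r_def)
  moreover have "Refl r" unfolding F refl_on_def by (auto simp: r_def)
  moreover have "trans r"
    using assms(2) unfolding trans_def r_def by blast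
  moreover have "antisym r"
    using asym unfolding antisym_def r_def by blast
  moreover have "total_on (Field r) r"
    unfolding F using total unfolding total_on_def r_def by blast
  moreover have "r \<subseteq> Field r \<times> Field r" by (auto simp: Field_def)
  ultimately show "Well_order r"
    unfolding well_order_on_def linear_order_on_def partial_order_on_def preorder_on_def by simp
  show "underS r b = {a \<in> F. (a, b) \<in> L}" if "b \<in> F"
    using that irr by (auto simp: underS_def r_def)
  show "under r a = {x \<in> F. x = a \<or> (x, a) \<in> L}" if "a \<in> F"
    using that by (auto simp: under_def r_def)
qed

text \<open>An injective relabelling neither creates nor destroys equal neighbours.\<close>

lemma remdups_adj_map_inj_on: "inj_on f (set xs) \<Longrightarrow> remdups_adj (map f xs) = map f (remdups_adj xs)"
  by (induction xs rule: remdups_adj.induct) (auto simp: inj_on_def)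

lemma bar_word_map:
  assumes "inj_on f S" "ps \<in> bar_pts S"
  shows "bar_word (map (map_prod f id) ps) = map f (bar_word ps)"
proof -
  have "inj_on f (set (map fst (filter (\<lambda>p. snd p \<noteq> 0) ps)))"
    using assms by (auto simp: bar_pts_def intro: inj_on_subset)
  from remdups_adj_map_inj_on[OF this] show ?thesis
    by (simp add: bar_word_def filter_map o_def)
qed

lemma bar_words_map:
  assumes "inj_on f S" "f ` S \<subseteq> S'" "w \<in> bar_words S"
  shows "map f w \<in> bar_words S'"
  using assms by (auto simp: bar_words_def intro!: distinct_adj_mapI intro: inj_on_subset)

text \<open>Closedness is tested on one simplex at a time. A simplex meets finitely many open cells,
  and those among them that belong to \<open>D\<close> already occur in a single \<open>E a\<close>;
  on this simplex \<open>B\<close> therefore coincides with its part in the closed set given for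
  \<open>a\<close>.\<close>

lemma closedin_bar_top_weak:
  assumes B: "B \<subseteq> bar_sub S D"
    and fin: "\<And>W. finite W \<Longrightarrow> W \<subseteq> D \<Longrightarrow> \<exists>a\<in>I. W \<subseteq> E a"
    and cl: "\<And>a. a \<in> I \<Longrightarrow> closedin (bar_top S) (B \<inter> bar_sub S (E a))"
  shows "closedin (bar_top S) B"
proof (rule closedin_bar_topI)
  show "B \<subseteq> topspace (bar_top S)" using B bar_sub_topspace by blast
  fix xs :: "'a list" assume xs: "xs \<noteq> []" "set xs \<subseteq> S"
  define \<Delta> where "\<Delta> = standard_simplex (length xs - 1)"
  have "finite ({bar_word (bar_zip xs t) | t. t \<in> \<Delta>} \<inter> D)"
    using finite_bar_chart_words[of xs \<Delta>] by blast
  from fin[OF this] obtain a where a: "a \<in> I" "{bar_word (bar_zip xs t) | t. t \<in> \<Delta>} \<inter> D \<subseteq> E a"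
    by auto
  have "bar_chart S xs t \<in> bar_sub S (E a)" if t: "t \<in> \<Delta>" "bar_chart S xs t \<in> B" for t
  proof -
    have "bar_class S (bar_zip xs t) \<in> bar_sub S D"
      using t B by (auto simp: bar_chart_eq)
    then show ?thesis
      using a(2) t(1) unfolding bar_chart_eq bar_class_in_sub by blast
  qed
  then have "{t \<in> topspace (simplex_top (length xs - 1)). bar_chart S xs t \<in> B \<inter> bar_sub S (E a)}
      = {t \<in> standard_simplex (length xs - 1). bar_chart S xs t \<in> B}"
    by (auto simp: \<Delta>_def)
  then show "closedin (simplex_top (length xs - 1)) {t \<in> standard_simplex (length xs - 1). bar_chart S xs t \<in> B}"
    using closedin_continuous_map_preimage[OF continuous_map_bar_chart[OF xs] cl[OF a(1)]] by simp
qed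

context group
begin

section \<open>Orbits of cells under left translation\<close>

lemma inj_on_translation: "a \<in> carrier G \<Longrightarrow> inj_on (\<lambda>c. a \<otimes> c) (carrier G)"
  by (auto simp: inj_on_def)

lemma translation_closed: "a \<in> carrier G \<Longrightarrow> (\<lambda>c. a \<otimes> c) ` carrier G \<subseteq> carrier G"
  by auto

text \<open>The chosen representative of the orbit of a word: left translation is free on words and
  moves the first letter to any prescribed element.\<close>

definition word_norm :: "'a list \<Rightarrow> 'a list" where
  "word_norm w = map (\<lambda>c. inv (hd w) \<otimes> c) w"

lemma length_word_norm [simp]: "length (word_norm w) = length w"
  by (simp add: word_norm_def)

lemma bar_words_hd: "w \<in> bar_words (carrier G) \<Longrightarrow> hd w \<in> carrier G"
  by (auto simp: bar_words_def)

lemma bar_words_translation: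
  "a \<in> carrier G \<Longrightarrow> w \<in> bar_words (carrier G) \<Longrightarrow> map (\<lambda>c. a \<otimes> c) w \<in> bar_words (carrier G)"
  by (rule bar_words_map[OF inj_on_translation translation_closed])

lemma word_norm_in: "w \<in> bar_words (carrier G) \<Longrightarrow> word_norm w \<in> bar_words (carrier G)"
  unfolding word_norm_def by (intro bar_words_translation inv_closed bar_words_hd)

lemma hd_word_norm: "w \<in> bar_words (carrier G) \<Longrightarrow> hd (word_norm w) = \<one>"
  using bar_words_hd[of w] by (auto simp: word_norm_def bar_words_def hd_map)

lemma map_word_norm: "w \<in> bar_words (carrier G) \<Longrightarrow> map (\<lambda>c. hd w \<otimes> c) (word_norm w) = w"
  using bar_words_hd[of w]
  by (auto simp: word_norm_def bar_words_def m_assoc[symmetric] intro!: map_idI)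

lemma word_norm_translation:
  assumes "a \<in> carrier G" "w \<in> bar_words (carrier G)"
  shows "word_norm (map (\<lambda>c. a \<otimes> c) w) = word_norm w"
proof -
  have "inv (a \<otimes> hd w) \<otimes> (a \<otimes> c) = inv (hd w) \<otimes> c" if "c \<in> carrier G" for c
    using assms(1) bar_words_hd[OF assms(2)] that
    by (simp add: inv_mult_group m_assoc) (simp add: m_assoc[symmetric])
  then show ?thesis
    using assms(2) by (auto simp: word_norm_def bar_words_def hd_map)
qed

lemma word_norm_id: "w \<in> bar_words (carrier G) \<Longrightarrow> hd w = \<one> \<Longrightarrow> word_norm w = w"
  by (auto simp: word_norm_def bar_words_def intro!: map_idI)

definition stages :: "'a list option set" where
  "stages = insert None (Some ` {w \<in> bar_words (carrier G). hd w = \<one>})"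

text \<open>The order is strict: the stage \<open>Some w\<close> is the complex to which the orbit
  of \<open>w\<close> has still to be attached. The least stage is therefore empty, and
  \<open>None\<close> yields all words.\<close>

definition stage_words :: "'a list option \<Rightarrow> 'a list set" where
  "stage_words y = {w \<in> bar_words (carrier G). (Some (word_norm w), y) \<in> stage_less}"

lemma word_norm_stage: "w \<in> bar_words (carrier G) \<Longrightarrow> Some (word_norm w) \<in> stages"
  by (simp add: stages_def word_norm_in hd_word_norm)

lemma word_closed_stage_words: "word_closed (carrier G) (stage_words y)"
  unfolding word_closed_def stage_words_def
proof clarify
  fix v w :: "'a list" assume "length v < length w" and w: "(Some (word_norm w), y) \<in> stage_less"
  then have "(Some (word_norm v), Some (word_norm w)) \<in> stage_less"
    by (intro stage_less_length) simp
  then show "(Some (word_norm v), y) \<in> stage_less"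
    using w by (rule stage_less_trans)
qed

lemma stage_words_translation:
  "a \<in> carrier G \<Longrightarrow> w \<in> stage_words y \<Longrightarrow> map (\<lambda>c. a \<otimes> c) w \<in> stage_words y"
  by (simp add: stage_words_def bar_words_translation word_norm_translation)

lemma stage_words_None: "stage_words None = bar_words (carrier G)"
  by (auto simp: stage_words_def stage_less_None)

lemma stage_words_mono: "(x, y) \<in> stage_less \<Longrightarrow> stage_words x \<subseteq> stage_words y"
  by (auto simp: stage_words_def intro: stage_less_trans)

lemma bar_sub_translation:
  assumes a: "a \<in> carrier G" and x: "x \<in> bar_sub (carrier G) (stage_words y)"
  shows "bar_map (carrier G) (\<lambda>c. a \<otimes> c) x \<in> bar_sub (carrier G) (stage_words y)"
proof -
  obtain ps where ps: "x = bar_class (carrier G) ps" "ps \<in> bar_pts (carrier G)" "bar_word ps \<in> stage_words y"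
    using x by (auto simp: bar_sub_def)
  show ?thesis
    unfolding ps(1) bar_map_class[OF translation_closed[OF a]] bar_class_in_sub
    using ps(2,3) by (simp add: bar_pts_map[OF translation_closed[OF a]]
        bar_word_map[OF inj_on_translation[OF a]] stage_words_translation[OF a])
qed

definition cell_map :: "'a list \<Rightarrow> 'a \<times> (nat \<Rightarrow> real) \<Rightarrow> ('a \<times> real) list set" where
  "cell_map w = (\<lambda>(c, y). bar_chart (carrier G) (map (\<lambda>s. c \<otimes> s) w) (disc_to_simplex (length w - 1) y))"

context
  fixes w m
  assumes w: "w \<in> bar_words (carrier G)" "hd w = \<one>" and m: "m = length w - 1"
begin

lemma cell_map_simplex:
  assumes "c \<in> carrier G" "y \<in> topspace (disc m)"
  shows "map (\<lambda>s. c \<otimes> s) w \<in> bar_words (carrier G)"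
    and "disc_to_simplex m y \<in> standard_simplex (length (map (\<lambda>s. c \<otimes> s) w) - 1)"
    and "bar_zip (map (\<lambda>s. c \<otimes> s) w) (disc_to_simplex m y) \<in> bar_pts (carrier G)"
    and "cell_map w (c, y) = bar_class (carrier G) (bar_zip (map (\<lambda>s. c \<otimes> s) w) (disc_to_simplex m y))"
proof -
  show *: "map (\<lambda>s. c \<otimes> s) w \<in> bar_words (carrier G)"
    using assms(1) w(1) by (rule bar_words_translation)
  show **: "disc_to_simplex m y \<in> standard_simplex (length (map (\<lambda>s. c \<otimes> s) w) - 1)"
    using assms(2) disc_to_simplex_in[of m y] by (simp add: topspace_disc m)
  show "bar_zip (map (\<lambda>s. c \<otimes> s) w) (disc_to_simplex m y) \<in> bar_pts (carrier G)"
    using * by (intro bar_zip_pts **) (auto simp: bar_words_def)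
  show "cell_map w (c, y) = bar_class (carrier G) (bar_zip (map (\<lambda>s. c \<otimes> s) w) (disc_to_simplex m y))"
    by (simp add: cell_map_def bar_chart_eq m)
qed

lemma cell_map_interior:
  assumes "c \<in> carrier G" "y \<in> topspace (disc m) - topspace (disc_boundary m)"
  shows "disc_to_simplex m y \<in> open_simplex m"
    and "bar_word (bar_zip (map (\<lambda>s. c \<otimes> s) w) (disc_to_simplex m y)) = map (\<lambda>s. c \<otimes> s) w"
proof -
  show *: "disc_to_simplex m y \<in> open_simplex m"
    using assms(2) disc_to_simplex_open_iff[of m y] by (auto simp: topspace_disc topspace_disc_boundary)
  show "bar_word (bar_zip (map (\<lambda>s. c \<otimes> s) w) (disc_to_simplex m y)) = map (\<lambda>s. c \<otimes> s) w"
    using cell_map_simplex(1)[of c y] assms * by (intro bar_word_chart_interior[of _ "carrier G"]) (auto simp: m)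
qed

lemma cell_map_boundary:
  assumes "c \<in> carrier G" "y \<in> topspace (disc_boundary m)"
  shows "cell_map w (c, y) \<in> bar_sub (carrier G) (stage_words (Some w))"
proof -
  have y: "y \<in> topspace (disc m)" using assms(2) topspace_disc_boundary_subset by blast
  note cell = cell_map_simplex[OF assms(1) y]
  have "disc_to_simplex m y \<notin> open_simplex m"
    using assms(2) disc_to_simplex_open_iff[of m y] by (auto simp: topspace_disc_boundary)
  then have "length (bar_word (bar_zip (map (\<lambda>s. c \<otimes> s) w) (disc_to_simplex m y))) < length (map (\<lambda>s. c \<otimes> s) w)"
    using cell(1,2) by (intro bar_word_chart_boundary) (auto simp: bar_words_def m)
  then show ?thesis
    unfolding cell(4) bar_class_in_sub
    using cell(3) bar_word_in[OF cell(3)] by (auto simp: stage_words_def intro: stage_less_length)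
qed

lemma cell_map_disjoint:
  assumes "c \<in> carrier G" "y \<in> topspace (disc m) - topspace (disc_boundary m)"
  shows "cell_map w (c, y) \<notin> bar_sub (carrier G) (stage_words (Some w))"
  using cell_map_simplex[of c y] cell_map_interior[OF assms] assms
  by (auto simp: bar_class_in_sub stage_words_def word_norm_translation[OF _ w(1)] word_norm_id[OF w] stage_less_irrefl)

text \<open>Uniqueness of normal forms gives equal translated words and equal interior points. As
  \<open>w\<close> starts with the unit, the first letter of a translate is the translating element,
  so the cells of one orbit are distinct.\<close>

lemma cell_map_inj:
  "inj_on (cell_map w) (carrier G \<times> (topspace (disc m) - topspace (disc_boundary m)))"
proof (rule inj_onI, clarify)
  fix c y c' y'
  assume c: "c \<in> carrier G" and y: "y \<in> topspace (disc m)" "y \<notin> topspace (disc_boundary m)"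
    and c': "c' \<in> carrier G" and y': "y' \<in> topspace (disc m)" "y' \<notin> topspace (disc_boundary m)"
    and eq: "cell_map w (c, y) = cell_map w (c', y')"
  have "map (\<lambda>s. c \<otimes> s) w = map (\<lambda>s. c' \<otimes> s) w \<and> disc_to_simplex m y = disc_to_simplex m y'"
  proof (rule bar_chart_interior_inj)
    show "bar_chart (carrier G) (map (\<lambda>s. c \<otimes> s) w) (disc_to_simplex m y)
        = bar_chart (carrier G) (map (\<lambda>s. c' \<otimes> s) w) (disc_to_simplex m y')"
      using eq by (simp add: cell_map_def m)
  qed (use cell_map_simplex(1)[OF c y(1)] cell_map_simplex(1)[OF c' y'(1)]
        cell_map_interior(1)[OF c, of y] cell_map_interior(1)[OF c', of y'] y y' in \<open>auto simp: m\<close>)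
  then have maps: "map (\<lambda>s. c \<otimes> s) w = map (\<lambda>s. c' \<otimes> s) w" and d: "disc_to_simplex m y = disc_to_simplex m y'"
    by auto
  have "w \<noteq> []" using w by (auto simp: bar_words_def)
  then have "c \<otimes> hd w = c' \<otimes> hd w"
    using maps by (metis hd_map)
  then have "c = c'" using w(2) c c' by simp
  moreover have "y = y'"
    by (rule disc_to_simplex_inj[OF _ _ d]) (use y(1) y'(1) in \<open>simp_all add: topspace_disc\<close>)
  ultimately show "c = c' \<and> y = y'" by simp
qed

text \<open>The interior of the orbit of cells consists of the open cells named by translates of
  \<open>w\<close>; its boundary was attached before. Each translate is hit, because every interior
  point comes from the disc.\<close>

lemma cell_map_image:
  "bar_sub (carrier G) (stage_words (Some w) \<union> {v \<in> bar_words (carrier G). word_norm v = w})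
    = bar_sub (carrier G) (stage_words (Some w)) \<union> cell_map w ` (carrier G \<times> topspace (disc m))"
  (is "bar_sub _ ?D = ?R")
proof (intro equalityI subsetI)
  fix x assume "x \<in> bar_sub (carrier G) ?D"
  then obtain ps where ps: "x = bar_class (carrier G) ps" "ps \<in> bar_pts (carrier G)" "bar_word ps \<in> ?D"
    by (auto simp: bar_sub_def)
  show "x \<in> ?R"
  proof (cases "bar_word ps \<in> stage_words (Some w)")
    case True
    then show ?thesis using ps by (auto simp: bar_sub_def)
  next
    case False
    then have v: "bar_word ps \<in> bar_words (carrier G)" "word_norm (bar_word ps) = w"
      using ps(3) by auto
    \<comment> \<open>The first letter is the element that translates the representative
      \<open>w\<close> to the word of the point.\<close>
    define c where "c = hd (bar_word ps)"
    have c: "c \<in> carrier G" using bar_words_hd[OF v(1)] by (simp add: c_def)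
    have vw: "map (\<lambda>s. c \<otimes> s) w = bar_word ps"
      using map_word_norm[OF v(1)] v(2) by (simp add: c_def)
    then have len: "length (bar_word ps) = length w" by (metis length_map)
    obtain t where t: "t \<in> open_simplex (length (bar_word ps) - 1)"
      "bar_class (carrier G) ps = bar_chart (carrier G) (bar_word ps) t"
      by (rule bar_top_interior_cases[OF ps(2)])
    then have "t \<in> standard_simplex m"
      by (simp add: open_simplex_def m len)
    then obtain y where y: "y \<in> topspace (disc m)" "disc_to_simplex m y = t"
      by (rule disc_to_simplex_surj)
    have "x = cell_map w (c, y)"
      using ps(1) t(2) y(2) vw by (simp add: cell_map_def m)
    then show ?thesis using c y(1) by blast
  qed
next
  fix x assume "x \<in> ?R"
  then consider "x \<in> bar_sub (carrier G) (stage_words (Some w))"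
    | c y where "x = cell_map w (c, y)" "c \<in> carrier G" "y \<in> topspace (disc m)"
    by auto
  then show "x \<in> bar_sub (carrier G) ?D"
  proof cases
    case 1
    then show ?thesis by (auto simp: bar_sub_def)
  next
    case 2
    show ?thesis
    proof (cases "y \<in> topspace (disc_boundary m)")
      case True
      then show ?thesis using cell_map_boundary[OF 2(2)] 2(1) by (auto simp: bar_sub_def)
    next
      case False
      then have "bar_word (bar_zip (map (\<lambda>s. c \<otimes> s) w) (disc_to_simplex m y)) \<in> ?D"
        using cell_map_interior(2)[OF 2(2), of y] 2(2,3) cell_map_simplex(1)[OF 2(2,3)]
        by (simp add: word_norm_translation[OF _ w(1)] word_norm_id[OF w])
      then show ?thesis
        unfolding 2(1) cell_map_simplex(4)[OF 2(2,3)] bar_class_in_sub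
        using cell_map_simplex(3)[OF 2(2,3)] by blast
    qed
  qed
qed

lemma continuous_map_cell_map:
  "continuous_map (prod_topology (discrete_topology (carrier G)) (disc m)) (bar_top (carrier G)) (cell_map w)"
proof -
  have "continuous_map (prod_topology (discrete_topology (carrier G)) (disc m)) (bar_top (carrier G))
      (\<lambda>(c, y). cell_map w (c, y))"
  proof (rule continuous_map_locally_constant_left)
    fix c assume "c \<in> topspace (discrete_topology (carrier G))"
    then have c: "c \<in> carrier G" by simp
    then show "\<exists>N. openin (discrete_topology (carrier G)) N \<and> c \<in> N \<and>
        (\<forall>h\<in>N. \<forall>x\<in>topspace (disc m). cell_map w (h, x) = cell_map w (c, x))"
      by (intro exI[of _ "{c}"]) simp
    define v where "v = map (\<lambda>s. c \<otimes> s) w"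
    have v: "v \<noteq> []" "set v \<subseteq> carrier G" "length v - 1 = m"
      using bar_words_translation[OF c w(1)] by (auto simp: v_def bar_words_def m)
    from continuous_map_compose[OF continuous_map_disc_to_simplex[of m] continuous_map_bar_chart[OF v(1,2), unfolded v(3)]]
    show "continuous_map (disc m) (bar_top (carrier G)) (\<lambda>x. cell_map w (c, x))"
      by (simp add: cell_map_def v_def m o_def)
  qed
  then show ?thesis by simp
qed

end

lemma cell_map_translation:
  assumes "a \<in> carrier G" "c \<in> carrier G" "w \<in> bar_words (carrier G)"
  shows "cell_map w (a \<otimes> c, y) = bar_map (carrier G) (\<lambda>s. a \<otimes> s) (cell_map w (c, y))"
proof -
  have "map (\<lambda>s. a \<otimes> s) (map (\<lambda>s. c \<otimes> s) w) = map (\<lambda>s. (a \<otimes> c) \<otimes> s) w"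
    using assms by (auto simp: bar_words_def m_assoc)
  then show ?thesis
    by (simp del: map_map add: cell_map_def bar_map_chart[OF translation_closed[OF assms(1)]])
qed

end

context profinite_group
begin

section \<open>The space E(G/U) as a relative cell complex\<close>

lemma Hausdorff_E_copy: "inj pc \<Longrightarrow> Hausdorff_space (gtop (E_copy pc U))"
  using Hausdorff_bar_top homeomorphic_space_copy_top homeomorphic_Hausdorff_space
  unfolding E_copy_def gspace_copy_simps E_gspace_simps by blast

lemma U_relative_cell_complex_E:
  fixes pc :: "('a set \<times> real) list set \<Rightarrow> 'u"
  assumes pc: "inj pc" and U: "U \<in> fi_normal_subgroups G T" "U \<subseteq> U0"
  shows "U_relative_cell_complex G T U0 (inclusion (E_copy pc U) {} (topspace (gtop (E_copy pc U))))"
proof -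
  have n: "U \<lhd> G" using U by (simp add: fi_normal_iff)
  interpret Q: group "G Mod U" by (rule normal.factorgroup_is_group[OF n])
  note S = carrier_Mod[of U]
  \<comment> \<open>The stages of a relative cell complex must be elements of \<open>'u\<close>. A
    word is turned into a list with coordinates 0, only to obtain something of the type on which
    \<open>pc\<close> is defined; the final stage becomes the empty set.\<close>
  define k where "k = (\<lambda>x :: 'a set list option. pc (case x of None \<Rightarrow> {} | Some w \<Rightarrow> {map (\<lambda>s. (s, 0)) w}))"
  have k: "inj k"
  proof (rule injI)
    fix x y assume "k x = k y"
    then have "(case x of None \<Rightarrow> {} | Some w \<Rightarrow> {map (\<lambda>s. (s, 0 :: real)) w})
        = (case y of None \<Rightarrow> {} | Some w \<Rightarrow> {map (\<lambda>s. (s, 0)) w})"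
      unfolding k_def by (rule injD[OF pc])
    then show "x = y"
      by (auto split: option.splits simp: map_eq_conv dest!: arg_cong[where f = "map fst"] simp: o_def)
  qed
  define \<iota> where "\<iota> = the_inv k"
  have \<iota>k: "\<iota> (k x) = x" for x unfolding \<iota>_def by (rule the_inv_f_f[OF k])
  define L where "L = inv_image stage_less \<iota>"
  define F where "F = k ` Q.stages"
  define r where "r = {(x, y). x \<in> F \<and> y \<in> F \<and> (x = y \<or> (x, y) \<in> L)}"
  have wfL: "wf L" and trL: "trans L"
    unfolding L_def by (intro wf_inv_image wf_stage_less, intro trans_inv_image trans_stage_less)
  have totL: "(x, y) \<in> L \<or> (y, x) \<in> L" if "x \<in> F" "y \<in> F" "x \<noteq> y" for x y
  proof -
    have "\<iota> x \<noteq> \<iota> y" using that \<iota>k by (auto simp: F_def)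
    from stage_less_total[OF this] show ?thesis by (simp add: L_def)
  qed
  note wo = Well_order_reflexive_closure[OF wfL trL totL, of F, folded r_def]
  have Fl: "\<iota> a \<in> Q.stages \<and> k (\<iota> a) = a" if "a \<in> F" for a
    using that \<iota>k by (auto simp: F_def)
  have r: "Well_order r" "Field r = F" and uS: "\<And>b. b \<in> F \<Longrightarrow> underS r b = {a \<in> F. (\<iota> a, \<iota> b) \<in> stage_less}"
    and u: "\<And>a. a \<in> F \<Longrightarrow> under r a = {x \<in> F. x = a \<or> (\<iota> x, \<iota> a) \<in> stage_less}"
    using wo by (auto simp: L_def)
  let ?X = "E_copy pc U"
  define B where "B = (\<lambda>a. bar_sub (rcosets U) (Q.stage_words (\<iota> a)))"
  define A where "A = (\<lambda>a. pc ` B a)"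
  have gX: "gtop ?X = copy_top pc (bar_top (rcosets U))"
    by (simp add: E_copy_def gspace_copy_simps E_gspace_simps)
  have aX: "gact ?X g (pc c) = pc (bar_map (rcosets U) (\<lambda>c. (U #> g) \<otimes>\<^bsub>G Mod U\<^esub> c) c)" for g c
    by (simp add: E_copy_def gspace_copy_simps pc E_gspace_simps)
  have pcl: "closedin (gtop ?X) (pc ` C)" if "closedin (bar_top (rcosets U)) C" for C
    using homeomorphic_maps_copy_top[OF pc, of "bar_top (rcosets U)"] that unfolding gX
    by (meson closed_map_def homeomorphic_imp_closed_map homeomorphic_maps_map)
  have Utr: "U #> g \<in> rcosets U" if "g \<in> carrier G" for g
    using that by (auto simp: RCOSETS_def)
  have ins: "inj (\<lambda>(c :: 'a set, \<phi> :: nat \<Rightarrow> real). pc (range (\<lambda>n. [(c, real n), (c, \<phi> n)])))"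
    by (rule inj_points[OF pc])
  have X: "is_gspace G T ?X" unfolding E_copy_def by (rule is_gspace_E[OF pc U(1)])
  have None: "k None \<in> F" by (simp add: F_def Q.stages_def)
  show ?thesis
  proof (rule cell_filtration_complex[OF ins U X Hausdorff_E_copy[OF pc] r(1), where l = "k None" and A = A];
      (unfold r(2))?)
    show "k None \<in> F" by (rule None)
    show "(b, k None) \<in> r" if "b \<in> F" for b
    proof (cases "\<iota> b")
      case None
      then show ?thesis using Fl[OF that] that by (auto simp: r_def)
    next
      case (Some w)
      then show ?thesis using that \<open>k None \<in> F\<close> by (simp add: r_def L_def \<iota>k stage_less_None)
    qed
    show "closed_sub ?X (A b)" for b
      unfolding closed_sub_def
    proof (intro conjI ballI)
      show "closedin (gtop ?X) (A b)"
        unfolding A_def B_def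
        by (intro pcl closedin_bar_sub) (use Q.word_closed_stage_words[of "\<iota> b"] in \<open>simp add: S\<close>)
      fix g x assume g: "g \<in> carrier G" and "x \<in> A b"
      then obtain c where c: "c \<in> B b" "x = pc c" by (auto simp: A_def)
      then show "gact ?X g x \<in> A b"
        using Q.bar_sub_translation[of "U #> g" c "\<iota> b"] Utr[OF g] by (simp add: aX A_def B_def S)
    qed
    show "A a \<subseteq> A b" if "(a, b) \<in> r" for a b
    proof (cases "a = b")
      case False
      then have "(\<iota> a, \<iota> b) \<in> stage_less" using that by (simp add: r_def L_def)
      from Q.stage_words_mono[OF this] show ?thesis
        by (auto simp: A_def B_def bar_sub_def)
    qed simp
    show "A b = {}" if b: "b \<in> F" "underS r b = {}" for b
    proof -
      have "Q.stage_words (\<iota> b) = {}"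
      proof (rule equals0I)
        fix w assume w: "w \<in> Q.stage_words (\<iota> b)"
        then have "k (Some (Q.word_norm w)) \<in> underS r b"
          using Q.word_norm_stage[of w] by (simp add: uS[OF b(1)] \<iota>k F_def Q.stage_words_def)
        then show False using b(2) by simp
      qed
      then show ?thesis by (simp add: A_def B_def bar_sub_def)
    qed
    show "A (k None) = topspace (gtop ?X)"
    proof -
      have "bar_sub (rcosets U) (bar_words (rcosets U)) = topspace (bar_top (rcosets U))"
        using bar_word_in[of _ "rcosets U"] by (auto simp: bar_sub_def topspace_bar_top)
      then show ?thesis
        by (simp add: A_def B_def \<iota>k Q.stage_words_None S topspace_E_copy[OF pc])
    qed
  next
    fix a b assume ab: "a \<in> underS r b" "underS r b = under r a"
    have bF: "b \<in> F" and aF: "a \<in> F"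
      using ab(1) r(2) by (auto simp: underS_def Field_def)
    have less: "(\<iota> a, \<iota> b) \<in> stage_less" using ab(1) uS[OF bF] by simp
    then obtain w where w: "\<iota> a = Some w" using stage_less_None_left by (cases "\<iota> a") auto
    then have w': "w \<in> bar_words (carrier (G Mod U))" "hd w = \<one>\<^bsub>G Mod U\<^esub>"
      using Fl[OF aF] by (auto simp: Q.stages_def)
    \<comment> \<open>Rephrases that \<open>b\<close> is the immediate successor of
      \<open>a\<close>. It follows that the step from \<open>a\<close> to \<open>b\<close> adds
      exactly the words in the orbit of \<open>w\<close>.\<close>
    have below: "(x, \<iota> b) \<in> stage_less \<longleftrightarrow> x = \<iota> a \<or> (x, \<iota> a) \<in> stage_less" if x: "x \<in> Q.stages" for x
    proof -
      have "k x \<in> F" using x by (simp add: F_def)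
      moreover have "k x = a \<longleftrightarrow> x = \<iota> a" using \<iota>k Fl[OF aF] by metis
      moreover have "k x \<in> underS r b \<longleftrightarrow> k x \<in> under r a"
        by (simp only: ab(2))
      ultimately show ?thesis
        by (simp add: uS[OF bF] u[OF aF] \<iota>k)
    qed
    have words: "Q.stage_words (\<iota> b) = Q.stage_words (Some w) \<union> {v \<in> bar_words (carrier (G Mod U)). Q.word_norm v = w}"
      using below[OF Q.word_norm_stage] by (auto simp: Q.stage_words_def w)
    define m where "m = length w - 1"
    have orb: "gtop (orbit_times G U (disc m)) = prod_topology (discrete_topology (rcosets U)) (disc m)"
      "gact (orbit_times G U (disc m)) = (\<lambda>g (c, y). (g <# c, y))"
      by (simp_all add: orbit_times_def lcosets_normal[OF n])
    have "cell_attachment ?X U (A a) (A b) m (\<lambda>p. pc (Q.cell_map w p))"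
      unfolding cell_attachment_def orb lcosets_normal[OF n]
    proof (intro conjI)
      show "continuous_map (prod_topology (discrete_topology (rcosets U)) (disc m)) (gtop ?X) (\<lambda>p. pc (Q.cell_map w p))"
        using continuous_map_compose[OF Q.continuous_map_cell_map[OF w' m_def] continuous_map_into_copy[OF pc]]
        by (simp add: gX S o_def)
      show "equivariant G (orbit_times G U (disc m)) ?X (\<lambda>p. pc (Q.cell_map w p))"
        unfolding equivariant_def orb
      proof (intro ballI)
        fix g p assume g: "g \<in> carrier G" and "p \<in> topspace (prod_topology (discrete_topology (rcosets U)) (disc m))"
        then obtain c y where p: "p = (c, y)" "c \<in> rcosets U" by auto
        show "pc (Q.cell_map w ((\<lambda>(c, y). (g <# c, y)) p)) = gact ?X g (pc (Q.cell_map w p))"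
          unfolding p(1) aX prod.case l_coset_r_coset[OF n g p(2)]
          using Q.cell_map_translation[OF _ _ w'(1), of "U #> g" c y] Utr[OF g] p(2) by (simp add: S)
      qed
      have img: "B b = B a \<union> Q.cell_map w ` ((rcosets U) \<times> topspace (disc m))"
        using Q.cell_map_image[OF w' m_def] by (simp add: B_def words w S)
      show "A b = A a \<union> (\<lambda>p. pc (Q.cell_map w p)) ` ((rcosets U) \<times> topspace (disc m))"
        unfolding A_def img by (simp add: image_Un image_image)
      show "(\<lambda>p. pc (Q.cell_map w p)) ` ((rcosets U) \<times> topspace (disc_boundary m)) \<subseteq> A a"
        using Q.cell_map_boundary[OF w' m_def] by (auto simp: A_def B_def w S)
      show "inj_on (\<lambda>p. pc (Q.cell_map w p)) ((rcosets U) \<times> (topspace (disc m) - topspace (disc_boundary m)))"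
        using comp_inj_on[OF Q.cell_map_inj[OF w' m_def] inj_on_subset[OF pc subset_UNIV]] by (simp add: S o_def)
      show "(\<lambda>p. pc (Q.cell_map w p)) ` ((rcosets U) \<times> (topspace (disc m) - topspace (disc_boundary m))) \<inter> A a = {}"
        using Q.cell_map_disjoint[OF w' m_def] by (auto simp: A_def B_def w S dest!: injD[OF pc])
    qed
    then show "\<exists>m h. cell_attachment ?X U (A a) (A b) m h" by blast
  next
    fix b assume b: "b \<in> F" "underS r b \<noteq> {}" "\<nexists>a. a \<in> underS r b \<and> underS r b = under r a"
    \<comment> \<open>Otherwise \<open>k x\<close> would be an immediate predecessor of
      \<open>b\<close>. A word that is available at the limit stage is thus available at some
      earlier one.\<close>
    have next_stage: "\<exists>a\<in>underS r b. (x, \<iota> a) \<in> stage_less" if x: "x \<in> Q.stages" "(x, \<iota> b) \<in> stage_less" for x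
    proof -
      have kF: "k x \<in> F" using x by (simp add: F_def)
      have kx: "k x \<in> underS r b" using kF x by (simp add: uS[OF b(1)] \<iota>k)
      moreover have "under r (k x) \<subseteq> underS r b"
        using x(2) by (auto simp: uS[OF b(1)] u[OF kF] \<iota>k intro: stage_less_trans)
      ultimately obtain a where a: "a \<in> underS r b" "a \<notin> under r (k x)"
        using b(3) by blast
      then have "a \<in> F" by (simp add: uS[OF b(1)])
      then have "\<iota> a \<noteq> x" "(\<iota> a, x) \<notin> stage_less"
        using a(2) Fl by (auto simp: u[OF kF] \<iota>k)
      then have "(x, \<iota> a) \<in> stage_less" using stage_less_total by blast
      then show ?thesis using a(1) by blast
    qed
    \<comment> \<open>Stages are nested and linearly ordered, so finitely many words fit into the
      largest of their stages. This is the hypothesis that \<open>closedin_bar_top_weak\<close>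
      needs.\<close>
    have fin: "\<exists>a\<in>underS r b. W \<subseteq> Q.stage_words (\<iota> a)" if "finite W" "W \<subseteq> Q.stage_words (\<iota> b)" for W
      using that
    proof (induction W rule: finite_induct)
      case empty
      then show ?case using b(2) by blast
    next
      case (insert v W)
      then obtain a where a: "a \<in> underS r b" "W \<subseteq> Q.stage_words (\<iota> a)" by auto
      have v: "v \<in> bar_words (carrier (G Mod U))" "(Some (Q.word_norm v), \<iota> b) \<in> stage_less"
        using insert.prems by (auto simp: Q.stage_words_def)
      obtain c where c: "c \<in> underS r b" "(Some (Q.word_norm v), \<iota> c) \<in> stage_less"
        using next_stage[OF Q.word_norm_stage[OF v(1)] v(2)] by blast
      have vc: "v \<in> Q.stage_words (\<iota> c)" using v(1) c(2) by (simp add: Q.stage_words_def)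
      consider "\<iota> a = \<iota> c" | "(\<iota> a, \<iota> c) \<in> stage_less" | "(\<iota> c, \<iota> a) \<in> stage_less"
        using stage_less_total by blast
      then show ?case
      proof cases
        case 1
        then show ?thesis using a vc by (intro bexI[of _ a]) auto
      next
        case 2
        then show ?thesis using a c(1) vc Q.stage_words_mono[OF 2] by (intro bexI[of _ c]) auto
      next
        case 3
        then show ?thesis using a vc Q.stage_words_mono[OF 3] by (intro bexI[of _ a]) auto
      qed
    qed
    show "A b = (\<Union>a\<in>underS r b. A a) \<and>
        (\<forall>C \<subseteq> A b. (\<forall>a\<in>underS r b. closedin (gtop ?X) (C \<inter> A a)) \<longrightarrow> closedin (gtop ?X) C)"
    proof (intro conjI allI impI)
      have "B b = (\<Union>a\<in>underS r b. B a)"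
      proof
        show "B b \<subseteq> (\<Union>a\<in>underS r b. B a)"
        proof
          fix x assume "x \<in> B b"
          then obtain ps where ps: "x = bar_class (rcosets U) ps" "ps \<in> bar_pts (rcosets U)"
            "bar_word ps \<in> Q.stage_words (\<iota> b)" by (auto simp: B_def bar_sub_def)
          then obtain a where "a \<in> underS r b" "bar_word ps \<in> Q.stage_words (\<iota> a)"
            using fin[of "{bar_word ps}"] by auto
          then show "x \<in> (\<Union>a\<in>underS r b. B a)"
            using ps by (auto simp: B_def bar_sub_def)
        qed
        show "(\<Union>a\<in>underS r b. B a) \<subseteq> B b"
          using Q.stage_words_mono by (auto simp: uS[OF b(1)] B_def bar_sub_def)
      qed
      then show "A b = (\<Union>a\<in>underS r b. A a)"
        by (simp add: A_def image_UN)
      fix C assume C: "C \<subseteq> A b" "\<forall>a\<in>underS r b. closedin (gtop ?X) (C \<inter> A a)"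
      define D where "D = {c \<in> B b. pc c \<in> C}"
      have CD: "C = pc ` D" using C(1) by (auto simp: D_def A_def)
      have "closedin (bar_top (rcosets U)) D"
      proof (rule closedin_bar_top_weak[where I = "underS r b" and E = "\<lambda>a. Q.stage_words (\<iota> a)" and D = "Q.stage_words (\<iota> b)"])
        show "D \<subseteq> bar_sub (rcosets U) (Q.stage_words (\<iota> b))" by (auto simp: D_def B_def)
        show "\<exists>a\<in>underS r b. W \<subseteq> Q.stage_words (\<iota> a)" if "finite W" "W \<subseteq> Q.stage_words (\<iota> b)" for W
          by (rule fin[OF that])
        fix a assume a: "a \<in> underS r b"
        have "closedin (gtop ?X) (C \<inter> A a)" using C(2) a by blast
        from closedin_continuous_map_preimage[OF continuous_map_into_copy[OF pc] this[unfolded gX]]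
        have "closedin (bar_top (rcosets U)) {c \<in> topspace (bar_top (rcosets U)). pc c \<in> C \<inter> A a}" .
        moreover have "{c \<in> topspace (bar_top (rcosets U)). pc c \<in> C \<inter> A a} = D \<inter> bar_sub (rcosets U) (Q.stage_words (\<iota> a))"
          using bar_sub_topspace[of "rcosets U"] unfolding CD A_def by (auto simp: B_def D_def dest!: injD[OF pc])
        ultimately show "closedin (bar_top (rcosets U)) (D \<inter> bar_sub (rcosets U) (Q.stage_words (\<iota> a)))"
          by simp
      qed
      then show "closedin (gtop ?X) C" unfolding CD by (rule pcl)
    qed
  qed
qed

lemma U_cofibration_E:
  assumes pc: "inj pc" and U: "U \<in> fi_normal_subgroups G T" "U \<subseteq> U0"
    and f: "f \<in> homs GC empty_gspace (E_copy pc U)"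
  shows "U_cofibration G T U0 f"
proof (rule U_cofibration_empty[OF _ Hausdorff_E_copy[OF pc] U_relative_cell_complex_E[OF pc U] f])
  show "is_gspace G T (E_copy pc U)" unfolding E_copy_def by (rule is_gspace_E[OF pc U(1)])
qed

end

section \<open>Pro-objects\<close>

definition colim_class ::
  "('o, 'm) cat \<Rightarrow> ('i, 'j, 'o, 'm) diagram \<Rightarrow> 'o \<Rightarrow> 'i \<times> 'm \<Rightarrow> ('i \<times> 'm) set" where
  "colim_class C X y p = colim_rel C X y `` {p}"

lemma ex1_unique: "\<exists>!x. x \<in> A \<Longrightarrow> a \<in> A \<Longrightarrow> b \<in> A \<Longrightarrow> a = b"
  by blast

locale base_category =
  fixes C :: "('o, 'm) cat"
  assumes cat: "category C"
begin

lemma homs_Ob: "f \<in> homs C a b \<Longrightarrow> a \<in> Ob C \<and> b \<in> Ob C"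
  using cat by (auto simp: category_def homs_def)

lemma Ident_homs: "a \<in> Ob C \<Longrightarrow> Ident C a \<in> homs C a a"
  using cat by (auto simp: category_def)

lemma Comp_homs: "f \<in> homs C a b \<Longrightarrow> g \<in> homs C b c \<Longrightarrow> Comp C g f \<in> homs C a c"
  using cat by (auto simp: category_def homs_def)

lemma Comp_Ident_right: "f \<in> homs C a b \<Longrightarrow> Comp C f (Ident C a) = f"
  and Comp_Ident_left: "f \<in> homs C a b \<Longrightarrow> Comp C (Ident C b) f = f"
  using cat by (auto simp: category_def homs_def)

lemma Comp_assoc:
  "f \<in> homs C a b \<Longrightarrow> g \<in> homs C b c \<Longrightarrow> h \<in> homs C c d \<Longrightarrow>
    Comp C h (Comp C g f) = Comp C (Comp C h g) f"
  using cat by (auto simp: category_def homs_def)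

lemma Cod_homs: "f \<in> homs C a b \<Longrightarrow> Cod C f = b"
  by (simp add: homs_def)

subsection \<open>Diagrams and representatives of pro-maps\<close>

context
  fixes X :: "('i, 'j, 'o, 'm) diagram"
  assumes X: "is_pro_object C X"
begin

lemma idx_category: "base_category (idx X)"
  using X by (simp add: is_pro_object_def base_category_def)

lemma dob_Ob: "s \<in> Ob (idx X) \<Longrightarrow> dob X s \<in> Ob C"
  using X by (simp add: is_pro_object_def)

lemma dar_homs: "u \<in> homs (idx X) t s \<Longrightarrow> dar X u \<in> homs C (dob X t) (dob X s)"
  using X by (auto simp: is_pro_object_def homs_def)

lemma dar_Ident: "s \<in> Ob (idx X) \<Longrightarrow> dar X (Ident (idx X) s) = Ident C (dob X s)"
  using X by (simp add: is_pro_object_def)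

lemma dar_Comp: "u \<in> homs (idx X) t s \<Longrightarrow> v \<in> homs (idx X) s r \<Longrightarrow>
    dar X (Comp (idx X) v u) = Comp C (dar X v) (dar X u)"
  using X by (auto simp: is_pro_object_def homs_def)

lemma idx_common:
  assumes "s \<in> Ob (idx X)" "t \<in> Ob (idx X)"
  obtains r u v where "r \<in> Ob (idx X)" "u \<in> homs (idx X) r s" "v \<in> homs (idx X) r t"
  using X assms unfolding is_pro_object_def cofiltering_def by blast

lemma idx_nonempty: "Ob (idx X) \<noteq> {}"
  using X by (simp add: is_pro_object_def cofiltering_def)

lemma colim_rel_refl [simp]: "(p, p) \<in> colim_rel C X y"
  by (simp add: colim_rel_def eq_closure_def)

lemma colim_rel_sym: "(p, q) \<in> colim_rel C X y \<Longrightarrow> (q, p) \<in> colim_rel C X y"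
  unfolding colim_rel_def eq_closure_def
  by (rule symD[OF sym_rtrancl]) (auto simp: sym_def)

lemma colim_rel_trans: "(p, q) \<in> colim_rel C X y \<Longrightarrow> (q, r) \<in> colim_rel C X y \<Longrightarrow> (p, r) \<in> colim_rel C X y"
  unfolding colim_rel_def eq_closure_def by (rule rtrancl_trans)

lemma colim_rel_step:
  assumes "t \<in> Ob (idx X)" "f \<in> homs C (dob X t) y" "u \<in> homs (idx X) t' t"
  shows "((t, f), (t', Comp C f (dar X u))) \<in> colim_rel C X y"
  unfolding colim_rel_def eq_closure_def
  by (rule r_into_rtrancl) (use assms in \<open>auto simp: colim_pts_def\<close>)

lemma colim_rel_induct [consumes 1, case_names refl sym trans step]:
  assumes "(p, q) \<in> colim_rel C X y"
    and "\<And>p. P p p" "\<And>p q. P p q \<Longrightarrow> P q p" "\<And>p q r. P p q \<Longrightarrow> P q r \<Longrightarrow> P p r"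
    and step: "\<And>t f u t'. t \<in> Ob (idx X) \<Longrightarrow> f \<in> homs C (dob X t) y \<Longrightarrow> u \<in> homs (idx X) t' t \<Longrightarrow>
      P (t, f) (t', Comp C f (dar X u))"
  shows "P p q"
  using assms(1) unfolding colim_rel_def eq_closure_def
proof (induction rule: rtrancl_induct)
  case base
  show ?case by (rule assms(2))
next
  case (step q r)
  have "P q r"
    using step.hyps(2)
  proof
    assume "(q, r) \<in> {((t, f), t', f'). (t, f) \<in> colim_pts C X y \<and> (\<exists>u\<in>homs (idx X) t' t. f' = Comp C f (dar X u))}"
    then show ?thesis using assms(5) by (auto simp: colim_pts_def)
  next
    assume "(q, r) \<in> {((t, f), t', f'). (t, f) \<in> colim_pts C X y \<and> (\<exists>u\<in>homs (idx X) t' t. f' = Comp C f (dar X u))}\<inverse>"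
    then show ?thesis using assms(3,5) by (auto simp: colim_pts_def)
  qed
  then show ?case using step.IH assms(4) by blast
qed

lemma colim_rel_pts: "(p, q) \<in> colim_rel C X y \<Longrightarrow> p \<in> colim_pts C X y \<longleftrightarrow> q \<in> colim_pts C X y"
proof (induction rule: colim_rel_induct)
  case (step t f u t')
  then have "t' \<in> Ob (idx X)" "Comp C f (dar X u) \<in> homs C (dob X t') y"
    using base_category.homs_Ob[OF idx_category step(3)] Comp_homs[OF dar_homs[OF step(3)] step(2)] by auto
  then show ?case using step by (simp add: colim_pts_def)
qed auto

lemma colim_class_eq_iff: "colim_class C X y p = colim_class C X y q \<longleftrightarrow> (p, q) \<in> colim_rel C X y"
proof
  assume "colim_class C X y p = colim_class C X y q"
  then have "q \<in> colim_class C X y p" by (simp add: colim_class_def)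
  then show "(p, q) \<in> colim_rel C X y" by (simp add: colim_class_def)
next
  assume r: "(p, q) \<in> colim_rel C X y"
  have "(p, x) \<in> colim_rel C X y \<longleftrightarrow> (q, x) \<in> colim_rel C X y" for x
    using colim_rel_trans[OF r, of x] colim_rel_trans[OF colim_rel_sym[OF r], of x] by blast
  then show "colim_class C X y p = colim_class C X y q"
    unfolding colim_class_def by auto
qed

lemma colim_hom_class: "p \<in> colim_pts C X y \<Longrightarrow> colim_class C X y p \<in> colim_hom C X y"
  by (auto simp: colim_hom_def quotient_def colim_class_def)

lemma colim_hom_mem:
  assumes "c \<in> colim_hom C X y" "p \<in> c"
  shows "p \<in> colim_pts C X y" "c = colim_class C X y p"
proof -
  obtain q where q: "q \<in> colim_pts C X y" "c = colim_class C X y q"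
    using assms(1) by (auto simp: colim_hom_def quotient_def colim_class_def)
  then have "(q, p) \<in> colim_rel C X y" using assms(2) by (simp add: colim_class_def)
  then show "p \<in> colim_pts C X y" "c = colim_class C X y p"
    using q colim_rel_pts by (simp_all add: colim_class_eq_iff)
qed

lemma colim_hom_nonempty:
  assumes "c \<in> colim_hom C X y"
  obtains t f where "(t, f) \<in> c"
proof -
  obtain q where "c = colim_class C X y q"
    using assms by (auto simp: colim_hom_def quotient_def colim_class_def)
  then have "q \<in> c" by (simp add: colim_class_def)
  then show thesis using that by (cases q) auto
qed

lemma colim_rel_push:
  assumes h: "h \<in> homs C y y'" and "(p, q) \<in> colim_rel C X y" 
  shows "((fst p, Comp C h (snd p)), (fst q, Comp C h (snd q))) \<in> colim_rel C X y'"
  using assms(2)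
proof (induction rule: colim_rel_induct)
  case (step t f u t')
  have "((t, Comp C h f), (t', Comp C (Comp C h f) (dar X u))) \<in> colim_rel C X y'"
    by (rule colim_rel_step[OF step(1) Comp_homs[OF step(2) h] step(3)])
  then show ?case
    by (simp add: Comp_assoc[OF dar_homs[OF step(3)] step(2) h])
qed (auto intro: colim_rel_sym colim_rel_trans)

lemma colim_push_class:
  assumes h: "h \<in> homs C y y'"
  shows "colim_push C X h (colim_class C X y (t, f)) = colim_class C X y' (t, Comp C h f)"
proof -
  have "(\<exists>q\<in>colim_class C X y (t, f). ((fst q, Comp C h (snd q)), r) \<in> colim_rel C X y')
      \<longleftrightarrow> ((t, Comp C h f), r) \<in> colim_rel C X y'" for r
  proof
    assume "\<exists>q\<in>colim_class C X y (t, f). ((fst q, Comp C h (snd q)), r) \<in> colim_rel C X y'"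
    then obtain q where q: "((t, f), q) \<in> colim_rel C X y" "((fst q, Comp C h (snd q)), r) \<in> colim_rel C X y'"
      by (auto simp: colim_class_def)
    from colim_rel_trans[OF colim_rel_push[OF h q(1)] q(2)]
    show "((t, Comp C h f), r) \<in> colim_rel C X y'" by simp
  next
    assume "((t, Comp C h f), r) \<in> colim_rel C X y'"
    then show "\<exists>q\<in>colim_class C X y (t, f). ((fst q, Comp C h (snd q)), r) \<in> colim_rel C X y'"
      by (intro bexI[of _ "(t, f)"]) (simp_all add: colim_class_def)
  qed
  moreover have "r \<in> colim_push C X h (colim_class C X y (t, f)) \<longleftrightarrow>
      (\<exists>q\<in>colim_class C X y (t, f). ((fst q, Comp C h (snd q)), r) \<in> colim_rel C X y')" for r
    unfolding colim_push_def Cod_homs[OF h] case_prod_unfold by blast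
  ultimately show ?thesis
    unfolding colim_class_def[of C X y'] by (intro Set.set_eqI) simp
qed

end

section \<open>Pro-maps and their composition\<close>

lemma pro_cat_simps [simp]:
  "X \<in> Ob (pro_cat C) \<longleftrightarrow> is_pro_object C X"
  "Dom (pro_cat C) = pdom" "Cod (pro_cat C) = pcod"
  "Ident (pro_cat C) X = level_arrow C X X (\<lambda>s. Ident C (dob X s))"
  "pdom (Comp (pro_cat C) q p) = pdom p" "pcod (Comp (pro_cat C) q p) = pcod q"
  by (simp_all add: pro_cat_def)

lemma in_homs_pro_iff: "p \<in> homs (pro_cat C) X Y \<longleftrightarrow> is_pro_map C p \<and> pdom p = X \<and> pcod p = Y"
  by (auto simp: homs_def pro_cat_def)

lemma homs_pro_objects: "p \<in> homs (pro_cat C) X Y \<Longrightarrow> is_pro_object C X \<and> is_pro_object C Y"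
  by (auto simp: in_homs_pro_iff is_pro_map_def)

lemma homs_pro_eqI:
  assumes "p \<in> homs (pro_cat C) X Y" "q \<in> homs (pro_cat C) X Y"
    and "\<And>s. s \<in> Ob (idx Y) \<Longrightarrow> pcomp p s = pcomp q s"
  shows "p = q"
proof (rule pro_arrow.equality)
  show "pcomp p = pcomp q"
    using assms by (intro ext) (metis in_homs_pro_iff is_pro_map_def)
qed (use assms in \<open>auto simp: in_homs_pro_iff\<close>)

context
  fixes X Y :: "('i, 'j, 'o, 'm) diagram" and p
  assumes p: "p \<in> homs (pro_cat C) X Y"
begin

lemma pro_objects: "is_pro_object C X" "is_pro_object C Y"
  using homs_pro_objects[OF p] by auto

lemma pcomp_rep:
  assumes "s \<in> Ob (idx Y)"
  obtains t f where "(t, f) \<in> pcomp p s"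
proof -
  have "pcomp p s \<in> colim_hom C X (dob Y s)"
    using p assms by (auto simp: in_homs_pro_iff is_pro_map_def)
  then show thesis using that by (rule colim_hom_nonempty[OF pro_objects(1)])
qed

lemma pcomp_mem:
  assumes "s \<in> Ob (idx Y)" "(t, f) \<in> pcomp p s"
  shows "t \<in> Ob (idx X)" "f \<in> homs C (dob X t) (dob Y s)" "pcomp p s = colim_class C X (dob Y s) (t, f)"
proof -
  have "pcomp p s \<in> colim_hom C X (dob Y s)"
    using p assms by (auto simp: in_homs_pro_iff is_pro_map_def)
  from colim_hom_mem[OF pro_objects(1) this assms(2)]
  show "t \<in> Ob (idx X)" "f \<in> homs C (dob X t) (dob Y s)" "pcomp p s = colim_class C X (dob Y s) (t, f)"
    by (auto simp: colim_pts_def)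
qed

lemma pcomp_compat:
  assumes "u \<in> homs (idx Y) s s'" "(t, f) \<in> pcomp p s"
  shows "(t, Comp C (dar Y u) f) \<in> pcomp p s'"
proof -
  have s: "s \<in> Ob (idx Y)"
    using base_category.homs_Ob[OF idx_category[OF pro_objects(2)] assms(1)] by simp
  have "is_pro_map C p" "pdom p = X" "pcod p = Y"
    using p by (simp_all add: in_homs_pro_iff)
  moreover have "u \<in> Ar (idx Y)" "Dom (idx Y) u = s" "Cod (idx Y) u = s'"
    using assms(1) by (simp_all add: homs_def)
  ultimately have "pcomp p s' = colim_push C X (dar Y u) (pcomp p s)"
    by (auto simp: is_pro_map_def)
  also have "\<dots> = colim_class C X (dob Y s') (t, Comp C (dar Y u) f)"
    unfolding pcomp_mem(3)[OF s assms(2)]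
    by (rule colim_push_class[OF pro_objects(1) dar_homs[OF pro_objects(2) assms(1)]])
  finally show ?thesis by (simp add: colim_class_def colim_rel_refl[OF pro_objects(1)])
qed

end

text \<open>If the representative \<open>(r, g)\<close> is moved along an index arrow from r' to r,
  compatibility of \<open>p\<close> moves its representative at r' to one at r, and associativity
  identifies the composites. All members of the union are hence equal, and one of them
  suffices.\<close>

lemma pcomp_Comp:
  assumes p: "p \<in> homs (pro_cat C) X Y" and q: "q \<in> homs (pro_cat C) Y Z" and s: "s \<in> Ob (idx Z)"
    and r: "(r, g) \<in> pcomp q s" and t: "(t, f) \<in> pcomp p r"
  shows "pcomp (Comp (pro_cat C) q p) s = colim_class C X (dob Z s) (t, Comp C g f)"
proof -
  note X = pro_objects(1)[OF p] and Y = pro_objects(2)[OF p]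
  define \<Phi> where "\<Phi> = (\<lambda>(r, g). colim_push C X g (pcomp p r))"
  have \<Phi>: "\<Phi> (r, g) = colim_class C X (dob Z s) (t, Comp C g f)"
    if "r \<in> Ob (idx Y)" "g \<in> homs C (dob Y r) (dob Z s)" "(t, f) \<in> pcomp p r" for r g t f
    unfolding \<Phi>_def prod.case pcomp_mem(3)[OF p that(1,3)] by (rule colim_push_class[OF X that(2)])
  have const: "\<Phi> a = \<Phi> b" if "(a, b) \<in> colim_rel C Y (dob Z s)" for a b
    using that
  proof (induction rule: colim_rel_induct[OF Y, consumes 1, case_names refl sym trans step])
    case (step r g u r')
    have r': "r' \<in> Ob (idx Y)"
      using base_category.homs_Ob[OF idx_category[OF Y] step(3)] by simp
    obtain t' f' where t': "(t', f') \<in> pcomp p r'" using pcomp_rep[OF p r'] by blast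
    have "\<Phi> (r, g) = colim_class C X (dob Z s) (t', Comp C g (Comp C (dar Y u) f'))"
      by (rule \<Phi>[OF step(1,2) pcomp_compat[OF p step(3) t']])
    also have "Comp C g (Comp C (dar Y u) f') = Comp C (Comp C g (dar Y u)) f'"
      by (rule Comp_assoc[OF pcomp_mem(2)[OF p r' t'] dar_homs[OF Y step(3)] step(2)])
    also have "colim_class C X (dob Z s) (t', \<dots>) = \<Phi> (r', Comp C g (dar Y u))"
      by (rule \<Phi>[OF r' Comp_homs[OF dar_homs[OF Y step(3)] step(2)] t', symmetric])
    finally show ?case .
  qed auto
  note rg = pcomp_mem[OF q s r]
  have \<Phi>_const: "\<Phi> a = \<Phi> (r, g)" if "a \<in> pcomp q s" for a
    using that const unfolding rg(3) colim_class_def by auto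
  have "(\<Union>a\<in>pcomp q s. \<Phi> a) = (\<Union>a\<in>pcomp q s. \<Phi> (r, g))"
    by (rule SUP_cong[OF refl \<Phi>_const])
  also have "\<dots> = \<Phi> (r, g)"
    using r by auto
  finally have "(\<Union>a\<in>pcomp q s. \<Phi> a) = \<Phi> (r, g)" .
  moreover have "pcomp (Comp (pro_cat C) q p) s = (\<Union>a\<in>pcomp q s. \<Phi> a)"
  proof -
    have "pdom p = X" using p by (simp add: in_homs_pro_iff)
    then show ?thesis by (simp add: pro_cat_def \<Phi>_def)
  qed
  ultimately show ?thesis
    using \<Phi>[OF rg(1,2) t] by simp
qed

lemma is_pro_map_classes:
  assumes X: "is_pro_object C X" and Y: "is_pro_object C Y"
    and r: "\<And>s. s \<in> Ob (idx Y) \<Longrightarrow> t s \<in> Ob (idx X) \<and> f s \<in> homs C (dob X (t s)) (dob Y s)"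
    and c: "\<And>a s s'. a \<in> homs (idx Y) s s' \<Longrightarrow>
      ((t s, Comp C (dar Y a) (f s)), (t s', f s')) \<in> colim_rel C X (dob Y s')"
  shows "\<lparr>pdom = X, pcod = Y, pcomp = (\<lambda>s. if s \<in> Ob (idx Y) then colim_class C X (dob Y s) (t s, f s) else {})\<rparr>
    \<in> homs (pro_cat C) X Y"
  unfolding in_homs_pro_iff is_pro_map_def pro_arrow.simps
proof (intro conjI ballI allI impI X Y refl)
  fix s assume "s \<in> Ob (idx Y)"
  then show "(if s \<in> Ob (idx Y) then colim_class C X (dob Y s) (t s, f s) else {}) \<in> colim_hom C X (dob Y s)"
    using r by (auto intro!: colim_hom_class[OF X] simp: colim_pts_def)
next
  fix a assume "a \<in> Ar (idx Y)"
  then have a: "a \<in> homs (idx Y) (Dom (idx Y) a) (Cod (idx Y) a)" by (simp add: homs_def)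
  have ob: "Dom (idx Y) a \<in> Ob (idx Y)" "Cod (idx Y) a \<in> Ob (idx Y)"
    using base_category.homs_Ob[OF idx_category[OF Y] a] by auto
  show "colim_push C X (dar Y a) (if Dom (idx Y) a \<in> Ob (idx Y)
        then colim_class C X (dob Y (Dom (idx Y) a)) (t (Dom (idx Y) a), f (Dom (idx Y) a)) else {}) =
      (if Cod (idx Y) a \<in> Ob (idx Y)
        then colim_class C X (dob Y (Cod (idx Y) a)) (t (Cod (idx Y) a), f (Cod (idx Y) a)) else {})"
    using ob c[OF a] by (simp add: colim_push_class[OF X dar_homs[OF Y a]] colim_class_eq_iff[OF X])
qed auto

lemma Comp_homs_pro:
  assumes p: "p \<in> homs (pro_cat C) X Y" and q: "q \<in> homs (pro_cat C) Y Z"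
  shows "Comp (pro_cat C) q p \<in> homs (pro_cat C) X Z"
proof -
  note X = pro_objects(1)[OF p] and Y = pro_objects(2)[OF p] and Z = pro_objects(2)[OF q]
  define R where "R = (\<lambda>s (t, f). \<exists>r g k. (r, g) \<in> pcomp q s \<and> (t, k) \<in> pcomp p r \<and> f = Comp C g k)"
  define w where "w = (\<lambda>s. SOME x. R s x)"
  have w: "R s (w s)" if s: "s \<in> Ob (idx Z)" for s
  proof -
    obtain r g where r: "(r, g) \<in> pcomp q s" using pcomp_rep[OF q s] by blast
    obtain t k where "(t, k) \<in> pcomp p r" using pcomp_rep[OF p pcomp_mem(1)[OF q s r]] by blast
    then have "R s (t, Comp C g k)" using r by (auto simp: R_def)
    then show ?thesis unfolding w_def by (rule someI)
  qed
  have wpts: "fst (w s) \<in> Ob (idx X) \<and> snd (w s) \<in> homs C (dob X (fst (w s))) (dob Z s)"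
    and wcomp: "pcomp (Comp (pro_cat C) q p) s = colim_class C X (dob Z s) (fst (w s), snd (w s))"
    if s: "s \<in> Ob (idx Z)" for s
  proof -
    obtain r g k where r: "(r, g) \<in> pcomp q s" "(fst (w s), k) \<in> pcomp p r" "snd (w s) = Comp C g k"
      using w[OF s] unfolding R_def by (auto simp: case_prod_unfold)
    show "fst (w s) \<in> Ob (idx X) \<and> snd (w s) \<in> homs C (dob X (fst (w s))) (dob Z s)"
      using pcomp_mem[OF q s r(1)] pcomp_mem[OF p pcomp_mem(1)[OF q s r(1)] r(2)] Comp_homs r(3) by auto
    show "pcomp (Comp (pro_cat C) q p) s = colim_class C X (dob Z s) (fst (w s), snd (w s))"
      unfolding r(3) by (rule pcomp_Comp[OF p q s r(1,2)])
  qed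
  have "\<lparr>pdom = X, pcod = Z, pcomp = (\<lambda>s. if s \<in> Ob (idx Z) then colim_class C X (dob Z s) (fst (w s), snd (w s)) else {})\<rparr>
    \<in> homs (pro_cat C) X Z"
  proof (rule is_pro_map_classes[OF X Z])
    fix a s s' assume a: "a \<in> homs (idx Z) s s'"
    have s: "s \<in> Ob (idx Z)" "s' \<in> Ob (idx Z)"
      using base_category.homs_Ob[OF idx_category[OF Z] a] by auto
    obtain r g k where r: "(r, g) \<in> pcomp q s" "(fst (w s), k) \<in> pcomp p r" "snd (w s) = Comp C g k"
      using w[OF s(1)] unfolding R_def by (auto simp: case_prod_unfold)
    have "pcomp (Comp (pro_cat C) q p) s' = colim_class C X (dob Z s') (fst (w s), Comp C (Comp C (dar Z a) g) k)"
      by (rule pcomp_Comp[OF p q s(2) pcomp_compat[OF q a r(1)] r(2)])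
    also have "Comp C (Comp C (dar Z a) g) k = Comp C (dar Z a) (snd (w s))"
      unfolding r(3)
      by (rule Comp_assoc[symmetric, OF pcomp_mem(2)[OF p pcomp_mem(1)[OF q s(1) r(1)] r(2)]
          pcomp_mem(2)[OF q s(1) r(1)] dar_homs[OF Z a]])
    finally show "((fst (w s), Comp C (dar Z a) (snd (w s))), (fst (w s'), snd (w s'))) \<in> colim_rel C X (dob Z s')"
      unfolding wcomp[OF s(2)] using colim_class_eq_iff[OF X] by (simp add: colim_rel_sym[OF X])
  qed (rule wpts)
  moreover have "\<lparr>pdom = X, pcod = Z, pcomp = (\<lambda>s. if s \<in> Ob (idx Z) then colim_class C X (dob Z s) (fst (w s), snd (w s)) else {})\<rparr>
      = Comp (pro_cat C) q p"
  proof (rule pro_arrow.equality)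
    have "pcomp (Comp (pro_cat C) q p) s = {}" if "s \<notin> Ob (idx Z)" for s
    proof -
      have "pcomp q s = {}" using that q by (auto simp: in_homs_pro_iff is_pro_map_def)
      then show ?thesis by (simp add: pro_cat_def)
    qed
    then show "pcomp \<lparr>pdom = X, pcod = Z, pcomp = (\<lambda>s. if s \<in> Ob (idx Z) then colim_class C X (dob Z s) (fst (w s), snd (w s)) else {})\<rparr>
        = pcomp (Comp (pro_cat C) q p)"
      using wcomp by (intro ext) auto
  qed (use p q in \<open>simp_all add: in_homs_pro_iff\<close>)
  ultimately show ?thesis by simp
qed

lemma level_arrow_homs:
  assumes \<theta>: "is_nat_trans C X Y \<theta>"
  shows "level_arrow C X Y \<theta> \<in> homs (pro_cat C) X Y"
proof -
  have X: "is_pro_object C X" and Y: "is_pro_object C Y" and i: "idx X = idx Y"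
    and h: "\<And>s. s \<in> Ob (idx Y) \<Longrightarrow> \<theta> s \<in> homs C (dob X s) (dob Y s)"
    and n: "\<And>a s s'. a \<in> homs (idx Y) s s' \<Longrightarrow> Comp C (dar Y a) (\<theta> s) = Comp C (\<theta> s') (dar X a)"
    using \<theta> by (auto simp: is_nat_trans_def homs_def)
  have "\<lparr>pdom = X, pcod = Y, pcomp = (\<lambda>s. if s \<in> Ob (idx Y) then colim_class C X (dob Y s) (s, \<theta> s) else {})\<rparr>
    \<in> homs (pro_cat C) X Y"
  proof (rule is_pro_map_classes[OF X Y])
    fix a s s' assume a: "a \<in> homs (idx Y) s s'"
    have s': "s' \<in> Ob (idx Y)" using base_category.homs_Ob[OF idx_category[OF Y] a] by simp
    have "((s', \<theta> s'), (s, Comp C (\<theta> s') (dar X a))) \<in> colim_rel C X (dob Y s')"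
      using a s' by (intro colim_rel_step[OF X _ h]) (simp_all add: i)
    then show "((s, Comp C (dar Y a) (\<theta> s)), (s', \<theta> s')) \<in> colim_rel C X (dob Y s')"
      unfolding n[OF a] by (rule colim_rel_sym[OF X])
  qed (use h i in auto)
  then show ?thesis unfolding level_arrow_def colim_class_def .
qed

lemma pcomp_level_arrow:
  "is_nat_trans C X Y \<theta> \<Longrightarrow> s \<in> Ob (idx Y) \<Longrightarrow> (s, \<theta> s) \<in> pcomp (level_arrow C X Y \<theta>) s"
  by (simp add: level_arrow_def colim_rel_def eq_closure_def)

lemma is_nat_trans_Ident:
  assumes X: "is_pro_object C X"
  shows "is_nat_trans C X X (\<lambda>s. Ident C (dob X s))"
  unfolding is_nat_trans_def
proof (intro conjI X refl ballI)
  fix a assume "a \<in> Ar (idx X)"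
  then have a: "a \<in> homs (idx X) (Dom (idx X) a) (Cod (idx X) a)" by (simp add: homs_def)
  show "Comp C (dar X a) (Ident C (dob X (Dom (idx X) a))) = Comp C (Ident C (dob X (Cod (idx X) a))) (dar X a)"
    using dar_homs[OF X a] by (simp add: Comp_Ident_left Comp_Ident_right)
qed (rule Ident_homs[OF dob_Ob[OF X]])

lemma Ident_homs_pro: "is_pro_object C X \<Longrightarrow> Ident (pro_cat C) X \<in> homs (pro_cat C) X X"
  using level_arrow_homs[OF is_nat_trans_Ident] by simp

lemma is_iso_pro_Ident:
  assumes X: "is_pro_object C X"
  shows "is_iso (pro_cat C) (Ident (pro_cat C) X)"
proof -
  let ?I = "Ident (pro_cat C) X"
  note I = Ident_homs_pro[OF X]
  have "Comp (pro_cat C) ?I ?I = ?I"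
  proof (rule homs_pro_eqI[OF Comp_homs_pro[OF I I] I])
    fix s assume s: "s \<in> Ob (idx X)"
    have r: "(s, Ident C (dob X s)) \<in> pcomp ?I s"
      using pcomp_level_arrow[OF is_nat_trans_Ident[OF X] s] by simp
    have "Comp C (Ident C (dob X s)) (Ident C (dob X s)) = Ident C (dob X s)"
      by (rule Comp_Ident_left[OF Ident_homs[OF dob_Ob[OF X s]]])
    then show "pcomp (Comp (pro_cat C) ?I ?I) s = pcomp ?I s"
      using pcomp_Comp[OF I I s r r] pcomp_mem(3)[OF I s r] by simp
  qed
  then show ?thesis
    using I unfolding is_iso_def by (auto simp: homs_def level_arrow_def)
qed

text \<open>If every Hom set is a singleton, any two elements of the colimit agree at a common
  refinement, so the limit of the colimits is a single point. This gives initiality of the empty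
  pro-space, maps to the point, and the commutativity of every square that involves them.\<close>

lemma ex1_pro_map:
  assumes X: "is_pro_object C X" and Y: "is_pro_object C Y"
    and u: "\<And>t s. t \<in> Ob (idx X) \<Longrightarrow> s \<in> Ob (idx Y) \<Longrightarrow> \<exists>!f. f \<in> homs C (dob X t) (dob Y s)"
  shows "\<exists>!p. p \<in> homs (pro_cat C) X Y"
proof -
  have rel: "((t, f), (t', f')) \<in> colim_rel C X (dob Y s)"
    if tf: "s \<in> Ob (idx Y)" "t \<in> Ob (idx X)" "t' \<in> Ob (idx X)"
      "f \<in> homs C (dob X t) (dob Y s)" "f' \<in> homs C (dob X t') (dob Y s)" for s t t' f f'
  proof -
    obtain r a b where r: "r \<in> Ob (idx X)" "a \<in> homs (idx X) r t" "b \<in> homs (idx X) r t'"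
      using idx_common[OF X tf(2,3)] by blast
    have "Comp C f (dar X a) = Comp C f' (dar X b)"
      using u[OF r(1) tf(1)] Comp_homs[OF dar_homs[OF X r(2)] tf(4)] Comp_homs[OF dar_homs[OF X r(3)] tf(5)]
      by blast
    then show ?thesis
      using colim_rel_step[OF X tf(2,4) r(2)] colim_rel_sym[OF X colim_rel_step[OF X tf(3,5) r(3)]]
      by (auto intro: colim_rel_trans[OF X])
  qed
  obtain t0 where t0: "t0 \<in> Ob (idx X)" using idx_nonempty[OF X] by blast
  define f where "f = (\<lambda>s. SOME f. f \<in> homs C (dob X t0) (dob Y s))"
  have f: "f s \<in> homs C (dob X t0) (dob Y s)" if "s \<in> Ob (idx Y)" for s
    unfolding f_def by (rule someI_ex[OF ex1_implies_ex[OF u[OF t0 that]]])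
  have ex: "\<lparr>pdom = X, pcod = Y, pcomp = (\<lambda>s. if s \<in> Ob (idx Y) then colim_class C X (dob Y s) (t0, f s) else {})\<rparr>
    \<in> homs (pro_cat C) X Y"
  proof (rule is_pro_map_classes[OF X Y, where t = "\<lambda>_. t0"])
    fix a s s' assume a: "a \<in> homs (idx Y) s s'"
    have s: "s \<in> Ob (idx Y)" "s' \<in> Ob (idx Y)"
      using base_category.homs_Ob[OF idx_category[OF Y] a] by auto
    show "((t0, Comp C (dar Y a) (f s)), (t0, f s')) \<in> colim_rel C X (dob Y s')"
      by (rule rel[OF s(2) t0 t0 Comp_homs[OF f[OF s(1)] dar_homs[OF Y a]] f[OF s(2)]])
  qed (intro conjI t0 f)
  moreover have "p = q" if p: "p \<in> homs (pro_cat C) X Y" and q: "q \<in> homs (pro_cat C) X Y" for p q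
  proof (rule homs_pro_eqI[OF p q])
    fix s assume s: "s \<in> Ob (idx Y)"
    obtain t f where t: "(t, f) \<in> pcomp p s" by (rule pcomp_rep[OF p s])
    obtain t' f' where t': "(t', f') \<in> pcomp q s" by (rule pcomp_rep[OF q s])
    have "((t, f), (t', f')) \<in> colim_rel C X (dob Y s)"
      by (rule rel[OF s pcomp_mem(1)[OF p s t] pcomp_mem(1)[OF q s t'] pcomp_mem(2)[OF p s t] pcomp_mem(2)[OF q s t']])
    then show "pcomp p s = pcomp q s"
      unfolding pcomp_mem(3)[OF p s t] pcomp_mem(3)[OF q s t'] colim_class_eq_iff[OF X] .
  qed
  ultimately show ?thesis by blast
qed

lemma is_iso_unique:
  assumes p: "p \<in> homs (pro_cat C) X Y" and q: "q \<in> homs (pro_cat C) Y X"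
    and u: "\<exists>!f. f \<in> homs (pro_cat C) X X" "\<exists>!f. f \<in> homs (pro_cat C) Y Y"
  shows "is_iso (pro_cat C) p"
proof -
  have X: "is_pro_object C X" and Y: "is_pro_object C Y" using homs_pro_objects[OF p] by auto
  have "Comp (pro_cat C) q p = Ident (pro_cat C) X"
    by (rule ex1_unique[OF u(1) Comp_homs_pro[OF p q] Ident_homs_pro[OF X]])
  moreover have "Comp (pro_cat C) p q = Ident (pro_cat C) Y"
    by (rule ex1_unique[OF u(2) Comp_homs_pro[OF q p] Ident_homs_pro[OF Y]])
  ultimately show ?thesis
    using p q unfolding is_iso_def homs_def by auto
qed

subsection \<open>Restriction to a cofinal subdiagram\<close>

text \<open>The map to the subdiagram is represented by identities, its inverse by transition maps
  from chosen indices of the subdiagram. In a thin index category these choices do not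
  matter.\<close>

lemma restriction_iso:
  assumes X: "is_pro_object C X" and X': "is_pro_object C X'"
    and sub: "Ob (idx X') \<subseteq> Ob (idx X)"
    and full: "\<And>s t. s \<in> Ob (idx X') \<Longrightarrow> t \<in> Ob (idx X') \<Longrightarrow> homs (idx X') s t = homs (idx X) s t"
    and same: "dob X' = dob X" "dar X' = dar X"
    and thin: "\<And>s t u v. u \<in> homs (idx X) s t \<Longrightarrow> v \<in> homs (idx X) s t \<Longrightarrow> u = v"
    and cofinal: "\<And>s. s \<in> Ob (idx X) \<Longrightarrow> \<exists>t\<in>Ob (idx X'). homs (idx X) t s \<noteq> {}"
  obtains p where "p \<in> homs (pro_cat C) X X'" "is_iso (pro_cat C) p"
proof -
  interpret I: base_category "idx X" by (rule idx_category[OF X])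
  interpret J: base_category "idx X'" by (rule idx_category[OF X'])
  define p where "p = \<lparr>pdom = X, pcod = X', pcomp = (\<lambda>s. if s \<in> Ob (idx X')
    then colim_class C X (dob X' s) (s, Ident C (dob X s)) else {})\<rparr>"
  have p: "p \<in> homs (pro_cat C) X X'"
    unfolding p_def
  proof (rule is_pro_map_classes[OF X X', where t = "\<lambda>s. s"])
    fix a s s' assume a': "a \<in> homs (idx X') s s'"
    have s: "s \<in> Ob (idx X')" "s' \<in> Ob (idx X')" using J.homs_Ob[OF a'] by auto
    have a: "a \<in> homs (idx X) s s'" using a' full[OF s] by simp
    have "Comp C (dar X a) (Ident C (dob X s)) = Comp C (Ident C (dob X s')) (dar X a)"
      using dar_homs[OF X a] by (simp add: Comp_Ident_left Comp_Ident_right)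
    moreover have "((s', Ident C (dob X s')), (s, Comp C (Ident C (dob X s')) (dar X a))) \<in> colim_rel C X (dob X s')"
      using s sub by (intro colim_rel_step[OF X _ Ident_homs[OF dob_Ob[OF X]] a]) auto
    ultimately show "((s, Comp C (dar X' a) (Ident C (dob X s))), (s', Ident C (dob X s'))) \<in> colim_rel C X (dob X' s')"
      unfolding same by (simp add: colim_rel_sym[OF X])
  qed (use sub Ident_homs[OF dob_Ob[OF X]] same in auto)
  \<comment> \<open>Over a common index \<open>r\<close> of the subdiagram both arrows to
    \<open>s\<close> become the only arrow from \<open>r\<close> to \<open>s\<close>. This gives
    compatibility of the inverse and one of the two composites.\<close>
  have rel: "((t, dar X u), (t', dar X u')) \<in> colim_rel C X' (dob X s)"
    if tf: "t \<in> Ob (idx X')" "t' \<in> Ob (idx X')" "u \<in> homs (idx X) t s" "u' \<in> homs (idx X) t' s" for s t t' u u'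
  proof -
    obtain r a b where r: "r \<in> Ob (idx X')" "a \<in> homs (idx X') r t" "b \<in> homs (idx X') r t'"
      using idx_common[OF X' tf(1,2)] by blast
    have ab: "a \<in> homs (idx X) r t" "b \<in> homs (idx X) r t'" using r that full by auto
    have "Comp (idx X) u a = Comp (idx X) u' b"
      by (rule thin[OF I.Comp_homs[OF ab(1) tf(3)] I.Comp_homs[OF ab(2) tf(4)]])
    then have eq: "Comp C (dar X u) (dar X a) = Comp C (dar X u') (dar X b)"
      using dar_Comp[OF X ab(1) tf(3)] dar_Comp[OF X ab(2) tf(4)] by simp
    have "((t, dar X u), (r, Comp C (dar X u) (dar X' a))) \<in> colim_rel C X' (dob X s)"
      using tf(3) by (intro colim_rel_step[OF X' tf(1) _ r(2)]) (simp add: same dar_homs[OF X])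
    moreover have "((t', dar X u'), (r, Comp C (dar X u') (dar X' b))) \<in> colim_rel C X' (dob X s)"
      using tf(4) by (intro colim_rel_step[OF X' tf(2) _ r(3)]) (simp add: same dar_homs[OF X])
    ultimately show ?thesis
      using eq by (auto simp: same intro: colim_rel_trans[OF X'] colim_rel_sym[OF X'])
  qed
  \<comment> \<open>Cofinality provides an index of the subdiagram above \<open>s\<close>, and
    \<open>u s\<close> is an arrow from it to \<open>s\<close>.\<close>
  define T where "T = (\<lambda>s. SOME t. t \<in> Ob (idx X') \<and> homs (idx X) t s \<noteq> {})"
  define u where "u = (\<lambda>s. SOME u. u \<in> homs (idx X) (T s) s)"
  have T: "T s \<in> Ob (idx X')" "homs (idx X) (T s) s \<noteq> {}" if "s \<in> Ob (idx X)" for s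
  proof -
    have "\<exists>t. t \<in> Ob (idx X') \<and> homs (idx X) t s \<noteq> {}" using cofinal[OF that] by blast
    from someI_ex[OF this] show "T s \<in> Ob (idx X')" "homs (idx X) (T s) s \<noteq> {}"
      unfolding T_def by auto
  qed
  have u: "u s \<in> homs (idx X) (T s) s" if "s \<in> Ob (idx X)" for s
    unfolding u_def using T(2)[OF that] by (simp add: some_in_eq)
  define q where "q = \<lparr>pdom = X', pcod = X, pcomp = (\<lambda>s. if s \<in> Ob (idx X)
    then colim_class C X' (dob X s) (T s, dar X (u s)) else {})\<rparr>"
  have q: "q \<in> homs (pro_cat C) X' X"
    unfolding q_def
  proof (rule is_pro_map_classes[OF X' X])
    fix a s s' assume a: "a \<in> homs (idx X) s s'"
    have s: "s \<in> Ob (idx X)" "s' \<in> Ob (idx X)" using I.homs_Ob[OF a] by auto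
    show "((T s, Comp C (dar X a) (dar X (u s))), (T s', dar X (u s'))) \<in> colim_rel C X' (dob X s')"
      using rel[OF T(1)[OF s(1)] T(1)[OF s(2)] I.Comp_homs[OF u[OF s(1)] a] u[OF s(2)]]
      by (simp add: dar_Comp[OF X u[OF s(1)] a])
  qed (use T(1) u dar_homs[OF X] same in auto)
  have prep: "(s, Ident C (dob X s)) \<in> pcomp p s" if "s \<in> Ob (idx X')" for s
    using that by (simp add: p_def colim_class_def colim_rel_refl[OF X])
  have qrep: "(T s, dar X (u s)) \<in> pcomp q s" if "s \<in> Ob (idx X)" for s
    using that by (simp add: q_def colim_class_def colim_rel_refl[OF X'])
  have irep: "(s, Ident C (dob Y s)) \<in> pcomp (Ident (pro_cat C) Y) s"
    if "is_pro_object C Y" "s \<in> Ob (idx Y)" for Y :: "('e, 'f, 'o, 'm) diagram" and s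
    using pcomp_level_arrow[OF is_nat_trans_Ident[OF that(1)] that(2)] by simp
  have "Comp (pro_cat C) q p = Ident (pro_cat C) X"
  proof (rule homs_pro_eqI[OF Comp_homs_pro[OF p q] Ident_homs_pro[OF X]])
    fix s assume s: "s \<in> Ob (idx X)"
    note us = dar_homs[OF X u[OF s]]
    have "pcomp (Comp (pro_cat C) q p) s = colim_class C X (dob X s) (T s, dar X (u s))"
      using pcomp_Comp[OF p q s qrep[OF s] prep[OF T(1)[OF s]]] by (simp add: Comp_Ident_right[OF us])
    also have "\<dots> = colim_class C X (dob X s) (s, Ident C (dob X s))"
      unfolding colim_class_eq_iff[OF X]
      using colim_rel_step[OF X s Ident_homs[OF dob_Ob[OF X s]] u[OF s]]
      by (simp add: Comp_Ident_left[OF us] colim_rel_sym[OF X])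
    also have "\<dots> = pcomp (Ident (pro_cat C) X) s"
      by (rule pcomp_mem(3)[OF Ident_homs_pro[OF X] s irep[OF X s], symmetric])
    finally show "pcomp (Comp (pro_cat C) q p) s = pcomp (Ident (pro_cat C) X) s" .
  qed
  moreover have "Comp (pro_cat C) p q = Ident (pro_cat C) X'"
  proof (rule homs_pro_eqI[OF Comp_homs_pro[OF q p] Ident_homs_pro[OF X']])
    fix s assume s': "s \<in> Ob (idx X')"
    then have s: "s \<in> Ob (idx X)" using sub by blast
    note us = dar_homs[OF X u[OF s]]
    have "pcomp (Comp (pro_cat C) p q) s = colim_class C X' (dob X' s) (T s, dar X (u s))"
      using pcomp_Comp[OF q p s' prep[OF s'] qrep[OF s]] by (simp add: Comp_Ident_left[OF us])
    also have "\<dots> = colim_class C X' (dob X' s) (s, Ident C (dob X' s))"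
      unfolding colim_class_eq_iff[OF X'] same
      using rel[OF T(1)[OF s] s' u[OF s] I.Ident_homs[OF s]] by (simp add: dar_Ident[OF X s])
    also have "\<dots> = pcomp (Ident (pro_cat C) X') s"
      by (rule pcomp_mem(3)[OF Ident_homs_pro[OF X'] s' irep[OF X' s'], symmetric])
    finally show "pcomp (Comp (pro_cat C) p q) s = pcomp (Ident (pro_cat C) X') s" .
  qed
  ultimately have "is_iso (pro_cat C) p"
    using p q unfolding is_iso_def homs_def by auto
  then show thesis using that p by blast
qed

subsection \<open>Constant diagrams\<close>

text \<open>A level map needs the same index category on both sides, so a constant object is spread
  over the index category of the other side; the isomorphism with \<open>const_pro\<close> comes
  from unique maps.\<close>

definition const_diagram :: "('i, 'j) cat \<Rightarrow> 'o \<Rightarrow> ('i, 'j, 'o, 'm) diagram" where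
  "const_diagram I x = \<lparr>idx = I, dob = (\<lambda>_. x), dar = (\<lambda>_. Ident C x)\<rparr>"

lemma is_pro_object_const_diagram:
  assumes "category I" "cofiltering I" "x \<in> Ob C"
  shows "is_pro_object C (const_diagram I x)"
  using assms Ident_homs[OF assms(3)] Comp_Ident_left[OF Ident_homs[OF assms(3)]]
  by (simp add: is_pro_object_def const_diagram_def)

lemma is_pro_object_const_pro:
  assumes "x \<in> Ob C"
  shows "is_pro_object C (const_pro C x)"
proof -
  have "category (one_cat :: ('i, 'j) cat)" "cofiltering (one_cat :: ('i, 'j) cat)"
    by (auto simp: category_def cofiltering_def one_cat_def homs_def)
  from is_pro_object_const_diagram[OF this assms] show ?thesis
    by (simp add: const_diagram_def const_pro_def)
qed

end

subsection \<open>Directed index categories\<close>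

lemma homs_directed_cat:
  assumes "inj oc" "inj ac"
  shows "u \<in> homs (directed_cat oc ac S below) i j \<longleftrightarrow>
    (\<exists>t\<in>S. \<exists>s\<in>S. below s t \<and> u = ac (t, s) \<and> i = oc t \<and> j = oc s)"
  by (auto simp: homs_def directed_cat_def the_inv_f_f[OF assms(1)] the_inv_f_f[OF assms(2)]) blast

lemma directed_cat_simps:
  assumes "inj oc" "inj ac"
  shows "Ob (directed_cat oc ac S below) = oc ` S"
    "Ident (directed_cat oc ac S below) (oc s) = ac (s, s)"
    "Comp (directed_cat oc ac S below) (ac (s, r)) (ac (t, s')) = ac (t, r)"
  by (simp_all add: directed_cat_def the_inv_f_f[OF assms(1)] the_inv_f_f[OF assms(2)])

lemma category_directed_cat:
  assumes i: "inj oc" "inj ac" and refl: "\<And>s. s \<in> S \<Longrightarrow> below s s"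
    and trans: "\<And>s t r. below s t \<Longrightarrow> below t r \<Longrightarrow> below s r"
  shows "category (directed_cat oc ac S below)"
proof -
  have arr: "a \<in> Ar (directed_cat oc ac S below) \<longleftrightarrow> (\<exists>t\<in>S. \<exists>s\<in>S. below s t \<and> a = ac (t, s))" for a
    by (auto simp: directed_cat_def)
  have dc: "Dom (directed_cat oc ac S below) (ac (t, s)) = oc t" "Cod (directed_cat oc ac S below) (ac (t, s)) = oc s" for s t
    by (simp_all add: directed_cat_def the_inv_f_f[OF i(2)])
  show ?thesis
    unfolding category_def
    by (auto simp: arr dc directed_cat_simps[OF i] homs_directed_cat[OF i] inj_eq[OF i(1)] intro: refl)
      (blast intro: trans)
qed

lemma cofiltering_directed_cat:
  assumes i: "inj oc" "inj ac" and ne: "S \<noteq> {}" and refl: "\<And>s. s \<in> S \<Longrightarrow> below s s"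
    and dir: "\<And>s t. s \<in> S \<Longrightarrow> t \<in> S \<Longrightarrow> \<exists>r\<in>S. below s r \<and> below t r"
  shows "cofiltering (directed_cat oc ac S below)"
  unfolding cofiltering_def directed_cat_simps[OF i]
proof (intro conjI ballI)
  show "oc ` S \<noteq> {}" using ne by simp
  fix s t assume s: "s \<in> oc ` S" and t: "t \<in> oc ` S"
  obtain s' t' where st: "s = oc s'" "s' \<in> S" "t = oc t'" "t' \<in> S" using s t by auto
  obtain r where "r \<in> S" "below s' r" "below t' r" using dir[OF st(2,4)] by blast
  then have "ac (r, s') \<in> homs (directed_cat oc ac S below) (oc r) s"
    "ac (r, t') \<in> homs (directed_cat oc ac S below) (oc r) t" "oc r \<in> oc ` S"
    using st by (auto simp: homs_directed_cat[OF i])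
  then show "\<exists>u\<in>oc ` S. homs (directed_cat oc ac S below) u s \<noteq> {} \<and> homs (directed_cat oc ac S below) u t \<noteq> {}"
    by blast
  fix a b assume "a \<in> homs (directed_cat oc ac S below) s t" "b \<in> homs (directed_cat oc ac S below) s t"
  then have "a = b" by (auto simp: homs_directed_cat[OF i] inj_eq[OF i(1)])
  moreover have "ac (s', s') \<in> homs (directed_cat oc ac S below) s s"
    using st refl by (auto simp: homs_directed_cat[OF i])
  ultimately show "\<exists>u\<in>oc ` S. \<exists>c\<in>homs (directed_cat oc ac S below) u s.
      Comp (directed_cat oc ac S below) a c = Comp (directed_cat oc ac S below) b c"
    using s by blast
qed

section \<open>The pro-space \<open>{E(G/U)}\<close>\<close>

context profinite_group
begin

lemma base_category_GC: "base_category GC"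
  by (simp add: base_category_def category_gspace_cat)

text \<open>Objects and arrows are taken over from \<open>E_pro\<close> and only the index set
  shrinks, as \<open>restriction_iso\<close> expects.\<close>

definition E_sub :: "(('a set \<times> real) list set \<Rightarrow> 'u) \<Rightarrow> ('a set \<Rightarrow> 'u) \<Rightarrow> ('a set \<times> 'a set \<Rightarrow> 'u) \<Rightarrow>
    'a set set \<Rightarrow> ('a, 'u) pro_gspace" where
  "E_sub pc oc ac S = \<lparr>idx = directed_cat oc ac S (\<lambda>U V. V \<subseteq> U),
     dob = dob (E_pro G T pc oc ac), dar = dar (E_pro G T pc oc ac)\<rparr>"

lemma E_sub_all: "E_sub pc oc ac (fi_normal_subgroups G T) = E_pro G T pc oc ac"
  by (simp add: E_sub_def E_pro_def)

context
  fixes pc :: "('a set \<times> real) list set \<Rightarrow> 'u" and oc :: "'a set \<Rightarrow> 'u" and ac :: "'a set \<times> 'a set \<Rightarrow> 'u"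
  assumes pc: "inj pc" and oc: "inj oc" and ac: "inj ac"
begin

lemma idx_E_sub: "idx (E_sub pc oc ac S) = directed_cat oc ac S (\<lambda>U V. V \<subseteq> U)"
  by (simp add: E_sub_def)

lemma dob_E_sub: "dob (E_sub pc oc ac S) (oc U) = E_copy pc U"
  by (simp add: E_sub_def E_pro_def E_copy_def the_inv_f_f[OF oc])

lemma dar_E_sub: "dar (E_sub pc oc ac S) (ac (V, U)) = E_map pc V U"
  by (simp add: E_sub_def E_pro_def E_map_def E_copy_def mk_gmap_def the_inv_f_f[OF ac])

definition directed_subgroups :: "'a set set \<Rightarrow> bool" where
  "directed_subgroups S \<longleftrightarrow> S \<subseteq> fi_normal_subgroups G T \<and> S \<noteq> {} \<and> (\<forall>U\<in>S. \<forall>V\<in>S. U \<inter> V \<in> S)"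

lemma directed_subgroups_all: "directed_subgroups (fi_normal_subgroups G T)"
  using fi_normal_carrier fi_normal_Int by (auto simp: directed_subgroups_def)

lemma directed_subgroups_below:
  assumes "fi_subgroup G T U"
  shows "directed_subgroups {V \<in> fi_normal_subgroups G T. V \<subseteq> U}"
proof -
  obtain V where "V \<in> fi_normal_subgroups G T" "V \<subseteq> U"
    by (rule ex_fi_normal_subset[OF assms])
  then show ?thesis
    using fi_normal_Int by (auto simp: directed_subgroups_def)
qed

lemma index_category:
  assumes "directed_subgroups S"
  shows "category (directed_cat oc ac S (\<lambda>U V. V \<subseteq> U))" "cofiltering (directed_cat oc ac S (\<lambda>U V. V \<subseteq> U))"
proof -
  show "category (directed_cat oc ac S (\<lambda>U V. V \<subseteq> U))"
    by (rule category_directed_cat[OF oc ac]) auto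
  show "cofiltering (directed_cat oc ac S (\<lambda>U V. V \<subseteq> U))"
  proof (rule cofiltering_directed_cat[OF oc ac])
    show "S \<noteq> {}" using assms by (simp add: directed_subgroups_def)
    show "\<exists>W\<in>S. W \<subseteq> U \<and> W \<subseteq> V" if "U \<in> S" "V \<in> S" for U V
      using assms that by (intro bexI[of _ "U \<inter> V"]) (auto simp: directed_subgroups_def)
  qed auto
qed

lemma is_pro_object_E_sub:
  assumes S: "directed_subgroups S"
  shows "is_pro_object GC (E_sub pc oc ac S)"
proof -
  let ?I = "directed_cat oc ac S (\<lambda>U V. V \<subseteq> U)"
  have N: "U \<in> fi_normal_subgroups G T" if "U \<in> S" for U
    using S that by (auto simp: directed_subgroups_def)
  have ob: "Ob ?I = oc ` S" by (rule directed_cat_simps(1)[OF oc ac])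
  have ar: "a \<in> Ar ?I \<longleftrightarrow> (\<exists>V\<in>S. \<exists>U\<in>S. V \<subseteq> U \<and> a = ac (V, U))" for a
    by (auto simp: directed_cat_def)
  have dc: "Dom ?I (ac (V, U)) = oc V" "Cod ?I (ac (V, U)) = oc U" for U V
    by (simp_all add: directed_cat_def the_inv_f_f[OF ac])
  show ?thesis
    unfolding is_pro_object_def idx_E_sub
  proof (intro conjI index_category S ballI impI)
    fix s assume "s \<in> Ob ?I"
    then obtain U where U: "U \<in> S" "s = oc U" by (auto simp: ob)
    show "dob (E_sub pc oc ac S) s \<in> Ob GC"
      using is_gspace_E[OF pc N[OF U(1)]] by (simp add: U(2) dob_E_sub E_copy_def)
    show "dar (E_sub pc oc ac S) (Ident ?I s) = Ident GC (dob (E_sub pc oc ac S) s)"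
      unfolding U(2) directed_cat_simps(2)[OF oc ac] dar_E_sub dob_E_sub E_map_id[OF pc N[OF U(1)]] by simp
  next
    fix a assume "a \<in> Ar ?I"
    then obtain V U where a: "V \<in> S" "U \<in> S" "V \<subseteq> U" "a = ac (V, U)" by (auto simp: ar)
    show "dar (E_sub pc oc ac S) a \<in> homs GC (dob (E_sub pc oc ac S) (Dom ?I a)) (dob (E_sub pc oc ac S) (Cod ?I a))"
      unfolding a(4) dc dar_E_sub dob_E_sub by (rule E_map_homs[OF pc N[OF a(2)] N[OF a(1)] a(3)])
    fix b assume "b \<in> Ar ?I" and ab: "Cod ?I a = Dom ?I b"
    then obtain V' W where b: "V' \<in> S" "W \<in> S" "V' \<subseteq> W" "b = ac (V', W)" by (auto simp: ar)
    have V': "V' = U" using ab injD[OF oc] unfolding a(4) b(4) dc by metis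
    have WU: "U \<subseteq> W" using b(3) V' by simp
    show "dar (E_sub pc oc ac S) (Comp ?I b a) = Comp GC (dar (E_sub pc oc ac S) b) (dar (E_sub pc oc ac S) a)"
      unfolding a(4) b(4) V' directed_cat_simps(3)[OF oc ac] dar_E_sub
      by (rule E_map_comp[OF pc N[OF b(2)] N[OF a(2)] N[OF a(1)] a(3) WU, symmetric])
  qed
qed

lemma E_sub_restriction_iso:
  assumes U: "fi_subgroup G T U"
  obtains p where "p \<in> homs (pro_cat GC) (E_pro G T pc oc ac) (E_sub pc oc ac {V \<in> fi_normal_subgroups G T. V \<subseteq> U})"
    "is_iso (pro_cat GC) p"
proof -
  interpret GC: base_category GC by (rule base_category_GC)
  let ?N = "fi_normal_subgroups G T" and ?S = "{V \<in> fi_normal_subgroups G T. V \<subseteq> U}"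
  have idx: "idx (E_pro G T pc oc ac) = directed_cat oc ac ?N (\<lambda>U V. V \<subseteq> U)"
    by (simp add: E_pro_def)
  show thesis
  proof (rule GC.restriction_iso[of "E_pro G T pc oc ac" "E_sub pc oc ac ?S"])
    show "is_pro_object GC (E_pro G T pc oc ac)"
      using is_pro_object_E_sub[OF directed_subgroups_all] by (simp add: E_sub_all)
    show "is_pro_object GC (E_sub pc oc ac ?S)"
      by (rule is_pro_object_E_sub[OF directed_subgroups_below[OF U]])
    show "Ob (idx (E_sub pc oc ac ?S)) \<subseteq> Ob (idx (E_pro G T pc oc ac))"
      unfolding idx idx_E_sub directed_cat_simps(1)[OF oc ac] by auto
    show "homs (idx (E_sub pc oc ac ?S)) s t = homs (idx (E_pro G T pc oc ac)) s t"
      if "s \<in> Ob (idx (E_sub pc oc ac ?S))" "t \<in> Ob (idx (E_sub pc oc ac ?S))" for s t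
      using that unfolding idx idx_E_sub directed_cat_simps(1)[OF oc ac]
      by (auto simp: homs_directed_cat[OF oc ac] inj_eq[OF oc])
    show "dob (E_sub pc oc ac ?S) = dob (E_pro G T pc oc ac)" "dar (E_sub pc oc ac ?S) = dar (E_pro G T pc oc ac)"
      by (simp_all add: E_sub_def)
    show "u = v" if "u \<in> homs (idx (E_pro G T pc oc ac)) s t" "v \<in> homs (idx (E_pro G T pc oc ac)) s t" for s t u v
      using that unfolding idx by (auto simp: homs_directed_cat[OF oc ac] inj_eq[OF oc])
    show "\<exists>t\<in>Ob (idx (E_sub pc oc ac ?S)). homs (idx (E_pro G T pc oc ac)) t s \<noteq> {}"
      if s: "s \<in> Ob (idx (E_pro G T pc oc ac))" for s
    proof -
      obtain W where W: "W \<in> ?N" "s = oc W"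
        using s unfolding idx directed_cat_simps(1)[OF oc ac] by auto
      obtain V where V: "V \<in> ?N" "V \<subseteq> U" by (rule ex_fi_normal_subset[OF U])
      have VW: "V \<inter> W \<in> ?N" by (rule fi_normal_Int[OF V(1) W(1)])
      have "ac (V \<inter> W, W) \<in> homs (idx (E_pro G T pc oc ac)) (oc (V \<inter> W)) s"
        unfolding idx homs_directed_cat[OF oc ac] W(2) by (intro bexI[of _ "V \<inter> W"] bexI[of _ W]) (use VW W in auto)
      moreover have "oc (V \<inter> W) \<in> Ob (idx (E_sub pc oc ac ?S))"
        unfolding idx_E_sub directed_cat_simps(1)[OF oc ac] using VW V by auto
      ultimately show ?thesis by blast
    qed
  qed (rule that)
qed

text \<open>One levelwise representative serves all indices: at the level V the subgroup required by
  \<open>W_class\<close> is V itself, which acts trivially on E(G/V).\<close>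

lemma E_pro_point_weak_equivalence:
  assumes q: "q \<in> homs (pro_cat GC) (E_pro G T pc oc ac) (const_pro GC (point_gspace pt))"
  shows "q \<in> pro_weak_equivalences G T"
  unfolding pro_weak_equivalences_def ess_levelwise_all_def
proof (intro CollectI conjI ballI)
  interpret GC: base_category GC by (rule base_category_GC)
  show "q \<in> Ar (pro_cat GC)" using q by (simp add: homs_def)
  fix a assume "a \<in> indices G T"
  let ?N = "fi_normal_subgroups G T"
  let ?X = "E_pro G T pc oc ac"
  let ?pt = "point_gspace pt :: ('a, 'u) gspace"
  let ?c = "const_pro GC ?pt :: ('a, 'u) pro_gspace"
  obtain U n where a: "a = (U, n)" by force
  have idx: "idx ?X = directed_cat oc ac ?N (\<lambda>U V. V \<subseteq> U)"
    by (simp add: E_pro_def)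
  have X: "is_pro_object GC ?X"
    using is_pro_object_E_sub[OF directed_subgroups_all] by (simp add: E_sub_all)
  have c: "is_pro_object GC ?c"
    by (rule GC.is_pro_object_const_pro) (simp add: is_gspace_point)
  \<comment> \<open>The constant pro-space on the point, spread over the index category of the
    source so that the collapse maps form a level map.\<close>
  define Y :: "('a, 'u) pro_gspace" where "Y = GC.const_diagram (idx ?X) ?pt"
  have Y: "is_pro_object GC Y"
    unfolding Y_def idx by (rule GC.is_pro_object_const_diagram[OF index_category[OF directed_subgroups_all]])
      (simp add: is_gspace_point)
  have idxY: "idx Y = idx ?X" and dobY: "dob Y s = ?pt" for s
    by (simp_all add: Y_def GC.const_diagram_def)
  have dobc: "dob ?c s = ?pt" for s by (simp add: const_pro_def)
  have toY: "\<exists>!f. f \<in> homs (pro_cat GC) Z Y" if "is_pro_object GC Z" for Z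
    using that by (rule GC.ex1_pro_map[OF _ Y]) (use GC.dob_Ob[OF that] in \<open>simp add: dobY homs_to_point\<close>)
  have toc: "\<exists>!f. f \<in> homs (pro_cat GC) Z ?c" if "is_pro_object GC Z" for Z
    using that by (rule GC.ex1_pro_map[OF _ c]) (use GC.dob_Ob[OF that] in \<open>simp add: dobc homs_to_point\<close>)
  define \<theta> where "\<theta> = (\<lambda>s. mk_gmap (dob ?X s) ?pt (\<lambda>_. pt))"
  have \<theta>: "\<theta> s \<in> homs GC (dob ?X s) ?pt" if "s \<in> Ob (idx ?X)" for s
    unfolding \<theta>_def by (rule point_map_homs) (use GC.dob_Ob[OF X that] in simp)
  have nat: "is_nat_trans GC ?X Y \<theta>"
    unfolding is_nat_trans_def
  proof (intro conjI ballI X Y idxY[symmetric])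
    show "\<theta> s \<in> homs GC (dob ?X s) (dob Y s)" if "s \<in> Ob (idx ?X)" for s
      using \<theta>[OF that] by (simp only: dobY)
    fix u assume "u \<in> Ar (idx ?X)"
    then have u: "u \<in> homs (idx ?X) (Dom (idx ?X) u) (Cod (idx ?X) u)" by (simp add: homs_def)
    have ob: "Dom (idx ?X) u \<in> Ob (idx ?X)" "Cod (idx ?X) u \<in> Ob (idx ?X)"
      using base_category.homs_Ob[OF GC.idx_category[OF X] u] by auto
    have uY: "dar Y u \<in> homs GC ?pt ?pt"
      using GC.dar_homs[OF Y, of u] u by (simp add: idxY dobY)
    show "Comp GC (dar Y u) (\<theta> (Dom (idx ?X) u)) = Comp GC (\<theta> (Cod (idx ?X) u)) (dar ?X u)"
      by (rule ex1_unique[OF homs_to_point GC.Comp_homs[OF \<theta>[OF ob(1)] uY] GC.Comp_homs[OF GC.dar_homs[OF X u] \<theta>[OF ob(2)]]])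
        (use GC.dob_Ob[OF X ob(1)] in simp)
  qed
  have W: "\<theta> s \<in> W_class G T a" if "s \<in> Ob (idx ?X)" for s
  proof -
    obtain V where V: "V \<in> ?N" "s = oc V"
      using \<open>s \<in> Ob (idx ?X)\<close> unfolding idx directed_cat_simps(1)[OF oc ac] by auto
    have "dob ?X s = E_copy pc V"
      using dob_E_sub[of ?N V] by (simp add: V(2) E_sub_all)
    then have "U_n_equivalence G T V n (\<theta> s)"
      using U_n_equivalence_E_point[OF pc V(1)] \<theta>[OF that] by simp
    then show ?thesis
      using V(1) by (auto simp: W_class_def a fi_normal_subgroups_def)
  qed
  have L: "level_arrow GC ?X Y \<theta> \<in> homs (pro_cat GC) ?X Y"
    by (rule GC.level_arrow_homs[OF nat])
  obtain \<beta> where \<beta>: "\<beta> \<in> homs (pro_cat GC) ?c Y" using toY[OF c] by blast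
  obtain \<gamma> where \<gamma>: "\<gamma> \<in> homs (pro_cat GC) Y ?c" using toc[OF Y] by blast
  have \<beta>_iso: "is_iso (pro_cat GC) \<beta>"
    by (rule GC.is_iso_unique[OF \<beta> \<gamma> toc[OF c] toY[OF Y]])
  let ?I = "Ident (pro_cat GC) ?X"
  have I: "?I \<in> homs (pro_cat GC) ?X ?X" by (rule GC.Ident_homs_pro[OF X])
  have "arrow_iso (pro_cat GC) q (level_arrow GC ?X Y \<theta>)"
    unfolding arrow_iso_def
  proof (intro conjI bexI)
    show "q \<in> Ar (pro_cat GC)" "level_arrow GC ?X Y \<theta> \<in> Ar (pro_cat GC)"
      using q L by (simp_all add: homs_def)
    show "is_iso (pro_cat GC) ?I" by (rule GC.is_iso_pro_Ident[OF X])
    show "is_iso (pro_cat GC) \<beta>" by (rule \<beta>_iso)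
    show "Comp (pro_cat GC) (level_arrow GC ?X Y \<theta>) ?I = Comp (pro_cat GC) \<beta> q"
      by (rule ex1_unique[OF toY[OF X] GC.Comp_homs_pro[OF I L] GC.Comp_homs_pro[OF q \<beta>]])
    have dq: "Dom (pro_cat GC) q = ?X" "Cod (pro_cat GC) q = ?c"
      "Dom (pro_cat GC) (level_arrow GC ?X Y \<theta>) = ?X" "Cod (pro_cat GC) (level_arrow GC ?X Y \<theta>) = Y"
      using q L by (simp_all only: homs_def mem_Collect_eq)
    show "\<beta> \<in> homs (pro_cat GC) (Cod (pro_cat GC) q) (Cod (pro_cat GC) (level_arrow GC ?X Y \<theta>))"
      unfolding dq by (rule \<beta>)
    show "?I \<in> homs (pro_cat GC) (Dom (pro_cat GC) q) (Dom (pro_cat GC) (level_arrow GC ?X Y \<theta>))"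
      unfolding dq by (rule I)
  qed
  then show "essentially_levelwise GC (W_class G T a) q"
    unfolding essentially_levelwise_def using nat W by blast
qed

text \<open>For an index (U, n) the map from the empty pro-space is compared with the level map over
  the normal subgroups inside U, where every level has a cell structure with U-cells. The target
  changes by the cofinality isomorphism, the source by the spreading of the empty space.\<close>

lemma cofibrant_E_pro: "cofibrant G T (E_pro G T pc oc ac)"
proof -
  interpret GC: base_category GC by (rule base_category_GC)
  let ?N = "fi_normal_subgroups G T"
  let ?E = "E_pro G T pc oc ac"
  let ?z = "const_pro GC empty_gspace :: ('a, 'u) pro_gspace"
  have E: "is_pro_object GC ?E"
    using is_pro_object_E_sub[OF directed_subgroups_all] by (simp add: E_sub_all)
  have empty: "topspace (gtop (empty_gspace :: ('a, 'u) gspace)) = {}" by (simp add: empty_gspace_def)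
  have z: "is_pro_object GC ?z"
    by (rule GC.is_pro_object_const_pro) (simp add: is_gspace_empty)
  have fromz: "\<exists>!f. f \<in> homs (pro_cat GC) ?z Z" if "is_pro_object GC Z" for Z
    by (rule GC.ex1_pro_map[OF z that])
      (use GC.dob_Ob[OF that] in \<open>simp add: const_pro_def homs_from_empty[OF is_gspace_empty empty]\<close>)
  obtain i where i: "i \<in> homs (pro_cat GC) ?z ?E" using fromz[OF E] by blast
  have "i \<in> pro_cofibrations G T"
    unfolding pro_cofibrations_def ess_levelwise_all_def
  proof (intro CollectI conjI ballI)
    show "i \<in> Ar (pro_cat GC)" using i by (simp add: homs_def)
    fix a assume a': "a \<in> indices G T"
    obtain U n where a: "a = (U, n)" by force
    have U: "fi_subgroup G T U" using a' by (simp add: a indices_def)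
    let ?S = "{V \<in> ?N. V \<subseteq> U}"
    let ?Y = "E_sub pc oc ac ?S"
    have S: "directed_subgroups ?S" by (rule directed_subgroups_below[OF U])
    have Y: "is_pro_object GC ?Y" by (rule is_pro_object_E_sub[OF S])
    define X :: "('a, 'u) pro_gspace" where "X = GC.const_diagram (idx ?Y) empty_gspace"
    have X: "is_pro_object GC X"
      unfolding X_def idx_E_sub by (rule GC.is_pro_object_const_diagram[OF index_category[OF S]])
        (simp add: is_gspace_empty)
    have idxX: "idx X = idx ?Y" and dobX: "dob X s = empty_gspace" for s
      by (simp_all add: X_def GC.const_diagram_def)
    have fromX: "\<exists>!f. f \<in> homs (pro_cat GC) X Z" if "is_pro_object GC Z" for Z
      by (rule GC.ex1_pro_map[OF X that], unfold dobX, rule homs_from_empty[OF is_gspace_empty empty])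
        (use GC.dob_Ob[OF that] in simp)
    define \<theta> where "\<theta> = (\<lambda>s. SOME f. f \<in> homs GC empty_gspace (dob ?Y s))"
    have uniq: "\<exists>!f. f \<in> homs GC empty_gspace (dob ?Y s)" if "s \<in> Ob (idx ?Y)" for s
      by (rule homs_from_empty[OF is_gspace_empty empty]) (use GC.dob_Ob[OF Y that] in simp)
    have \<theta>: "\<theta> s \<in> homs GC empty_gspace (dob ?Y s)" if "s \<in> Ob (idx ?Y)" for s
      unfolding \<theta>_def by (rule someI_ex[OF ex1_implies_ex[OF uniq[OF that]]])
    have nat: "is_nat_trans GC X ?Y \<theta>"
      unfolding is_nat_trans_def
    proof (intro conjI ballI X Y idxX)
      show "\<theta> s \<in> homs GC (dob X s) (dob ?Y s)" if "s \<in> Ob (idx X)" for s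
        unfolding dobX by (rule \<theta>) (use that idxX in simp)
      fix u assume "u \<in> Ar (idx X)"
      then have u: "u \<in> homs (idx ?Y) (Dom (idx X) u) (Cod (idx X) u)" by (simp add: homs_def idxX)
      have ob: "Dom (idx X) u \<in> Ob (idx ?Y)" "Cod (idx X) u \<in> Ob (idx ?Y)"
        using base_category.homs_Ob[OF GC.idx_category[OF Y] u] by auto
      have uX: "dar X u \<in> homs GC empty_gspace empty_gspace"
        using GC.dar_homs[OF X, of u] u by (simp add: idxX dobX)
      show "Comp GC (dar ?Y u) (\<theta> (Dom (idx X) u)) = Comp GC (\<theta> (Cod (idx X) u)) (dar X u)"
        by (rule ex1_unique[OF uniq[OF ob(2)] GC.Comp_homs[OF \<theta>[OF ob(1)] GC.dar_homs[OF Y u]]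
              GC.Comp_homs[OF uX \<theta>[OF ob(2)]]])
    qed
    have C: "\<theta> s \<in> C_class G T a" if "s \<in> Ob (idx X)" for s
    proof -
      have s: "s \<in> Ob (idx ?Y)" using that idxX by simp
      obtain V where V: "V \<in> ?N" "V \<subseteq> U" "s = oc V"
        using s unfolding idx_E_sub directed_cat_simps(1)[OF oc ac] by auto
      have "U_cofibration G T U (\<theta> s)"
        using \<theta>[OF s] unfolding V(3) dob_E_sub by (rule U_cofibration_E[OF pc V(1,2)])
      then show ?thesis by (simp add: C_class_def a)
    qed
    have L: "level_arrow GC X ?Y \<theta> \<in> homs (pro_cat GC) X ?Y"
      by (rule GC.level_arrow_homs[OF nat])
    obtain \<alpha> where \<alpha>: "\<alpha> \<in> homs (pro_cat GC) ?z X" using fromz[OF X] by blast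
    obtain \<gamma> where \<gamma>: "\<gamma> \<in> homs (pro_cat GC) X ?z" using fromX[OF z] by blast
    have \<alpha>_iso: "is_iso (pro_cat GC) \<alpha>"
      by (rule GC.is_iso_unique[OF \<alpha> \<gamma> fromz[OF z] fromX[OF X]])
    obtain \<beta> where \<beta>: "\<beta> \<in> homs (pro_cat GC) ?E ?Y" and \<beta>_iso: "is_iso (pro_cat GC) \<beta>"
      by (rule E_sub_restriction_iso[OF U])
    have "arrow_iso (pro_cat GC) i (level_arrow GC X ?Y \<theta>)"
      unfolding arrow_iso_def
    proof (intro conjI bexI)
      show "i \<in> Ar (pro_cat GC)" "level_arrow GC X ?Y \<theta> \<in> Ar (pro_cat GC)"
        using i L by (simp_all add: homs_def)
      show "is_iso (pro_cat GC) \<alpha>" "is_iso (pro_cat GC) \<beta>" by (rule \<alpha>_iso, rule \<beta>_iso)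
      show "Comp (pro_cat GC) (level_arrow GC X ?Y \<theta>) \<alpha> = Comp (pro_cat GC) \<beta> i"
        by (rule ex1_unique[OF fromz[OF Y] GC.Comp_homs_pro[OF \<alpha> L] GC.Comp_homs_pro[OF i \<beta>]])
      have di: "Dom (pro_cat GC) i = ?z" "Cod (pro_cat GC) i = ?E"
        "Dom (pro_cat GC) (level_arrow GC X ?Y \<theta>) = X" "Cod (pro_cat GC) (level_arrow GC X ?Y \<theta>) = ?Y"
        using i L by (simp_all only: homs_def mem_Collect_eq)
      show "\<beta> \<in> homs (pro_cat GC) (Cod (pro_cat GC) i) (Cod (pro_cat GC) (level_arrow GC X ?Y \<theta>))"
        unfolding di by (rule \<beta>)
      show "\<alpha> \<in> homs (pro_cat GC) (Dom (pro_cat GC) i) (Dom (pro_cat GC) (level_arrow GC X ?Y \<theta>))"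
        unfolding di by (rule \<alpha>)
    qed
    then show "essentially_levelwise GC (C_class G T a) i"
      unfolding essentially_levelwise_def using nat C by blast
  qed
  moreover have "is_initial (pro_gspace_cat G T) ?z"
    using z fromz by (simp add: is_initial_def pro_gspace_cat_def GC.pro_cat_simps)
  ultimately show ?thesis
    unfolding cofibrant_def using i by (auto simp: pro_gspace_cat_def)
qed

lemma ex1_E_pro_point:
  "\<exists>!q. q \<in> homs (pro_cat GC) (E_pro G T pc oc ac) (const_pro GC (point_gspace pt))"
proof -
  interpret GC: base_category GC by (rule base_category_GC)
  have E: "is_pro_object GC (E_pro G T pc oc ac)"
    using is_pro_object_E_sub[OF directed_subgroups_all] by (simp add: E_sub_all)
  have c: "is_pro_object GC (const_pro GC (point_gspace pt) :: ('a, 'u) pro_gspace)"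
    by (rule GC.is_pro_object_const_pro) (simp add: is_gspace_point)
  show ?thesis
    by (rule GC.ex1_pro_map[OF E c]) (use GC.dob_Ob[OF E] in \<open>simp add: const_pro_def homs_to_point\<close>)
qed

end

end

text \<open>The comparison map is not given by a formula: the constant pro-space on a point admits
  exactly one map from the given pro-space, and the last clause speaks of that map.\<close>

theorem proposition8p18:
  fixes G :: "('g, 'b) monoid_scheme"
    and T :: "'g topology"
    and pt :: "'u"
    and pc :: "('g set \<times> real) list set \<Rightarrow> 'u"
    and oc :: "'g set \<Rightarrow> 'u"
    and ac :: "'g set \<times> 'g set \<Rightarrow> 'u"
  assumes "profinite_group G T"
    and "inj pc" and "inj oc" and "inj ac"
  shows "cofibrant G T (E_pro G T pc oc ac)
    \<and> (\<exists>!q. q \<in> homs (pro_gspace_cat G T) (E_pro G T pc oc ac)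
                  (const_pro (gspace_cat G T) (point_gspace pt)))
    \<and> (\<forall>q \<in> homs (pro_gspace_cat G T) (E_pro G T pc oc ac)
                  (const_pro (gspace_cat G T) (point_gspace pt)).
           q \<in> pro_weak_equivalences G T)"
proof -
  interpret profinite_group G T by (rule assms(1))
  show ?thesis
    using cofibrant_E_pro[OF assms(2-4)] ex1_E_pro_point[OF assms(2-4), of pt]
      E_pro_point_weak_equivalence[OF assms(2-4)]
    unfolding pro_gspace_cat_def by blast
qed

end
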